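(* Let $F:\mathbb{R}^{2}\to\mathbb{R}$ be a nonconstant stationary isotropic (centred) Gaussian random field, and assume that $F$ is a.s. $C^{4+\epsilon}(\mathbb{R}^{2})$ for some $\epsilon>0$. Then the critical points of $F$ neither repel nor attract each other; that is, neither $K_2(r)\to 0$ nor $K_2(r)\to\infty$ holds as $r\to 0^+$, where $K_2$ is the two-point correlation function of the critical points of $F$.
   Context: "Nonconstant" means that $F$ is not a.s. equal to a (random) constant function of $x$. Isotropy means that $\mathbb{E}[F(x)F(y)]$ depends only on $\|x-y\|$. Let $\mathcal{C}_F=\{x\in\mathbb{R}^2:\nabla F(x)=0\}$ be the point process of critical points. Its two-point correlation function is, for $x\neq y$, $$K_2(x,y)=\lim_{\epsilon_1,\epsilon_2\to 0}\frac{1}{\operatorname{Vol}(B(\epsilon_1))\operatorname{Vol}(B(\epsilon_2))}\mathbb{E}\big[\#(\mathcal{C}_F\cap B_x(\epsilon_1))\cdot\#(\mathcal{C}_F\cap B_y(\epsilon_2))\big],$$ where $B_x(\epsilon)$ is the ball of radius $\epsilon$ centred at $x$, and $B(\epsilon)$ is a ball of radius $\epsilon$; equivalently it is given by the Kac-Rice formula $$K_{2}(x,y) = \phi_{(\nabla F (x),\nabla F(y))}(0,0)\cdot \mathbb{E}\big[|\det H_{F}(x)|\cdot |\det H_{F}(y)|\ \big|\ \nabla F(x)=\nabla F(y)=0\big],$$ where $\phi_{(\nabla F(x),\nabla F(y))}$ is the density of the Gaussian vector $(\nabla F(x),\nabla F(y))\in\mathbb{R}^4$ and $H_F$ is the Hessian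 of $F$. By stationarity and isotropy it depends only on $r=\|x-y\|>0$ and is written $K_2(r)$. The critical points are said to attract each other if $K_2(r)\to\infty$ as $r\to0$, and to repel each other if $K_2(r)\to 0$ as $r\to 0$. *)

theory Defs
  imports "HOL-Probability.Probability"
begin

text \<open>A random field on \<open>\<real>\<^sup>2\<close> is given by its sample functions: \<open>F \<omega>\<close> is the realisation belonging
  to the outcome \<open>\<omega>\<close> of the probability space \<open>M\<close>.\<close>

text \<open>Point masses count as (degenerate) Gaussian variables.\<close>

definition gaussian_rv :: "'a measure \<Rightarrow> ('a \<Rightarrow> real) \<Rightarrow> bool" where
  "gaussian_rv M X \<longleftrightarrow> X \<in> borel_measurable M \<and>
     ((\<exists>\<mu> \<sigma>. \<sigma> > 0 \<and> distributed M lborel X (normal_density \<mu> \<sigma>)) \<or>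
      (\<exists>\<mu>. AE \<omega> in M. X \<omega> = \<mu>))"

definition gaussian_field :: "'a measure \<Rightarrow> ('a \<Rightarrow> real ^ 2 \<Rightarrow> real) \<Rightarrow> bool" where
  "gaussian_field M F \<longleftrightarrow>
     (\<forall>S a. finite S \<longrightarrow> gaussian_rv M (\<lambda>\<omega>. \<Sum>x\<in>S. a x * F \<omega> x))"

definition centred_field :: "'a measure \<Rightarrow> ('a \<Rightarrow> real ^ 2 \<Rightarrow> real) \<Rightarrow> bool" where
  "centred_field M F \<longleftrightarrow> (\<forall>x. (\<integral>\<omega>. F \<omega> x \<partial>M) = 0)"

text \<open>All finite-dimensional distributions are invariant under translations.\<close>

definition stationary_field :: "'a measure \<Rightarrow> ('a \<Rightarrow> real ^ 2 \<Rightarrow> real) \<Rightarrow> bool" where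
  "stationary_field M F \<longleftrightarrow>
     (\<forall>S h. finite S \<longrightarrow>
        distr M (\<Pi>\<^sub>M x\<in>S. borel) (\<lambda>\<omega>. \<lambda>x\<in>S. F \<omega> (x + h)) =
        distr M (\<Pi>\<^sub>M x\<in>S. borel) (\<lambda>\<omega>. \<lambda>x\<in>S. F \<omega> x))"

definition isotropic_field :: "'a measure \<Rightarrow> ('a \<Rightarrow> real ^ 2 \<Rightarrow> real) \<Rightarrow> bool" where
  "isotropic_field M F \<longleftrightarrow>
     (\<forall>x y x' y'. norm (x - y) = norm (x' - y') \<longrightarrow>
        (\<integral>\<omega>. F \<omega> x * F \<omega> y \<partial>M) = (\<integral>\<omega>. F \<omega> x' * F \<omega> y' \<partial>M))"

definition nonconstant_field :: "'a measure \<Rightarrow> ('a \<Rightarrow> real ^ 2 \<Rightarrow> real) \<Rightarrow> bool" where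
  "nonconstant_field M F \<longleftrightarrow> \<not> (AE \<omega> in M. F \<omega> constant_on UNIV)"

text \<open>The class \<open>C\<^sup>s\<close> on the whole space for real \<open>s \<ge> 0\<close>: all partial derivatives up to order \<open>\<lfloor>s\<rfloor>\<close>
  exist and are continuous, and those of order \<open>\<lfloor>s\<rfloor>\<close> are locally Hoelder with exponent \<open>s - \<lfloor>s\<rfloor>\<close>.
  The Hoelder bound is uniform on compact sets only. When \<open>s\<close> is an integer the exponent is \<open>0\<close>;
  the bound then follows from continuity, and \<open>C\<^sup>s\<close> is the usual class.\<close>

definition locally_holder :: "real \<Rightarrow> ('v::euclidean_space \<Rightarrow> real) \<Rightarrow> bool" where
  "locally_holder \<alpha> f \<longleftrightarrow>
     (\<forall>K. compact K \<longrightarrow> (\<exists>C. \<forall>x\<in>K. \<forall>y\<in>K. \<bar>f x - f y\<bar> \<le> C * dist x y powr \<alpha>))"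

primrec C_k_holder :: "nat \<Rightarrow> real \<Rightarrow> ('v::euclidean_space \<Rightarrow> real) \<Rightarrow> bool" where
  "C_k_holder 0 \<alpha> f \<longleftrightarrow> continuous_on UNIV f \<and> locally_holder \<alpha> f"
| "C_k_holder (Suc k) \<alpha> f \<longleftrightarrow>
     (\<forall>x. f differentiable (at x)) \<and>
     (\<forall>b\<in>Basis. C_k_holder k \<alpha> (\<lambda>x. frechet_derivative f (at x) b))"

definition C_class :: "real \<Rightarrow> ('v::euclidean_space \<Rightarrow> real) \<Rightarrow> bool" where
  "C_class s f \<longleftrightarrow> C_k_holder (nat \<lfloor>s\<rfloor>) (frac s) f"

definition critical_points :: "(real ^ 2 \<Rightarrow> real) \<Rightarrow> (real ^ 2) set" where
  "critical_points f = {x. GDERIV f x :> 0}"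

text \<open>Counting measure rather than \<^const>\<open>card\<close>, so that infinite sets have infinitely many points.\<close>

definition num_critical :: "(real ^ 2 \<Rightarrow> real) \<Rightarrow> real ^ 2 \<Rightarrow> real \<Rightarrow> ennreal" where
  "num_critical f x \<epsilon> = emeasure (count_space UNIV) (critical_points f \<inter> ball x \<epsilon>)"

text \<open>\<open>K\<close> is the value at \<open>(x, y)\<close> of the two-point correlation function of the critical points,
  that is, the defining limit exists and equals \<open>K\<close>. The two radii tend to \<open>0\<close> independently.\<close>

definition has_two_point_correlation ::
  "'a measure \<Rightarrow> ('a \<Rightarrow> real ^ 2 \<Rightarrow> real) \<Rightarrow> real ^ 2 \<Rightarrow> real ^ 2 \<Rightarrow> ennreal \<Rightarrow> bool" where
  "has_two_point_correlation M F x y K \<longleftrightarrow>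
     ((\<lambda>(\<epsilon>\<^sub>1, \<epsilon>\<^sub>2).
         (\<integral>\<^sup>+ \<omega>. num_critical (F \<omega>) x \<epsilon>\<^sub>1 * num_critical (F \<omega>) y \<epsilon>\<^sub>2 \<partial>M) /
         (emeasure lborel (ball (0 :: real ^ 2) \<epsilon>\<^sub>1) * emeasure lborel (ball (0 :: real ^ 2) \<epsilon>\<^sub>2)))
       \<longlongrightarrow> K) (at_right 0 \<times>\<^sub>F at_right 0)"

end

theory Submission
  imports Defs
begin

text \<open>
  Let \<open>2 * s\<close> be the distance of the two points. After a rotation and a shift they are
  \<open>u = - s *\<^sub>R e1\<close> and \<open>v = s *\<^sub>R e1\<close>. The two-point function is the Kac-Rice density
  of the zeros of the field \<open>(u, v) \<mapsto> (\<nabla>F u, \<nabla>F v)\<close> on four-space: the density of this Gaussian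
  vector at \<open>0\<close>, times the expectation of \<open>\<bar>det H u\<bar> * \<bar>det H v\<bar>\<close> conditional on both gradients being \<open>0\<close>.
  As \<open>s\<close> tends to \<open>0\<close> two effects compete, and they cancel.

  The density is large. The two gradients nearly coincide; their difference is \<open>2 * s\<close> times a second
  derivative in direction \<open>e1\<close>, so in two of the four dimensions the standard deviation is of order \<open>s\<close>,
  and the density grows like \<open>s\<close> to the power \<open>- 2\<close>.

  The determinants are small. If the gradient vanishes at both ends of the segment, so do the difference
  quotients of \<open>F\<^sub>1\<close> and \<open>F\<^sub>2\<close> along it, and the second derivatives \<open>F\<^sub>1\<^sub>1\<close> and \<open>F\<^sub>1\<^sub>2\<close> at the ends
  differ from these quotients only to first order: \<open>F\<^sub>1\<^sub>1\<close> is \<open>\<plusminus> s * F\<^sub>1\<^sub>1\<^sub>1 + o(s)\<close>, and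
  \<open>F\<^sub>1\<^sub>2\<close> is of order \<open>s\<close>. Hence each determinant is \<open>\<plusminus> s * F\<^sub>1\<^sub>1\<^sub>1 * F\<^sub>2\<^sub>2 + o(s)\<close>, and the product of
  the two is of order \<open>s\<^sup>2\<close>.

  So the two-point function converges to a constant times the expectation of \<open>(F\<^sub>1\<^sub>1\<^sub>1 * F\<^sub>2\<^sub>2)\<^sup>2\<close>
  conditional on \<open>F\<^sub>1 = F\<^sub>2 = F\<^sub>1\<^sub>1 = F\<^sub>1\<^sub>2 = 0\<close> (\<open>pair_intensity_tendsto\<close>). This limit is finite, and it is
  positive unless \<open>F\<^sub>1\<^sub>1\<^sub>1\<close> or \<open>F\<^sub>2\<^sub>2\<close> is a linear function of the conditioning variables. For \<open>F\<^sub>2\<^sub>2\<close> this is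
  excluded by \<open>Var F\<^sub>1\<^sub>1 = 3 * Var F\<^sub>1\<^sub>2\<close>, a consequence of isotropy. For \<open>F\<^sub>1\<^sub>1\<^sub>1\<close> it would force the covariance of
  \<open>F\<^sub>1\<close> along the first axis to be a multiple of a cosine, so that \<open>F\<^sub>1\<close> at suitable points would be perfectly
  correlated; that is impossible for a nonconstant isotropic field (\<open>C_gradient_pair_less\<close>,
  \<open>third_derivative_nondegenerate\<close>).

  Three devices make this rigorous. First, the values of the field and of its derivatives all lie in a
  linear space of Gaussian variables that is closed under almost sure limits (\<open>gaussian_hilbert\<close>); in such
  a space pathwise convergence implies convergence of covariances and boundedness of all moments, so every
  limit may be taken for a fixed sample function. Secondly, conditioning is replaced by orthogonal
  projection: a Gaussian variable minus its projection onto the conditioning variables (\<open>residual\<close>) is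
  independent of them, and the projections of an arbitrary family can be exchanged for independent copies
  without changing the joint law (\<open>decoupled_law\<close>). Thirdly, with this exchange the Kac-Rice formula
  (\<open>Kac_Rice_intensity\<close>) becomes the area formula for a fixed outcome, followed by Fubini's theorem; the
  conditioning variables are the components of the field at the point in question, normalised to
  be orthonormal.
\<close>

section \<open>Centred Gaussian variables\<close>

text \<open>Stated through the characteristic function, so that the point mass at \<open>0\<close> is included and the
  notion survives passage to limits of random variables.\<close>

definition centred_gaussian :: "'a measure \<Rightarrow> ('a \<Rightarrow> real) \<Rightarrow> bool" where
  "centred_gaussian M X \<longleftrightarrow> X \<in> borel_measurable M \<and> integrable M (\<lambda>\<omega>. (X \<omega>)\<^sup>2) \<and>
     (\<forall>t. (CLINT \<omega>|M. iexp (t * X \<omega>)) = complex_of_real (exp (- (t\<^sup>2 * (\<integral>\<omega>. (X \<omega>)\<^sup>2 \<partial>M)) / 2)))"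

lemma centred_gaussian_distr:
  assumes "prob_space M" and X: "centred_gaussian M X"
  shows "distr M borel X = distr std_normal_distribution borel ((*) (sqrt (\<integral>\<omega>. (X \<omega>)\<^sup>2 \<partial>M)))"
proof (rule Levy_uniqueness)
  interpret prob_space M by fact
  have m[measurable]: "X \<in> borel_measurable M" using X by (simp add: centred_gaussian_def)
  show "real_distribution (distr M borel X)" by (rule real_distribution_distr) simp
  interpret S: real_distribution std_normal_distribution by (rule real_dist_normal_dist)
  let ?s = "sqrt (\<integral>\<omega>. (X \<omega>)\<^sup>2 \<partial>M)"
  have p: "(\<integral>\<omega>. (X \<omega>)\<^sup>2 \<partial>M) \<ge> 0" by simp
  show "real_distribution (distr std_normal_distribution borel ((*) ?s))"
    by (rule S.real_distribution_distr) simp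
  show "char (distr M borel X) = char (distr std_normal_distribution borel ((*) ?s))"
  proof
    fix t
    have "char (distr M borel X) t = (CLINT \<omega>|M. iexp (t * X \<omega>))"
      unfolding char_def by (subst integral_distr) simp_all
    also have "\<dots> = complex_of_real (exp (- (t\<^sup>2 * (\<integral>\<omega>. (X \<omega>)\<^sup>2 \<partial>M)) / 2))"
      using X by (simp add: centred_gaussian_def)
    also have "\<dots> = complex_of_real (exp (- ((t * ?s)\<^sup>2) / 2))"
      using p by (simp add: power_mult_distrib)
    also have "\<dots> = char std_normal_distribution (t * ?s)"
      by (simp add: char_std_normal_distribution)
    also have "\<dots> = char (distr std_normal_distribution borel ((*) ?s)) t"
      unfolding char_def by (subst integral_distr) (simp_all add: ac_simps)
    finally show "char (distr M borel X) t = char (distr std_normal_distribution borel ((*) ?s)) t" .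
  qed
qed

lemma centred_gaussian_even_moment:
  assumes "prob_space M" and X: "centred_gaussian M X"
  shows "integrable M (\<lambda>\<omega>. X \<omega> ^ (2 * k))"
    and "(\<integral>\<omega>. X \<omega> ^ (2 * k) \<partial>M) = fact (2 * k) / (2 ^ k * fact k) * (\<integral>\<omega>. (X \<omega>)\<^sup>2 \<partial>M) ^ k"
proof -
  interpret prob_space M by fact
  have m[measurable]: "X \<in> borel_measurable M" using X by (simp add: centred_gaussian_def)
  let ?v = "\<integral>\<omega>. (X \<omega>)\<^sup>2 \<partial>M"
  have p: "?v \<ge> 0" by simp
  have eq: "(sqrt ?v * x) ^ (2 * k) = ?v ^ k * x ^ (2 * k)" for x
    using p by (simp add: power_mult_distrib power_mult)
  have b: "has_bochner_integral lborel (\<lambda>x. std_normal_density x * x ^ (2 * k)) (fact (2 * k) / (2 ^ k * fact k))"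
    by (rule std_normal_moment_even)
  then have b1: "integrable std_normal_distribution (\<lambda>x. x ^ (2 * k))"
    by (subst integrable_density) (auto simp: has_bochner_integral_iff)
  have b2: "(\<integral>x. x ^ (2 * k) \<partial>std_normal_distribution) = fact (2 * k) / (2 ^ k * fact k)"
    using b by (subst integral_density) (auto simp: has_bochner_integral_iff)
  have "integrable (distr M borel X) (\<lambda>x. x ^ (2 * k))"
    unfolding centred_gaussian_distr[OF assms]
    by (subst integrable_distr_eq) (use b1 in \<open>simp_all add: eq\<close>)
  then show "integrable M (\<lambda>\<omega>. X \<omega> ^ (2 * k))"
    by (subst (asm) integrable_distr_eq) simp_all
  have "(\<integral>\<omega>. X \<omega> ^ (2 * k) \<partial>M) = (\<integral>x. x ^ (2 * k) \<partial>distr M borel X)"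
    by (subst integral_distr) simp_all
  also have "\<dots> = (\<integral>x. (sqrt ?v * x) ^ (2 * k) \<partial>std_normal_distribution)"
    unfolding centred_gaussian_distr[OF assms] by (subst integral_distr) simp_all
  also have "\<dots> = ?v ^ k * (\<integral>x. x ^ (2 * k) \<partial>std_normal_distribution)"
    unfolding eq by simp
  finally show "(\<integral>\<omega>. X \<omega> ^ (2 * k) \<partial>M) = fact (2 * k) / (2 ^ k * fact k) * ?v ^ k"
    by (simp add: b2)
qed

lemma centred_gaussian_no_atom:
  assumes "prob_space M" and X: "centred_gaussian M X" and v: "(\<integral>\<omega>. (X \<omega>)\<^sup>2 \<partial>M) \<noteq> 0"
  shows "AE \<omega> in M. X \<omega> \<noteq> 0"
proof -
  have m[measurable]: "X \<in> borel_measurable M" using X by (simp add: centred_gaussian_def)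
  let ?v = "\<integral>\<omega>. (X \<omega>)\<^sup>2 \<partial>M"
  have "AE x in std_normal_distribution. sqrt ?v * x \<noteq> 0"
    using AE_lborel_singleton[of "0::real"] v by (subst AE_density) auto
  then have "AE x in distr M borel X. x \<noteq> 0"
    unfolding centred_gaussian_distr[OF assms(1,2)] by (subst AE_distr_iff) auto
  then show ?thesis by (subst (asm) AE_distr_iff) auto
qed

lemma gaussian_rv_imp_centred_gaussian:
  assumes "prob_space M" "gaussian_rv M X" "(\<integral>\<omega>. X \<omega> \<partial>M) = 0"
  shows "centred_gaussian M X"
proof -
  interpret prob_space M by fact
  have m[measurable]: "X \<in> borel_measurable M" using assms(2) by (simp add: gaussian_rv_def)
  from assms(2) consider (n) \<mu> \<sigma> where "\<sigma> > 0" "distributed M lborel X (normal_density \<mu> \<sigma>)"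
    | (c) \<mu> where "AE \<omega> in M. X \<omega> = \<mu>" by (auto simp: gaussian_rv_def)
  then show ?thesis
  proof cases
    case c
    have "(\<integral>\<omega>. X \<omega> \<partial>M) = (\<integral>\<omega>. \<mu> \<partial>M)"
      by (rule integral_cong_AE) (use c in auto)
    then have "\<mu> = 0" using assms(3) by (simp add: prob_space)
    then have z: "AE \<omega> in M. X \<omega> = 0" using c by simp
    have v: "(\<integral>\<omega>. (X \<omega>)\<^sup>2 \<partial>M) = (\<integral>\<omega>. 0 \<partial>M)"
      by (rule integral_cong_AE) (use z in auto)
    have i: "integrable M (\<lambda>\<omega>. (X \<omega>)\<^sup>2)"
      by (subst integrable_cong_AE[where g = "\<lambda>_. 0"]) (use z in auto)
    have e: "(CLINT \<omega>|M. iexp (t * X \<omega>)) = (CLINT \<omega>|M. 1)" for t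
      by (rule integral_cong_AE) (use z in auto)
    show ?thesis unfolding centred_gaussian_def v e using i by (simp add: prob_space)
  next
    case n
    have "\<mu> = 0" using normal_distributed_expectation[OF n] assms(3) by simp
    note D = n(2)[unfolded this]
    have v: "(\<integral>\<omega>. (X \<omega>)\<^sup>2 \<partial>M) = \<sigma>\<^sup>2"
      using normal_distributed_variance[OF n(1) D] assms(3) by simp
    have nm: "integrable lborel (\<lambda>x. normal_density 0 \<sigma> x * x ^ 2)"
      using integrable_normal_moment[OF n(1), of 0 2] by simp
    have i: "integrable M (\<lambda>\<omega>. (X \<omega>)\<^sup>2)"
      using distributed_integrable[OF D, of "\<lambda>x. x^2"] nm by simp
    have s: "distributed M lborel (\<lambda>x. X x / \<sigma>) std_normal_density"
      using normal_standard_normal_convert[OF n(1), of X 0] D by simp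
    have d: "distr M borel (\<lambda>x. X x / \<sigma>) = std_normal_distribution"
      using s unfolding distributed_def by (metis distr_cong sets_lborel)
    have "(CLINT \<omega>|M. iexp (t * X \<omega>)) = complex_of_real (exp (- (t\<^sup>2 * \<sigma>\<^sup>2) / 2))" for t
    proof -
      have "(CLINT \<omega>|M. iexp (t * X \<omega>)) = char (distr M borel (\<lambda>x. X x / \<sigma>)) (t * \<sigma>)"
        unfolding char_def using n(1) by (subst integral_distr) simp_all
      then show ?thesis by (simp add: d char_std_normal_distribution power_mult_distrib)
    qed
    then show ?thesis unfolding centred_gaussian_def v using i by simp
  qed
qed

section \<open>Laws determined by linear combinations\<close>

lemma integrable_weighted_iexp:
  fixes g X :: "'a \<Rightarrow> real"
  assumes "finite_measure M" and [measurable]: "X \<in> borel_measurable M" "g \<in> borel_measurable M"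
    and b: "\<And>\<omega>. \<bar>g \<omega>\<bar> \<le> B"
  shows "integrable M (\<lambda>\<omega>. complex_of_real (g \<omega>) * iexp (X \<omega>))"
proof -
  interpret finite_measure M by fact
  show ?thesis
    by (rule integrable_const_bound[where B = B]) (use b in \<open>auto simp: norm_mult\<close>)
qed

text \<open>Divided by their common mass, the weights \<open>g\<close> and \<open>h\<close> become probability densities, and the
  hypothesis says that the laws of \<open>X\<close> and \<open>Y\<close> under the reweighted measures have the same
  characteristic function. If the mass is \<open>0\<close>, the weights vanish almost surely.\<close>

lemma weighted_char_determines:
  fixes g X :: "'a \<Rightarrow> real" and h Y :: "'b \<Rightarrow> real"
  assumes "prob_space M" "prob_space N"
    and [measurable]: "X \<in> borel_measurable M" "Y \<in> borel_measurable N"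
      "g \<in> borel_measurable M" "h \<in> borel_measurable N" "A \<in> sets borel"
    and g: "\<And>\<omega>. 0 \<le> g \<omega>" "\<And>\<omega>. g \<omega> \<le> B" and h: "\<And>\<omega>. 0 \<le> h \<omega>" "\<And>\<omega>. h \<omega> \<le> B"
    and eq: "\<And>s. (CLINT \<omega>|M. g \<omega> * iexp (s * X \<omega>)) = (CLINT \<omega>|N. h \<omega> * iexp (s * Y \<omega>))"
  shows "(\<integral>\<omega>. g \<omega> * indicator A (X \<omega>) \<partial>M) = (\<integral>\<omega>. h \<omega> * indicator A (Y \<omega>) \<partial>N)"
proof -
  interpret M: prob_space M by fact
  interpret N: prob_space N by fact
  have ig: "integrable M g" by (rule M.integrable_const_bound[where B = B]) (use g in auto)
  have ih: "integrable N h" by (rule N.integrable_const_bound[where B = B]) (use h in auto)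
  define c where "c = (\<integral>\<omega>. g \<omega> \<partial>M)"
  have "complex_of_real (\<integral>\<omega>. g \<omega> \<partial>M) = complex_of_real (\<integral>\<omega>. h \<omega> \<partial>N)"
    using eq[of 0] by simp
  then have ch: "c = (\<integral>\<omega>. h \<omega> \<partial>N)" unfolding c_def by (simp only: of_real_eq_iff)
  have c0: "c \<ge> 0" unfolding c_def using g by (simp add: integral_nonneg_AE)
  have law: "real_distribution (distr (density P (\<lambda>\<omega>. ennreal (k \<omega> / c))) borel Z) \<and>
      (\<forall>s. char (distr (density P (\<lambda>\<omega>. ennreal (k \<omega> / c))) borel Z) s = (CLINT \<omega>|P. k \<omega> * iexp (s * Z \<omega>)) / c) \<and>
      measure (distr (density P (\<lambda>\<omega>. ennreal (k \<omega> / c))) borel Z) A = (\<integral>\<omega>. k \<omega> * indicator A (Z \<omega>) \<partial>P) / c"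
    if c: "c > 0" and P: "prob_space P" "integrable P k" "\<And>\<omega>. 0 \<le> k \<omega>" "c = (\<integral>\<omega>. k \<omega> \<partial>P)"
      and Z[measurable]: "Z \<in> borel_measurable P" for P :: "'c measure" and k Z
  proof -
    interpret P: prob_space P by fact
    let ?D = "density P (\<lambda>\<omega>. ennreal (k \<omega> / c))"
    have [measurable]: "k \<in> borel_measurable P" using P(2) by auto
    have "emeasure ?D (space ?D) = (\<integral>\<^sup>+\<omega>. ennreal (k \<omega> / c) \<partial>P)"
      by (subst emeasure_density) (auto intro!: nn_integral_cong)
    also have "\<dots> = ennreal (\<integral>\<omega>. k \<omega> / c \<partial>P)"
      by (rule nn_integral_eq_integral) (use P c in auto)
    also have "\<dots> = 1" using c P(4) by simp
    finally interpret D: prob_space ?D by (rule prob_spaceI)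
    have Zm: "Z \<in> borel_measurable ?D" by simp
    have 1: "real_distribution (distr ?D borel Z)" by (rule D.real_distribution_distr[OF Zm])
    have 2: "char (distr ?D borel Z) s = (CLINT \<omega>|P. k \<omega> * iexp (s * Z \<omega>)) / c" for s
    proof -
      have "char (distr ?D borel Z) s = (CLINT \<omega>|?D. iexp (s * Z \<omega>))"
        unfolding char_def by (subst integral_distr) simp_all
      also have "\<dots> = (CLINT \<omega>|P. (k \<omega> / c) *\<^sub>R iexp (s * Z \<omega>))"
        by (subst integral_density) (use P c in auto)
      also have "\<dots> = (CLINT \<omega>|P. (k \<omega> * iexp (s * Z \<omega>)) / c)"
        by (intro Bochner_Integration.integral_cong) (auto simp: scaleR_conv_of_real)
      finally show ?thesis by simp
    qed
    have "measure (distr ?D borel Z) A = measure ?D (Z -` A \<inter> space ?D)"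
      by (rule measure_distr) auto
    also have "\<dots> = (\<integral>\<omega>. indicator (Z -` A \<inter> space ?D) \<omega> \<partial>?D)" by simp
    also have "\<dots> = (\<integral>\<omega>. (k \<omega> / c) *\<^sub>R indicator (Z -` A \<inter> space P) \<omega> \<partial>P)"
      by (subst integral_density) (use P c in auto)
    also have "\<dots> = (\<integral>\<omega>. (k \<omega> * indicator A (Z \<omega>)) / c \<partial>P)"
      by (intro Bochner_Integration.integral_cong) (auto simp: indicator_def)
    finally show ?thesis using 1 2 by simp
  qed
  show ?thesis
  proof (cases "c = 0")
    case True
    have "AE \<omega> in M. g \<omega> = 0" using integral_nonneg_eq_0_iff_AE[OF ig] g True c_def by simp
    then have 1: "(\<integral>\<omega>. g \<omega> * indicator A (X \<omega>) \<partial>M) = (\<integral>\<omega>. 0 \<partial>M)"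
      by (intro integral_cong_AE) auto
    have "AE \<omega> in N. h \<omega> = 0" using integral_nonneg_eq_0_iff_AE[OF ih] h True ch by simp
    then have 2: "(\<integral>\<omega>. h \<omega> * indicator A (Y \<omega>) \<partial>N) = (\<integral>\<omega>. 0 \<partial>N)"
      by (intro integral_cong_AE) auto
    show ?thesis using 1 2 by simp
  next
    case False
    then have c: "c > 0" using c0 by simp
    note 1 = law[OF c \<open>prob_space M\<close> ig g(1) c_def assms(3)]
    note 2 = law[OF c \<open>prob_space N\<close> ih h(1) ch assms(4)]
    have "distr (density M (\<lambda>\<omega>. ennreal (g \<omega> / c))) borel X = distr (density N (\<lambda>\<omega>. ennreal (h \<omega> / c))) borel Y"
      by (rule Levy_uniqueness) (use 1 2 eq in \<open>auto simp: fun_eq_iff\<close>)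
    with 1 2 c show ?thesis by simp
  qed
qed

text \<open>Only nonnegative weights turn into densities, so \<open>iexp (T \<omega>)\<close> cannot be used as a weight
  directly. The weights \<open>1\<close>, \<open>1 + cos T\<close> and \<open>1 + sin T\<close> can, and real and imaginary part
  of \<open>iexp T\<close> are differences of these.\<close>

lemma char_swap_indicator:
  fixes G T X :: "'a \<Rightarrow> real" and G' T' X' :: "'b \<Rightarrow> real"
  assumes "prob_space M" "prob_space N"
    and [measurable]: "X \<in> borel_measurable M" "T \<in> borel_measurable M" "G \<in> borel_measurable M"
      "X' \<in> borel_measurable N" "T' \<in> borel_measurable N" "G' \<in> borel_measurable N" "A \<in> sets borel"
    and G: "\<And>\<omega>. 0 \<le> G \<omega>" "\<And>\<omega>. G \<omega> \<le> 1" and G': "\<And>\<omega>. 0 \<le> G' \<omega>" "\<And>\<omega>. G' \<omega> \<le> 1"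
    and eq: "\<And>s r. (CLINT \<omega>|M. G \<omega> * iexp (s * X \<omega> + r * T \<omega>)) = (CLINT \<omega>|N. G' \<omega> * iexp (s * X' \<omega> + r * T' \<omega>))"
  shows "(CLINT \<omega>|M. complex_of_real (G \<omega> * indicator A (X \<omega>)) * iexp (T \<omega>))
       = (CLINT \<omega>|N. complex_of_real (G' \<omega> * indicator A (X' \<omega>)) * iexp (T' \<omega>))"
proof -
  interpret M: prob_space M by fact
  interpret N: prob_space N by fact
  have iM: "integrable M (\<lambda>\<omega>. complex_of_real (G \<omega>) * iexp (s * X \<omega> + r * T \<omega>))" for s r
    by (rule integrable_weighted_iexp[where B = 1]) (use G in \<open>auto simp: M.finite_measure_axioms\<close>)
  have iN: "integrable N (\<lambda>\<omega>. complex_of_real (G' \<omega>) * iexp (s * X' \<omega> + r * T' \<omega>))" for s r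
    by (rule integrable_weighted_iexp[where B = 1]) (use G' in \<open>auto simp: N.finite_measure_axioms\<close>)
  have ie: "iexp x = Complex (cos x) (sin x)" for x :: real
    by (simp add: complex_eq_iff flip: cis_conv_exp)
  have trig: "0 \<le> 1 + cos x" "1 + cos x \<le> 2" "0 \<le> 1 + sin x" "1 + sin x \<le> 2" for x :: real
    using cos_ge_minus_one[of x] cos_le_one[of x] sin_ge_minus_one[of x] sin_le_one[of x] by linarith+
  have tc: "complex_of_real (g * (1 + cos t)) * iexp s = complex_of_real g * iexp (s + 0 * t)
      + (complex_of_real g * iexp (s + 1 * t) + complex_of_real g * iexp (s + (-1) * t)) / 2" for g s t :: real
    unfolding ie by (simp add: complex_eq_iff cos_add sin_add cos_diff sin_diff algebra_simps)
  have ts: "complex_of_real (g * (1 + sin t)) * iexp s = complex_of_real g * iexp (s + 0 * t)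
      + Complex 0 (- 1 / 2) * (complex_of_real g * iexp (s + 1 * t) - complex_of_real g * iexp (s + (-1) * t))" for g s t :: real
    unfolding ie by (simp add: complex_eq_iff cos_add sin_add cos_diff sin_diff algebra_simps)
  have e0: "(\<integral>\<omega>. G \<omega> * indicator A (X \<omega>) \<partial>M) = (\<integral>\<omega>. G' \<omega> * indicator A (X' \<omega>) \<partial>N)"
    by (rule weighted_char_determines[OF assms(1,2), where B = 1]) (use G G' eq[of _ 0] in auto)
  have ec: "(\<integral>\<omega>. (G \<omega> * (1 + cos (T \<omega>))) * indicator A (X \<omega>) \<partial>M) = (\<integral>\<omega>. (G' \<omega> * (1 + cos (T' \<omega>))) * indicator A (X' \<omega>) \<partial>N)"
  proof (rule weighted_char_determines[OF assms(1,2), where B = 2])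
    show "0 \<le> G \<omega> * (1 + cos (T \<omega>))" "0 \<le> G' \<omega>' * (1 + cos (T' \<omega>'))" for \<omega> \<omega>'
      using G G' by (auto intro!: mult_nonneg_nonneg trig)
    show "G \<omega> * (1 + cos (T \<omega>)) \<le> 2" "G' \<omega>' * (1 + cos (T' \<omega>')) \<le> 2" for \<omega> \<omega>'
      using mult_mono[OF G(2)[of \<omega>] trig(2)[of "T \<omega>"]] mult_mono[OF G'(2)[of \<omega>'] trig(2)[of "T' \<omega>'"]] trig(1) by simp_all
    show "(CLINT \<omega>|M. (G \<omega> * (1 + cos (T \<omega>))) * iexp (s * X \<omega>)) = (CLINT \<omega>|N. (G' \<omega> * (1 + cos (T' \<omega>))) * iexp (s * X' \<omega>))" for s
      unfolding tc by (simp only: Bochner_Integration.integral_add Bochner_Integration.integrable_add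
          integral_divide_zero integrable_divide_zero iM iN eq)
  qed simp_all
  have es: "(\<integral>\<omega>. (G \<omega> * (1 + sin (T \<omega>))) * indicator A (X \<omega>) \<partial>M) = (\<integral>\<omega>. (G' \<omega> * (1 + sin (T' \<omega>))) * indicator A (X' \<omega>) \<partial>N)"
  proof (rule weighted_char_determines[OF assms(1,2), where B = 2])
    show "0 \<le> G \<omega> * (1 + sin (T \<omega>))" "0 \<le> G' \<omega>' * (1 + sin (T' \<omega>'))" for \<omega> \<omega>'
      using G G' by (auto intro!: mult_nonneg_nonneg trig)
    show "G \<omega> * (1 + sin (T \<omega>)) \<le> 2" "G' \<omega>' * (1 + sin (T' \<omega>')) \<le> 2" for \<omega> \<omega>'
      using mult_mono[OF G(2)[of \<omega>] trig(4)[of "T \<omega>"]] mult_mono[OF G'(2)[of \<omega>'] trig(4)[of "T' \<omega>'"]] trig(3) by simp_all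
    show "(CLINT \<omega>|M. (G \<omega> * (1 + sin (T \<omega>))) * iexp (s * X \<omega>)) = (CLINT \<omega>|N. (G' \<omega> * (1 + sin (T' \<omega>))) * iexp (s * X' \<omega>))" for s
      unfolding ts by (simp only: Bochner_Integration.integral_add Bochner_Integration.integrable_add
          Bochner_Integration.integral_diff Bochner_Integration.integrable_diff
          integral_mult_right_zero integrable_mult_right iM iN eq)
  qed simp_all
  \<comment> \<open>the integrands that occur are bounded, hence integrable\<close>
  have bd: "\<bar>g * f * indicator A (x::real)\<bar> \<le> 1" if "0 \<le> g" "g \<le> 1" "\<bar>f\<bar> \<le> 1" for g f x :: real
    using that mult_mono[of g 1 "\<bar>f\<bar>" 1] by (auto simp: indicator_def abs_mult)
  have split: "(CLINT \<omega>|P. complex_of_real (K \<omega> * indicator A (Z \<omega>)) * iexp (U \<omega>)) =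
      complex_of_real ((\<integral>\<omega>. (K \<omega> * (1 + cos (U \<omega>))) * indicator A (Z \<omega>) \<partial>P) - (\<integral>\<omega>. K \<omega> * indicator A (Z \<omega>) \<partial>P))
      + \<i> * complex_of_real ((\<integral>\<omega>. (K \<omega> * (1 + sin (U \<omega>))) * indicator A (Z \<omega>) \<partial>P) - (\<integral>\<omega>. K \<omega> * indicator A (Z \<omega>) \<partial>P))"
    if "prob_space P" and [measurable]: "K \<in> borel_measurable P" "Z \<in> borel_measurable P" "U \<in> borel_measurable P"
      and K: "\<And>\<omega>. 0 \<le> K \<omega>" "\<And>\<omega>. K \<omega> \<le> 1"
    for P :: "'c measure" and K Z U
  proof -
    interpret P: prob_space P by fact
    have i1: "integrable P (\<lambda>\<omega>. K \<omega> * 1 * indicator A (Z \<omega>))"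
      by (rule P.integrable_const_bound[where B = 1]) (use K bd[OF K, of 1] in \<open>auto intro!: AE_I2\<close>)
    have i2: "integrable P (\<lambda>\<omega>. K \<omega> * cos (U \<omega>) * indicator A (Z \<omega>))"
      by (rule P.integrable_const_bound[where B = 1]) (use K in \<open>auto intro!: AE_I2 bd\<close>)
    have i3: "integrable P (\<lambda>\<omega>. K \<omega> * sin (U \<omega>) * indicator A (Z \<omega>))"
      by (rule P.integrable_const_bound[where B = 1]) (use K in \<open>auto intro!: AE_I2 bd\<close>)
    have c: "(\<integral>\<omega>. (K \<omega> * (1 + cos (U \<omega>))) * indicator A (Z \<omega>) \<partial>P) - (\<integral>\<omega>. K \<omega> * indicator A (Z \<omega>) \<partial>P)
        = (\<integral>\<omega>. K \<omega> * cos (U \<omega>) * indicator A (Z \<omega>) \<partial>P)"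
      using i1 i2 by (simp add: algebra_simps)
    have s: "(\<integral>\<omega>. (K \<omega> * (1 + sin (U \<omega>))) * indicator A (Z \<omega>) \<partial>P) - (\<integral>\<omega>. K \<omega> * indicator A (Z \<omega>) \<partial>P)
        = (\<integral>\<omega>. K \<omega> * sin (U \<omega>) * indicator A (Z \<omega>) \<partial>P)"
      using i1 i3 by (simp add: algebra_simps)
    have "(CLINT \<omega>|P. complex_of_real (K \<omega> * indicator A (Z \<omega>)) * iexp (U \<omega>)) =
        (CLINT \<omega>|P. complex_of_real (K \<omega> * cos (U \<omega>) * indicator A (Z \<omega>)) + \<i> * complex_of_real (K \<omega> * sin (U \<omega>) * indicator A (Z \<omega>)))"
      by (intro Bochner_Integration.integral_cong refl)
         (simp add: ie complex_eq_iff)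
    also have "\<dots> = complex_of_real (\<integral>\<omega>. K \<omega> * cos (U \<omega>) * indicator A (Z \<omega>) \<partial>P)
        + \<i> * complex_of_real (\<integral>\<omega>. K \<omega> * sin (U \<omega>) * indicator A (Z \<omega>) \<partial>P)"
      using i2 i3 by (subst Bochner_Integration.integral_add) (auto simp del: of_real_mult)
    finally show ?thesis unfolding c s .
  qed
  show ?thesis
    unfolding split[OF assms(1,5,3,4) G] split[OF assms(2,8,6,7) G'] by (simp only: e0 ec es)
qed

text \<open>The coordinates are moved one at a time out of the exponential and into an indicator; the
  frequencies of the remaining coordinates stay arbitrary, which is what the next move consumes.\<close>

lemma char_swap_indicators:
  fixes X :: "'i \<Rightarrow> 'a \<Rightarrow> real" and Y :: "'i \<Rightarrow> 'b \<Rightarrow> real"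
  assumes "prob_space M" "prob_space N"
    and X[measurable]: "\<And>i. X i \<in> borel_measurable M" and Y[measurable]: "\<And>i. Y i \<in> borel_measurable N"
    and eq: "\<And>S a. finite S \<Longrightarrow> (CLINT \<omega>|M. iexp (\<Sum>i\<in>S. a i * X i \<omega>)) = (CLINT \<omega>|N. iexp (\<Sum>i\<in>S. a i * Y i \<omega>))"
    and "finite J" "\<And>i. A i \<in> sets borel"
  shows "finite S \<Longrightarrow> (CLINT \<omega>|M. (\<Prod>j\<in>J. indicator (A j) (X j \<omega>) :: real) * iexp (\<Sum>i\<in>S. a i * X i \<omega>))
       = (CLINT \<omega>|N. (\<Prod>j\<in>J. indicator (A j) (Y j \<omega>) :: real) * iexp (\<Sum>i\<in>S. a i * Y i \<omega>))"
  using \<open>finite J\<close>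
proof (induction J arbitrary: S a)
  case empty
  then show ?case using eq by simp
next
  case (insert j J)
  note [measurable] = assms(7)
  have pr: "(\<Prod>j\<in>insert j J. f j) = (\<Prod>j\<in>J. f j) * f j" for f :: "'i \<Rightarrow> real"
    using insert.hyps by (simp add: mult.commute)
  have b: "0 \<le> (\<Prod>j\<in>J. indicator (A j) (x j) :: real)" "(\<Prod>j\<in>J. indicator (A j) (x j) :: real) \<le> 1" for x :: "'i \<Rightarrow> real"
    by (auto intro!: prod_nonneg prod_le_1)
  have comb: "s * x j + r * (\<Sum>i\<in>S. a i * x i) = (\<Sum>i\<in>insert j S. ((if i = j then s else 0) + (if i \<in> S then r * a i else 0)) * x i)"
    for s r and x :: "'i \<Rightarrow> real"
  proof -
    have "(\<Sum>i\<in>insert j S. ((if i = j then s else 0) + (if i \<in> S then r * a i else 0)) * x i)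
       = (\<Sum>i\<in>insert j S. if i = j then s * x i else 0) + (\<Sum>i\<in>insert j S. if i \<in> S then r * a i * x i else 0)"
      by (subst sum.distrib[symmetric]) (auto intro!: sum.cong simp: algebra_simps)
    also have "(\<Sum>i\<in>insert j S. if i = j then s * x i else 0) = s * x j"
      using insert.prems by (subst sum.delta) auto
    also have "(\<Sum>i\<in>insert j S. if i \<in> S then r * a i * x i else 0) = (\<Sum>i\<in>S. r * a i * x i)"
      using insert.prems by (intro sum.mono_neutral_cong_right) auto
    finally show ?thesis by (simp add: sum_distrib_left algebra_simps)
  qed
  note comb_X = comb[of _ "\<lambda>i. X i \<omega>" for \<omega>] and comb_Y = comb[of _ "\<lambda>i. Y i \<omega>" for \<omega>]
  have fin: "finite (insert j S)" using insert.prems by simp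
  show ?case
    unfolding pr
    by (rule char_swap_indicator[OF assms(1,2)])
       (use b insert.IH[OF fin] in \<open>simp_all add: comb_X comb_Y del: of_real_add of_real_mult of_real_sum of_real_prod\<close>)
qed

text \<open>The Cramer-Wold device for families over an arbitrary, in general uncountable, index set.
  Cylinder sets generate the product \<open>\<sigma>\<close>-algebra, and their probabilities are the case of an empty
  exponential in \<open>char_swap_indicators\<close>.\<close>

theorem cramer_wold_PiM:
  fixes X :: "'i \<Rightarrow> 'a \<Rightarrow> real" and Y :: "'i \<Rightarrow> 'b \<Rightarrow> real"
  assumes "prob_space M" "prob_space N"
    and X[measurable]: "\<And>i. X i \<in> borel_measurable M" and Y[measurable]: "\<And>i. Y i \<in> borel_measurable N"
    and eq: "\<And>S a. finite S \<Longrightarrow> (CLINT \<omega>|M. iexp (\<Sum>i\<in>S. a i * X i \<omega>)) = (CLINT \<omega>|N. iexp (\<Sum>i\<in>S. a i * Y i \<omega>))"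
  shows "distr M (PiM UNIV (\<lambda>_. borel)) (\<lambda>\<omega> i. X i \<omega>) = distr N (PiM UNIV (\<lambda>_. borel)) (\<lambda>\<omega> i. Y i \<omega>)"
proof (rule measure_eqI_PiM_infinite)
  interpret M: prob_space M by fact
  interpret N: prob_space N by fact
  have mX[measurable]: "(\<lambda>\<omega> i. X i \<omega>) \<in> measurable M (PiM UNIV (\<lambda>_. borel))"
    by (rule measurable_PiM_single') (auto simp: space_PiM)
  have mY[measurable]: "(\<lambda>\<omega> i. Y i \<omega>) \<in> measurable N (PiM UNIV (\<lambda>_. borel))"
    by (rule measurable_PiM_single') (auto simp: space_PiM)
  show "finite_measure (distr M (PiM UNIV (\<lambda>_. borel)) (\<lambda>\<omega> i. X i \<omega>))"
    using M.prob_space_distr[OF mX] prob_space.finite_measure by blast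
  fix A :: "'i \<Rightarrow> real set" and J :: "'i set"
  assume J: "finite J" and "\<And>i. i \<in> J \<Longrightarrow> A i \<in> sets borel"
  define B where "B i = (if i \<in> J then A i else UNIV)" for i
  have B[measurable]: "B i \<in> sets borel" for i using \<open>\<And>i. i \<in> J \<Longrightarrow> A i \<in> sets borel\<close> by (simp add: B_def)
  have AB: "Pi\<^sub>E J A = Pi\<^sub>E J B" by (rule PiE_cong) (simp add: B_def)
  have E: "emeasure (distr P (PiM UNIV (\<lambda>_. borel)) (\<lambda>\<omega> i. Z i \<omega>)) (prod_emb UNIV (\<lambda>_. borel) J (Pi\<^sub>E J A))
      = ennreal (\<integral>\<omega>. (\<Prod>j\<in>J. indicator (B j) (Z j \<omega>)) \<partial>P)"
    if "prob_space P" and m[measurable]: "(\<lambda>\<omega> i. Z i \<omega>) \<in> measurable P (PiM UNIV (\<lambda>_. borel))"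
    for P :: "'c measure" and Z :: "'i \<Rightarrow> 'c \<Rightarrow> real"
  proof -
    interpret P: prob_space P by fact
    have [measurable]: "Z i \<in> borel_measurable P" for i
      using measurable_compose[OF m measurable_component_singleton[of i]] by simp
    let ?E = "{\<omega> \<in> space P. \<forall>j\<in>J. Z j \<omega> \<in> B j}"
    have "prod_emb UNIV (\<lambda>_. borel) J (Pi\<^sub>E J B) \<in> sets (PiM UNIV (\<lambda>_. borel))"
      by (rule sets_PiM_I) (use J B in auto)
    then have "emeasure (distr P (PiM UNIV (\<lambda>_. borel)) (\<lambda>\<omega> i. Z i \<omega>)) (prod_emb UNIV (\<lambda>_. borel) J (Pi\<^sub>E J A))
        = emeasure P ((\<lambda>\<omega> i. Z i \<omega>) -` prod_emb UNIV (\<lambda>_. borel) J (Pi\<^sub>E J B) \<inter> space P)"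
      unfolding AB by (subst emeasure_distr) auto
    also have "(\<lambda>\<omega> i. Z i \<omega>) -` prod_emb UNIV (\<lambda>_. borel) J (Pi\<^sub>E J B) \<inter> space P = ?E"
      by (auto simp: prod_emb_def space_PiM PiE_iff extensional_def)
    also have "emeasure P ?E = ennreal (measure P ?E)" by (rule P.emeasure_eq_measure)
    also have "measure P ?E = (\<integral>\<omega>. indicator ?E \<omega> \<partial>P)" using J by simp
    also have "\<dots> = (\<integral>\<omega>. (\<Prod>j\<in>J. indicator (B j) (Z j \<omega>)) \<partial>P)"
      using J by (intro Bochner_Integration.integral_cong refl) (auto simp: indicator_def prod_eq_1_iff intro!: prod.neutral[symmetric])
    finally show ?thesis .
  qed
  have "complex_of_real (\<integral>\<omega>. (\<Prod>j\<in>J. indicator (B j) (X j \<omega>)) \<partial>M) = complex_of_real (\<integral>\<omega>. (\<Prod>j\<in>J. indicator (B j) (Y j \<omega>)) \<partial>N)"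
    using char_swap_indicators[OF assms J B, where S = "{}"] by (simp del: of_real_prod)
  then have "(\<integral>\<omega>. (\<Prod>j\<in>J. indicator (B j) (X j \<omega>) :: real) \<partial>M) = (\<integral>\<omega>. (\<Prod>j\<in>J. indicator (B j) (Y j \<omega>)) \<partial>N)"
    by (simp only: of_real_eq_iff)
  then show "emeasure (distr M (PiM UNIV (\<lambda>_. borel)) (\<lambda>\<omega> i. X i \<omega>)) (prod_emb UNIV (\<lambda>_. borel) J (Pi\<^sub>E J A)) =
      emeasure (distr N (PiM UNIV (\<lambda>_. borel)) (\<lambda>\<omega> i. Y i \<omega>)) (prod_emb UNIV (\<lambda>_. borel) J (Pi\<^sub>E J A))"
    by (simp add: E[OF assms(1) mX] E[OF assms(2) mY])
qed simp_all

section \<open>Gaussian Hilbert spaces\<close>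

lemma integrable_mult_if_square_integrable:
  fixes X Y :: "'a \<Rightarrow> real"
  assumes [measurable]: "X \<in> borel_measurable M" "Y \<in> borel_measurable M"
    and "integrable M (\<lambda>\<omega>. (X \<omega>)\<^sup>2)" "integrable M (\<lambda>\<omega>. (Y \<omega>)\<^sup>2)"
  shows "integrable M (\<lambda>\<omega>. X \<omega> * Y \<omega>)"
proof (rule Bochner_Integration.integrable_bound)
  show "integrable M (\<lambda>\<omega>. (X \<omega>)\<^sup>2 + (Y \<omega>)\<^sup>2)" using assms by simp
  have "\<bar>x * y\<bar> \<le> x\<^sup>2 + y\<^sup>2" for x y :: real
  proof -
    have "0 \<le> \<bar>x\<bar> * \<bar>y\<bar>" by simp
    moreover have "2 * (\<bar>x\<bar> * \<bar>y\<bar>) \<le> x\<^sup>2 + y\<^sup>2" using sum_squares_bound[of "\<bar>x\<bar>" "\<bar>y\<bar>"] by (simp add: mult.assoc)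
    ultimately show ?thesis unfolding abs_mult by linarith
  qed
  then show "AE \<omega> in M. norm (X \<omega> * Y \<omega>) \<le> norm ((X \<omega>)\<^sup>2 + (Y \<omega>)\<^sup>2)" by simp
qed simp

lemma square_integrable_add:
  fixes X Y :: "'a \<Rightarrow> real"
  assumes [measurable]: "X \<in> borel_measurable M" "Y \<in> borel_measurable M"
    and "integrable M (\<lambda>\<omega>. (X \<omega>)\<^sup>2)" "integrable M (\<lambda>\<omega>. (Y \<omega>)\<^sup>2)"
  shows "integrable M (\<lambda>\<omega>. (X \<omega> + Y \<omega>)\<^sup>2)"
proof -
  have "(\<lambda>\<omega>. (X \<omega> + Y \<omega>)\<^sup>2) = (\<lambda>\<omega>. (X \<omega>)\<^sup>2 + (Y \<omega>)\<^sup>2 + 2 * (X \<omega> * Y \<omega>))"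
    by (auto simp: power2_eq_square algebra_simps)
  then show ?thesis using assms integrable_mult_if_square_integrable[OF assms] by simp
qed

lemma Cauchy_Schwarz_integral:
  fixes X Y :: "'a \<Rightarrow> real"
  assumes [measurable]: "X \<in> borel_measurable M" "Y \<in> borel_measurable M"
    and iX: "integrable M (\<lambda>\<omega>. (X \<omega>)\<^sup>2)" and iY: "integrable M (\<lambda>\<omega>. (Y \<omega>)\<^sup>2)"
  shows "(\<integral>\<omega>. X \<omega> * Y \<omega> \<partial>M)\<^sup>2 \<le> (\<integral>\<omega>. (X \<omega>)\<^sup>2 \<partial>M) * (\<integral>\<omega>. (Y \<omega>)\<^sup>2 \<partial>M)"
proof -
  let ?a = "\<integral>\<omega>. (X \<omega>)\<^sup>2 \<partial>M" and ?b = "\<integral>\<omega>. X \<omega> * Y \<omega> \<partial>M" and ?c = "\<integral>\<omega>. (Y \<omega>)\<^sup>2 \<partial>M"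
  have iXY: "integrable M (\<lambda>\<omega>. X \<omega> * Y \<omega>)" by (rule integrable_mult_if_square_integrable[OF assms])
  have q: "0 \<le> t\<^sup>2 * ?a + 2 * t * s * ?b + s\<^sup>2 * ?c" for t s
  proof -
    have "0 \<le> (\<integral>\<omega>. (t * X \<omega> + s * Y \<omega>)\<^sup>2 \<partial>M)" by simp
    also have "(\<lambda>\<omega>. (t * X \<omega> + s * Y \<omega>)\<^sup>2) = (\<lambda>\<omega>. t\<^sup>2 * (X \<omega>)\<^sup>2 + 2 * t * s * (X \<omega> * Y \<omega>) + s\<^sup>2 * (Y \<omega>)\<^sup>2)"
      by (auto simp: power2_eq_square algebra_simps)
    finally show ?thesis using iX iY iXY by simp
  qed
  have a: "?a \<ge> 0" by simp
  show ?thesis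
  proof (cases "?a = 0")
    case True
    have "?b = 0"
    proof (rule ccontr)
      assume b: "?b \<noteq> 0"
      show False using q[of "- (?c + 1) / (2 * ?b)" 1] True b by (simp add: field_simps)
    qed
    then show ?thesis using True by simp
  next
    case False
    then have "?a > 0" using a by linarith
    then show ?thesis using q[of "- ?b" "?a"] by (simp add: power2_eq_square algebra_simps)
  qed
qed

lemma (in prob_space) second_moment_le_of_AE_limit:
  fixes Y :: "nat \<Rightarrow> 'a \<Rightarrow> real"
  assumes [measurable]: "\<And>n. Y n \<in> borel_measurable M" "Z \<in> borel_measurable M"
    and lim: "AE \<omega> in M. (\<lambda>n. Y n \<omega>) \<longlonglongrightarrow> Z \<omega>"
    and i: "\<And>n. integrable M (\<lambda>\<omega>. (Y n \<omega>)\<^sup>2)" and C: "\<And>n. expectation (\<lambda>\<omega>. (Y n \<omega>)\<^sup>2) \<le> C"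
  shows "integrable M (\<lambda>\<omega>. (Z \<omega>)\<^sup>2)" "expectation (\<lambda>\<omega>. (Z \<omega>)\<^sup>2) \<le> C"
proof -
  have nn: "(\<integral>\<^sup>+\<omega>. ennreal ((Z \<omega>)\<^sup>2) \<partial>M) \<le> ennreal C"
  proof -
    have "(\<integral>\<^sup>+\<omega>. ennreal ((Z \<omega>)\<^sup>2) \<partial>M) = (\<integral>\<^sup>+\<omega>. liminf (\<lambda>n. ennreal ((Y n \<omega>)\<^sup>2)) \<partial>M)"
    proof (rule nn_integral_cong_AE, use lim in eventually_elim)
      fix \<omega> assume "(\<lambda>n. Y n \<omega>) \<longlonglongrightarrow> Z \<omega>"
      then have "(\<lambda>n. ennreal ((Y n \<omega>)\<^sup>2)) \<longlonglongrightarrow> ennreal ((Z \<omega>)\<^sup>2)" by (intro tendsto_intros)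
      then show "ennreal ((Z \<omega>)\<^sup>2) = liminf (\<lambda>n. ennreal ((Y n \<omega>)\<^sup>2))"
        by (intro lim_imp_Liminf[symmetric]) simp_all
    qed
    also have "\<dots> \<le> liminf (\<lambda>n. \<integral>\<^sup>+\<omega>. ennreal ((Y n \<omega>)\<^sup>2) \<partial>M)" by (rule nn_integral_liminf) simp
    also have "\<dots> \<le> ennreal C"
    proof (rule Liminf_le[OF trivial_limit_sequentially], rule always_eventually, rule allI)
      show "(\<integral>\<^sup>+\<omega>. ennreal ((Y n \<omega>)\<^sup>2) \<partial>M) \<le> ennreal C" for n
        by (subst nn_integral_eq_integral[OF i]) (use C in \<open>auto intro!: ennreal_leI\<close>)
    qed
    finally show ?thesis .
  qed
  then show iZ: "integrable M (\<lambda>\<omega>. (Z \<omega>)\<^sup>2)"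
    by (intro integrableI_bounded) (auto simp: order_le_less_trans)
  show "expectation (\<lambda>\<omega>. (Z \<omega>)\<^sup>2) \<le> C"
  proof -
    have "0 \<le> C" using C[of 0] by (rule order_trans[rotated]) simp
    then show ?thesis using nn by (subst (asm) nn_integral_eq_integral[OF iZ]) auto
  qed
qed

text \<open>Bounded second moments make the sequence uniformly integrable: truncating at height \<open>R\<close> costs
  at most \<open>C / R\<close>, uniformly along the sequence and, by Fatou, in the limit. The truncated
  variables converge by dominated convergence.\<close>

lemma (in prob_space) expectation_tendsto_if_L2_bounded:
  fixes Y :: "nat \<Rightarrow> 'a \<Rightarrow> real"
  assumes [measurable]: "\<And>n. Y n \<in> borel_measurable M" "Z \<in> borel_measurable M"
    and lim: "AE \<omega> in M. (\<lambda>n. Y n \<omega>) \<longlonglongrightarrow> Z \<omega>"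
    and i: "\<And>n. integrable M (\<lambda>\<omega>. (Y n \<omega>)\<^sup>2)" and C: "\<And>n. expectation (\<lambda>\<omega>. (Y n \<omega>)\<^sup>2) \<le> C"
  shows "integrable M (\<lambda>\<omega>. (Z \<omega>)\<^sup>2)" "(\<lambda>n. expectation (Y n)) \<longlonglongrightarrow> expectation Z"
proof -
  note fatou = second_moment_le_of_AE_limit[of Y Z C, OF assms]
  note iZ = fatou(1) and EZ = fatou(2)
  show "integrable M (\<lambda>\<omega>. (Z \<omega>)\<^sup>2)" by (rule iZ)
  define T where "T R y = max (-R) (min R y)" for R y :: real
  have tail: "\<bar>expectation X - expectation (\<lambda>\<omega>. T R (X \<omega>))\<bar> \<le> C / R"
    if [measurable]: "X \<in> borel_measurable M" and X: "integrable M (\<lambda>\<omega>. (X \<omega>)\<^sup>2)" "expectation (\<lambda>\<omega>. (X \<omega>)\<^sup>2) \<le> C" and R: "R > 0" for X R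
  proof -
    have i1: "integrable M X" by (rule square_integrable_imp_integrable[OF _ X(1)]) simp
    have i2: "integrable M (\<lambda>\<omega>. T R (X \<omega>))"
      by (rule integrable_const_bound[where B = R]) (use R in \<open>auto simp: T_def\<close>)
    have p: "\<bar>x - T R x\<bar> \<le> x\<^sup>2 / R" for x
    proof (cases "\<bar>x\<bar> \<le> R")
      case True then show ?thesis using R by (simp add: T_def max_def min_def abs_if split: if_splits)
    next
      case False
      then have "\<bar>x - T R x\<bar> \<le> \<bar>x\<bar>" using R by (auto simp: T_def max_def min_def abs_if split: if_splits)
      also have "\<dots> * R \<le> \<bar>x\<bar> * \<bar>x\<bar>" using False by (intro mult_left_mono) auto
      then have "\<bar>x\<bar> \<le> x\<^sup>2 / R" using R by (simp add: field_simps power2_eq_square)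
      finally show ?thesis .
    qed
    have "\<bar>expectation X - expectation (\<lambda>\<omega>. T R (X \<omega>))\<bar> = \<bar>expectation (\<lambda>\<omega>. X \<omega> - T R (X \<omega>))\<bar>"
      using i1 i2 by simp
    also have "\<dots> \<le> expectation (\<lambda>\<omega>. \<bar>X \<omega> - T R (X \<omega>)\<bar>)" by (rule integral_abs_bound)
    also have "\<dots> \<le> expectation (\<lambda>\<omega>. (X \<omega>)\<^sup>2 / R)"
      by (rule integral_mono) (use i1 i2 X p in auto)
    also have "\<dots> \<le> C / R" using X R by (simp add: divide_right_mono)
    finally show ?thesis .
  qed
  have tr: "(\<lambda>n. expectation (\<lambda>\<omega>. T R (Y n \<omega>))) \<longlonglongrightarrow> expectation (\<lambda>\<omega>. T R (Z \<omega>))" if "R > 0" for R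
  proof (rule integral_dominated_convergence[where w = "\<lambda>_. R"])
    show "AE \<omega> in M. (\<lambda>n. T R (Y n \<omega>)) \<longlonglongrightarrow> T R (Z \<omega>)"
      using lim by eventually_elim (auto simp: T_def intro!: tendsto_intros)
    show "AE \<omega> in M. norm (T R (Y n \<omega>)) \<le> R" for n using that by (auto simp: T_def)
  qed (auto simp: T_def)
  show "(\<lambda>n. expectation (Y n)) \<longlonglongrightarrow> expectation Z"
  proof (rule LIMSEQ_I)
    fix r :: real assume r: "r > 0"
    have C0: "0 \<le> C" using C[of 0] by (rule order_trans[rotated]) simp
    define R where "R = 3 * (C + 1) / r"
    have R: "R > 0" "C / R < r / 3" using C0 r by (auto simp: R_def field_simps)
    from LIMSEQ_D[OF tr[OF R(1)], of "r / 3"] r obtain N where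
      N: "\<And>n. n \<ge> N \<Longrightarrow> \<bar>expectation (\<lambda>\<omega>. T R (Y n \<omega>)) - expectation (\<lambda>\<omega>. T R (Z \<omega>))\<bar> < r / 3" by auto
    have "norm (expectation (Y n) - expectation Z) < r" if "n \<ge> N" for n
      using N[OF that] tail[OF assms(1)[of n] i C R(1)] tail[OF assms(2) iZ EZ R(1)] R(2) unfolding real_norm_def by linarith
    then show "\<exists>no. \<forall>n\<ge>no. norm (expectation (Y n) - expectation Z) < r" by blast
  qed
qed

text \<open>A linear space of jointly Gaussian variables that is closed under almost sure limits. This is
  the form of completeness that differentiation of sample functions needs, since difference quotients
  converge pathwise and nothing is known about their moments beforehand. Joint normality is implicit:
  every linear combination is again in the space, hence Gaussian.\<close>

locale gaussian_hilbert = prob_space M for M :: "'a measure" +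
  fixes H :: "('a \<Rightarrow> real) set"
  assumes H_gaussian: "\<And>X. X \<in> H \<Longrightarrow> centred_gaussian M X"
    and H_add: "\<And>X Y. X \<in> H \<Longrightarrow> Y \<in> H \<Longrightarrow> (\<lambda>\<omega>. X \<omega> + Y \<omega>) \<in> H"
    and H_scale: "\<And>c X. X \<in> H \<Longrightarrow> (\<lambda>\<omega>. c * X \<omega>) \<in> H"
    and H_zero: "(\<lambda>\<omega>. 0) \<in> H"
    and H_lim: "\<And>X Y. (\<And>n::nat. X n \<in> H) \<Longrightarrow> Y \<in> borel_measurable M \<Longrightarrow>
                  AE \<omega> in M. (\<lambda>n. X n \<omega>) \<longlonglongrightarrow> Y \<omega> \<Longrightarrow> Y \<in> H"
begin

lemma H_measurable[measurable_dest]: "X \<in> H \<Longrightarrow> X \<in> borel_measurable M"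
  using H_gaussian by (simp add: centred_gaussian_def)

lemma H_square_integrable: "X \<in> H \<Longrightarrow> integrable M (\<lambda>\<omega>. (X \<omega>)\<^sup>2)"
  using H_gaussian by (simp add: centred_gaussian_def)

lemma H_mult_integrable: "X \<in> H \<Longrightarrow> Y \<in> H \<Longrightarrow> integrable M (\<lambda>\<omega>. X \<omega> * Y \<omega>)"
  by (intro integrable_mult_if_square_integrable H_square_integrable H_measurable)

lemma H_char: "X \<in> H \<Longrightarrow> (CLINT \<omega>|M. iexp (X \<omega>)) = complex_of_real (exp (- (expectation (\<lambda>\<omega>. (X \<omega>)\<^sup>2)) / 2))"
  using H_gaussian[of X] by (auto simp: centred_gaussian_def dest!: spec[of _ 1])

lemma H_diff: "X \<in> H \<Longrightarrow> Y \<in> H \<Longrightarrow> (\<lambda>\<omega>. X \<omega> - Y \<omega>) \<in> H"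
  using H_add[of X "\<lambda>\<omega>. (-1) * Y \<omega>"] H_scale[of Y "-1"] by simp

lemma H_sum: "(\<And>i. i \<in> I \<Longrightarrow> X i \<in> H) \<Longrightarrow> (\<lambda>\<omega>. \<Sum>i\<in>I. X i \<omega>) \<in> H"
  by (induction I rule: infinite_finite_induct) (auto simp: H_zero H_add)

lemma H_divide: "X \<in> H \<Longrightarrow> (\<lambda>\<omega>. X \<omega> / c) \<in> H"
  using H_scale[of X "inverse c"] by (simp add: field_simps)

lemma H_minus: "X \<in> H \<Longrightarrow> (\<lambda>\<omega>. - X \<omega>) \<in> H"
  using H_scale[of X "-1"] by simp

text \<open>Within a Gaussian space, almost sure convergence controls second moments without any domination:
  the variance is recovered from the characteristic function at \<open>1\<close>, which is bounded.\<close>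

lemma variance_tendsto:
  fixes X :: "nat \<Rightarrow> 'a \<Rightarrow> real"
  assumes X: "\<And>n. X n \<in> H" and Y: "Y \<in> H" and lim: "AE \<omega> in M. (\<lambda>n. X n \<omega>) \<longlonglongrightarrow> Y \<omega>"
  shows "(\<lambda>n. expectation (\<lambda>\<omega>. (X n \<omega>)\<^sup>2)) \<longlonglongrightarrow> expectation (\<lambda>\<omega>. (Y \<omega>)\<^sup>2)"
proof -
  note [measurable] = X[THEN H_measurable] Y[THEN H_measurable]
  have "(\<lambda>n. CLINT \<omega>|M. iexp (X n \<omega>)) \<longlonglongrightarrow> (CLINT \<omega>|M. iexp (Y \<omega>))"
  proof (rule integral_dominated_convergence[where w = "\<lambda>_. 1"])
    show "AE \<omega> in M. (\<lambda>n. iexp (X n \<omega>)) \<longlonglongrightarrow> iexp (Y \<omega>)"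
      using lim by eventually_elim (auto intro!: tendsto_intros)
  qed auto
  then have "(\<lambda>n. exp (- (expectation (\<lambda>\<omega>. (X n \<omega>)\<^sup>2)) / 2)) \<longlonglongrightarrow> exp (- (expectation (\<lambda>\<omega>. (Y \<omega>)\<^sup>2)) / 2)"
    unfolding H_char[OF X] H_char[OF Y] by (simp only: tendsto_of_real_iff)
  then have "(\<lambda>n. - 2 * ln (exp (- (expectation (\<lambda>\<omega>. (X n \<omega>)\<^sup>2)) / 2))) \<longlonglongrightarrow> - 2 * ln (exp (- (expectation (\<lambda>\<omega>. (Y \<omega>)\<^sup>2)) / 2))"
    by (intro tendsto_mult tendsto_const tendsto_ln) auto
  then have "(\<lambda>n. expectation (\<lambda>\<omega>. (X n \<omega>)\<^sup>2)) \<longlonglongrightarrow> - 2 * (- expectation (\<lambda>\<omega>. (Y \<omega>)\<^sup>2) / 2)"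
    unfolding ln_exp by simp
  then show ?thesis by simp
qed

lemma expectation_mult_eq_polar:
  assumes "X \<in> H" "Y \<in> H"
  shows "expectation (\<lambda>\<omega>. X \<omega> * Y \<omega>) = (expectation (\<lambda>\<omega>. (X \<omega> + Y \<omega>)\<^sup>2) - expectation (\<lambda>\<omega>. (X \<omega> - Y \<omega>)\<^sup>2)) / 4"
proof -
  have "expectation (\<lambda>\<omega>. (X \<omega> + Y \<omega>)\<^sup>2) - expectation (\<lambda>\<omega>. (X \<omega> - Y \<omega>)\<^sup>2)
      = expectation (\<lambda>\<omega>. (X \<omega> + Y \<omega>)\<^sup>2 - (X \<omega> - Y \<omega>)\<^sup>2)"
    using assms by (subst Bochner_Integration.integral_diff) (auto intro!: H_square_integrable H_add H_diff)
  also have "(\<lambda>\<omega>. (X \<omega> + Y \<omega>)\<^sup>2 - (X \<omega> - Y \<omega>)\<^sup>2) = (\<lambda>\<omega>. 4 * (X \<omega> * Y \<omega>))"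
    by (auto simp: power2_eq_square algebra_simps)
  finally show ?thesis by simp
qed

text \<open>By polarisation this is a statement about variances.\<close>

lemma covariance_tendsto:
  fixes X Y :: "nat \<Rightarrow> 'a \<Rightarrow> real"
  assumes X: "\<And>n. X n \<in> H" "X' \<in> H" "AE \<omega> in M. (\<lambda>n. X n \<omega>) \<longlonglongrightarrow> X' \<omega>"
    and Y: "\<And>n. Y n \<in> H" "Y' \<in> H" "AE \<omega> in M. (\<lambda>n. Y n \<omega>) \<longlonglongrightarrow> Y' \<omega>"
  shows "(\<lambda>n. expectation (\<lambda>\<omega>. X n \<omega> * Y n \<omega>)) \<longlonglongrightarrow> expectation (\<lambda>\<omega>. X' \<omega> * Y' \<omega>)"
proof -
  have 1: "AE \<omega> in M. (\<lambda>n. X n \<omega> + Y n \<omega>) \<longlonglongrightarrow> X' \<omega> + Y' \<omega>"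
    using X(3) Y(3) by eventually_elim (auto intro!: tendsto_intros)
  have 2: "AE \<omega> in M. (\<lambda>n. X n \<omega> - Y n \<omega>) \<longlonglongrightarrow> X' \<omega> - Y' \<omega>"
    using X(3) Y(3) by eventually_elim (auto intro!: tendsto_intros)
  show ?thesis
    unfolding expectation_mult_eq_polar[OF X(1) Y(1)] expectation_mult_eq_polar[OF X(2) Y(2)]
    by (intro tendsto_intros variance_tendsto H_add H_diff X Y 1 2) simp
qed

lemma variance_zero_iff: "X \<in> H \<Longrightarrow> expectation (\<lambda>\<omega>. (X \<omega>)\<^sup>2) = 0 \<longleftrightarrow> (AE \<omega> in M. X \<omega> = 0)"
  using integral_nonneg_eq_0_iff_AE[OF H_square_integrable] by simp

lemma covariance_Cauchy_Schwarz:
  "X \<in> H \<Longrightarrow> Y \<in> H \<Longrightarrow> (expectation (\<lambda>\<omega>. X \<omega> * Y \<omega>))\<^sup>2 \<le> expectation (\<lambda>\<omega>. (X \<omega>)\<^sup>2) * expectation (\<lambda>\<omega>. (Y \<omega>)\<^sup>2)"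
  by (intro Cauchy_Schwarz_integral H_measurable H_square_integrable)

end

definition L2_closed_span :: "'a measure \<Rightarrow> ('a \<Rightarrow> 'i \<Rightarrow> real) \<Rightarrow> ('a \<Rightarrow> real) set" where
  "L2_closed_span M F = {Z \<in> borel_measurable M. integrable M (\<lambda>\<omega>. (Z \<omega>)\<^sup>2) \<and>
     (\<forall>e>0. \<exists>S a. finite S \<and> (\<integral>\<omega>. (Z \<omega> - (\<Sum>i\<in>S. a i * F \<omega> i))\<^sup>2 \<partial>M) < e)}"

text \<open>Closedness under almost sure limits: in the span, almost sure convergence to \<open>0\<close> forces the
  variances to \<open>0\<close>, so an almost surely convergent sequence is a Cauchy sequence in mean square, and
  Fatou's lemma identifies its mean square limit with the pointwise one.\<close>

lemma L2_closed_span_gaussian_hilbert: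
  fixes F :: "'a \<Rightarrow> 'i \<Rightarrow> real"
  assumes "prob_space M"
    and m[measurable]: "\<And>i. (\<lambda>\<omega>. F \<omega> i) \<in> borel_measurable M"
    and gauss: "\<And>S a. finite S \<Longrightarrow> centred_gaussian M (\<lambda>\<omega>. \<Sum>i\<in>S. a i * F \<omega> i)"
  shows "gaussian_hilbert M (L2_closed_span M F)" "(\<lambda>\<omega>. F \<omega> i) \<in> L2_closed_span M F"
proof -
  interpret prob_space M by fact
  let ?H = "L2_closed_span M F"
  let ?L = "\<lambda>S a \<omega>. \<Sum>i\<in>S. a i * F \<omega> i"
  have Lm[measurable]: "?L S a \<in> borel_measurable M" for S a by simp
  have Li: "integrable M (\<lambda>\<omega>. (?L S a \<omega>)\<^sup>2)" if "finite S" for S a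
    using gauss[OF that] by (simp add: centred_gaussian_def)
  have Hm[measurable_dest]: "Z \<in> borel_measurable M" if "Z \<in> ?H" for Z using that by (simp add: L2_closed_span_def)
  have Hi: "integrable M (\<lambda>\<omega>. (Z \<omega>)\<^sup>2)" if "Z \<in> ?H" for Z using that by (simp add: L2_closed_span_def)
  have sqdiff: "integrable M (\<lambda>\<omega>. (X \<omega> - Y \<omega>)\<^sup>2)"
    if [measurable]: "X \<in> borel_measurable M" "Y \<in> borel_measurable M"
      and "integrable M (\<lambda>\<omega>. (X \<omega>)\<^sup>2)" "integrable M (\<lambda>\<omega>. (Y \<omega>)\<^sup>2)" for X Y :: "'a \<Rightarrow> real"
    using square_integrable_add[of X M "\<lambda>\<omega>. - Y \<omega>"] that by simp
  have par: "expectation (\<lambda>\<omega>. (X \<omega> + Y \<omega>)\<^sup>2) \<le> 2 * expectation (\<lambda>\<omega>. (X \<omega>)\<^sup>2) + 2 * expectation (\<lambda>\<omega>. (Y \<omega>)\<^sup>2)"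
    if [measurable]: "X \<in> borel_measurable M" "Y \<in> borel_measurable M"
      and i: "integrable M (\<lambda>\<omega>. (X \<omega>)\<^sup>2)" "integrable M (\<lambda>\<omega>. (Y \<omega>)\<^sup>2)" for X Y :: "'a \<Rightarrow> real"
  proof -
    have "(x + y)\<^sup>2 \<le> 2 * x\<^sup>2 + 2 * y\<^sup>2" for x y :: real
      using sum_squares_bound[of x y] by (simp add: power2_sum)
    then have "expectation (\<lambda>\<omega>. (X \<omega> + Y \<omega>)\<^sup>2) \<le> expectation (\<lambda>\<omega>. 2 * (X \<omega>)\<^sup>2 + 2 * (Y \<omega>)\<^sup>2)"
      by (intro integral_mono square_integrable_add) (use that in auto)
    then show ?thesis using i by simp
  qed
  show "(\<lambda>\<omega>. F \<omega> i) \<in> ?H" for i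
    unfolding L2_closed_span_def
  proof (safe intro!: m)
    show "integrable M (\<lambda>\<omega>. (F \<omega> i)\<^sup>2)" using Li[of "{i}" "\<lambda>_. 1"] by simp
    show "\<exists>S a. finite S \<and> expectation (\<lambda>\<omega>. (F \<omega> i - ?L S a \<omega>)\<^sup>2) < e" if "e > 0" for e
      by (rule exI[of _ "{i}"], rule exI[of _ "\<lambda>_. 1"]) (use that in simp)
  qed
  have gaussH: "centred_gaussian M Z" if Z: "Z \<in> ?H" for Z
  proof -
    note [measurable] = Hm[OF Z]
    have "\<forall>n. \<exists>S a. finite S \<and> expectation (\<lambda>\<omega>. (Z \<omega> - ?L S a \<omega>)\<^sup>2) < inverse (Suc n)"
      using Z by (auto simp: L2_closed_span_def)
    then obtain S a where S: "\<And>n. finite (S n)" and d: "\<And>n. expectation (\<lambda>\<omega>. (Z \<omega> - ?L (S n) (a n) \<omega>)\<^sup>2) < inverse (Suc n)"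
      by metis
    define Y where "Y n = ?L (S n) (a n)" for n
    have [measurable]: "Y n \<in> borel_measurable M" for n unfolding Y_def by simp
    have Yi: "integrable M (\<lambda>\<omega>. (Y n \<omega>)\<^sup>2)" for n unfolding Y_def using Li S by simp
    have Yg: "centred_gaussian M (Y n)" for n unfolding Y_def using gauss S by simp
    have Di: "integrable M (\<lambda>\<omega>. (Y n \<omega> - Z \<omega>)\<^sup>2)" for n using sqdiff Yi Hi[OF Z] by simp
    let ?d = "\<lambda>n. expectation (\<lambda>\<omega>. (Y n \<omega> - Z \<omega>)\<^sup>2)"
    have d0: "?d \<longlonglongrightarrow> 0"
    proof (rule tendsto_sandwich[OF _ _ tendsto_const LIMSEQ_inverse_real_of_nat])
      show "\<forall>\<^sub>F n in sequentially. 0 \<le> ?d n" by simp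
      show "\<forall>\<^sub>F n in sequentially. ?d n \<le> inverse (real (Suc n))"
        using d by (auto simp: Y_def power2_commute intro!: always_eventually less_imp_le)
    qed
    have v: "(\<lambda>n. expectation (\<lambda>\<omega>. (Y n \<omega>)\<^sup>2)) \<longlonglongrightarrow> expectation (\<lambda>\<omega>. (Z \<omega>)\<^sup>2)"
    proof -
      have eq: "expectation (\<lambda>\<omega>. (Y n \<omega>)\<^sup>2) = expectation (\<lambda>\<omega>. (Z \<omega>)\<^sup>2) + ?d n + 2 * expectation (\<lambda>\<omega>. Z \<omega> * (Y n \<omega> - Z \<omega>))" for n
      proof -
        have "(\<lambda>\<omega>. (Y n \<omega>)\<^sup>2) = (\<lambda>\<omega>. (Z \<omega>)\<^sup>2 + (Y n \<omega> - Z \<omega>)\<^sup>2 + 2 * (Z \<omega> * (Y n \<omega> - Z \<omega>)))"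
          by (auto simp: power2_eq_square algebra_simps)
        moreover have "integrable M (\<lambda>\<omega>. Z \<omega> * (Y n \<omega> - Z \<omega>))"
          by (rule integrable_mult_if_square_integrable) (use Di Hi[OF Z] in auto)
        ultimately show ?thesis using Di Hi[OF Z] by simp
      qed
      have "(\<lambda>n. expectation (\<lambda>\<omega>. Z \<omega> * (Y n \<omega> - Z \<omega>))) \<longlonglongrightarrow> 0"
      proof (rule Lim_null_comparison)
        show "\<forall>\<^sub>F n in sequentially. norm (expectation (\<lambda>\<omega>. Z \<omega> * (Y n \<omega> - Z \<omega>))) \<le> sqrt (expectation (\<lambda>\<omega>. (Z \<omega>)\<^sup>2) * ?d n)"
          using Cauchy_Schwarz_integral[of Z M "\<lambda>\<omega>. Y _ \<omega> - Z \<omega>"] Di Hi[OF Z]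
          by (auto intro!: always_eventually real_le_rsqrt)
        show "(\<lambda>n. sqrt (expectation (\<lambda>\<omega>. (Z \<omega>)\<^sup>2) * ?d n)) \<longlonglongrightarrow> 0"
          using tendsto_real_sqrt[OF tendsto_mult_right_zero[OF d0, of "expectation (\<lambda>\<omega>. (Z \<omega>)\<^sup>2)"]] by simp
      qed
      then have "(\<lambda>n. expectation (\<lambda>\<omega>. (Z \<omega>)\<^sup>2) + ?d n + 2 * expectation (\<lambda>\<omega>. Z \<omega> * (Y n \<omega> - Z \<omega>))) \<longlonglongrightarrow> expectation (\<lambda>\<omega>. (Z \<omega>)\<^sup>2) + 0 + 2 * 0"
        by (intro tendsto_intros d0)
      then show ?thesis unfolding eq by simp
    qed
    obtain r where r: "strict_mono r" "AE \<omega> in M. (\<lambda>n. (Y (r n) \<omega> - Z \<omega>)\<^sup>2) \<longlonglongrightarrow> 0"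
      using tendsto_L1_AE_subseq[of M "\<lambda>n \<omega>. (Y n \<omega> - Z \<omega>)\<^sup>2"] Di d0 by auto
    have lim: "AE \<omega> in M. (\<lambda>n. Y (r n) \<omega>) \<longlonglongrightarrow> Z \<omega>"
      using r(2)
    proof eventually_elim
      case (elim \<omega>)
      then have "(\<lambda>n. sqrt ((Y (r n) \<omega> - Z \<omega>)\<^sup>2)) \<longlonglongrightarrow> sqrt 0" by (intro tendsto_intros)
      then show ?case by (simp add: tendsto_rabs_zero_iff LIM_zero_iff)
    qed
    show ?thesis unfolding centred_gaussian_def
    proof (intro conjI allI Hm[OF Z] Hi[OF Z])
      fix t
      have "(\<lambda>n. CLINT \<omega>|M. iexp (t * Y (r n) \<omega>)) \<longlonglongrightarrow> (CLINT \<omega>|M. iexp (t * Z \<omega>))"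
      proof (rule integral_dominated_convergence[where w = "\<lambda>_. 1"])
        show "AE \<omega> in M. (\<lambda>n. iexp (t * Y (r n) \<omega>)) \<longlonglongrightarrow> iexp (t * Z \<omega>)"
          using lim by eventually_elim (auto intro!: tendsto_intros)
      qed (auto simp del: of_real_mult)
      moreover have "(\<lambda>n. CLINT \<omega>|M. iexp (t * Y (r n) \<omega>)) = (\<lambda>n. complex_of_real (exp (- (t\<^sup>2 * (expectation (\<lambda>\<omega>. (Y (r n) \<omega>)\<^sup>2))) / 2)))"
        using Yg by (auto simp: centred_gaussian_def simp del: of_real_mult)
      moreover have "(\<lambda>n. complex_of_real (exp (- (t\<^sup>2 * (expectation (\<lambda>\<omega>. (Y (r n) \<omega>)\<^sup>2))) / 2)))
          \<longlonglongrightarrow> complex_of_real (exp (- (t\<^sup>2 * (expectation (\<lambda>\<omega>. (Z \<omega>)\<^sup>2))) / 2))"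
        using LIMSEQ_subseq_LIMSEQ[OF v r(1)] by (intro tendsto_intros) (simp_all add: o_def)
      ultimately show "(CLINT \<omega>|M. iexp (t * Z \<omega>)) = complex_of_real (exp (- (t\<^sup>2 * (expectation (\<lambda>\<omega>. (Z \<omega>)\<^sup>2))) / 2))"
        using LIMSEQ_unique by metis
    qed
  qed
  have add: "(\<lambda>\<omega>. X \<omega> + Y \<omega>) \<in> ?H" if X: "X \<in> ?H" and Y: "Y \<in> ?H" for X Y
    unfolding L2_closed_span_def
  proof safe
    note [measurable] = Hm[OF X] Hm[OF Y]
    show "(\<lambda>\<omega>. X \<omega> + Y \<omega>) \<in> borel_measurable M" by simp
    show "integrable M (\<lambda>\<omega>. (X \<omega> + Y \<omega>)\<^sup>2)"
      by (rule square_integrable_add[OF Hm[OF X] Hm[OF Y] Hi[OF X] Hi[OF Y]])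
    fix e :: real assume e: "e > 0"
    then have e4: "e / 4 > 0" by simp
    obtain S a where S: "finite S" "expectation (\<lambda>\<omega>. (X \<omega> - ?L S a \<omega>)\<^sup>2) < e / 4" using X e4 unfolding L2_closed_span_def by blast
    obtain T b where T: "finite T" "expectation (\<lambda>\<omega>. (Y \<omega> - ?L T b \<omega>)\<^sup>2) < e / 4" using Y e4 unfolding L2_closed_span_def by blast
    define c where "c i = (if i \<in> S then a i else 0) + (if i \<in> T then b i else 0)" for i
    have 1: "(\<Sum>i\<in>S \<union> T. (if i \<in> S then a i else 0) * F \<omega> i) = ?L S a \<omega>" for \<omega>
      using S T by (intro sum.mono_neutral_cong_right) auto
    have 2: "(\<Sum>i\<in>S \<union> T. (if i \<in> T then b i else 0) * F \<omega> i) = ?L T b \<omega>" for \<omega>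
      using S T by (intro sum.mono_neutral_cong_right) auto
    have c: "?L (S \<union> T) c \<omega> = ?L S a \<omega> + ?L T b \<omega>" for \<omega>
      unfolding c_def 1[symmetric] 2[symmetric] by (simp only: distrib_right sum.distrib)
    have "expectation (\<lambda>\<omega>. (X \<omega> + Y \<omega> - ?L (S \<union> T) c \<omega>)\<^sup>2) = expectation (\<lambda>\<omega>. ((X \<omega> - ?L S a \<omega>) + (Y \<omega> - ?L T b \<omega>))\<^sup>2)"
      unfolding c by (simp add: algebra_simps)
    also have "\<dots> \<le> 2 * expectation (\<lambda>\<omega>. (X \<omega> - ?L S a \<omega>)\<^sup>2) + 2 * expectation (\<lambda>\<omega>. (Y \<omega> - ?L T b \<omega>)\<^sup>2)"
      by (rule par) (auto intro!: sqdiff simp: Hi[OF X] Hi[OF Y] Li S T)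
    also have "\<dots> < e" using S(2) T(2) by simp
    finally show "\<exists>S a. finite S \<and> expectation (\<lambda>\<omega>. (X \<omega> + Y \<omega> - ?L S a \<omega>)\<^sup>2) < e" using S(1) T(1) by blast
  qed
  have zero: "(\<lambda>\<omega>. 0) \<in> ?H"
    unfolding L2_closed_span_def
    by (auto intro!: exI[of _ "{} :: 'i set"])
  have scale: "(\<lambda>\<omega>. c * X \<omega>) \<in> ?H" if X: "X \<in> ?H" for X c
  proof (cases "c = 0")
    case True then show ?thesis using zero by simp
  next
    case False
    note [measurable] = Hm[OF X]
    show ?thesis unfolding L2_closed_span_def
    proof safe
      show "(\<lambda>\<omega>. c * X \<omega>) \<in> borel_measurable M" by simp
      show "integrable M (\<lambda>\<omega>. (c * X \<omega>)\<^sup>2)" using Hi[OF X] by (simp add: power_mult_distrib)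
      fix e :: real assume e: "e > 0"
      then have "e / c\<^sup>2 > 0" using False by simp
      then obtain S a where S: "finite S" "expectation (\<lambda>\<omega>. (X \<omega> - ?L S a \<omega>)\<^sup>2) < e / c\<^sup>2"
        using X unfolding L2_closed_span_def by blast
      have "expectation (\<lambda>\<omega>. (c * X \<omega> - ?L S (\<lambda>i. c * a i) \<omega>)\<^sup>2) = expectation (\<lambda>\<omega>. c\<^sup>2 * (X \<omega> - ?L S a \<omega>)\<^sup>2)"
      proof -
        have "c * X \<omega> - ?L S (\<lambda>i. c * a i) \<omega> = c * (X \<omega> - ?L S a \<omega>)" for \<omega>
          by (simp add: right_diff_distrib sum_distrib_left mult.assoc)
        then show ?thesis by (simp only: power_mult_distrib)
      qed
      also have "\<dots> = expectation (\<lambda>\<omega>. (X \<omega> - ?L S a \<omega>)\<^sup>2) * c\<^sup>2" by (simp only: integral_mult_right_zero mult.commute)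
      also have "\<dots> < e"
      proof -
        have "0 < c\<^sup>2" using False by simp
        from S(2)[unfolded pos_less_divide_eq[OF this]] show ?thesis .
      qed
      finally show "\<exists>S a. finite S \<and> expectation (\<lambda>\<omega>. (c * X \<omega> - ?L S a \<omega>)\<^sup>2) < e"
        using S(1) by (intro exI[of _ S] exI[of _ "\<lambda>i. c * a i"] conjI)
    qed
  qed
  have diff: "(\<lambda>\<omega>. X \<omega> - Y \<omega>) \<in> ?H" if "X \<in> ?H" "Y \<in> ?H" for X Y
    using add[OF that(1) scale[OF that(2), of "-1"]] by simp
  have null: "(\<lambda>n. expectation (\<lambda>\<omega>. (V n \<omega>)\<^sup>2)) \<longlonglongrightarrow> 0"
    if V: "\<And>n::nat. V n \<in> ?H" and lim: "AE \<omega> in M. (\<lambda>n. V n \<omega>) \<longlonglongrightarrow> 0" for V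
  proof -
    note [measurable] = Hm[OF V]
    have ch: "(CLINT \<omega>|M. iexp (V n \<omega>)) = complex_of_real (exp (- (expectation (\<lambda>\<omega>. (V n \<omega>)\<^sup>2)) / 2))" for n
      using gaussH[OF V[of n]] by (auto simp: centred_gaussian_def dest!: spec[of _ 1])
    have "(\<lambda>n. CLINT \<omega>|M. iexp (V n \<omega>)) \<longlonglongrightarrow> (CLINT \<omega>|M. 1)"
    proof (rule integral_dominated_convergence[where w = "\<lambda>_. 1"])
      show "AE \<omega> in M. (\<lambda>n. iexp (V n \<omega>)) \<longlonglongrightarrow> 1"
        using lim
      proof eventually_elim
        case (elim \<omega>)
        then have "(\<lambda>n. iexp (V n \<omega>)) \<longlonglongrightarrow> iexp 0" by (intro tendsto_intros)
        then show ?case by simp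
      qed
    qed auto
    then have "(\<lambda>n. complex_of_real (exp (- (expectation (\<lambda>\<omega>. (V n \<omega>)\<^sup>2)) / 2))) \<longlonglongrightarrow> complex_of_real 1"
      unfolding ch by (simp add: prob_space)
    then have "(\<lambda>n. exp (- (expectation (\<lambda>\<omega>. (V n \<omega>)\<^sup>2)) / 2)) \<longlonglongrightarrow> 1" by (simp only: tendsto_of_real_iff)
    then have "(\<lambda>n. - 2 * ln (exp (- (expectation (\<lambda>\<omega>. (V n \<omega>)\<^sup>2)) / 2))) \<longlonglongrightarrow> - 2 * ln 1"
      by (intro tendsto_mult tendsto_const tendsto_ln) auto
    then show ?thesis unfolding ln_exp by simp
  qed
  have lim: "Y \<in> ?H" if X: "\<And>n::nat. X n \<in> ?H" and Ym: "Y \<in> borel_measurable M"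
    and lim: "AE \<omega> in M. (\<lambda>n. X n \<omega>) \<longlonglongrightarrow> Y \<omega>" for X Y
  proof -
    note [measurable] = Hm[OF X] Ym
    have cauchy: "\<exists>N. \<forall>n\<ge>N. \<forall>k\<ge>N. expectation (\<lambda>\<omega>. (X n \<omega> - X k \<omega>)\<^sup>2) < e" if e: "e > 0" for e
    proof (rule ccontr)
      assume "\<not> ?thesis"
      then have "\<forall>N. \<exists>n k. n \<ge> N \<and> k \<ge> N \<and> e \<le> expectation (\<lambda>\<omega>. (X n \<omega> - X k \<omega>)\<^sup>2)" by (meson not_le)
      then obtain p q where pq: "\<And>N. p N \<ge> N" "\<And>N. q N \<ge> N" "\<And>N. e \<le> expectation (\<lambda>\<omega>. (X (p N) \<omega> - X (q N) \<omega>)\<^sup>2)"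
        by metis
      have pl: "filterlim p at_top sequentially" "filterlim q at_top sequentially"
        using pq(1,2) by (auto intro!: filterlim_at_top_mono[OF filterlim_ident])
      have "AE \<omega> in M. (\<lambda>N. X (p N) \<omega> - X (q N) \<omega>) \<longlonglongrightarrow> 0"
        using lim
      proof eventually_elim
        case (elim \<omega>)
        then have "(\<lambda>N. X (p N) \<omega> - X (q N) \<omega>) \<longlonglongrightarrow> Y \<omega> - Y \<omega>"
          by (intro tendsto_diff filterlim_compose[OF elim] pl)
        then show ?case by simp
      qed
      from null[OF diff[OF X X] this] have "(\<lambda>N. expectation (\<lambda>\<omega>. (X (p N) \<omega> - X (q N) \<omega>)\<^sup>2)) \<longlonglongrightarrow> 0" .
      from LIMSEQ_le_const[OF this, of e] pq(3) e show False by auto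
    qed
    have close: "\<exists>n. integrable M (\<lambda>\<omega>. (X n \<omega> - Y \<omega>)\<^sup>2) \<and> expectation (\<lambda>\<omega>. (X n \<omega> - Y \<omega>)\<^sup>2) \<le> e" if e: "e > 0" for e
    proof -
      obtain N where N: "\<And>n k. n \<ge> N \<Longrightarrow> k \<ge> N \<Longrightarrow> expectation (\<lambda>\<omega>. (X n \<omega> - X k \<omega>)\<^sup>2) < e" using cauchy[OF e] by blast
      have l: "AE \<omega> in M. (\<lambda>k. X N \<omega> - X (k + N) \<omega>) \<longlonglongrightarrow> X N \<omega> - Y \<omega>"
        using lim
      proof eventually_elim
        case (elim \<omega>)
        show ?case by (intro tendsto_diff tendsto_const LIMSEQ_ignore_initial_segment elim)
      qed
      have c: "expectation (\<lambda>\<omega>. (X N \<omega> - X (k + N) \<omega>)\<^sup>2) \<le> e" for k using N[of N "k + N"] by simp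
      show ?thesis
        using second_moment_le_of_AE_limit[of "\<lambda>k \<omega>. X N \<omega> - X (k + N) \<omega>" "\<lambda>\<omega>. X N \<omega> - Y \<omega>" e,
            OF _ _ l Hi[OF diff[OF X X]] c]
        by (intro exI[of _ N] conjI) simp_all
    qed
    show ?thesis unfolding L2_closed_span_def
    proof safe
      obtain n where n: "integrable M (\<lambda>\<omega>. (X n \<omega> - Y \<omega>)\<^sup>2)" using close[of 1] by auto
      have "integrable M (\<lambda>\<omega>. (X n \<omega> - (X n \<omega> - Y \<omega>))\<^sup>2)" by (rule sqdiff) (use n Hi[OF X] in auto)
      then show iY: "integrable M (\<lambda>\<omega>. (Y \<omega>)\<^sup>2)" by simp
      fix e :: real assume e: "e > 0"
      then have e8: "e / 8 > 0" by simp
      obtain n where n: "integrable M (\<lambda>\<omega>. (X n \<omega> - Y \<omega>)\<^sup>2)" "expectation (\<lambda>\<omega>. (X n \<omega> - Y \<omega>)\<^sup>2) \<le> e / 8" using close[OF e8] by auto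
      obtain S a where S: "finite S" "expectation (\<lambda>\<omega>. (X n \<omega> - ?L S a \<omega>)\<^sup>2) < e / 8" using X[of n] e8 unfolding L2_closed_span_def by blast
      have "expectation (\<lambda>\<omega>. (Y \<omega> - ?L S a \<omega>)\<^sup>2) = expectation (\<lambda>\<omega>. ((Y \<omega> - X n \<omega>) + (X n \<omega> - ?L S a \<omega>))\<^sup>2)" by simp
      also have "\<dots> \<le> 2 * expectation (\<lambda>\<omega>. (Y \<omega> - X n \<omega>)\<^sup>2) + 2 * expectation (\<lambda>\<omega>. (X n \<omega> - ?L S a \<omega>)\<^sup>2)"
        by (rule par) (auto intro!: sqdiff simp: Hi[OF X] iY Li S)
      also have "\<dots> < e" using S(2) n(2) e by (simp add: power2_commute)
      finally show "\<exists>S a. finite S \<and> expectation (\<lambda>\<omega>. (Y \<omega> - ?L S a \<omega>)\<^sup>2) < e"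
        using S(1) by (intro exI[of _ S] exI[of _ a] conjI)
    qed (rule Ym)
  qed
  show "gaussian_hilbert M ?H"
  proof (unfold_locales, goal_cases)
    case (1 X) then show ?case by (rule gaussH)
  next
    case (2 X Y) then show ?case by (rule add)
  next
    case (3 X c) then show ?case by (rule scale)
  next
    case 4 show ?case by (rule zero)
  next
    case (5 X Y) then show ?case by (rule lim)
  qed
qed

section \<open>Measurability of the number of zeros\<close>

lemma finite_uniform_separation:
  fixes Z :: "'v::euclidean_space set"
  assumes Z: "finite Z" "Z \<subseteq> W" and W: "open W"
  obtains d where "d > 0" "\<And>z. z \<in> Z \<Longrightarrow> ball z d \<subseteq> W" "\<And>z z'. z \<in> Z \<Longrightarrow> z' \<in> Z \<Longrightarrow> z \<noteq> z' \<Longrightarrow> d \<le> dist z z'"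
proof -
  have "\<exists>d>0. ball z d \<subseteq> W \<and> (\<forall>z'\<in>Z. z' \<noteq> z \<longrightarrow> d \<le> dist z z')" if z: "z \<in> Z" for z
  proof -
    obtain d1 where d1: "d1 > 0" "\<forall>z'\<in>Z. z' \<noteq> z \<longrightarrow> d1 \<le> dist z z'" using finite_set_avoid[OF Z(1)] by blast
    obtain d2 where d2: "d2 > 0" "ball z d2 \<subseteq> W" using W Z z by (meson open_contains_ball subsetD)
    show ?thesis
      by (rule exI[of _ "min d1 d2"]) (use d1 d2 in \<open>auto simp: min_le_iff_disj subset_iff\<close>)
  qed
  then obtain e where e: "\<And>z. z \<in> Z \<Longrightarrow> e z > 0" "\<And>z. z \<in> Z \<Longrightarrow> ball z (e z) \<subseteq> W"
    "\<And>z z'. z \<in> Z \<Longrightarrow> z' \<in> Z \<Longrightarrow> z' \<noteq> z \<Longrightarrow> e z \<le> dist z z'" by metis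
  define d where "d = Min (insert 1 (e ` Z))"
  have dz: "d \<le> e z" if "z \<in> Z" for z unfolding d_def using Z that by (intro Min_le) auto
  show ?thesis
  proof (rule that)
    show "d > 0" unfolding d_def using Z e by (subst Min_gr_iff) auto
    show "ball z d \<subseteq> W" if "z \<in> Z" for z using dz[OF that] e(2)[OF that] by (auto simp: subset_iff)
    show "d \<le> dist z z'" if "z \<in> Z" "z' \<in> Z" "z \<noteq> z'" for z z'
      using dz[OF that(1)] e(3)[OF that(1,2)] that(3) by fastforce
  qed
qed

text \<open>The number of common zeros in \<open>W\<close> is the supremum, over finite families of disjoint closed balls
  in \<open>W\<close> with centres in a countable dense set and radii \<open>1 / n\<close>, of the number of balls that contain
  a zero. For continuous \<open>g\<close>, compactness shows that a closed ball contains a zero iff near it there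
  are points of the dense set at which \<open>g\<close> is arbitrarily small. The latter condition involves
  countably many values of \<open>g\<close> and so defines a measurable function \<open>T\<close> of all \<open>g\<close>, continuous or
  not, on the product space. Thus the law of a continuous field in the product \<open>\<sigma>\<close>-algebra determines
  its expected number of zeros.\<close>

lemma zero_count_measurable:
  fixes W :: "'v::euclidean_space set"
  assumes W: "open W"
  obtains T :: "('v \<times> 'm::finite \<Rightarrow> real) \<Rightarrow> ennreal"
  where "T \<in> borel_measurable (PiM UNIV (\<lambda>_. borel))"
    "\<And>g. (\<And>k. continuous_on UNIV (\<lambda>w. g (w, k))) \<Longrightarrow> T g = emeasure (count_space UNIV) {w \<in> W. \<forall>k. g (w, k) = 0}"
proof -
  obtain D :: "'v set" where D: "countable D" "\<And>X. open X \<Longrightarrow> X \<noteq> {} \<Longrightarrow> \<exists>d\<in>D. d \<in> X"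
    using countable_dense_setE by blast
  define r where "r n = inverse (real (Suc n))" for n
  have r0: "r n > 0" for n by (simp add: r_def)
  have rlim: "r \<longlonglongrightarrow> 0" unfolding r_def by (rule LIMSEQ_inverse_real_of_nat)
  define Z :: "('v \<times> nat) \<Rightarrow> ('v \<times> 'm \<Rightarrow> real) \<Rightarrow> bool" where
    "Z b g \<longleftrightarrow> (\<forall>m. \<exists>q\<in>D. dist q (fst b) < r (snd b) + r m \<and> (\<forall>k\<in>UNIV. \<bar>g (q, k)\<bar> < r m))" for b g
  define cb where "cb b = cball (fst b) (r (snd b))" for b :: "'v \<times> nat"
  define \<B> where "\<B> = {B. finite B \<and> B \<subseteq> D \<times> (UNIV :: nat set) \<and> (\<forall>b\<in>B. cb b \<subseteq> W) \<and> (\<forall>b\<in>B. \<forall>b'\<in>B. b \<noteq> b' \<longrightarrow> cb b \<inter> cb b' = {})}"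
  have cB: "countable \<B>"
    by (rule countable_subset[OF _ countable_Collect_finite_subset[of "D \<times> (UNIV::nat set)"]]) (use D in \<open>auto simp: \<B>_def\<close>)
  \<comment> \<open>the number of balls of a disjoint family that pass the test for containing a zero\<close>
  define T where "T g = (SUP B\<in>\<B>. \<Sum>b\<in>B. indicator {g. Z b g} g :: ennreal)" for g
  have Zm: "{g. Z b g} \<in> sets (PiM UNIV (\<lambda>_. borel))" for b
  proof -
    have [measurable]: "(\<lambda>g. g i) \<in> borel_measurable (PiM UNIV (\<lambda>_::'v \<times> 'm. borel :: real measure))" for i
      by (rule measurable_component_singleton) simp
    have U: "UNIV \<in> sets (PiM UNIV (\<lambda>_::'v \<times> 'm. borel :: real measure))"
      using sets.top[of "PiM UNIV (\<lambda>_::'v \<times> 'm. borel :: real measure)"] by (simp add: space_PiM)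
    have "{g. Z b g} = (\<Inter>m\<in>UNIV. \<Union>q\<in>{q\<in>D. dist q (fst b) < r (snd b) + r m}. \<Inter>k\<in>UNIV.
        {g \<in> space (PiM UNIV (\<lambda>_. borel)). \<bar>g (q, k)\<bar> < r m})"
      unfolding Z_def Bex_def by (auto simp: space_PiM)
    also have "\<dots> \<in> sets (PiM UNIV (\<lambda>_. borel))"
    proof (intro sets.countable_INT''[OF U] sets.countable_UN'')
      show "{g \<in> space (PiM UNIV (\<lambda>_. borel)). \<bar>g (q, k)\<bar> < r m} \<in> sets (PiM UNIV (\<lambda>_. borel))" for q :: 'v and k :: 'm and m
        by measurable
      show "countable {q \<in> D. dist q (fst b) < r (snd b) + r m}" for m
        using D(1) by (rule countable_subset[rotated]) auto
      show "countable (UNIV :: 'm set)" by (rule countable_finite) simp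
    qed simp
    finally show ?thesis .
  qed
  have "T \<in> borel_measurable (PiM UNIV (\<lambda>_. borel))"
    unfolding T_def using Zm by (intro borel_measurable_SUP[OF cB] borel_measurable_sum borel_measurable_indicator)
  moreover have "T g = emeasure (count_space UNIV) {w \<in> W. \<forall>k. g (w, k) = 0}" (is "_ = emeasure _ ?N")
    if cont: "\<And>k. continuous_on UNIV (\<lambda>w. g (w, k))" for g
  proof -
    \<comment> \<open>density of the centres gives one direction, compactness of the slightly enlarged ball the other\<close>
    have Zb: "Z b g \<longleftrightarrow> (\<exists>w\<in>cb b. \<forall>k. g (w, k) = 0)" for b
    proof
      assume "\<exists>w\<in>cb b. \<forall>k. g (w, k) = 0"
      then obtain w where w: "w \<in> cb b" "\<And>k. g (w, k) = 0" by blast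
      show "Z b g" unfolding Z_def
      proof
        fix m
        let ?U = "ball (fst b) (r (snd b) + r m) \<inter> (\<Inter>k\<in>UNIV. {q. \<bar>g (q, k)\<bar> < r m})"
        have "open ?U"
          by (intro open_Int open_ball open_INT ballI open_Collect_less continuous_intros cont) auto
        moreover have "w \<in> ?U" using w r0[of m] by (auto simp: cb_def intro: le_less_trans)
        ultimately obtain d where "d \<in> D" "d \<in> ?U" using D(2)[of ?U] by blast
        then show "\<exists>q\<in>D. dist q (fst b) < r (snd b) + r m \<and> (\<forall>k\<in>UNIV. \<bar>g (q, k)\<bar> < r m)"
          by (intro bexI[of _ d]) (auto simp: dist_commute)
      qed
    next
      assume "Z b g"
      then obtain q where q: "\<And>m. dist (q m) (fst b) < r (snd b) + r m" "\<And>m k. \<bar>g (q m, k)\<bar> < r m"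
        unfolding Z_def by (metis UNIV_I)
      have "q m \<in> cball (fst b) (r (snd b) + 1)" for m
        using q(1)[of m] by (simp add: dist_commute r_def) (smt (verit) inverse_le_1_iff of_nat_0_le_iff)
      then obtain w \<phi> where \<phi>: "strict_mono \<phi>" and lim: "(q \<circ> \<phi>) \<longlonglongrightarrow> w"
        using compact_cball[of "fst b" "r (snd b) + 1"] unfolding compact_def by blast
      have r\<phi>: "(\<lambda>m. r (\<phi> m)) \<longlonglongrightarrow> 0" using LIMSEQ_subseq_LIMSEQ[OF rlim \<phi>] by (simp add: o_def)
      have "dist w (fst b) \<le> r (snd b) + 0"
      proof (rule LIMSEQ_le)
        show "(\<lambda>m. dist (q (\<phi> m)) (fst b)) \<longlonglongrightarrow> dist w (fst b)"
          using lim unfolding o_def by (intro tendsto_intros)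
        show "(\<lambda>m. r (snd b) + r (\<phi> m)) \<longlonglongrightarrow> r (snd b) + 0" by (intro tendsto_add tendsto_const r\<phi>)
      qed (use q(1) in \<open>auto intro: less_imp_le\<close>)
      moreover have "g (w, k) = 0" for k
      proof -
        have "(\<lambda>m. g (q (\<phi> m), k)) \<longlonglongrightarrow> g (w, k)"
          using continuous_on_tendsto_compose[OF cont[of k] lim] by (simp add: o_def)
        moreover have "(\<lambda>m. g (q (\<phi> m), k)) \<longlonglongrightarrow> 0"
          by (rule Lim_null_comparison[OF _ r\<phi>]) (use q(2) in \<open>auto intro!: always_eventually less_imp_le\<close>)
        ultimately show ?thesis using LIMSEQ_unique by blast
      qed
      ultimately show "\<exists>w\<in>cb b. \<forall>k. g (w, k) = 0" by (intro bexI[of _ w]) (auto simp: cb_def dist_commute)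
    qed
    have ind: "(\<Sum>b\<in>B. indicator {g. Z b g} g :: ennreal) = of_nat (card {b \<in> B. Z b g})" if "finite B" for B
      using that by (simp add: indicator_def sum.If_cases Int_def)
    show "T g = emeasure (count_space UNIV) ?N"
    proof (rule antisym)
      show "T g \<le> emeasure (count_space UNIV) ?N"
        unfolding T_def
      proof (rule SUP_least)
        fix B assume B: "B \<in> \<B>"
        then have fB: "finite B" by (simp add: \<B>_def)
        let ?B = "{b \<in> B. Z b g}"
        obtain w where w: "\<And>b. b \<in> ?B \<Longrightarrow> w b \<in> cb b" "\<And>b k. b \<in> ?B \<Longrightarrow> g (w b, k) = 0"
          using Zb by (metis (mono_tags, lifting) mem_Collect_eq)
        have inj: "inj_on w ?B"
        proof (rule inj_onI)
          fix b b' assume b: "b \<in> ?B" "b' \<in> ?B" "w b = w b'"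
          then have "w b \<in> cb b \<inter> cb b'" using w(1)[of b] w(1)[of b'] by auto
          moreover have "\<forall>b\<in>B. \<forall>b'\<in>B. b \<noteq> b' \<longrightarrow> cb b \<inter> cb b' = {}" using B by (simp add: \<B>_def)
          ultimately show "b = b'" using b(1,2) by blast
        qed
        have "\<forall>b\<in>B. cb b \<subseteq> W" using B by (simp add: \<B>_def)
        then have sub: "w ` ?B \<subseteq> ?N" using w by blast
        have "(\<Sum>b\<in>B. indicator {g. Z b g} g :: ennreal) = of_nat (card (w ` ?B))"
          using ind[OF fB] card_image[OF inj] by simp
        also have "\<dots> = emeasure (count_space UNIV) (w ` ?B)"
          using fB by (subst emeasure_count_space_finite) (auto simp: ennreal_of_nat_eq_real_of_nat)
        also have "\<dots> \<le> emeasure (count_space UNIV) ?N" by (rule emeasure_mono[OF sub]) simp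
        finally show "(\<Sum>b\<in>B. indicator {g. Z b g} g) \<le> emeasure (count_space UNIV) ?N" .
      qed
      \<comment> \<open>finitely many zeros are separated by sufficiently small balls of the countable family\<close>
      have fin: "of_nat (card Q) \<le> T g" if Q: "finite Q" "Q \<subseteq> ?N" for Q
      proof -
        obtain d where d: "d > 0" "\<And>z. z \<in> Q \<Longrightarrow> ball z d \<subseteq> W" "\<And>z z'. z \<in> Q \<Longrightarrow> z' \<in> Q \<Longrightarrow> z \<noteq> z' \<Longrightarrow> d \<le> dist z z'"
          using finite_uniform_separation[OF Q(1) _ W] Q(2) by blast
        obtain n where n: "r n < d / 4" using d(1) reals_Archimedean[of "d / 4"] by (auto simp: r_def)
        have "\<exists>c\<in>D. c \<in> ball z (r n)" for z using D(2)[of "ball z (r n)"] r0[of n] by auto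
        then obtain c where c: "\<And>z. c z \<in> D" "\<And>z. dist z (c z) < r n" by (metis mem_ball)
        let ?b = "\<lambda>z. (c z, n)"
        have near: "dist z p < d / 2" if "p \<in> cb (?b z)" for z p
        proof -
          have "dist z p \<le> dist z (c z) + dist (c z) p" by (rule dist_triangle)
          also have "\<dots> < r n + r n" using c(2)[of z] that by (intro add_less_le_mono) (auto simp: cb_def)
          finally show ?thesis using n by simp
        qed
        have disj: "z = z'" if "z \<in> Q" "z' \<in> Q" "p \<in> cb (?b z)" "p \<in> cb (?b z')" for z z' p
        proof (rule ccontr)
          assume "z \<noteq> z'"
          then have "d \<le> dist z z'" using d(3) that by blast
          also have "\<dots> \<le> dist z p + dist z' p" by (rule dist_triangle2)
          finally show False using near[OF that(3)] near[OF that(4)] by simp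
        qed
        have zc: "z \<in> cb (?b z)" for z using c(2)[of z] by (simp add: cb_def dist_commute)
        have inj: "inj_on ?b Q" using disj zc by (intro inj_onI) metis
        have B: "?b ` Q \<in> \<B>"
          unfolding \<B>_def mem_Collect_eq
        proof (intro conjI ballI impI)
          show "finite (?b ` Q)" using Q(1) by simp
          show "?b ` Q \<subseteq> D \<times> UNIV" using c(1) by auto
          fix b assume "b \<in> ?b ` Q"
          then obtain z where z: "z \<in> Q" "b = ?b z" by blast
          show "cb b \<subseteq> W"
          proof
            fix p assume "p \<in> cb b"
            then have "dist z p < d / 2" using near z(2) by simp
            then have "p \<in> ball z d" using d(1) by simp
            then show "p \<in> W" using d(2)[OF z(1)] by blast
          qed
          fix b' assume "b' \<in> ?b ` Q" "b \<noteq> b'"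
          then obtain z' where z': "z' \<in> Q" "b' = ?b z'" by blast
          show "cb b \<inter> cb b' = {}" using disj[OF z(1) z'(1)] z(2) z'(2) \<open>b \<noteq> b'\<close> by blast
        qed
        have "{b \<in> ?b ` Q. Z b g} = ?b ` Q" using Zb zc Q(2) by fastforce
        then have "of_nat (card Q) = (\<Sum>b\<in>?b ` Q. indicator {g. Z b g} g :: ennreal)"
          using ind[of "?b ` Q"] Q(1) card_image[OF inj] by simp
        also have "\<dots> \<le> T g" unfolding T_def by (rule SUP_upper[OF B])
        finally show ?thesis .
      qed
      show "emeasure (count_space UNIV) ?N \<le> T g"
      proof (cases "finite ?N")
        case True
        then show ?thesis using fin[OF True] by (simp add: emeasure_count_space_finite ennreal_of_nat_eq_real_of_nat)
      next
        case False
        have "of_nat n \<le> T g" for n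
        proof -
          obtain Q where "finite Q" "card Q = n" "Q \<subseteq> ?N" using infinite_arbitrarily_large[OF False, of n] by blast
          with fin[of Q] show ?thesis by simp
        qed
        then have "\<not> T g < of_nat n" for n by (simp add: not_less)
        then have "T g = top" using ennreal_Ex_less_of_nat[of "T g"] top.not_eq_extremum[of "T g"] by auto
        then show ?thesis by simp
      qed
    qed
  qed
  ultimately show thesis by (rule that)
qed

section \<open>The area formula\<close>

text \<open>The change of variables formula for sets of finite measure, extended to the case in which both
  sides are infinite.\<close>

lemma emeasure_differentiable_image_inj:
  fixes f :: "real^'n::{finite,wellorder} \<Rightarrow> real^'n::_"
  assumes S: "S \<in> sets lebesgue"
    and der: "\<And>x. x \<in> S \<Longrightarrow> (f has_derivative (\<lambda>h. D x *v h)) (at x within S)"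
    and inj: "inj_on f S"
    and meas: "(\<lambda>x. indicator S x * \<bar>det (D x)\<bar>) \<in> borel_measurable lebesgue"
  shows "f ` S \<in> sets lebesgue"
    and "emeasure lebesgue (f ` S) = (\<integral>\<^sup>+x. indicator S x * ennreal \<bar>det (D x)\<bar> \<partial>lebesgue)"
proof -
  show fS: "f ` S \<in> sets lebesgue"
    by (rule differentiable_image_in_sets_lebesgue[OF S])
       (use der in \<open>auto simp: differentiable_on_def differentiable_def\<close>)
  have hm: "f ` S \<in> lmeasurable \<and> measure lebesgue (f ` S) = m \<longleftrightarrow> ((\<lambda>x. \<bar>det (D x)\<bar>) has_integral m) S" for m
    using has_measure_differentiable_image[OF S der inj, of m] by (simp add: matrix_of_matrix_vector_mul)
  have e: "(\<integral>\<^sup>+x. ennreal (indicator S x * \<bar>det (D x)\<bar>) \<partial>lebesgue) = (\<integral>\<^sup>+x. indicator S x * ennreal \<bar>det (D x)\<bar> \<partial>lebesgue)"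
    by (intro nn_integral_cong) (auto simp: indicator_def)
  show "emeasure lebesgue (f ` S) = (\<integral>\<^sup>+x. indicator S x * ennreal \<bar>det (D x)\<bar> \<partial>lebesgue)"
  proof (cases "f ` S \<in> lmeasurable")
    case True
    then have "((\<lambda>x. \<bar>det (D x)\<bar>) has_integral measure lebesgue (f ` S)) S" using hm by blast
    from nn_integral_has_integral_lebesgue[OF _ this]
    have "(\<integral>\<^sup>+x. ennreal (indicator S x * \<bar>det (D x)\<bar>) \<partial>lebesgue) = ennreal (measure lebesgue (f ` S))"
      by (simp add: nn_integral_completion)
    then show ?thesis using emeasure_eq_measure2[OF True] unfolding e by simp
  next
    case False
    have "(\<integral>\<^sup>+x. ennreal (indicator S x * \<bar>det (D x)\<bar>) \<partial>lebesgue) = \<infinity>"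
    proof (rule ccontr)
      assume "\<not> ?thesis"
      then have "integrable lebesgue (\<lambda>x. indicator S x * \<bar>det (D x)\<bar>)"
        using meas by (intro integrableI_bounded) (auto simp: top.not_eq_extremum abs_mult)
      then have "(\<lambda>x. \<bar>det (D x)\<bar>) absolutely_integrable_on S"
        by (simp add: set_integrable_def)
      then obtain m where "((\<lambda>x. \<bar>det (D x)\<bar>) has_integral m) S"
        using set_lebesgue_integral_eq_integral(1) by (metis integrable_on_def)
      then show False using hm False by blast
    qed
    moreover have "emeasure lebesgue (f ` S) = \<infinity>" using False fS top.not_eq_extremum[of "emeasure lebesgue (f ` S)"] by (auto simp: fmeasurable_def)
    ultimately show ?thesis unfolding e by simp
  qed
qed

text \<open>Both sides integrate \<open>g\<close> against the same measure on the target, by the case of indicators.\<close>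

lemma nn_integral_differentiable_image_inj:
  fixes f :: "real^'n::{finite,wellorder} \<Rightarrow> real^'n::_"
  assumes S: "S \<in> sets lebesgue"
    and der: "\<And>x. x \<in> S \<Longrightarrow> (f has_derivative (\<lambda>h. D x *v h)) (at x within S)"
    and inj: "inj_on f S"
    and meas: "(\<lambda>x. indicator S x * \<bar>det (D x)\<bar>) \<in> borel_measurable lebesgue"
    and g: "g \<in> borel_measurable borel"
  shows "(\<integral>\<^sup>+z. indicator (f ` S) z * g z \<partial>lebesgue) = (\<integral>\<^sup>+x. indicator S x * ennreal \<bar>det (D x)\<bar> * g (f x) \<partial>lebesgue)"
proof -
  note [measurable] = S meas
  have fS[measurable]: "f ` S \<in> sets lebesgue" by (rule emeasure_differentiable_image_inj[OF S der inj meas])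
  define f0 where "f0 x = (if x \<in> S then f x else 0)" for x
  have "f \<in> borel_measurable (lebesgue_on S)"
    by (rule continuous_imp_measurable_on_sets_lebesgue[OF _ S])
       (use der in \<open>auto simp: continuous_on_eq_continuous_within intro: has_derivative_continuous\<close>)
  then have f0[measurable]: "f0 \<in> borel_measurable lebesgue"
    unfolding f0_def by (subst (asm) borel_measurable_if[OF S, symmetric]) auto
  let ?J = "\<lambda>x. indicator S x * ennreal \<bar>det (D x)\<bar>"
  have J[measurable]: "?J \<in> borel_measurable lebesgue"
  proof -
    have "?J = (\<lambda>x. ennreal (indicator S x * \<bar>det (D x)\<bar>))" by (auto simp: ennreal_mult' ennreal_indicator)
    then show ?thesis by simp
  qed
  have id[measurable]: "(\<lambda>x. x) \<in> measurable lebesgue borel" by (simp add: measurable_completion)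
  have eq: "distr (density lebesgue (indicator (f ` S))) borel (\<lambda>x. x) = distr (density lebesgue ?J) borel f0"
  proof (rule measure_eqI)
    fix B assume "B \<in> sets (distr (density lebesgue (indicator (f ` S))) borel (\<lambda>x. x))"
    then have B[measurable]: "B \<in> sets borel" by simp
    have B'[measurable]: "B \<in> sets lebesgue" using B by simp
    let ?T = "S \<inter> f0 -` B"
    have T[measurable]: "?T \<in> sets lebesgue" using measurable_sets[OF f0 B] S by (auto intro: sets.Int)
    have fT: "f ` ?T = f ` S \<inter> B" by (auto simp: f0_def)
    have "emeasure (distr (density lebesgue (indicator (f ` S))) borel (\<lambda>x. x)) B = emeasure lebesgue (f ` S \<inter> B)"
    proof -
      have "emeasure (distr (density lebesgue (indicator (f ` S))) borel (\<lambda>x. x)) B = emeasure (density lebesgue (indicator (f ` S))) B"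
        using id by (subst emeasure_distr) auto
      also have "\<dots> = (\<integral>\<^sup>+x. indicator (f ` S) x * indicator B x \<partial>lebesgue)"
        by (rule emeasure_density) auto
      also have "\<dots> = (\<integral>\<^sup>+x. indicator (f ` S \<inter> B) x \<partial>lebesgue)"
        by (intro nn_integral_cong) (auto simp: indicator_def)
      also have "\<dots> = emeasure lebesgue (f ` S \<inter> B)" by (rule nn_integral_indicator) auto
      finally show ?thesis .
    qed
    also have "\<dots> = emeasure lebesgue (f ` ?T)" by (simp add: fT)
    also have "\<dots> = (\<integral>\<^sup>+x. indicator ?T x * ennreal \<bar>det (D x)\<bar> \<partial>lebesgue)"
    proof (rule emeasure_differentiable_image_inj(2)[OF T])
      show "(f has_derivative (\<lambda>h. D x *v h)) (at x within ?T)" if "x \<in> ?T" for x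
        using der[of x] that by (auto intro: has_derivative_subset)
      show "inj_on f ?T" using inj by (rule inj_on_subset) auto
      have "(\<lambda>x. indicator ?T x * \<bar>det (D x)\<bar>) = (\<lambda>x. indicator ?T x * (indicator S x * \<bar>det (D x)\<bar>))"
        by (auto simp: indicator_def)
      also have "\<dots> \<in> borel_measurable lebesgue" by measurable
      finally show "(\<lambda>x. indicator ?T x * \<bar>det (D x)\<bar>) \<in> borel_measurable lebesgue" .
    qed
    also have "\<dots> = (\<integral>\<^sup>+x. ?J x * indicator (f0 -` B \<inter> space lebesgue) x \<partial>lebesgue)"
      by (intro nn_integral_cong) (auto simp: indicator_def)
    also have "\<dots> = emeasure (distr (density lebesgue ?J) borel f0) B"
      using measurable_sets[OF f0 B] by (subst emeasure_distr) (auto simp: emeasure_density)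
    finally show "emeasure (distr (density lebesgue (indicator (f ` S))) borel (\<lambda>x. x)) B = emeasure (distr (density lebesgue ?J) borel f0) B" .
  qed simp
  have "(\<integral>\<^sup>+z. indicator (f ` S) z * g z \<partial>lebesgue) = (\<integral>\<^sup>+z. g z \<partial>distr (density lebesgue (indicator (f ` S))) borel (\<lambda>x. x))"
    using g measurable_compose[OF id g] by (subst nn_integral_distr) (auto simp: nn_integral_density)
  also have "\<dots> = (\<integral>\<^sup>+x. ?J x * g (f0 x) \<partial>lebesgue)"
    unfolding eq using g measurable_compose[OF f0 g] by (subst nn_integral_distr) (auto simp: nn_integral_density)
  also have "\<dots> = (\<integral>\<^sup>+x. ?J x * g (f x) \<partial>lebesgue)"
    by (intro nn_integral_cong) (auto simp: indicator_def f0_def)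
  finally show ?thesis .
qed

lemma locally_injective_if_det_nonzero:
  fixes f :: "real^'n::{finite,wellorder} \<Rightarrow> real^'n::_"
  assumes W: "open W" and der: "\<And>x. x \<in> W \<Longrightarrow> (f has_derivative (\<lambda>h. D x *v h)) (at x)"
    and cont: "continuous_on W D" and x: "x \<in> W" "det (D x) \<noteq> 0"
  obtains U where "open U" "x \<in> U" "U \<subseteq> W" "inj_on f U"
proof -
  define f' where "f' y = Blinfun (\<lambda>h. D y *v h)" for y
  have f': "blinfun_apply (f' y) = (\<lambda>h. D y *v h)" for y
    unfolding f'_def by (rule bounded_linear_Blinfun_apply[OF matrix_vector_mul_bounded_linear])
  have "invertible (D x)" using x by (simp add: invertible_det_nz)
  then obtain B where B: "B ** D x = mat 1" by (auto simp: invertible_left_inverse)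
  define inv where "inv = Blinfun (\<lambda>h. B *v h)"
  have inv: "blinfun_apply inv = (\<lambda>h. B *v h)" unfolding inv_def by (rule bounded_linear_Blinfun_apply[OF matrix_vector_mul_bounded_linear])
  obtain U' V g g' where U: "open U'" "U' \<subseteq> W" "x \<in> U'" "homeomorphism U' V f g"
  proof (rule inverse_function_theorem[of W f f' x inv])
    show "(f has_derivative blinfun_apply (f' y)) (at y)" if "y \<in> W" for y using der[OF that] by (simp add: f')
    show "continuous_on W f'"
      by (rule continuous_on_blinfun_componentwise) (auto simp: f' matrix_vector_mult_def intro!: continuous_on_vec_lambda continuous_intros cont)
    show "inv o\<^sub>L f' x = id_blinfun"
      by (rule blinfun_eqI) (simp add: f' inv B matrix_vector_mul_assoc)
  qed (use W x in auto)
  then show thesis using that[of U'] by (metis homeomorphism_def inj_on_inverseI)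
qed

text \<open>The part of \<open>W\<close> on which the Jacobian does not vanish is, by Lindelof's theorem, a countable
  disjoint union of Borel sets on which \<open>f\<close> is injective; the change of variables formula holds on
  each of them, and the indicators of the images add up to the number of preimages. The remaining
  part of \<open>W\<close> has a null image by Sard's theorem and a vanishing integrand.\<close>

theorem area_formula:
  fixes f :: "real^'n::{finite,wellorder} \<Rightarrow> real^'n::_"
  assumes W: "open W" and der: "\<And>x. x \<in> W \<Longrightarrow> (f has_derivative (\<lambda>h. D x *v h)) (at x)"
    and cont: "continuous_on W D" and g[measurable]: "g \<in> borel_measurable borel"
  shows "(\<integral>\<^sup>+z. emeasure (count_space UNIV) {x \<in> W. f x = z} * g z \<partial>lborel)
       = (\<integral>\<^sup>+x. indicator W x * ennreal \<bar>det (D x)\<bar> * g (f x) \<partial>lborel)"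
proof -
  have cd: "continuous_on W (\<lambda>x. det (D x))" unfolding det_def by (intro continuous_intros cont)
  define W' where "W' = {x \<in> W. det (D x) \<noteq> 0}"
  have W'W: "W' \<subseteq> W" by (auto simp: W'_def)
  have oW': "open W'"
  proof -
    have "W' = W \<inter> (\<lambda>x. det (D x)) -` (- {0})" by (auto simp: W'_def)
    then show ?thesis using continuous_open_preimage[OF cd W, of "- {0}"] by auto
  qed
  let ?F = "{U. open U \<and> U \<subseteq> W' \<and> inj_on f U}"
  obtain F where F: "F \<subseteq> ?F" "countable F" "\<Union>F = \<Union>?F" by (rule Lindelof[of ?F]) auto
  have "W' \<subseteq> \<Union>?F"
  proof
    fix x assume "x \<in> W'"
    then obtain U where "open U" "x \<in> U" "U \<subseteq> W'" "inj_on f U"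
      using locally_injective_if_det_nonzero[of W' f D x] oW' W'W der continuous_on_subset[OF cont] by (auto simp: W'_def)
    then show "x \<in> \<Union>?F" by blast
  qed
  then have UF: "\<Union>F = W'" using F by auto
  define U where "U = from_nat_into (insert {} F)"
  have rU: "range U = insert {} F" unfolding U_def using F(2) by (intro range_from_nat_into) auto
  have oU: "open (U n)" and injU: "inj_on f (U n)" for n
  proof -
    have "U n \<in> insert {} F" using rU by blast
    then show "open (U n)" "inj_on f (U n)" using F(1) by auto
  qed
  define E where "E = disjointed U"
  have EU: "E n \<subseteq> U n" for n unfolding E_def by (rule disjointed_subset)
  have UE: "(\<Union>n. E n) = W'" unfolding E_def UN_disjointed_eq using rU UF by simp
  have dE: "disjoint_family E" unfolding E_def by (rule disjoint_family_disjointed)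
  have Eb: "E n \<in> sets borel" for n
    unfolding E_def using sets.range_disjointed_sets[of U borel] oU by (auto simp: image_subset_iff)
  have injE: "inj_on f (E n)" for n using injU EU by (rule inj_on_subset)
  have EW: "E n \<subseteq> W" for n using UE W'W by auto
  have detm: "(\<lambda>x. indicator (E n) x * \<bar>det (D x)\<bar>) \<in> borel_measurable lebesgue" for n
  proof -
    have "(\<lambda>x. indicator W x *\<^sub>R \<bar>det (D x)\<bar>) \<in> borel_measurable borel"
      by (rule borel_measurable_continuous_on_indicator) (use W cd in \<open>auto intro!: continuous_intros\<close>)
    then have "(\<lambda>x. indicator (E n) x * (indicator W x *\<^sub>R \<bar>det (D x)\<bar>)) \<in> borel_measurable lborel"
      using Eb by simp
    also have "(\<lambda>x. indicator (E n) x * (indicator W x *\<^sub>R \<bar>det (D x)\<bar>)) = (\<lambda>x. indicator (E n) x * \<bar>det (D x)\<bar>)"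
      using EW by (auto simp: indicator_def fun_eq_iff)
    finally show ?thesis by (rule measurable_completion)
  qed
  have derE: "(f has_derivative (\<lambda>h. D x *v h)) (at x within E n)" if "x \<in> E n" for x n
    using der EW that by (blast intro: has_derivative_at_withinI)
  have El: "E n \<in> sets lebesgue" for n using Eb by simp
  have piece: "(\<integral>\<^sup>+z. indicator (f ` E n) z * g z \<partial>lebesgue) = (\<integral>\<^sup>+x. indicator (E n) x * ennreal \<bar>det (D x)\<bar> * g (f x) \<partial>lebesgue)" for n
    by (rule nn_integral_differentiable_image_inj[OF El _ injE detm g]) (rule derE)
  have fE[measurable]: "f ` E n \<in> sets lebesgue" for n by (rule emeasure_differentiable_image_inj(1)[OF El _ injE detm]) (rule derE)
  have gl[measurable]: "g \<in> borel_measurable lebesgue" using g by (simp add: measurable_completion)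
  have "negligible (f ` (W - W'))"
  proof (rule baby_Sard[where f' = "\<lambda>x h. D x *v h"])
    show "(f has_derivative (\<lambda>h. D x *v h)) (at x within W - W')" if "x \<in> W - W'" for x
      using der that by (auto intro: has_derivative_at_withinI)
    show "rank (matrix (\<lambda>h. D x *v h)) < CARD('n)" if "x \<in> W - W'" for x
      using that by (simp add: W'_def matrix_of_matrix_vector_mul det_eq_0_rank)
  qed simp
  then have crit: "AE z in lebesgue. z \<notin> f ` (W - W')" by (simp add: negligible_iff_null_sets AE_not_in)
  have count: "emeasure (count_space UNIV) {x \<in> W. f x = z} = (\<Sum>n. indicator (f ` E n) z)" if z: "z \<notin> f ` (W - W')" for z
  proof -
    have "{x \<in> W. f x = z} = (\<Union>n. {x \<in> E n. f x = z})" using z UE W'W by blast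
    then have "emeasure (count_space UNIV) {x \<in> W. f x = z} = (\<Sum>n. emeasure (count_space UNIV) {x \<in> E n. f x = z})"
      using dE by (subst suminf_emeasure) (auto simp: disjoint_family_on_def)
    also have "\<dots> = (\<Sum>n. indicator (f ` E n) z)"
    proof (intro suminf_cong)
      fix n
      show "emeasure (count_space UNIV) {x \<in> E n. f x = z} = indicator (f ` E n) z"
      proof (cases "z \<in> f ` E n")
        case True
        then obtain x where x: "x \<in> E n" "z = f x" by blast
        then have "{x \<in> E n. f x = z} = {x}" using injE[of n] by (auto dest: inj_onD)
        then show ?thesis using True by simp
      next
        case False
        then have "{x \<in> E n. f x = z} = {}" by auto
        then show ?thesis using False by (simp only: emeasure_empty) simp
      qed
    qed
    finally show ?thesis .
  qed
  have "(\<integral>\<^sup>+z. emeasure (count_space UNIV) {x \<in> W. f x = z} * g z \<partial>lborel) = (\<integral>\<^sup>+z. emeasure (count_space UNIV) {x \<in> W. f x = z} * g z \<partial>lebesgue)"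
    by (rule nn_integral_completion[symmetric])
  also have "\<dots> = (\<integral>\<^sup>+z. (\<Sum>n. indicator (f ` E n) z * g z) \<partial>lebesgue)"
    by (rule nn_integral_cong_AE, use crit in eventually_elim) (simp add: count ennreal_suminf_multc)
  also have "\<dots> = (\<Sum>n. \<integral>\<^sup>+z. indicator (f ` E n) z * g z \<partial>lebesgue)"
    by (rule nn_integral_suminf) simp
  also have "\<dots> = (\<Sum>n. \<integral>\<^sup>+x. indicator (E n) x * ennreal \<bar>det (D x)\<bar> * g (f x) \<partial>lebesgue)" by (simp only: piece)
  also have "\<dots> = (\<integral>\<^sup>+x. (\<Sum>n. indicator (E n) x * ennreal \<bar>det (D x)\<bar> * g (f x)) \<partial>lebesgue)"
  proof (rule nn_integral_suminf[symmetric])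
    fix n
    have fm: "(\<lambda>x. indicator W x *\<^sub>R f x) \<in> borel_measurable borel"
      by (rule borel_measurable_continuous_on_indicator)
         (use W der in \<open>auto intro!: continuous_at_imp_continuous_on intro: has_derivative_continuous\<close>)
    have "(\<lambda>x. g (indicator W x *\<^sub>R f x)) \<in> borel_measurable lborel"
      using measurable_compose[OF fm g] by simp
    then have "(\<lambda>x. g (indicator W x *\<^sub>R f x)) \<in> borel_measurable lebesgue" by (rule measurable_completion)
    then have "(\<lambda>x. ennreal (indicator (E n) x * \<bar>det (D x)\<bar>) * g (indicator W x *\<^sub>R f x)) \<in> borel_measurable lebesgue"
      by (intro borel_measurable_times_ennreal measurable_compose[OF detm measurable_ennreal])
    also have "(\<lambda>x. ennreal (indicator (E n) x * \<bar>det (D x)\<bar>) * g (indicator W x *\<^sub>R f x)) = (\<lambda>x. indicator (E n) x * ennreal \<bar>det (D x)\<bar> * g (f x))"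
      using EW by (auto simp: indicator_def fun_eq_iff)
    finally show "(\<lambda>x. indicator (E n) x * ennreal \<bar>det (D x)\<bar> * g (f x)) \<in> borel_measurable lebesgue" .
  qed
  also have "\<dots> = (\<integral>\<^sup>+x. indicator W x * ennreal \<bar>det (D x)\<bar> * g (f x) \<partial>lebesgue)"
  proof (rule nn_integral_cong)
    fix x
    have "(\<Sum>n. indicator (E n) x * ennreal \<bar>det (D x)\<bar> * g (f x)) = indicator W' x * ennreal \<bar>det (D x)\<bar> * g (f x)"
      by (simp add: ennreal_suminf_multc suminf_indicator[OF dE] UE)
    also have "\<dots> = indicator W x * ennreal \<bar>det (D x)\<bar> * g (f x)" by (auto simp: indicator_def W'_def)
    finally show "(\<Sum>n. indicator (E n) x * ennreal \<bar>det (D x)\<bar> * g (f x)) = indicator W x * ennreal \<bar>det (D x)\<bar> * g (f x)" .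
  qed
  finally show ?thesis by (simp add: nn_integral_completion)
qed

section \<open>Tools for random matrices and smooth coefficients\<close>

definition std_gaussian :: "(real ^ 'n) measure" where
  "std_gaussian = density lborel (\<lambda>z. \<Prod>k\<in>UNIV. ennreal (std_normal_density (z $ k)))"

lemma nn_integral_lborel_vec_prod:
  fixes F :: "'n::finite \<Rightarrow> real \<Rightarrow> ennreal"
  assumes [measurable]: "\<And>k. F k \<in> borel_measurable borel"
  shows "(\<integral>\<^sup>+z. (\<Prod>k\<in>UNIV. F k (z $ k)) \<partial>(lborel :: (real ^ 'n) measure)) = (\<Prod>k\<in>UNIV. \<integral>\<^sup>+x. F k x \<partial>lborel)"
proof -
  define G where "G b = F (SOME k. b = axis k (1::real))" for b :: "real ^ 'n"
  have G: "G (axis k 1) = F k" for k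
    unfolding G_def by (rule arg_cong[where f = F], rule some_equality) (auto simp: axis_eq_axis)
  have B: "(Basis :: (real ^ 'n) set) = (\<lambda>k. axis k 1) ` UNIV" by (auto simp: Basis_vec_def)
  have inj: "inj (\<lambda>k::'n. axis k (1::real))" by (auto simp: inj_on_def axis_eq_axis)
  have "(\<integral>\<^sup>+z. (\<Prod>b\<in>Basis. G b (z \<bullet> b)) \<partial>(lborel :: (real ^ 'n) measure)) = (\<Prod>b\<in>Basis. \<integral>\<^sup>+x. G b x \<partial>lborel)"
    by (rule nn_integral_lborel_prod) (auto simp: B G)
  then show ?thesis unfolding B by (simp add: prod.reindex[OF inj] G inner_axis)
qed

lemma std_gaussian_box:
  fixes A :: "'n::finite \<Rightarrow> real set"
  assumes [measurable]: "\<And>k. A k \<in> sets borel"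
  shows "emeasure std_gaussian {z. \<forall>k. z $ k \<in> A k} = (\<Prod>k\<in>UNIV. emeasure std_normal_distribution (A k))"
proof -
  have m[measurable]: "{z::real^'n. \<forall>k. z $ k \<in> A k} \<in> sets borel"
  proof -
    have "{z::real^'n. \<forall>k. z $ k \<in> A k} = (\<Inter>k\<in>UNIV. (\<lambda>z. z $ k) -` A k \<inter> space borel)" by auto
    also have "\<dots> \<in> sets borel" by (intro sets.finite_INT measurable_sets[where A = borel]) auto
    finally show ?thesis .
  qed
  have "emeasure std_gaussian {z. \<forall>k. z $ k \<in> A k} = (\<integral>\<^sup>+z. (\<Prod>k\<in>UNIV. ennreal (std_normal_density (z $ k))) * indicator {z. \<forall>k. z $ k \<in> A k} z \<partial>(lborel :: (real ^ 'n) measure))"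
    unfolding std_gaussian_def by (rule emeasure_density) simp_all
  also have "\<dots> = (\<integral>\<^sup>+z. (\<Prod>k\<in>UNIV. ennreal (std_normal_density (z $ k)) * indicator (A k) (z $ k)) \<partial>lborel)"
    by (intro nn_integral_cong) (auto simp: prod.distrib indicator_def prod_zero_iff)
  also have "\<dots> = (\<Prod>k\<in>UNIV. \<integral>\<^sup>+x. ennreal (std_normal_density x) * indicator (A k) x \<partial>lborel)"
    by (rule nn_integral_lborel_vec_prod) simp
  also have "\<dots> = (\<Prod>k\<in>UNIV. emeasure std_normal_distribution (A k))"
    by (intro prod.cong refl emeasure_density[symmetric]) auto
  finally show ?thesis .
qed

lemma sets_std_gaussian[simp, measurable_cong]: "sets std_gaussian = sets borel"
  by (simp add: std_gaussian_def)

lemma space_std_gaussian[simp]: "space std_gaussian = UNIV"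
  by (simp add: std_gaussian_def)

lemma prob_space_std_gaussian: "prob_space (std_gaussian :: (real ^ 'n::finite) measure)"
proof (rule prob_spaceI)
  interpret real_distribution std_normal_distribution by (rule real_dist_normal_dist)
  show "emeasure std_gaussian (space (std_gaussian :: (real ^ 'n) measure)) = 1"
    using std_gaussian_box[of "\<lambda>_::'n. UNIV"] emeasure_space_1 by simp
qed

lemma std_gaussian_char:
  fixes a :: "'n::finite \<Rightarrow> real"
  shows "(CLINT z|std_gaussian. iexp (\<Sum>k\<in>UNIV. a k * z $ k)) = complex_of_real (exp (- (\<Sum>k\<in>UNIV. (a k)\<^sup>2) / 2))"
proof -
  interpret prob_space "std_gaussian :: (real ^ 'n) measure" by (rule prob_space_std_gaussian)
  interpret S: real_distribution std_normal_distribution by (rule real_dist_normal_dist)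
  have [measurable]: "(\<lambda>z::real^'n. z $ k) \<in> borel_measurable std_gaussian" for k by simp
  have marg: "emeasure std_gaussian {z. z $ j \<in> B} = emeasure std_normal_distribution B" if B: "B \<in> sets borel" for B and j :: 'n
  proof -
    have "{z :: real^'n. z $ j \<in> B} = {z. \<forall>k. z $ k \<in> (if k = j then B else UNIV)}" by auto
    then have "emeasure std_gaussian {z. z $ j \<in> B} = (\<Prod>k\<in>UNIV. emeasure std_normal_distribution (if k = j then B else UNIV))"
      using std_gaussian_box[of "\<lambda>k. if k = j then B else UNIV"] B by simp
    also have "\<dots> = (\<Prod>k\<in>UNIV. if k = j then emeasure std_normal_distribution B else 1)"
      using S.emeasure_space_1 by (intro prod.cong) auto
    finally show ?thesis by simp
  qed
  have distr: "distr std_gaussian borel (\<lambda>z::real^'n. z $ k) = std_normal_distribution" for k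
    by (rule measure_eqI) (auto simp: emeasure_distr vimage_def marg)
  have indep: "indep_vars (\<lambda>_. borel) (\<lambda>k z. z $ k) (UNIV :: 'n set)"
  proof (subst indep_vars_finite[where E = "\<lambda>_. sets borel"])
    show "\<forall>A\<in>UNIV \<rightarrow> sets borel. prob (\<Inter>j\<in>UNIV. (\<lambda>z::real^'n. z $ j) -` A j \<inter> space std_gaussian) = (\<Prod>j\<in>UNIV. prob ((\<lambda>z. z $ j) -` A j \<inter> space std_gaussian))"
    proof
      fix A :: "'n \<Rightarrow> real set" assume "A \<in> UNIV \<rightarrow> sets borel"
      then have A[measurable]: "A k \<in> sets borel" for k by auto
      have "(\<Inter>j\<in>UNIV. (\<lambda>z::real^'n. z $ j) -` A j \<inter> space std_gaussian) = {z. \<forall>k. z $ k \<in> A k}" by auto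
      then have "ennreal (prob (\<Inter>j\<in>UNIV. (\<lambda>z::real^'n. z $ j) -` A j \<inter> space std_gaussian)) = (\<Prod>k\<in>UNIV. emeasure std_normal_distribution (A k))"
        using std_gaussian_box[of A] A by (simp add: emeasure_eq_measure)
      also have "\<dots> = (\<Prod>k\<in>UNIV. ennreal (prob ((\<lambda>z. z $ k) -` A k \<inter> space std_gaussian)))"
        using marg[OF A] by (simp add: vimage_def emeasure_eq_measure)
      also have "\<dots> = ennreal (\<Prod>k\<in>UNIV. prob ((\<lambda>z. z $ k) -` A k \<inter> space std_gaussian))"
        by (rule prod_ennreal) simp
      finally show "prob (\<Inter>j\<in>UNIV. (\<lambda>z::real^'n. z $ j) -` A j \<inter> space std_gaussian) = (\<Prod>j\<in>UNIV. prob ((\<lambda>z. z $ j) -` A j \<inter> space std_gaussian))"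
        by (subst (asm) ennreal_inj) (auto intro!: prod_nonneg)
    qed
  qed (auto simp: Int_stable_def sets.sigma_sets_eq[of borel, simplified])
  have indep': "indep_vars (\<lambda>_. borel) (\<lambda>k z. a k * z $ k) (UNIV :: 'n set)"
    by (rule indep_vars_compose2[OF indep]) simp
  have "(CLINT z|std_gaussian. iexp (\<Sum>k\<in>UNIV. a k * z $ k)) = char (distr std_gaussian borel (\<lambda>z. \<Sum>k\<in>UNIV. a k * z $ k)) 1"
    unfolding char_def by (subst integral_distr) simp_all
  also have "\<dots> = (\<Prod>k\<in>UNIV. char (distr std_gaussian borel (\<lambda>z. a k * z $ k)) 1)"
    by (rule char_distr_sum[OF indep'])
  also have "\<dots> = (\<Prod>k\<in>UNIV. complex_of_real (exp (- (a k)\<^sup>2 / 2)))"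
  proof (intro prod.cong refl)
    fix k
    have "char (distr std_gaussian borel (\<lambda>z. a k * z $ k)) 1 = char (distr std_gaussian borel (\<lambda>z. z $ k)) (a k)"
      unfolding char_def by (subst (1 2) integral_distr) simp_all
    then show "char (distr std_gaussian borel (\<lambda>z. a k * z $ k)) 1 = complex_of_real (exp (- (a k)\<^sup>2 / 2))"
      by (simp add: distr char_std_normal_distribution)
  qed
  also have "\<dots> = complex_of_real (exp (\<Sum>k\<in>UNIV. - (a k)\<^sup>2 / 2))"
    by (simp add: exp_sum)
  also have "(\<Sum>k\<in>UNIV. - (a k)\<^sup>2 / 2) = - (\<Sum>k\<in>UNIV. (a k)\<^sup>2) / 2"
    by (simp add: sum_negf sum_divide_distrib)
  finally show ?thesis .
qed

text \<open>With \<open>d\<close> a dense sequence in \<open>S\<close>, the functions \<open>f \<omega> (d i)\<close> with \<open>i\<close> the first index such that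
  \<open>d i\<close> lies within \<open>1 / (m + 1)\<close> of \<open>w\<close> are measurable in \<open>(\<omega>, w)\<close> and converge to \<open>f \<omega> w\<close>.\<close>

lemma Caratheodory_function_measurable:
  fixes f :: "'a \<Rightarrow> 'v::euclidean_space \<Rightarrow> real"
  assumes S: "open S" and m: "\<And>w. w \<in> S \<Longrightarrow> (\<lambda>\<omega>. f \<omega> w) \<in> borel_measurable M"
    and c: "\<And>\<omega>. \<omega> \<in> space M \<Longrightarrow> continuous_on S (f \<omega>)"
  shows "(\<lambda>(\<omega>, w). indicator S w * f \<omega> w) \<in> borel_measurable (M \<Otimes>\<^sub>M borel)"
proof (cases "S = {}")
  case True then show ?thesis by simp
next
  case False
  obtain D :: "'v set" where D: "countable D" "\<And>X. open X \<Longrightarrow> X \<noteq> {} \<Longrightarrow> \<exists>d\<in>D. d \<in> X"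
    using countable_dense_setE by blast
  have ne: "D \<inter> S \<noteq> {}" using D(2)[OF S False] by blast
  define d where "d = from_nat_into (D \<inter> S)"
  have d: "d i \<in> S" for i using from_nat_into[OF ne, of i] by (simp add: d_def)
  have rd: "range d = D \<inter> S" unfolding d_def using D(1) ne by (intro range_from_nat_into) auto
  define p where "p m w = (LEAST i. dist (d i) w < inverse (real (Suc m)))" for m and w :: 'v
  have ex: "\<exists>i. dist (d i) w < inverse (real (Suc m))" if "w \<in> S" for m w
  proof -
    have "w \<in> ball w (inverse (real (Suc m))) \<inter> S" using that by (intro IntI) (simp_all only: centre_in_ball, simp)
    then have "open (ball w (inverse (real (Suc m))) \<inter> S)" "ball w (inverse (real (Suc m))) \<inter> S \<noteq> {}"
      using S by (blast intro: open_Int open_ball)+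
    then obtain x where "x \<in> D" "x \<in> ball w (inverse (real (Suc m))) \<inter> S" using D(2) by blast
    then show ?thesis using rd by (metis IntD1 IntD2 IntI dist_commute mem_ball rangeE)
  qed
  have [measurable]: "(\<lambda>\<omega>. f \<omega> (d i)) \<in> borel_measurable M" for i using m d by blast
  have pm[measurable]: "p m \<in> measurable borel (count_space UNIV)" for m
    unfolding p_def by measurable
  have "(\<lambda>x. indicator S (snd x) * f (fst x) (d (p m (snd x)))) \<in> borel_measurable (M \<Otimes>\<^sub>M borel)" for m
  proof -
    have [measurable]: "S \<in> sets borel" using S by simp
    have [measurable]: "(\<lambda>x. f (fst x) (d (p m (snd x)))) \<in> borel_measurable (M \<Otimes>\<^sub>M borel)"
      by (rule measurable_compose_countable[where f = "\<lambda>i x. f (fst x) (d i)" and g = "\<lambda>x. p m (snd x)"]) measurable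
    show ?thesis by measurable
  qed
  then have "(\<lambda>x. indicator S (snd x) * f (fst x) (snd x)) \<in> borel_measurable (M \<Otimes>\<^sub>M borel)"
  proof (rule borel_measurable_LIMSEQ_real[rotated])
    fix x assume x: "x \<in> space (M \<Otimes>\<^sub>M (borel :: 'v measure))"
    show "(\<lambda>m. indicator S (snd x) * f (fst x) (d (p m (snd x)))) \<longlonglongrightarrow> indicator S (snd x) * f (fst x) (snd x)"
    proof (cases "snd x \<in> S")
      case True
      have "dist (d (p m (snd x))) (snd x) < inverse (real (Suc m))" for m
        unfolding p_def by (rule LeastI_ex[OF ex[OF True]])
      then have "(\<lambda>m. dist (d (p m (snd x))) (snd x)) \<longlonglongrightarrow> 0"
        by (intro tendsto_sandwich[OF _ _ tendsto_const LIMSEQ_inverse_real_of_nat] always_eventually allI)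
           (simp_all add: less_imp_le)
      then have "(\<lambda>m. d (p m (snd x))) \<longlonglongrightarrow> snd x" by (rule tendsto_dist_iff[THEN iffD2])
      then have "(\<lambda>m. f (fst x) (d (p m (snd x)))) \<longlonglongrightarrow> f (fst x) (snd x)"
      proof (rule continuous_on_tendsto_compose[rotated])
        show "continuous_on S (f (fst x))" using x by (intro c) (auto simp: space_pair_measure)
        show "\<forall>\<^sub>F m in sequentially. d (p m (snd x)) \<in> S" using d by simp
      qed (rule True)
      then show ?thesis by (intro tendsto_intros)
    qed simp
  qed
  then show ?thesis by (simp add: case_prod_beta')
qed

text \<open>A crude bound by even powers of the entries, because the even moments of Gaussian variables are
  explicit powers of the variance.\<close>

lemma det_squared_le:
  fixes A :: "real ^ 'n ^ 'n"
  shows "(det A)\<^sup>2 \<le> (fact CARD('n))\<^sup>2 * (\<Sum>i\<in>UNIV. \<Sum>l\<in>UNIV. (A $ i $ l) ^ (2 * CARD('n)))"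
proof -
  define m where "m = Max (range (\<lambda>(i, l). \<bar>A $ i $ l\<bar>))"
  have le: "\<bar>A $ i $ l\<bar> \<le> m" for i l unfolding m_def by (rule Max_ge) (auto intro: range_eqI[of _ _ "(i, l)"])
  have "m \<in> range (\<lambda>(i, l). \<bar>A $ i $ l\<bar>)" unfolding m_def by (rule Max_in) auto
  then obtain i0 l0 where m: "m = \<bar>A $ i0 $ l0\<bar>" by auto
  have "\<bar>det A\<bar> \<le> (\<Sum>p\<in>{p. p permutes (UNIV :: 'n set)}. \<bar>of_int (sign p) * (\<Prod>i\<in>UNIV. A $ i $ p i)\<bar>)"
    unfolding det_def by (rule sum_abs)
  also have "\<dots> \<le> (\<Sum>p\<in>{p. p permutes (UNIV :: 'n set)}. m ^ CARD('n))"
  proof (rule sum_mono)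
    fix p
    have "\<bar>of_int (sign p) * (\<Prod>i\<in>UNIV. A $ i $ p i)\<bar> = (\<Prod>i\<in>UNIV. \<bar>A $ i $ p i\<bar>)"
      by (simp add: abs_mult abs_prod sign_def)
    also have "\<dots> \<le> (\<Prod>i\<in>(UNIV :: 'n set). m)" by (rule prod_mono) (use le in auto)
    finally show "\<bar>of_int (sign p) * (\<Prod>i\<in>UNIV. A $ i $ p i)\<bar> \<le> m ^ CARD('n)" by simp
  qed
  also have "\<dots> = fact CARD('n) * m ^ CARD('n)" by (simp add: card_permutations[OF refl])
  finally have "(det A)\<^sup>2 \<le> (fact CARD('n) * m ^ CARD('n))\<^sup>2" by (rule abs_le_square_iff[THEN iffD1, OF order_trans]) (simp add: m)
  also have "\<dots> = (fact CARD('n))\<^sup>2 * (A $ i0 $ l0) ^ (2 * CARD('n))"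
    by (simp add: m power_mult_distrib power_mult[symmetric] mult.commute power_even_abs)
  also have "(A $ i0 $ l0) ^ (2 * CARD('n)) \<le> (\<Sum>l\<in>UNIV. (A $ i0 $ l) ^ (2 * CARD('n)))"
    by (rule member_le_sum) auto
  also have "\<dots> \<le> (\<Sum>i\<in>UNIV. \<Sum>l\<in>UNIV. (A $ i $ l) ^ (2 * CARD('n)))"
    by (rule member_le_sum[of _ _ "\<lambda>i. \<Sum>l\<in>UNIV. (A $ i $ l) ^ (2 * CARD('n))"]) (auto intro!: sum_nonneg)
  finally show ?thesis by (simp add: mult_left_mono)
qed

lemma matrix_inv_entry:
  fixes A :: "real ^ 'n ^ 'n"
  assumes "det A \<noteq> 0"
  shows "matrix_inv A $ i $ k = det (\<chi> r j. if j = i then (if r = k then 1 else 0) else A $ r $ j) / det A"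
proof -
  have inv: "invertible A" using assms by (simp add: invertible_det_nz)
  have "A *v (matrix_inv A *v axis k 1) = axis k 1"
    using someI_ex[OF inv[unfolded invertible_def]] by (simp add: matrix_vector_mul_assoc matrix_inv_def)
  then have "matrix_inv A *v axis k 1 = (\<chi> i. det (\<chi> r j. if j = i then axis k 1 $ r else A $ r $ j) / det A)"
    using cramer[OF assms] by blast
  then have "(matrix_inv A *v axis k 1) $ i = det (\<chi> r j. if j = i then axis k 1 $ r else A $ r $ j) / det A" by simp
  moreover have "(matrix_inv A *v axis k 1) $ i = matrix_inv A $ i $ k"
    by (simp add: matrix_vector_mult_basis column_def)
  moreover have "(\<chi> r j. if j = i then axis k 1 $ r else A $ r $ j) = (\<chi> r j. if j = i then (if r = k then 1 else 0) else (A $ r $ j :: real))"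
    by (simp add: vec_eq_iff axis_def)
  ultimately show ?thesis by simp
qed

definition C1_on :: "'v::euclidean_space set \<Rightarrow> ('v \<Rightarrow> real) \<Rightarrow> bool" where
  "C1_on S f \<longleftrightarrow> (\<exists>G. continuous_on S G \<and> (\<forall>w\<in>S. (f has_derivative (\<lambda>h. G w \<bullet> h)) (at w)))"

lemma C1_on_continuous: "C1_on S f \<Longrightarrow> continuous_on S f"
  unfolding C1_on_def by (meson continuous_at_imp_continuous_on has_derivative_continuous)

lemma C1_on_const: "C1_on S (\<lambda>_. c)"
  unfolding C1_on_def by (rule exI[of _ "\<lambda>_. 0"]) (auto intro!: derivative_eq_intros)

lemma C1_on_add:
  assumes "C1_on S f" "C1_on S g" shows "C1_on S (\<lambda>w. f w + g w)"
proof -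
  obtain F G where "continuous_on S F" "\<forall>w\<in>S. (f has_derivative (\<lambda>h. F w \<bullet> h)) (at w)"
    "continuous_on S G" "\<forall>w\<in>S. (g has_derivative (\<lambda>h. G w \<bullet> h)) (at w)" using assms unfolding C1_on_def by blast
  then show ?thesis unfolding C1_on_def
    by (intro exI[of _ "\<lambda>w. F w + G w"]) (auto intro!: continuous_intros derivative_eq_intros simp: inner_add_left)
qed

lemma C1_on_mult:
  assumes "C1_on S f" "C1_on S g" shows "C1_on S (\<lambda>w. f w * g w)"
proof -
  obtain F G where "continuous_on S F" "\<forall>w\<in>S. (f has_derivative (\<lambda>h. F w \<bullet> h)) (at w)"
    "continuous_on S G" "\<forall>w\<in>S. (g has_derivative (\<lambda>h. G w \<bullet> h)) (at w)" using assms unfolding C1_on_def by blast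
  then show ?thesis unfolding C1_on_def
    using C1_on_continuous[OF assms(1)] C1_on_continuous[OF assms(2)]
    by (intro exI[of _ "\<lambda>w. f w *\<^sub>R G w + g w *\<^sub>R F w"]) (auto intro!: continuous_intros derivative_eq_intros simp: inner_add_left)
qed

lemma C1_on_sum: "(\<And>i. i \<in> I \<Longrightarrow> C1_on S (f i)) \<Longrightarrow> C1_on S (\<lambda>w. \<Sum>i\<in>I. f i w)"
  by (induction I rule: infinite_finite_induct) (auto simp: C1_on_const C1_on_add)

lemma C1_on_prod: "(\<And>i. i \<in> I \<Longrightarrow> C1_on S (f i)) \<Longrightarrow> C1_on S (\<lambda>w. \<Prod>i\<in>I. f i w)"
  by (induction I rule: infinite_finite_induct) (auto simp: C1_on_const C1_on_mult)

lemma C1_on_inverse: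
  assumes "C1_on S f" "\<And>w. w \<in> S \<Longrightarrow> f w \<noteq> 0" shows "C1_on S (\<lambda>w. inverse (f w))"
proof -
  obtain F where "continuous_on S F" "\<forall>w\<in>S. (f has_derivative (\<lambda>h. F w \<bullet> h)) (at w)" using assms(1) unfolding C1_on_def by blast
  then show ?thesis unfolding C1_on_def
    using C1_on_continuous[OF assms(1)] assms(2)
    by (intro exI[of _ "\<lambda>w. (- (inverse (f w) * inverse (f w))) *\<^sub>R F w"]) (auto intro!: continuous_intros derivative_eq_intros)
qed

lemma C1_on_det:
  fixes A :: "'v::euclidean_space \<Rightarrow> real ^ 'n ^ 'n"
  assumes "\<And>i j. C1_on S (\<lambda>w. A w $ i $ j)" shows "C1_on S (\<lambda>w. det (A w))"
  unfolding det_def by (intro C1_on_sum C1_on_mult C1_on_const C1_on_prod assms)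

lemma C1_on_cong: "(\<And>w. w \<in> S \<Longrightarrow> f w = g w) \<Longrightarrow> open S \<Longrightarrow> C1_on S f \<Longrightarrow> C1_on S g"
  unfolding C1_on_def by (metis has_derivative_transform_within_open)

lemma C1_on_matrix_inv:
  fixes A :: "'v::euclidean_space \<Rightarrow> real ^ 'n ^ 'n"
  assumes "open S" and A: "\<And>i j. C1_on S (\<lambda>w. A w $ i $ j)" and "\<And>w. w \<in> S \<Longrightarrow> det (A w) \<noteq> 0"
  shows "C1_on S (\<lambda>w. matrix_inv (A w) $ i $ k)"
proof (rule C1_on_cong[OF _ \<open>open S\<close>])
  show "C1_on S (\<lambda>w. det (\<chi> r j. if j = i then (if r = k then 1 else 0) else A w $ r $ j) * inverse (det (A w)))"
  proof (intro C1_on_mult C1_on_det C1_on_inverse A assms(3))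
    fix r j
    show "C1_on S (\<lambda>w. (\<chi> r j. if j = i then (if r = k then 1 else 0) else A w $ r $ j) $ r $ j)"
      by (cases "j = i") (simp_all add: C1_on_const A)
  qed
qed (simp add: matrix_inv_entry[OF assms(3)] divide_inverse)

section \<open>Gaussian regression\<close>

lemma iexp_mult_integral_pair:
  fixes f :: "'a \<Rightarrow> real" and g :: "'b \<Rightarrow> real"
  assumes "prob_space M" "prob_space N" and [measurable]: "f \<in> borel_measurable M" "g \<in> borel_measurable N"
  shows "(CLINT x|M \<Otimes>\<^sub>M N. iexp (f (fst x) + g (snd x))) = (CLINT \<omega>|M. iexp (f \<omega>)) * (CLINT z|N. iexp (g z))"
proof -
  interpret M: prob_space M by fact
  interpret N: prob_space N by fact
  interpret P: pair_prob_space M N ..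
  have i: "integrable (M \<Otimes>\<^sub>M N) (\<lambda>x. iexp (f (fst x) + g (snd x)))"
    by (rule P.integrable_const_bound[where B = 1]) (auto simp del: of_real_add)
  have "(CLINT x|M \<Otimes>\<^sub>M N. iexp (f (fst x) + g (snd x))) = (CLINT \<omega>|M. CLINT z|N. iexp (f \<omega> + g z))"
    using P.integral_fst'[OF i] by simp
  also have "\<dots> = (CLINT \<omega>|M. CLINT z|N. iexp (f \<omega>) * iexp (g z))"
    by (simp add: exp_add distrib_left)
  finally show ?thesis by simp
qed

context gaussian_hilbert
begin

text \<open>For orthonormal \<open>\<xi>\<close> this is the part of \<open>Z\<close> orthogonal to \<open>\<xi>\<close>. For Gaussian variables it is
  independent of \<open>\<xi>\<close>, so that conditioning \<open>Z\<close> on \<open>\<xi> = 0\<close> amounts to passing to the residual; no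
  conditional expectation has to be defined.\<close>

definition residual :: "('n::finite \<Rightarrow> 'a \<Rightarrow> real) \<Rightarrow> ('a \<Rightarrow> real) \<Rightarrow> 'a \<Rightarrow> real" where
  "residual \<xi> Z = (\<lambda>\<omega>. Z \<omega> - (\<Sum>k\<in>UNIV. expectation (\<lambda>\<omega>. Z \<omega> * \<xi> k \<omega>) * \<xi> k \<omega>))"

lemma residual_in_H:
  assumes "Z \<in> H" "\<And>k. \<xi> k \<in> H" shows "residual \<xi> Z \<in> H"
  unfolding residual_def by (intro H_diff H_sum H_scale assms)

lemma covariance_sum_left:
  assumes "\<And>i. i \<in> S \<Longrightarrow> X i \<in> H" and "Y \<in> H"
  shows "expectation (\<lambda>\<omega>. (\<Sum>i\<in>S. a i * X i \<omega>) * Y \<omega>) = (\<Sum>i\<in>S. a i * expectation (\<lambda>\<omega>. X i \<omega> * Y \<omega>))"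
proof -
  have "expectation (\<lambda>\<omega>. (\<Sum>i\<in>S. a i * X i \<omega>) * Y \<omega>) = expectation (\<lambda>\<omega>. \<Sum>i\<in>S. a i * (X i \<omega> * Y \<omega>))"
    by (simp add: sum_distrib_right mult.assoc)
  also have "\<dots> = (\<Sum>i\<in>S. expectation (\<lambda>\<omega>. a i * (X i \<omega> * Y \<omega>)))"
    by (rule Bochner_Integration.integral_sum) (intro integrable_mult_right H_mult_integrable assms)
  finally show ?thesis by simp
qed

lemma covariance_sum_sum:
  assumes X: "\<And>i. i \<in> S \<Longrightarrow> X i \<in> H"
  shows "expectation (\<lambda>\<omega>. (\<Sum>i\<in>S. a i * X i \<omega>) * (\<Sum>i\<in>S. a i * X i \<omega>)) = (\<Sum>i\<in>S. \<Sum>j\<in>S. a i * a j * expectation (\<lambda>\<omega>. X i \<omega> * X j \<omega>))"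
proof -
  have S: "(\<lambda>\<omega>. \<Sum>j\<in>S. a j * X j \<omega>) \<in> H" by (intro H_sum H_scale X)
  have "expectation (\<lambda>\<omega>. X i \<omega> * (\<Sum>j\<in>S. a j * X j \<omega>)) = (\<Sum>j\<in>S. a j * expectation (\<lambda>\<omega>. X i \<omega> * X j \<omega>))" if "i \<in> S" for i
    using covariance_sum_left[of S X "X i" a, OF X X[OF that]] by (simp add: mult.commute)
  moreover have "expectation (\<lambda>\<omega>. (\<Sum>i\<in>S. a i * X i \<omega>) * (\<Sum>i\<in>S. a i * X i \<omega>)) = (\<Sum>i\<in>S. a i * expectation (\<lambda>\<omega>. X i \<omega> * (\<Sum>j\<in>S. a j * X j \<omega>)))"
    by (rule covariance_sum_left) (auto intro: X S)
  ultimately show ?thesis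
    by (simp add: sum_distrib_left mult.assoc)
qed

lemma residual_sum:
  assumes X: "\<And>i. i \<in> S \<Longrightarrow> X i \<in> H" and \<xi>: "\<And>k. \<xi> k \<in> H"
  shows "residual \<xi> (\<lambda>\<omega>. \<Sum>i\<in>S. a i * X i \<omega>) = (\<lambda>\<omega>. \<Sum>i\<in>S. a i * residual \<xi> (X i) \<omega>)"
proof
  fix \<omega>
  have "(\<Sum>k\<in>UNIV. (\<Sum>i\<in>S. a i * expectation (\<lambda>\<omega>. X i \<omega> * \<xi> k \<omega>)) * \<xi> k \<omega>)
      = (\<Sum>i\<in>S. a i * (\<Sum>k\<in>UNIV. expectation (\<lambda>\<omega>. X i \<omega> * \<xi> k \<omega>) * \<xi> k \<omega>))"
    unfolding sum_distrib_right sum_distrib_left mult.assoc by (rule sum.swap)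
  then show "residual \<xi> (\<lambda>\<omega>. \<Sum>i\<in>S. a i * X i \<omega>) \<omega> = (\<Sum>i\<in>S. a i * residual \<xi> (X i) \<omega>)"
    unfolding residual_def by (simp add: covariance_sum_left X \<xi> sum_subtractf right_diff_distrib)
qed

lemma residual_variance:
  fixes \<xi> :: "'n::finite \<Rightarrow> 'a \<Rightarrow> real"
  assumes Z: "Z \<in> H" and \<xi>: "\<And>k. \<xi> k \<in> H" and orth: "\<And>j k. expectation (\<lambda>\<omega>. \<xi> j \<omega> * \<xi> k \<omega>) = (if j = k then 1 else 0)"
  shows "expectation (\<lambda>\<omega>. (residual \<xi> Z \<omega>)\<^sup>2) = expectation (\<lambda>\<omega>. (Z \<omega>)\<^sup>2) - (\<Sum>k\<in>UNIV. (expectation (\<lambda>\<omega>. Z \<omega> * \<xi> k \<omega>))\<^sup>2)"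
proof -
  let ?c = "\<lambda>k. expectation (\<lambda>\<omega>. Z \<omega> * \<xi> k \<omega>)"
  let ?P = "\<lambda>\<omega>. \<Sum>k\<in>UNIV. ?c k * \<xi> k \<omega>"
  have P: "?P \<in> H" by (intro H_sum H_scale \<xi>)
  have "expectation (\<lambda>\<omega>. ?P \<omega> * Z \<omega>) = (\<Sum>k\<in>UNIV. (?c k)\<^sup>2)"
    unfolding covariance_sum_left[OF \<xi> Z] by (simp add: power2_eq_square mult.commute)
  then have ZP: "expectation (\<lambda>\<omega>. Z \<omega> * ?P \<omega>) = (\<Sum>k\<in>UNIV. (?c k)\<^sup>2)" by (simp add: mult.commute)
  have PP: "expectation (\<lambda>\<omega>. ?P \<omega> * ?P \<omega>) = (\<Sum>k\<in>UNIV. (?c k)\<^sup>2)"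
  proof -
    have "(\<Sum>j\<in>UNIV. ?c k * ?c j * expectation (\<lambda>\<omega>. \<xi> k \<omega> * \<xi> j \<omega>)) = (?c k)\<^sup>2" for k
    proof -
      have "(\<Sum>j\<in>UNIV. ?c k * ?c j * expectation (\<lambda>\<omega>. \<xi> k \<omega> * \<xi> j \<omega>)) = (\<Sum>j\<in>UNIV. if k = j then (?c k)\<^sup>2 else 0)"
        by (intro sum.cong refl) (simp add: orth power2_eq_square)
      then show ?thesis by simp
    qed
    then show ?thesis unfolding covariance_sum_sum[of UNIV \<xi>, OF \<xi>] by simp
  qed
  have "(\<lambda>\<omega>. (residual \<xi> Z \<omega>)\<^sup>2) = (\<lambda>\<omega>. (Z \<omega>)\<^sup>2 - 2 * (Z \<omega> * ?P \<omega>) + ?P \<omega> * ?P \<omega>)"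
  proof
    have "(z - p)\<^sup>2 = z\<^sup>2 - 2 * (z * p) + p * p" for z p :: real by (simp add: power2_eq_square algebra_simps)
    then show "(residual \<xi> Z \<omega>)\<^sup>2 = (Z \<omega>)\<^sup>2 - 2 * (Z \<omega> * ?P \<omega>) + ?P \<omega> * ?P \<omega>" for \<omega>
      unfolding residual_def by blast
  qed
  then have "expectation (\<lambda>\<omega>. (residual \<xi> Z \<omega>)\<^sup>2) = expectation (\<lambda>\<omega>. (Z \<omega>)\<^sup>2) - 2 * expectation (\<lambda>\<omega>. Z \<omega> * ?P \<omega>) + expectation (\<lambda>\<omega>. ?P \<omega> * ?P \<omega>)"
    using H_square_integrable[OF Z] H_mult_integrable[OF Z P] H_mult_integrable[OF P P] by simp
  then show ?thesis using ZP PP by simp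
qed

text \<open>Gaussian regression: \<open>\<xi>\<close> is a standard Gaussian vector independent of all residuals, so it may be
  replaced by a copy that lives on another factor of a product space. Each linear combination has the
  same characteristic function on both sides, because the variance splits by Pythagoras.\<close>

lemma decoupled_law:
  fixes X :: "'i \<Rightarrow> 'a \<Rightarrow> real" and \<xi> :: "'n::finite \<Rightarrow> 'a \<Rightarrow> real"
  assumes X: "\<And>i. X i \<in> H" and \<xi>: "\<And>k. \<xi> k \<in> H"
    and orth: "\<And>j k. expectation (\<lambda>\<omega>. \<xi> j \<omega> * \<xi> k \<omega>) = (if j = k then 1 else 0)"
  shows "distr M (PiM UNIV (\<lambda>_. borel)) (\<lambda>\<omega> i. X i \<omega>) =
     distr (M \<Otimes>\<^sub>M (std_gaussian :: (real ^ 'n) measure)) (PiM UNIV (\<lambda>_. borel))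
       (\<lambda>x i. residual \<xi> (X i) (fst x) + (\<Sum>k\<in>UNIV. expectation (\<lambda>\<omega>. X i \<omega> * \<xi> k \<omega>) * snd x $ k))"
proof (rule cramer_wold_PiM)
  interpret G: prob_space "std_gaussian :: (real ^ 'n) measure" by (rule prob_space_std_gaussian)
  interpret P: pair_prob_space M "std_gaussian :: (real ^ 'n) measure" ..
  show "prob_space M" by unfold_locales
  show "prob_space (M \<Otimes>\<^sub>M (std_gaussian :: (real ^ 'n) measure))" by unfold_locales
  show "X i \<in> borel_measurable M" for i using X H_measurable by blast
  have r: "residual \<xi> Z \<in> borel_measurable M" if "Z \<in> H" for Z by (rule H_measurable[OF residual_in_H[OF that \<xi>]])
  note [measurable] = r[OF X]
  have [measurable]: "(\<lambda>x. snd x $ k) \<in> borel_measurable (M \<Otimes>\<^sub>M (std_gaussian :: (real ^ 'n) measure))" for k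
    by (rule measurable_compose[OF measurable_snd]) simp
  show "(\<lambda>x. residual \<xi> (X i) (fst x) + (\<Sum>k\<in>UNIV. expectation (\<lambda>\<omega>. X i \<omega> * \<xi> k \<omega>) * snd x $ k)) \<in> borel_measurable (M \<Otimes>\<^sub>M (std_gaussian :: (real ^ 'n) measure))" for i
    by measurable
  fix S :: "'i set" and a :: "'i \<Rightarrow> real" assume S: "finite S"
  define Z where "Z = (\<lambda>\<omega>. \<Sum>i\<in>S. a i * X i \<omega>)"
  let ?c = "\<lambda>k. expectation (\<lambda>\<omega>. Z \<omega> * \<xi> k \<omega>)"
  have Z: "Z \<in> H" unfolding Z_def by (intro H_sum H_scale X)
  have c: "?c k = (\<Sum>i\<in>S. a i * expectation (\<lambda>\<omega>. X i \<omega> * \<xi> k \<omega>))" for k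
    unfolding Z_def by (rule covariance_sum_left[OF X \<xi>])
  have eq: "(\<Sum>i\<in>S. a i * (residual \<xi> (X i) \<omega> + (\<Sum>k\<in>UNIV. expectation (\<lambda>\<omega>. X i \<omega> * \<xi> k \<omega>) * z $ k)))
      = residual \<xi> Z \<omega> + (\<Sum>k\<in>UNIV. ?c k * z $ k)" for \<omega> and z :: "real ^ 'n"
  proof -
    have "(\<Sum>k\<in>UNIV. ?c k * z $ k) = (\<Sum>i\<in>S. a i * (\<Sum>k\<in>UNIV. expectation (\<lambda>\<omega>. X i \<omega> * \<xi> k \<omega>) * z $ k))"
      unfolding c sum_distrib_right sum_distrib_left mult.assoc by (rule sum.swap)
    then show ?thesis
      unfolding distrib_left sum.distrib Z_def residual_sum[of S X \<xi> a, OF X \<xi>] by simp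
  qed
  have "(CLINT x|M \<Otimes>\<^sub>M (std_gaussian :: (real ^ 'n) measure). iexp (\<Sum>i\<in>S. a i * (residual \<xi> (X i) (fst x) + (\<Sum>k\<in>UNIV. expectation (\<lambda>\<omega>. X i \<omega> * \<xi> k \<omega>) * snd x $ k))))
     = (CLINT x|M \<Otimes>\<^sub>M (std_gaussian :: (real ^ 'n) measure). iexp (residual \<xi> Z (fst x) + (\<Sum>k\<in>UNIV. ?c k * snd x $ k)))"
    by (simp only: eq)
  also have "\<dots> = (CLINT \<omega>|M. iexp (residual \<xi> Z \<omega>)) * (CLINT z|std_gaussian. iexp (\<Sum>k\<in>UNIV. ?c k * (z :: real ^ 'n) $ k))"
    by (rule iexp_mult_integral_pair[OF prob_space_axioms prob_space_std_gaussian r[OF Z]]) measurable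
  also have "\<dots> = complex_of_real (exp (- expectation (\<lambda>\<omega>. (residual \<xi> Z \<omega>)\<^sup>2) / 2)) * complex_of_real (exp (- (\<Sum>k\<in>UNIV. (?c k)\<^sup>2) / 2))"
    unfolding H_char[OF residual_in_H[OF Z \<xi>]] std_gaussian_char ..
  also have "\<dots> = complex_of_real (exp (- expectation (\<lambda>\<omega>. (Z \<omega>)\<^sup>2) / 2))"
  proof -
    have "exp (- (v - c) / 2) * exp (- c / 2) = exp (- v / 2)" for v c :: real
      unfolding exp_add[symmetric] by (simp add: field_simps)
    then show ?thesis unfolding residual_variance[OF Z \<xi> orth] of_real_mult[symmetric] by simp
  qed
  also have "\<dots> = (CLINT \<omega>|M. iexp (Z \<omega>))" by (rule H_char[OF Z, symmetric])
  finally show "(CLINT \<omega>|M. iexp (\<Sum>i\<in>S. a i * X i \<omega>)) = (CLINT x|M \<Otimes>\<^sub>M (std_gaussian :: (real ^ 'n) measure).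
      iexp (\<Sum>i\<in>S. a i * (residual \<xi> (X i) (fst x) + (\<Sum>k\<in>UNIV. expectation (\<lambda>\<omega>. X i \<omega> * \<xi> k \<omega>) * snd x $ k))))"
    unfolding Z_def by (rule sym)
qed

lemma covariance_determines_law:
  fixes X Y :: "'i \<Rightarrow> 'a \<Rightarrow> real"
  assumes X: "\<And>i. X i \<in> H" and Y: "\<And>i. Y i \<in> H"
    and cov: "\<And>i j. expectation (\<lambda>\<omega>. X i \<omega> * X j \<omega>) = expectation (\<lambda>\<omega>. Y i \<omega> * Y j \<omega>)"
  shows "distr M (PiM UNIV (\<lambda>_. borel)) (\<lambda>\<omega> i. X i \<omega>) = distr M (PiM UNIV (\<lambda>_. borel)) (\<lambda>\<omega> i. Y i \<omega>)"
proof (rule cramer_wold_PiM)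
  show "prob_space M" by unfold_locales
  then show "prob_space M" .
  show "X i \<in> borel_measurable M" "Y i \<in> borel_measurable M" for i using X Y H_measurable by blast+
  fix S :: "'i set" and a :: "'i \<Rightarrow> real" assume S: "finite S"
  have "(\<lambda>\<omega>. \<Sum>i\<in>S. a i * X i \<omega>) \<in> H" "(\<lambda>\<omega>. \<Sum>i\<in>S. a i * Y i \<omega>) \<in> H" by (intro H_sum H_scale X Y)+
  note ch = this[THEN H_char]
  show "(CLINT \<omega>|M. iexp (\<Sum>i\<in>S. a i * X i \<omega>)) = (CLINT \<omega>|M. iexp (\<Sum>i\<in>S. a i * Y i \<omega>))"
    unfolding ch power2_eq_square covariance_sum_sum[of S X a, OF X] covariance_sum_sum[of S Y a, OF Y] cov ..
qed

end

section \<open>Derivatives in Gaussian spaces\<close>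

lemma has_derivative_directional_sequence:
  fixes f :: "'v::real_normed_vector \<Rightarrow> real"
  assumes "(f has_derivative f') (at x)" and r: "r \<longlonglongrightarrow> 0" "\<And>m. r m \<noteq> 0"
  shows "(\<lambda>m. (f (x + r m *\<^sub>R v) - f x) / r m) \<longlonglongrightarrow> f' v"
proof -
  have "((\<lambda>t. f (x + t *\<^sub>R v)) has_derivative (\<lambda>t. f' (t *\<^sub>R v))) (at 0)"
    by (rule has_derivative_compose[of "\<lambda>t. x + t *\<^sub>R v" "\<lambda>t. t *\<^sub>R v" 0 UNIV f f'])
       (use assms(1) in \<open>auto intro!: derivative_eq_intros\<close>)
  moreover have "f' (t *\<^sub>R v) = f' v * t" for t
    using has_derivative_linear[OF assms(1)] by (simp add: linear_scale)
  ultimately have "((\<lambda>t. f (x + t *\<^sub>R v)) has_field_derivative f' v) (at 0)"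
    by (simp add: has_field_derivative_def)
  then have "((\<lambda>t. (f (x + t *\<^sub>R v) - f x) / t) \<longlongrightarrow> f' v) (at 0)" by (simp add: DERIV_def)
  moreover have "filterlim r (at 0) sequentially" using r by (simp add: filterlim_at)
  ultimately show ?thesis by (rule filterlim_compose)
qed

lemma has_derivative_vec_componentwise:
  fixes f :: "'v::real_normed_vector \<Rightarrow> real ^ 'n"
  assumes "\<And>i. ((\<lambda>w. f w $ i) has_derivative (\<lambda>h. g h $ i)) (at w)"
  shows "(f has_derivative g) (at w)"
  by (subst has_derivative_componentwise_within) (use assms in \<open>auto simp: Basis_vec_def inner_axis\<close>)

context gaussian_hilbert
begin

lemma covariance_diff_left: "X \<in> H \<Longrightarrow> Y \<in> H \<Longrightarrow> Z \<in> H \<Longrightarrow>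
    expectation (\<lambda>\<omega>. (X \<omega> - Y \<omega>) * Z \<omega>) = expectation (\<lambda>\<omega>. X \<omega> * Z \<omega>) - expectation (\<lambda>\<omega>. Y \<omega> * Z \<omega>)"
  by (simp add: left_diff_distrib H_mult_integrable)

lemma covariance_divide_left:
  fixes X Z :: "'a \<Rightarrow> real"
  shows "expectation (\<lambda>\<omega>. (X \<omega> / c) * Z \<omega>) = expectation (\<lambda>\<omega>. X \<omega> * Z \<omega>) / c"
  by simp

lemma derivative_in_H:
  assumes X: "\<And>w. (\<lambda>\<omega>. X \<omega> w) \<in> H" and der: "\<And>\<omega>. (X \<omega> has_derivative D \<omega>) (at w)"
  shows "(\<lambda>\<omega>. D \<omega> v) \<in> H"
proof (rule H_lim[where X = "\<lambda>m \<omega>. (X \<omega> (w + inverse (real (Suc m)) *\<^sub>R v) - X \<omega> w) / inverse (real (Suc m))"])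
  show "(\<lambda>\<omega>. (X \<omega> (w + inverse (real (Suc m)) *\<^sub>R v) - X \<omega> w) / inverse (real (Suc m))) \<in> H" for m
    by (intro H_divide H_diff X)
  have l: "(\<lambda>m. (X \<omega> (w + inverse (real (Suc m)) *\<^sub>R v) - X \<omega> w) / inverse (real (Suc m))) \<longlonglongrightarrow> D \<omega> v" for \<omega>
    by (rule has_derivative_directional_sequence[OF der LIMSEQ_inverse_real_of_nat]) simp
  then show "AE \<omega> in M. (\<lambda>m. (X \<omega> (w + inverse (real (Suc m)) *\<^sub>R v) - X \<omega> w) / inverse (real (Suc m))) \<longlonglongrightarrow> D \<omega> v" by simp
  have [measurable]: "(\<lambda>\<omega>. X \<omega> u) \<in> borel_measurable M" for u by (rule H_measurable[OF X])
  show "(\<lambda>\<omega>. D \<omega> v) \<in> borel_measurable M"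
    by (rule borel_measurable_LIMSEQ_real[OF l]) measurable
qed

lemma covariance_continuous:
  fixes X :: "'a \<Rightarrow> 'v::metric_space \<Rightarrow> real"
  assumes X: "\<And>w. w \<in> S \<Longrightarrow> (\<lambda>\<omega>. X \<omega> w) \<in> H" and c: "\<And>\<omega>. continuous_on S (X \<omega>)" and Z: "Z \<in> H"
  shows "continuous_on S (\<lambda>w. expectation (\<lambda>\<omega>. X \<omega> w * Z \<omega>))"
  unfolding continuous_on_sequentially o_def
proof (intro allI ballI impI, elim conjE)
  fix x a assume x: "a \<in> S" "\<forall>n. x n \<in> S" "x \<longlonglongrightarrow> a"
  show "(\<lambda>n. expectation (\<lambda>\<omega>. X \<omega> (x n) * Z \<omega>)) \<longlonglongrightarrow> expectation (\<lambda>\<omega>. X \<omega> a * Z \<omega>)"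
  proof (rule covariance_tendsto)
    have "(\<lambda>n. X \<omega> (x n)) \<longlonglongrightarrow> X \<omega> a" for \<omega>
      by (rule continuous_on_tendsto_compose[OF c x(3,1)]) (use x(2) in simp)
    then show "AE \<omega> in M. (\<lambda>n. X \<omega> (x n)) \<longlonglongrightarrow> X \<omega> a" by simp
  qed (use X x Z in auto)
qed

lemma covariance_has_derivative:
  fixes X :: "'a \<Rightarrow> real ^ 'n \<Rightarrow> real"
  assumes X: "\<And>w. (\<lambda>\<omega>. X \<omega> w) \<in> H" and der: "\<And>\<omega>. (X \<omega> has_derivative (\<lambda>h. G \<omega> \<bullet> h)) (at w)" and Z: "Z \<in> H"
  shows "((\<lambda>w. expectation (\<lambda>\<omega>. X \<omega> w * Z \<omega>)) has_derivative (\<lambda>h. (\<chi> l. expectation (\<lambda>\<omega>. G \<omega> $ l * Z \<omega>)) \<bullet> h)) (at w)"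
proof -
  have GH: "(\<lambda>\<omega>. G \<omega> $ l) \<in> H" for l
    using derivative_in_H[of X "\<lambda>\<omega> h. G \<omega> \<bullet> h" w "axis l 1"] X der by (simp add: inner_axis)
  let ?a = "\<lambda>w. expectation (\<lambda>\<omega>. X \<omega> w * Z \<omega>)" and ?g = "\<chi> l. expectation (\<lambda>\<omega>. G \<omega> $ l * Z \<omega>)"
  show ?thesis
    unfolding has_derivative_within
  proof (intro conjI bounded_linear_inner_right)
    show "((\<lambda>y. (1 / norm (y - w)) *\<^sub>R (?a y - (?a w + ?g \<bullet> (y - w)))) \<longlongrightarrow> 0) (at w)"
      unfolding tendsto_at_iff_sequentially o_def
    proof (intro allI impI)
      fix y :: "nat \<Rightarrow> real ^ 'n" assume y: "\<forall>i. y i \<in> UNIV - {w}" "y \<longlonglongrightarrow> w"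
      define V where "V i \<omega> = (X \<omega> (y i) - X \<omega> w - (\<Sum>l\<in>UNIV. (y i - w) $ l * G \<omega> $ l)) / norm (y i - w)" for i \<omega>
      have V: "V i \<in> H" for i
        unfolding V_def by (intro H_divide H_diff H_sum H_scale X GH)
      have "(\<lambda>i. V i \<omega>) \<longlonglongrightarrow> 0" for \<omega>
      proof -
        have "((\<lambda>y. (1 / norm (y - w)) *\<^sub>R (X \<omega> y - (X \<omega> w + G \<omega> \<bullet> (y - w)))) \<longlongrightarrow> 0) (at w)"
          using der[of \<omega>] unfolding has_derivative_within by blast
        then have "(\<lambda>i. (1 / norm (y i - w)) *\<^sub>R (X \<omega> (y i) - (X \<omega> w + G \<omega> \<bullet> (y i - w)))) \<longlonglongrightarrow> 0"
          unfolding tendsto_at_iff_sequentially o_def using y by blast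
        moreover have "(1 / norm (y i - w)) *\<^sub>R (X \<omega> (y i) - (X \<omega> w + G \<omega> \<bullet> (y i - w))) = V i \<omega>" for i
          by (simp add: V_def inner_vec_def mult.commute)
        ultimately show ?thesis by simp
      qed
      then have "(\<lambda>i. expectation (\<lambda>\<omega>. V i \<omega> * Z \<omega>)) \<longlonglongrightarrow> expectation (\<lambda>\<omega>. 0 * Z \<omega>)"
        by (intro covariance_tendsto V H_zero Z) simp_all
      moreover have "expectation (\<lambda>\<omega>. V i \<omega> * Z \<omega>) = (1 / norm (y i - w)) *\<^sub>R (?a (y i) - (?a w + ?g \<bullet> (y i - w)))" for i
      proof -
        have "expectation (\<lambda>\<omega>. V i \<omega> * Z \<omega>) = (?a (y i) - ?a w - (\<Sum>l\<in>UNIV. (y i - w) $ l * expectation (\<lambda>\<omega>. G \<omega> $ l * Z \<omega>))) / norm (y i - w)"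
          unfolding V_def covariance_divide_left
          by (simp only: covariance_diff_left covariance_sum_left H_diff H_sum H_scale X GH Z)
        then show ?thesis by (simp add: inner_vec_def mult.commute)
      qed
      ultimately show "(\<lambda>i. (1 / norm (y i - w)) *\<^sub>R (?a (y i) - (?a w + ?g \<bullet> (y i - w)))) \<longlonglongrightarrow> 0"
        by simp
    qed
  qed
qed

end

section \<open>The Kac-Rice formula\<close>

lemma std_normal_density_le_1: "std_normal_density x \<le> 1"
proof -
  have "1 \<le> sqrt (2 * pi)" using pi_ge_two by (simp add: real_le_rsqrt)
  then have "1 / sqrt (2 * pi) \<le> 1" by simp
  moreover have "exp (- x\<^sup>2 / 2) \<le> 1" by simp
  ultimately have "1 / sqrt (2 * pi) * exp (- x\<^sup>2 / 2) \<le> 1 * 1" by (intro mult_mono) auto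
  then show ?thesis by (simp add: normal_density_def)
qed

context gaussian_hilbert
begin

text \<open>Near a point \<open>w0\<close> at which the field has independent standard normal components \<open>\<xi>\<close>, the expected
  number of zeros has a continuous density.

  Write \<open>X w = Xr w + a w *v \<xi>\<close> with \<open>Xr w\<close> the residual of \<open>X w\<close>; then \<open>a w0\<close> is the identity, and
  \<open>a w\<close> stays invertible near \<open>w0\<close>. By \<open>decoupled_law\<close> the vector \<open>\<xi>\<close> may be replaced by an independent
  standard Gaussian vector \<open>z\<close>. The point \<open>w\<close> is then a zero iff \<open>z = \<Phi> w\<close> with
  \<open>\<Phi> w = - (a w)\<inverse> *v Xr w\<close>, so for a fixed outcome the expected number of zeros is the integral over
  \<open>z\<close> of the number of solutions of \<open>\<Phi> w = z\<close> against the Gaussian density. The area formula turns this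
  into an integral over \<open>w\<close>, and Fubini's theorem gives the density
  \<open>j w = E (\<bar>det D\<Phi> w\<bar> * density (\<Phi> w))\<close>. At \<open>w0\<close> the residual vanishes, whence the simple value of
  \<open>j w0\<close>.\<close>

theorem Kac_Rice_intensity:
  fixes X :: "'a \<Rightarrow> real ^ 'n::{finite,wellorder} \<Rightarrow> real ^ 'n::_" and DX :: "'a \<Rightarrow> real ^ 'n::_ \<Rightarrow> real ^ 'n::_ ^ 'n::_"
    and w0 :: "real ^ 'n::_"
  defines "\<xi> \<equiv> \<lambda>k \<omega>. X \<omega> w0 $ k"
  assumes XH: "\<And>w k. (\<lambda>\<omega>. X \<omega> w $ k) \<in> H"
    and der: "\<And>\<omega> w. (X \<omega> has_derivative (\<lambda>h. DX \<omega> w *v h)) (at w)"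
    and cont: "\<And>\<omega>. continuous_on UNIV (DX \<omega>)"
    and orth: "\<And>j k. expectation (\<lambda>\<omega>. \<xi> j \<omega> * \<xi> k \<omega>) = (if j = k then 1 else 0)"
  obtains W0 j where "open W0" "w0 \<in> W0" "continuous_on W0 j" "\<And>w. 0 \<le> j w"
    "j w0 = (1 / sqrt (2 * pi)) ^ CARD('n) * expectation (\<lambda>\<omega>. \<bar>det (\<chi> k l. residual \<xi> (\<lambda>\<omega>. DX \<omega> w0 $ k $ l) \<omega>)\<bar>)"
    "\<And>W. open W \<Longrightarrow> W \<subseteq> W0 \<Longrightarrow>
       (\<integral>\<^sup>+\<omega>. emeasure (count_space UNIV) {w \<in> W. X \<omega> w = 0} \<partial>M) = (\<integral>\<^sup>+w. indicator W w * ennreal (j w) \<partial>lborel)"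
proof -
  have \<xi>H: "\<xi> k \<in> H" for k unfolding \<xi>_def by (rule XH)
  have derk: "((\<lambda>w. X \<omega> w $ k) has_derivative (\<lambda>h. DX \<omega> w $ k \<bullet> h)) (at w)" for \<omega> w k
  proof -
    have "((\<lambda>w. X \<omega> w $ k) has_derivative (\<lambda>h. (DX \<omega> w *v h) $ k)) (at w)"
      by (rule bounded_linear.has_derivative[OF bounded_linear_vec_nth der])
    then show ?thesis by (simp add: matrix_vector_mult_def inner_vec_def)
  qed
  have contk: "continuous_on S (\<lambda>w. DX \<omega> w $ k $ l)" for \<omega> k l S
    by (intro continuous_intros continuous_on_subset[OF cont]) auto
  have Xcont: "continuous_on S (\<lambda>w. X \<omega> w $ k)" for \<omega> k S
    using derk by (intro continuous_at_imp_continuous_on) (blast intro: has_derivative_continuous)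
  have DXH: "(\<lambda>\<omega>. DX \<omega> w $ k $ l) \<in> H" for w k l
    using derivative_in_H[of "\<lambda>\<omega> w. X \<omega> w $ k" "\<lambda>\<omega> h. DX \<omega> w $ k \<bullet> h" w "axis l 1", OF XH derk] by (simp add: inner_axis)

  \<comment> \<open>regression coefficients of the field and of its derivative on the value at \<open>w0\<close>\<close>
  define a where "a w = (\<chi> k j. expectation (\<lambda>\<omega>. X \<omega> w $ k * \<xi> j \<omega>))" for w
  define d where "d w k l j = expectation (\<lambda>\<omega>. DX \<omega> w $ k $ l * \<xi> j \<omega>)" for w k l j
  have dcont: "continuous_on S (\<lambda>w. d w k l j)" for S k l j
    unfolding d_def by (rule covariance_continuous) (intro DXH contk \<xi>H)+
  have ader: "((\<lambda>w. a w $ k $ j) has_derivative (\<lambda>h. (\<chi> l. d w k l j) \<bullet> h)) (at w)" for w k j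
    using covariance_has_derivative[of "\<lambda>\<omega> w. X \<omega> w $ k" "\<lambda>\<omega>. DX \<omega> w $ k" w "\<xi> j", OF XH derk \<xi>H] by (simp add: a_def d_def)
  have aC1: "C1_on S (\<lambda>w. a w $ k $ j)" for S k j
    unfolding C1_on_def by (rule exI[of _ "\<lambda>w. \<chi> l. d w k l j"]) (use ader dcont in \<open>auto intro!: continuous_intros\<close>)
  have aw0: "a w0 = mat 1"
    using orth by (simp add: a_def \<xi>_def vec_eq_iff mat_def)

  define Xr where "Xr \<omega> w k = residual \<xi> (\<lambda>\<omega>. X \<omega> w $ k) \<omega>" for \<omega> w k
  define DXr where "DXr \<omega> w k l = residual \<xi> (\<lambda>\<omega>. DX \<omega> w $ k $ l) \<omega>" for \<omega> w k l
  have Xr: "Xr \<omega> w k = X \<omega> w $ k - (\<Sum>j\<in>UNIV. a w $ k $ j * \<xi> j \<omega>)" for \<omega> w k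
    by (simp add: Xr_def residual_def a_def)
  have DXr: "DXr \<omega> w k l = DX \<omega> w $ k $ l - (\<Sum>j\<in>UNIV. d w k l j * \<xi> j \<omega>)" for \<omega> w k l
    by (simp add: DXr_def residual_def d_def)
  have XrH: "(\<lambda>\<omega>. Xr \<omega> w k) \<in> H" for w k
    using residual_in_H[of "\<lambda>\<omega>. X \<omega> w $ k" \<xi>, OF XH \<xi>H] by (simp add: Xr_def[abs_def])
  have DXrH: "(\<lambda>\<omega>. DXr \<omega> w k l) \<in> H" for w k l
    using residual_in_H[of "\<lambda>\<omega>. DX \<omega> w $ k $ l" \<xi>, OF DXH \<xi>H] by (simp add: DXr_def[abs_def])
  have Xrder: "((\<lambda>w. Xr \<omega> w k) has_derivative (\<lambda>h. (\<chi> l. DXr \<omega> w k l) \<bullet> h)) (at w)" for \<omega> w k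
  proof -
    have "((\<lambda>w. Xr \<omega> w k) has_derivative (\<lambda>h. DX \<omega> w $ k \<bullet> h - (\<Sum>j\<in>UNIV. (\<chi> l. d w k l j) \<bullet> h * \<xi> j \<omega>))) (at w)"
      unfolding Xr by (intro has_derivative_diff has_derivative_sum has_derivative_mult_left derk ader)
    moreover have "DX \<omega> w $ k \<bullet> h - (\<Sum>j\<in>UNIV. (\<chi> l. d w k l j) \<bullet> h * \<xi> j \<omega>) = (\<chi> l. DXr \<omega> w k l) \<bullet> h" for h
    proof -
      have "(\<Sum>j\<in>UNIV. (\<chi> l. d w k l j) \<bullet> h * \<xi> j \<omega>) = (\<Sum>j\<in>UNIV. \<Sum>l\<in>UNIV. d w k l j * \<xi> j \<omega> * h $ l)"
        unfolding inner_vec_def sum_distrib_right by (intro sum.cong refl) simp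
      also have "\<dots> = (\<Sum>l\<in>UNIV. (\<Sum>j\<in>UNIV. d w k l j * \<xi> j \<omega>) * h $ l)"
        unfolding sum_distrib_right by (rule sum.swap)
      finally show ?thesis
        by (simp add: inner_vec_def DXr sum_subtractf left_diff_distrib)
    qed
    ultimately show ?thesis by simp
  qed
  have DXrcont: "continuous_on S (\<lambda>w. DXr \<omega> w k l)" for S \<omega> k l
    unfolding DXr by (intro continuous_intros contk dcont)
  have Xrcont: "continuous_on S (\<lambda>w. Xr \<omega> w k)" for S \<omega> k
    using Xrder by (intro continuous_at_imp_continuous_on) (blast intro: has_derivative_continuous)

  \<comment> \<open>the region in which the linear equation for the substituted vector can be solved\<close>
  define W0 where "W0 = {w. det (a w) \<noteq> 0}"
  have acont: "continuous_on S (\<lambda>w. det (a w))" for S by (rule C1_on_continuous[OF C1_on_det[OF aC1]])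
  have oW0: "open W0" unfolding W0_def by (intro open_Collect_neq acont continuous_intros)
  have w0W0: "w0 \<in> W0" by (simp add: W0_def aw0)
  have BC1: "C1_on W0 (\<lambda>w. matrix_inv (a w) $ i $ k)" for i k
    by (rule C1_on_matrix_inv[OF oW0 aC1]) (simp add: W0_def)
  define B where "B w = matrix_inv (a w)" for w
  have inv: "B w ** a w = mat 1" "a w ** B w = mat 1" if "w \<in> W0" for w
  proof -
    have "invertible (a w)" using that by (simp add: W0_def invertible_det_nz)
    from someI_ex[OF this[unfolded invertible_def]] show "B w ** a w = mat 1" "a w ** B w = mat 1"
      by (simp_all add: B_def matrix_inv_def)
  qed
  have Bw0: "B w0 = mat 1" using inv(1)[OF w0W0] by (simp add: aw0)
  have "\<forall>i k. \<exists>G. continuous_on W0 G \<and> (\<forall>w\<in>W0. ((\<lambda>w. B w $ i $ k) has_derivative (\<lambda>h. G w \<bullet> h)) (at w))"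
    using BC1 unfolding C1_on_def B_def by blast
  then obtain gB where gB: "\<And>i k. continuous_on W0 (gB i k)"
    "\<And>i k w. w \<in> W0 \<Longrightarrow> ((\<lambda>w. B w $ i $ k) has_derivative (\<lambda>h. gB i k w \<bullet> h)) (at w)" by metis
  have Bcont: "continuous_on W0 (\<lambda>w. B w $ i $ k)" for i k
    using C1_on_continuous[OF BC1] by (simp add: B_def)

  define \<Phi> where "\<Phi> \<omega> w = (\<chi> i. - (\<Sum>k\<in>UNIV. B w $ i $ k * Xr \<omega> w k))" for \<omega> w
  define D\<Phi> where "D\<Phi> \<omega> w = (\<chi> i l. - (\<Sum>k\<in>UNIV. B w $ i $ k * DXr \<omega> w k l + gB i k w $ l * Xr \<omega> w k))" for \<omega> w
  have \<Phi>der: "(\<Phi> \<omega> has_derivative (\<lambda>h. D\<Phi> \<omega> w *v h)) (at w)" if w: "w \<in> W0" for \<omega> w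
  proof (rule has_derivative_vec_componentwise)
    fix i
    have "((\<lambda>w. - (\<Sum>k\<in>UNIV. B w $ i $ k * Xr \<omega> w k)) has_derivative
        (\<lambda>h. - (\<Sum>k\<in>UNIV. B w $ i $ k * ((\<chi> l. DXr \<omega> w k l) \<bullet> h) + (gB i k w \<bullet> h) * Xr \<omega> w k))) (at w)"
      by (intro has_derivative_minus has_derivative_sum has_derivative_mult gB(2)[OF w] Xrder)
    moreover have "- (\<Sum>k\<in>UNIV. B w $ i $ k * ((\<chi> l. DXr \<omega> w k l) \<bullet> h) + (gB i k w \<bullet> h) * Xr \<omega> w k) = (D\<Phi> \<omega> w *v h) $ i" for h
    proof -
      have "(\<Sum>k\<in>UNIV. B w $ i $ k * ((\<chi> l. DXr \<omega> w k l) \<bullet> h) + (gB i k w \<bullet> h) * Xr \<omega> w k)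
          = (\<Sum>k\<in>UNIV. \<Sum>l\<in>UNIV. (B w $ i $ k * DXr \<omega> w k l + gB i k w $ l * Xr \<omega> w k) * h $ l)"
        by (intro sum.cong refl) (simp add: inner_vec_def sum_distrib_left sum_distrib_right sum.distrib distrib_right distrib_left mult.assoc mult.commute mult.left_commute)
      also have "\<dots> = (\<Sum>l\<in>UNIV. (\<Sum>k\<in>UNIV. B w $ i $ k * DXr \<omega> w k l + gB i k w $ l * Xr \<omega> w k) * h $ l)"
        unfolding sum_distrib_right by (rule sum.swap)
      finally show ?thesis by (simp add: D\<Phi>_def matrix_vector_mult_def sum_negf)
    qed
    ultimately show "((\<lambda>w. \<Phi> \<omega> w $ i) has_derivative (\<lambda>h. (D\<Phi> \<omega> w *v h) $ i)) (at w)" by (simp add: \<Phi>_def)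
  qed
  have D\<Phi>cont: "continuous_on W0 (\<lambda>w. D\<Phi> \<omega> w $ i $ l)" for \<omega> i l
    unfolding D\<Phi>_def by (simp, intro continuous_intros Bcont DXrcont gB(1) Xrcont)
  have D\<Phi>cont': "continuous_on W0 (D\<Phi> \<omega>)" for \<omega>
    unfolding D\<Phi>_def by (intro continuous_intros Bcont DXrcont gB(1) Xrcont)
  have \<Phi>cont: "continuous_on W0 (\<lambda>w. \<Phi> \<omega> w $ i)" for \<omega> i
    unfolding \<Phi>_def by (simp, intro continuous_intros Bcont Xrcont)
  have \<Phi>H: "(\<lambda>\<omega>. \<Phi> \<omega> w $ i) \<in> H" for w i
    unfolding \<Phi>_def by (simp, intro H_minus H_sum H_scale XrH)
  have D\<Phi>H: "(\<lambda>\<omega>. D\<Phi> \<omega> w $ i $ l) \<in> H" for w i l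
    unfolding D\<Phi>_def by (simp, intro H_minus H_sum H_add H_scale XrH DXrH)

  have solve: "(\<forall>k. Xr \<omega> w k + (\<Sum>j\<in>UNIV. a w $ k $ j * z $ j) = 0) \<longleftrightarrow> \<Phi> \<omega> w = z" if w: "w \<in> W0" for \<omega> w z
  proof -
    let ?x = "\<chi> k. Xr \<omega> w k"
    have "(\<forall>k. Xr \<omega> w k + (\<Sum>j\<in>UNIV. a w $ k $ j * z $ j) = 0) \<longleftrightarrow> ?x + a w *v z = 0"
      by (simp add: vec_eq_iff matrix_vector_mult_def)
    also have "\<dots> \<longleftrightarrow> a w *v z = - ?x" by (metis add.commute add_eq_0_iff)
    also have "\<dots> \<longleftrightarrow> z = B w *v (- ?x)"
    proof
      assume "a w *v z = - ?x"
      then have "B w *v (- ?x) = (B w ** a w) *v z" by (metis matrix_vector_mul_assoc)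
      then show "z = B w *v (- ?x)" by (simp add: inv(1)[OF w])
    next
      assume "z = B w *v (- ?x)"
      then show "a w *v z = - ?x" by (simp only: matrix_vector_mul_assoc inv(2)[OF w] matrix_vector_mul_lid)
    qed
    also have "B w *v (- ?x) = \<Phi> \<omega> w"
      by (simp add: \<Phi>_def vec_eq_iff matrix_vector_mult_def sum_negf)
    finally show ?thesis by auto
  qed

  \<comment> \<open>the integrand of the area formula for \<open>\<Phi>\<close> and the Gaussian density\<close>
  define J where "J \<omega> w = \<bar>det (D\<Phi> \<omega> w)\<bar> * (\<Prod>k\<in>UNIV. std_normal_density (\<Phi> \<omega> w $ k))" for \<omega> w
  define j where "j w = expectation (\<lambda>\<omega>. J \<omega> w)" for w
  have J0: "0 \<le> J \<omega> w" for \<omega> w unfolding J_def by (intro mult_nonneg_nonneg prod_nonneg) auto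
  have Jm: "(\<lambda>\<omega>. J \<omega> w) \<in> borel_measurable M" for w
  proof -
    have [measurable]: "(\<lambda>\<omega>. D\<Phi> \<omega> w $ i $ l) \<in> borel_measurable M" "(\<lambda>\<omega>. \<Phi> \<omega> w $ i) \<in> borel_measurable M" for i l
      by (rule H_measurable[OF D\<Phi>H], rule H_measurable[OF \<Phi>H])
    show ?thesis unfolding J_def det_def by measurable
  qed
  have Jcont: "continuous_on W0 (J \<omega>)" for \<omega>
    unfolding J_def det_def normal_density_def
    by (intro continuous_intros D\<Phi>cont \<Phi>cont) auto

  define c :: real where "c = fact (2 * CARD('n)) / (2 ^ CARD('n) * fact CARD('n))"
  \<comment> \<open>a bound for the second moment of \<open>J\<close> that is continuous in \<open>w\<close>, as variances are\<close>
  define b where "b w = (fact CARD('n))\<^sup>2 * (\<Sum>i\<in>(UNIV :: 'n set). \<Sum>l\<in>(UNIV :: 'n set). c * expectation (\<lambda>\<omega>. (D\<Phi> \<omega> w $ i $ l)\<^sup>2) ^ CARD('n))" for w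
  have Jsq: "integrable M (\<lambda>\<omega>. (J \<omega> w)\<^sup>2)" "expectation (\<lambda>\<omega>. (J \<omega> w)\<^sup>2) \<le> b w" for w
  proof -
    let ?R = "\<lambda>\<omega>. (fact CARD('n))\<^sup>2 * (\<Sum>i\<in>UNIV. \<Sum>l\<in>UNIV. (D\<Phi> \<omega> w $ i $ l) ^ (2 * CARD('n)))"
    note mom = centred_gaussian_even_moment[OF prob_space_axioms H_gaussian[OF D\<Phi>H], of w _ _ "CARD('n)"]
    have R: "integrable M ?R" by (intro integrable_mult_right Bochner_Integration.integrable_sum mom(1))
    have le: "(J \<omega> w)\<^sup>2 \<le> ?R \<omega>" for \<omega>
    proof -
      have p: "0 \<le> (\<Prod>k\<in>UNIV. std_normal_density (\<Phi> \<omega> w $ k))" "(\<Prod>k\<in>UNIV. std_normal_density (\<Phi> \<omega> w $ k)) \<le> 1"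
        by (auto intro!: prod_nonneg prod_le_1 std_normal_density_le_1)
      have "J \<omega> w \<le> \<bar>det (D\<Phi> \<omega> w)\<bar>" unfolding J_def by (rule mult_left_le[OF p(2)]) simp
      then have "(J \<omega> w)\<^sup>2 \<le> \<bar>det (D\<Phi> \<omega> w)\<bar>\<^sup>2" by (rule power_mono) (rule J0)
      then show ?thesis using det_squared_le[of "D\<Phi> \<omega> w"] by simp
    qed
    show i: "integrable M (\<lambda>\<omega>. (J \<omega> w)\<^sup>2)"
      by (rule Bochner_Integration.integrable_bound[OF R])
         (use Jm le in \<open>auto intro!: AE_I2 simp: sum_nonneg intro: order_trans[OF le]\<close>)
    have "expectation (\<lambda>\<omega>. (J \<omega> w)\<^sup>2) \<le> expectation ?R" by (rule integral_mono[OF i R le])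
    also have "\<dots> = b w"
      unfolding b_def c_def mom(2)[symmetric]
      by (subst integral_mult_right_zero, subst Bochner_Integration.integral_sum,
          (intro Bochner_Integration.integrable_sum mom(1))[1],
          intro arg_cong[where f = "(*) _"] sum.cong refl Bochner_Integration.integral_sum mom(1))
    finally show "expectation (\<lambda>\<omega>. (J \<omega> w)\<^sup>2) \<le> b w" .
  qed
  have Jint: "integrable M (\<lambda>\<omega>. J \<omega> w)" for w
    by (rule square_integrable_imp_integrable[OF Jm Jsq(1)])
  have jcont: "continuous_on W0 j"
    unfolding continuous_on_sequentially o_def
  proof (intro allI ballI impI, elim conjE)
    fix x w assume x: "w \<in> W0" "\<forall>n. x n \<in> W0" "x \<longlonglongrightarrow> w"
    have "(\<lambda>n. expectation (\<lambda>\<omega>. (D\<Phi> \<omega> (x n) $ i $ l)\<^sup>2)) \<longlonglongrightarrow> expectation (\<lambda>\<omega>. (D\<Phi> \<omega> w $ i $ l)\<^sup>2)" for i l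
    proof (rule variance_tendsto[OF D\<Phi>H D\<Phi>H], rule AE_I2)
      show "(\<lambda>n. D\<Phi> \<omega> (x n) $ i $ l) \<longlonglongrightarrow> D\<Phi> \<omega> w $ i $ l" for \<omega>
        by (rule continuous_on_tendsto_compose[OF D\<Phi>cont x(3,1)]) (use x(2) in simp)
    qed
    then have "(\<lambda>n. b (x n)) \<longlonglongrightarrow> b w" unfolding b_def by (intro tendsto_intros)
    then have "Bseq (\<lambda>n. b (x n))" by (rule convergent_imp_Bseq[OF convergentI])
    then obtain C where "\<And>n. norm (b (x n)) \<le> C" by (auto simp: Bseq_def)
    then have C: "b (x n) \<le> C" for n by (metis abs_le_D1 real_norm_def)
    show "(\<lambda>n. j (x n)) \<longlonglongrightarrow> j w"
      unfolding j_def
    proof (rule expectation_tendsto_if_L2_bounded(2)[where C = C])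
      show "AE \<omega> in M. (\<lambda>n. J \<omega> (x n)) \<longlonglongrightarrow> J \<omega> w"
        by (intro AE_I2 continuous_on_tendsto_compose[OF Jcont x(3,1)]) (use x(2) in simp)
      show "expectation (\<lambda>\<omega>. (J \<omega> (x n))\<^sup>2) \<le> C" for n using Jsq(2)[of "x n"] C[of n] by linarith
    qed (intro Jm Jsq(1))+
  qed
  have jw0: "j w0 = (1 / sqrt (2 * pi)) ^ CARD('n) * expectation (\<lambda>\<omega>. \<bar>det (\<chi> k l. residual \<xi> (\<lambda>\<omega>. DX \<omega> w0 $ k $ l) \<omega>)\<bar>)"
  proof -
    have Xr0: "Xr \<omega> w0 k = 0" for \<omega> k
      by (simp add: Xr aw0 mat_def \<xi>_def if_distrib[of "\<lambda>x. x * _"] cong: if_cong)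
    have \<Phi>0: "\<Phi> \<omega> w0 $ k = 0" for \<omega> k by (simp add: \<Phi>_def Xr0)
    have "D\<Phi> \<omega> w0 = - (\<chi> k l. DXr \<omega> w0 k l)" for \<omega>
      by (simp add: D\<Phi>_def vec_eq_iff Xr0 Bw0 mat_def if_distrib[of "\<lambda>x. x * _"] cong: if_cong)
    moreover have "\<bar>det (- A)\<bar> = \<bar>det A\<bar>" for A :: "real ^ 'n::_ ^ 'n::_"
    proof -
      have "det (- A) = (- 1) ^ CARD('n) * det A"
        unfolding det_def sum_distrib_left by (intro sum.cong refl) (simp add: prod_uminus)
      then show ?thesis by (simp add: abs_mult power_abs)
    qed
    ultimately have "J \<omega> w0 = (1 / sqrt (2 * pi)) ^ CARD('n) * \<bar>det (\<chi> k l. DXr \<omega> w0 k l)\<bar>" for \<omega>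
      by (simp add: J_def \<Phi>0 normal_density_def)
    then show ?thesis unfolding j_def DXr_def by simp
  qed

  have count: "(\<integral>\<^sup>+\<omega>. emeasure (count_space UNIV) {w \<in> W. X \<omega> w = 0} \<partial>M) = (\<integral>\<^sup>+w. indicator W w * ennreal (j w) \<partial>lborel)"
    if W: "open W" "W \<subseteq> W0" for W
  proof -
    interpret G: prob_space "std_gaussian :: (real ^ 'n::_) measure" by (rule prob_space_std_gaussian)
    interpret P: pair_prob_space M "std_gaussian :: (real ^ 'n::_) measure" ..
    interpret L: pair_sigma_finite M "lborel :: (real ^ 'n::_) measure" ..
    obtain T :: "((real ^ 'n::_) \<times> 'n \<Rightarrow> real) \<Rightarrow> ennreal" where T: "T \<in> borel_measurable (PiM UNIV (\<lambda>_. borel))"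
      "\<And>g. (\<And>k. continuous_on UNIV (\<lambda>w. g (w, k))) \<Longrightarrow> T g = emeasure (count_space UNIV) {w \<in> W. \<forall>k. g (w, k) = 0}"
      using zero_count_measurable[OF W(1)] by blast
    define Y where "Y i \<omega> = X \<omega> (fst i) $ snd i" for i \<omega>
    have YH: "Y i \<in> H" for i using XH[of "fst i" "snd i"] by (simp add: Y_def[abs_def])
    define Z where "Z x i = residual \<xi> (Y i) (fst x) + (\<Sum>k\<in>UNIV. expectation (\<lambda>\<omega>. Y i \<omega> * \<xi> k \<omega>) * snd x $ k)"
      for x :: "'a \<times> (real ^ 'n::_)" and i
    have Ym: "(\<lambda>\<omega> i. Y i \<omega>) \<in> measurable M (PiM UNIV (\<lambda>_. borel))"
      by (rule measurable_PiM_single') (use YH H_measurable in \<open>auto simp: space_PiM\<close>)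
    have rm[measurable]: "residual \<xi> (Y i) \<in> borel_measurable M" for i by (rule H_measurable[OF residual_in_H[OF YH \<xi>H]])
    have sm[measurable]: "(\<lambda>x. snd x $ k) \<in> borel_measurable (M \<Otimes>\<^sub>M (std_gaussian :: (real ^ 'n::_) measure))" for k
      by (rule measurable_compose[OF measurable_snd]) simp
    have Zm: "Z \<in> measurable (M \<Otimes>\<^sub>M (std_gaussian :: (real ^ 'n::_) measure)) (PiM UNIV (\<lambda>_. borel))"
    proof (rule measurable_PiM_single')
      show "(\<lambda>x. Z x i) \<in> borel_measurable (M \<Otimes>\<^sub>M (std_gaussian :: (real ^ 'n::_) measure))" for i
        unfolding Z_def by measurable
    qed (auto simp: space_PiM)
    have TY: "T (\<lambda>i. Y i \<omega>) = emeasure (count_space UNIV) {w \<in> W. X \<omega> w = 0}" for \<omega>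
      by (subst T(2)) (auto simp: Y_def Xcont vec_eq_iff)
    have Zeq: "Z x (w, k) = Xr (fst x) w k + (\<Sum>j\<in>UNIV. a w $ k $ j * snd x $ j)" for x w k
      by (simp add: Z_def Y_def[abs_def] Xr_def a_def)
    have TZ: "T (Z x) = emeasure (count_space UNIV) {w \<in> W. \<Phi> (fst x) w = snd x}" for x
    proof -
      have "T (Z x) = emeasure (count_space UNIV) {w \<in> W. \<forall>k. Z x (w, k) = 0}"
        unfolding Zeq by (rule T(2)[of "Z x", unfolded Zeq])
          (intro continuous_intros Xrcont C1_on_continuous[OF aC1])
      also have "{w \<in> W. \<forall>k. Z x (w, k) = 0} = {w \<in> W. \<Phi> (fst x) w = snd x}"
        using solve W(2) unfolding Zeq by blast
      finally show ?thesis .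
    qed
    have TZm: "(\<lambda>x. T (Z x)) \<in> borel_measurable (M \<Otimes>\<^sub>M (std_gaussian :: (real ^ 'n::_) measure))"
      by (rule measurable_compose[OF Zm T(1)])
    have "(\<integral>\<^sup>+\<omega>. emeasure (count_space UNIV) {w \<in> W. X \<omega> w = 0} \<partial>M) = (\<integral>\<^sup>+\<omega>. T (\<lambda>i. Y i \<omega>) \<partial>M)"
      by (simp only: TY)
    also have "\<dots> = (\<integral>\<^sup>+g. T g \<partial>distr M (PiM UNIV (\<lambda>_. borel)) (\<lambda>\<omega> i. Y i \<omega>))"
      by (rule nn_integral_distr[OF Ym, symmetric]) (use T(1) in simp)
    also have "\<dots> = (\<integral>\<^sup>+g. T g \<partial>distr (M \<Otimes>\<^sub>M (std_gaussian :: (real ^ 'n::_) measure)) (PiM UNIV (\<lambda>_. borel)) Z)"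
      using decoupled_law[of Y \<xi>, OF YH \<xi>H orth] by (simp add: Z_def[abs_def])
    also have "\<dots> = (\<integral>\<^sup>+x. T (Z x) \<partial>(M \<Otimes>\<^sub>M (std_gaussian :: (real ^ 'n::_) measure)))"
      by (rule nn_integral_distr[OF Zm]) (use T(1) in simp)
    also have "\<dots> = (\<integral>\<^sup>+\<omega>. \<integral>\<^sup>+z. T (Z (\<omega>, z)) \<partial>std_gaussian \<partial>M)"
      by (rule G.nn_integral_fst[OF TZm, symmetric])
    also have "\<dots> = (\<integral>\<^sup>+\<omega>. \<integral>\<^sup>+w. ennreal (indicator W0 w * J \<omega> w) * indicator W w \<partial>lborel \<partial>M)"
    proof (rule nn_integral_cong)
      fix \<omega> assume \<omega>: "\<omega> \<in> space M"
      let ?\<phi> = "\<lambda>z :: real ^ 'n::_. \<Prod>k\<in>UNIV. ennreal (std_normal_density (z $ k))"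
      have TZ1: "(\<lambda>z. T (Z (\<omega>, z))) \<in> borel_measurable lborel"
        using measurable_compose[OF measurable_Pair1'[OF \<omega>, of "std_gaussian :: (real ^ 'n::_) measure"] TZm] by (simp add: measurable_lborel2 measurable_def)
      have "(\<integral>\<^sup>+z. T (Z (\<omega>, z)) \<partial>std_gaussian) = (\<integral>\<^sup>+z. ?\<phi> z * T (Z (\<omega>, z)) \<partial>lborel)"
        unfolding std_gaussian_def by (rule nn_integral_density) (use TZ1 in simp_all)
      also have "\<dots> = (\<integral>\<^sup>+z. emeasure (count_space UNIV) {w \<in> W. \<Phi> \<omega> w = z} * ?\<phi> z \<partial>lborel)"
        unfolding TZ by (simp add: mult.commute)
      also have "\<dots> = (\<integral>\<^sup>+w. indicator W w * ennreal \<bar>det (D\<Phi> \<omega> w)\<bar> * ?\<phi> (\<Phi> \<omega> w) \<partial>lborel)"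
        by (rule area_formula[OF W(1)]) (use W(2) \<Phi>der in \<open>auto intro: continuous_on_subset[OF D\<Phi>cont']\<close>)
      also have "\<dots> = (\<integral>\<^sup>+w. ennreal (indicator W0 w * J \<omega> w) * indicator W w \<partial>lborel)"
        using W(2) by (intro nn_integral_cong) (auto simp: indicator_def J_def ennreal_mult prod_ennreal prod_nonneg)
      finally show "(\<integral>\<^sup>+z. T (Z (\<omega>, z)) \<partial>std_gaussian) = (\<integral>\<^sup>+w. ennreal (indicator W0 w * J \<omega> w) * indicator W w \<partial>lborel)" .
    qed
    also have "\<dots> = (\<integral>\<^sup>+w. \<integral>\<^sup>+\<omega>. ennreal (indicator W0 w * J \<omega> w) * indicator W w \<partial>M \<partial>lborel)"
    proof (rule L.Fubini'[symmetric])
      have [measurable]: "(\<lambda>(\<omega>, w). indicator W0 w * J \<omega> w) \<in> borel_measurable (M \<Otimes>\<^sub>M lborel)"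
        using Caratheodory_function_measurable[OF oW0 Jm Jcont] by (simp cong: measurable_cong_sets sets_pair_measure_cong)
      have [measurable]: "W \<in> sets borel" using W(1) by simp
      show "(\<lambda>(\<omega>, w). ennreal (indicator W0 w * J \<omega> w) * indicator W w) \<in> borel_measurable (M \<Otimes>\<^sub>M lborel)"
        by measurable
    qed
    also have "\<dots> = (\<integral>\<^sup>+w. indicator W w * ennreal (j w) \<partial>lborel)"
    proof (rule nn_integral_cong)
      fix w
      have "(\<integral>\<^sup>+\<omega>. ennreal (J \<omega> w) \<partial>M) = ennreal (j w)"
        unfolding j_def by (rule nn_integral_eq_integral[OF Jint]) (simp add: J0)
      then show "(\<integral>\<^sup>+\<omega>. ennreal (indicator W0 w * J \<omega> w) * indicator W w \<partial>M) = indicator W w * ennreal (j w)"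
        using W(2) by (auto simp: indicator_def)
    qed
    finally show ?thesis .
  qed
  have "0 \<le> j w" for w unfolding j_def by (intro integral_nonneg_AE AE_I2 J0)
  show thesis by (rule that[OF oW0 w0W0 jcont \<open>\<And>w. 0 \<le> j w\<close> jw0 count])
qed

end

section \<open>Iterated directional derivatives\<close>

definition dird :: "'v::euclidean_space \<Rightarrow> ('v \<Rightarrow> real) \<Rightarrow> 'v \<Rightarrow> real" where
  "dird a f = (\<lambda>x. frechet_derivative f (at x) a)"

text \<open>Directional derivatives in all directions, not only along the axes: in this form the class is
  visibly preserved by rotations.\<close>

primrec Ck :: "nat \<Rightarrow> ('v::euclidean_space \<Rightarrow> real) \<Rightarrow> bool" where
  "Ck 0 f \<longleftrightarrow> continuous_on UNIV f"
| "Ck (Suc k) f \<longleftrightarrow> (\<forall>x. f differentiable (at x)) \<and> (\<forall>a. Ck k (dird a f))"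

lemma dird_eqI: "(f has_derivative f') (at x) \<Longrightarrow> dird a f x = f' a"
  unfolding dird_def by (simp add: frechet_derivative_at[symmetric])

lemma has_derivative_dird: "f differentiable (at x) \<Longrightarrow> (f has_derivative (\<lambda>h. dird h f x)) (at x)"
  unfolding dird_def by (simp add: frechet_derivative_works)

lemma linear_dird: "f differentiable (at x) \<Longrightarrow> linear (\<lambda>h. dird h f x)"
  using has_derivative_dird has_derivative_linear by blast

lemma dird_add_dir: "f differentiable (at x) \<Longrightarrow> dird (a + b) f x = dird a f x + dird b f x"
  using linear_add[OF linear_dird[of f x], of a b] by simp

lemma dird_scale_dir: "f differentiable (at x) \<Longrightarrow> dird (c *\<^sub>R a) f x = c * dird a f x"
  using linear_dird[of f x] linear_scale[of "\<lambda>h. dird h f x" c a] by simp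

lemma dird_add: "(\<And>x. f differentiable (at x)) \<Longrightarrow> (\<And>x. g differentiable (at x)) \<Longrightarrow>
    dird a (\<lambda>x. f x + g x) = (\<lambda>x. dird a f x + dird a g x)"
  by (rule ext, rule dird_eqI) (intro has_derivative_add has_derivative_dird)

lemma dird_scale: "(\<And>x. f differentiable (at x)) \<Longrightarrow> dird a (\<lambda>x. c * f x) = (\<lambda>x. c * dird a f x)"
  by (rule ext, rule dird_eqI) (intro has_derivative_mult_right has_derivative_dird)

lemma Ck_continuous: "Ck k f \<Longrightarrow> continuous_on UNIV f"
  by (cases k) (auto intro!: continuous_at_imp_continuous_on differentiable_imp_continuous_within)

lemma Ck_Suc_imp: "Ck (Suc k) f \<Longrightarrow> Ck k f"
proof (induction k arbitrary: f)
  case 0 then show ?case using Ck_continuous[of "Suc 0" f] by simp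
next
  case (Suc k) then show ?case by (metis Ck.simps(2))
qed

lemma Ck_mono: "k \<le> m \<Longrightarrow> Ck m f \<Longrightarrow> Ck k f"
  by (induction m rule: dec_induct) (auto simp del: Ck.simps dest: Ck_Suc_imp)

lemma Ck_add: "Ck k f \<Longrightarrow> Ck k g \<Longrightarrow> Ck k (\<lambda>x. f x + g x)"
proof (induction k arbitrary: f g)
  case 0 then show ?case by (auto intro: continuous_intros)
next
  case (Suc k) then show ?case by (auto simp: dird_add)
qed

lemma Ck_scale: "Ck k f \<Longrightarrow> Ck k (\<lambda>x. c * f x)"
proof (induction k arbitrary: f)
  case 0 then show ?case by (auto intro: continuous_intros)
next
  case (Suc k) then show ?case by (auto simp: dird_scale)
qed

lemma Ck_zero: "Ck k (\<lambda>x. 0)"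
proof (induction k)
  case (Suc k)
  have "dird a (\<lambda>x. 0) = (\<lambda>x. 0)" for a :: 'a
    by (rule ext, rule dird_eqI) simp
  then show ?case using Suc by simp
qed simp

lemma Ck_sum: "(\<And>i. i \<in> I \<Longrightarrow> Ck k (f i)) \<Longrightarrow> Ck k (\<lambda>x. \<Sum>i\<in>I. f i x)"
  by (induction I rule: infinite_finite_induct) (auto simp: Ck_zero Ck_add)

lemma C_k_holder_imp_Ck: "C_k_holder k \<alpha> f \<Longrightarrow> Ck k f"
proof (induction k arbitrary: f)
  case (Suc k)
  then have d: "f differentiable (at x)" for x by simp
  have "Ck k (dird a f)" for a
  proof -
    have "dird a f = (\<lambda>x. \<Sum>b\<in>Basis. (a \<bullet> b) * dird b f x)"
    proof
      fix x
      have "dird a f x = dird (\<Sum>b\<in>Basis. (a \<bullet> b) *\<^sub>R b) f x" by (simp add: euclidean_representation)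
      also have "\<dots> = (\<Sum>b\<in>Basis. (a \<bullet> b) * dird b f x)"
        by (simp add: linear_sum[OF linear_dird[OF d[of x]]] dird_scale_dir[OF d])
      finally show "dird a f x = (\<Sum>b\<in>Basis. (a \<bullet> b) * dird b f x)" .
    qed
    moreover have "Ck k (dird b f)" if "b \<in> Basis" for b
      using Suc that by (simp add: dird_def)
    ultimately show ?thesis by (simp add: Ck_sum Ck_scale)
  qed
  then show ?case using d by simp
qed simp

lemma C_class_imp_Ck: "real k \<le> s \<Longrightarrow> C_class s f \<Longrightarrow> Ck k f"
  unfolding C_class_def by (rule Ck_mono[of k "nat \<lfloor>s\<rfloor>"]) (auto simp: le_nat_floor intro: C_k_holder_imp_Ck)

lemma dird_along_line:
  assumes "\<And>x. f differentiable (at x)"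
  shows "((\<lambda>t. f (x + t *\<^sub>R a)) has_field_derivative dird a f (x + t *\<^sub>R a)) (at t)"
proof -
  have "((\<lambda>t. f (x + t *\<^sub>R a)) has_derivative (\<lambda>s. dird (s *\<^sub>R a) f (x + t *\<^sub>R a))) (at t)"
    by (rule has_derivative_compose[of "\<lambda>t. x + t *\<^sub>R a" "\<lambda>s. s *\<^sub>R a" t UNIV f "\<lambda>h. dird h f (x + t *\<^sub>R a)"])
       (auto intro!: derivative_eq_intros has_derivative_dird assms)
  then show ?thesis
    unfolding has_field_derivative_def dird_scale_dir[OF assms] by (simp add: mult.commute[of _ "dird a f (x + t *\<^sub>R a)"])
qed

text \<open>The mean value theorem, first in direction \<open>a\<close>, then in direction \<open>b\<close>. The second difference on
  the left is symmetric in \<open>a\<close> and \<open>b\<close>, from which Clairaut's theorem follows.\<close>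

lemma second_difference_mean_value:
  assumes f: "Ck 2 f" and h: "h > 0"
  shows "\<exists>p q. 0 < p \<and> p < h \<and> 0 < q \<and> q < h \<and>
    f (x + h *\<^sub>R a + h *\<^sub>R b) - f (x + h *\<^sub>R a) - f (x + h *\<^sub>R b) + f x = h * h * dird b (dird a f) (x + p *\<^sub>R a + q *\<^sub>R b)"
proof -
  have f1: "f differentiable (at y)" and f2: "dird a f differentiable (at y)" for y
    using f by (auto simp: numeral_2_eq_2)
  let ?g = "\<lambda>t. f (x + h *\<^sub>R b + t *\<^sub>R a) - f (x + t *\<^sub>R a)"
  have "\<exists>p. 0 < p \<and> p < h \<and> ?g h - ?g 0 = (h - 0) * (dird a f (x + h *\<^sub>R b + p *\<^sub>R a) - dird a f (x + p *\<^sub>R a))"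
    by (rule MVT2[OF h]) (intro derivative_intros dird_along_line f1)
  then obtain p where p: "0 < p" "p < h" "?g h - ?g 0 = h * (dird a f (x + h *\<^sub>R b + p *\<^sub>R a) - dird a f (x + p *\<^sub>R a))" by auto
  let ?k = "\<lambda>s. dird a f (x + p *\<^sub>R a + s *\<^sub>R b)"
  have "\<exists>q. 0 < q \<and> q < h \<and> ?k h - ?k 0 = (h - 0) * dird b (dird a f) (x + p *\<^sub>R a + q *\<^sub>R b)"
    by (rule MVT2[OF h]) (intro dird_along_line f2)
  then obtain q where q: "0 < q" "q < h" "?k h - ?k 0 = h * dird b (dird a f) (x + p *\<^sub>R a + q *\<^sub>R b)" by auto
  have "f (x + h *\<^sub>R a + h *\<^sub>R b) - f (x + h *\<^sub>R a) - f (x + h *\<^sub>R b) + f x = ?g h - ?g 0" by (simp add: add_ac)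
  also have "\<dots> = h * (?k h - ?k 0)" using p(3) by (simp add: add_ac)
  finally show ?thesis using p(1,2) q by (intro exI[of _ p] exI[of _ q]) simp
qed

lemma dird_commute:
  assumes f: "Ck 2 f" shows "dird a (dird b f) = dird b (dird a f)"
proof
  fix x
  let ?r = "\<lambda>n. inverse (real (Suc n))"
  have lim: "(\<lambda>n. g (x + p n *\<^sub>R a + q n *\<^sub>R b)) \<longlonglongrightarrow> g x"
    if g: "continuous_on UNIV g" and pq: "\<And>n. 0 < p n \<and> p n < ?r n" "\<And>n. 0 < q n \<and> q n < ?r n" for g :: "'a \<Rightarrow> real" and p q
  proof -
    have p0: "p \<longlonglongrightarrow> 0" by (rule tendsto_sandwich[OF _ _ tendsto_const LIMSEQ_inverse_real_of_nat]) (use pq(1) in \<open>auto intro!: always_eventually less_imp_le\<close>)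
    have q0: "q \<longlonglongrightarrow> 0" by (rule tendsto_sandwich[OF _ _ tendsto_const LIMSEQ_inverse_real_of_nat]) (use pq(2) in \<open>auto intro!: always_eventually less_imp_le\<close>)
    have "(\<lambda>n. x + p n *\<^sub>R a + q n *\<^sub>R b) \<longlonglongrightarrow> x + 0 *\<^sub>R a + 0 *\<^sub>R b" by (intro tendsto_intros p0 q0)
    then show ?thesis using continuous_on_tendsto_compose[OF g] by simp
  qed
  have f2: "continuous_on UNIV (dird b (dird a f))" "continuous_on UNIV (dird a (dird b f))"
    using f by (auto simp: numeral_2_eq_2)
  have r: "?r n > 0" for n by simp
  obtain p q where 1: "\<And>n. 0 < p n \<and> p n < ?r n" "\<And>n. 0 < q n \<and> q n < ?r n"
    "\<And>n. f (x + ?r n *\<^sub>R a + ?r n *\<^sub>R b) - f (x + ?r n *\<^sub>R a) - f (x + ?r n *\<^sub>R b) + f x = ?r n * ?r n * dird b (dird a f) (x + p n *\<^sub>R a + q n *\<^sub>R b)"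
    using second_difference_mean_value[OF f r, of _ x a b] by metis
  obtain p' q' where 2: "\<And>n. 0 < p' n \<and> p' n < ?r n" "\<And>n. 0 < q' n \<and> q' n < ?r n"
    "\<And>n. f (x + ?r n *\<^sub>R b + ?r n *\<^sub>R a) - f (x + ?r n *\<^sub>R b) - f (x + ?r n *\<^sub>R a) + f x = ?r n * ?r n * dird a (dird b f) (x + p' n *\<^sub>R b + q' n *\<^sub>R a)"
    using second_difference_mean_value[OF f r, of _ x b a] by metis
  have "?r n * ?r n * dird b (dird a f) (x + p n *\<^sub>R a + q n *\<^sub>R b) = ?r n * ?r n * dird a (dird b f) (x + q' n *\<^sub>R a + p' n *\<^sub>R b)" for n
  proof -
    have s: "x + ?r n *\<^sub>R b + ?r n *\<^sub>R a = x + ?r n *\<^sub>R a + ?r n *\<^sub>R b"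
      "x + p' n *\<^sub>R b + q' n *\<^sub>R a = x + q' n *\<^sub>R a + p' n *\<^sub>R b" by (simp_all only: add_ac)
    show ?thesis using 1(3)[of n] 2(3)[of n] unfolding s by linarith
  qed
  then have e: "dird b (dird a f) (x + p n *\<^sub>R a + q n *\<^sub>R b) = dird a (dird b f) (x + q' n *\<^sub>R a + p' n *\<^sub>R b)" for n
    using r[of n] by (metis mult_cancel_left mult_eq_0_iff less_irrefl)
  have "(\<lambda>n. dird b (dird a f) (x + p n *\<^sub>R a + q n *\<^sub>R b)) \<longlonglongrightarrow> dird a (dird b f) x"
    unfolding e by (rule lim[OF f2(2) 2(2,1)])
  then show "dird a (dird b f) x = dird b (dird a f) x"
    using lim[OF f2(1) 1(1,2)] LIMSEQ_unique by blast
qed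

text \<open>\<open>D [a, b] f\<close> differentiates first along \<open>a\<close>, then along \<open>b\<close>.\<close>

definition D :: "'v::euclidean_space list \<Rightarrow> ('v \<Rightarrow> real) \<Rightarrow> 'v \<Rightarrow> real" where
  "D A f = fold dird A f"

lemma D_Nil[simp]: "D [] f = f" by (simp add: D_def)
lemma D_Cons: "D (a # A) f = D A (dird a f)" by (simp add: D_def)
lemma D_snoc: "D (A @ [a]) f = dird a (D A f)" by (simp add: D_def)

lemma Ck_D: "Ck (k + length A) f \<Longrightarrow> Ck k (D A f)"
  by (induction A arbitrary: f) (auto simp: D_Cons)

lemma D_scaled_dirs:
  assumes "\<And>a. a \<in> set A \<Longrightarrow> R a = s a *\<^sub>R a" and "Ck (length A) f"
  shows "D (map R A) f = (\<lambda>x. prod_list (map s A) * D A f x)"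
  using assms
proof (induction A rule: rev_induct)
  case (snoc a A)
  have C: "Ck 1 (D A f)" using Ck_D[of 1 A f] snoc.prems(2) by simp
  have d: "D A f differentiable (at x)" for x using C by simp
  have IH: "D (map R A) f = (\<lambda>x. prod_list (map s A) * D A f x)"
    using snoc Ck_mono[of "length A" "length (A @ [a])" f] by simp
  have "D (map R (A @ [a])) f = dird (s a *\<^sub>R a) (\<lambda>x. prod_list (map s A) * D A f x)"
    using snoc.prems(1)[of a] by (simp add: D_snoc IH)
  also have "\<dots> = (\<lambda>x. prod_list (map s A) * (s a * dird a (D A f) x))"
    by (simp add: dird_scale[OF d] dird_scale_dir[OF d])
  finally show ?case by (simp add: D_snoc mult.assoc)
qed simp

section \<open>Smooth isotropic Gaussian fields in the plane\<close>

abbreviation e1 :: "real ^ 2" where "e1 \<equiv> axis 1 1"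
abbreviation e2 :: "real ^ 2" where "e2 \<equiv> axis 2 1"

lemma e1_neq_e2[simp]: "e1 \<noteq> e2" "e2 \<noteq> e1" by (simp_all add: axis_eq_axis)

definition rot :: "real \<Rightarrow> real ^ 2 \<Rightarrow> real ^ 2" where
  "rot t x = (x $ 1) *\<^sub>R (cos t *\<^sub>R e1 + sin t *\<^sub>R e2) + (x $ 2) *\<^sub>R (- sin t *\<^sub>R e1 + cos t *\<^sub>R e2)"

definition reflect_axes :: "real \<Rightarrow> real \<Rightarrow> real ^ 2 \<Rightarrow> real ^ 2" where
  "reflect_axes s t x = (x $ 1 * s) *\<^sub>R e1 + (x $ 2 * t) *\<^sub>R e2"

lemma axis_nth_simps[simp]: "e1 $ 1 = 1" "e1 $ 2 = 0" "e2 $ 1 = 0" "e2 $ 2 = 1"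
  by (simp_all add: axis_def)

lemma rot_axes: "rot t e1 = cos t *\<^sub>R e1 + sin t *\<^sub>R e2" "rot t e2 = (- sin t) *\<^sub>R e1 + cos t *\<^sub>R e2"
  by (simp_all add: rot_def)

lemma orthogonal_rot: "orthogonal_transformation (rot t)"
  unfolding orthogonal_transformation
proof
  show "linear (rot t)" by (rule linearI) (auto simp: rot_def vec_eq_iff forall_2 algebra_simps)
  have "(norm (rot t x))\<^sup>2 = (norm x)\<^sup>2" for x
  proof -
    have "(norm (rot t x))\<^sup>2 = (x $ 1 * cos t - x $ 2 * sin t)\<^sup>2 + (x $ 1 * sin t + x $ 2 * cos t)\<^sup>2"
      unfolding power2_norm_eq_inner by (simp add: inner_vec_def sum_2 rot_def power2_eq_square)
    also have "\<dots> = ((x $ 1)\<^sup>2 + (x $ 2)\<^sup>2) * ((sin t)\<^sup>2 + (cos t)\<^sup>2)"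
      by algebra
    also have "\<dots> = (norm x)\<^sup>2"
      unfolding sin_cos_squared_add power2_norm_eq_inner by (simp add: inner_vec_def sum_2 power2_eq_square)
    finally show ?thesis .
  qed
  then show "\<forall>x. norm (rot t x) = norm x" by (metis norm_ge_zero power2_eq_imp_eq)
qed

lemma orthogonal_reflect_axes: "s\<^sup>2 = 1 \<Longrightarrow> t\<^sup>2 = 1 \<Longrightarrow> orthogonal_transformation (reflect_axes s t)"
  unfolding orthogonal_transformation
proof
  assume st: "s\<^sup>2 = 1" "t\<^sup>2 = 1"
  show "linear (reflect_axes s t)" by (rule linearI) (auto simp: reflect_axes_def vec_eq_iff forall_2 algebra_simps)
  have "(norm (reflect_axes s t x))\<^sup>2 = (norm x)\<^sup>2" for x
  proof -
    have "(norm (reflect_axes s t x))\<^sup>2 = (x $ 1)\<^sup>2 * s\<^sup>2 + (x $ 2)\<^sup>2 * t\<^sup>2"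
      unfolding power2_norm_eq_inner by (simp add: inner_vec_def sum_2 reflect_axes_def power2_eq_square)
    also have "\<dots> = (norm x)\<^sup>2" unfolding st power2_norm_eq_inner by (simp add: inner_vec_def sum_2 power2_eq_square)
    finally show ?thesis .
  qed
  then show "\<forall>x. norm (reflect_axes s t x) = norm x" by (metis norm_ge_zero power2_eq_imp_eq)
qed

lemma dird_linear_combination:
  assumes "Ck 1 f"
  shows "dird (p *\<^sub>R a + q *\<^sub>R b) f = (\<lambda>x. p * dird a f x + q * dird b f x)"
  using assms by (auto simp: dird_add_dir dird_scale_dir)

lemma dird_combination:
  assumes f: "\<And>x. f differentiable (at x)" and g: "\<And>x. g differentiable (at x)"
  shows "dird a (\<lambda>x. p * f x + q * g x) = (\<lambda>x. p * dird a f x + q * dird a g x)"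
  by (rule ext, rule dird_eqI)
     (intro has_derivative_add has_derivative_mult_right has_derivative_dird f g)

text \<open>All sample functions are smooth, without exceptional outcomes, so that derivatives are random
  variables given by honest formulas. The general case is reduced to this one in \<open>smooth_version\<close>.\<close>

locale smooth_gaussian_field = prob_space M for M :: "'a measure" +
  fixes F :: "'a \<Rightarrow> real ^ 2 \<Rightarrow> real"
  assumes field_measurable: "\<And>x. (\<lambda>\<omega>. F \<omega> x) \<in> borel_measurable M"
    and field_smooth: "\<And>\<omega>. Ck 4 (F \<omega>)"
    and field_gaussian: "\<And>S a. finite S \<Longrightarrow> centred_gaussian M (\<lambda>\<omega>. \<Sum>x\<in>S. a x * F \<omega> x)"
    and field_isotropic: "\<And>x y x' y'. norm (x - y) = norm (x' - y') \<Longrightarrow>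
      expectation (\<lambda>\<omega>. F \<omega> x * F \<omega> y) = expectation (\<lambda>\<omega>. F \<omega> x' * F \<omega> y')"
    and field_nonconstant: "\<not> (AE \<omega> in M. F \<omega> constant_on UNIV)"
begin

definition H :: "('a \<Rightarrow> real) set" where "H = L2_closed_span M F"

sublocale gaussian_hilbert M H
  unfolding H_def by (rule L2_closed_span_gaussian_hilbert(1)[OF prob_space_axioms field_measurable field_gaussian])

lemma field_Ck: "k + length A \<le> 4 \<Longrightarrow> Ck k (D A (F \<omega>))"
  by (rule Ck_D, rule Ck_mono[OF _ field_smooth])

lemma field_D_differentiable: "length A < 4 \<Longrightarrow> D A (F \<omega>) differentiable (at u)"
  using field_Ck[of 1 A \<omega>] by simp

lemma field_D_continuous: "length A \<le> 4 \<Longrightarrow> continuous_on UNIV (D A (F \<omega>))"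
  using field_Ck[of 0 A \<omega>] by simp

lemma field_D_has_derivative: "length A < 4 \<Longrightarrow> (D A (F \<omega>) has_derivative (\<lambda>h. D (A @ [h]) (F \<omega>) u)) (at u)"
  unfolding D_snoc by (rule has_derivative_dird[OF field_D_differentiable])

text \<open>A derivative is a pointwise limit of difference quotients, so it stays in the Gaussian space.\<close>

lemma field_D_in_H: "length A \<le> 4 \<Longrightarrow> (\<lambda>\<omega>. D A (F \<omega>) u) \<in> H"
proof (induction A arbitrary: u rule: rev_induct)
  case Nil
  show ?case unfolding H_def
    using L2_closed_span_gaussian_hilbert(2)[OF prob_space_axioms field_measurable field_gaussian] by simp
next
  case (snoc a A)
  then have l: "length A < 4" by simp
  show ?case
    by (rule derivative_in_H[of "\<lambda>\<omega>. D A (F \<omega>)" "\<lambda>\<omega> h. D (A @ [h]) (F \<omega>) u" u a])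
       (use snoc.IH l field_D_has_derivative[OF l] in auto)
qed

definition C :: "(real ^ 2) list \<Rightarrow> (real ^ 2) list \<Rightarrow> real ^ 2 \<Rightarrow> real ^ 2 \<Rightarrow> real" where
  "C A B u v = expectation (\<lambda>\<omega>. D A (F \<omega>) u * D B (F \<omega>) v)"

lemma C_commute: "C A B u v = C B A v u"
  unfolding C_def by (simp add: mult.commute)

lemma C_derivative_left:
  assumes "length A < 4" "length B \<le> 4" and r: "r \<longlonglongrightarrow> 0" "\<And>m. r m \<noteq> 0"
  shows "(\<lambda>m. (C A B (u + r m *\<^sub>R a) v - C A B u v) / r m) \<longlonglongrightarrow> C (A @ [a]) B u v"
proof -
  have DA: "(\<lambda>\<omega>. D A (F \<omega>) w) \<in> H" for w using assms(1) by (intro field_D_in_H) simp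
  have DB: "(\<lambda>\<omega>. D B (F \<omega>) w) \<in> H" for w using assms(2) by (intro field_D_in_H) simp
  have "(\<lambda>m. expectation (\<lambda>\<omega>. (D A (F \<omega>) (u + r m *\<^sub>R a) - D A (F \<omega>) u) / r m * D B (F \<omega>) v)) \<longlonglongrightarrow> C (A @ [a]) B u v"
    unfolding C_def
    by (rule covariance_tendsto)
       (use assms in \<open>auto intro!: H_divide H_diff DA DB field_D_in_H has_derivative_directional_sequence[OF field_D_has_derivative]\<close>)
  moreover have "expectation (\<lambda>\<omega>. (D A (F \<omega>) (u + r m *\<^sub>R a) - D A (F \<omega>) u) / r m * D B (F \<omega>) v) = (C A B (u + r m *\<^sub>R a) v - C A B u v) / r m" for m
    unfolding covariance_divide_left C_def by (simp only: covariance_diff_left DA DB)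
  ultimately show ?thesis by (simp only:)
qed

lemma C_derivative_right:
  assumes "length A \<le> 4" "length B < 4" and r: "r \<longlonglongrightarrow> 0" "\<And>m. r m \<noteq> 0"
  shows "(\<lambda>m. (C A B u (v + r m *\<^sub>R b) - C A B u v) / r m) \<longlonglongrightarrow> C A (B @ [b]) u v"
  using C_derivative_left[OF assms(2,1) r, of v b u] by (simp add: C_commute[of B] C_commute[of "B @ [b]"])

text \<open>The covariance of the field is invariant under isometries, and covariances of derivatives are
  limits of its difference quotients.\<close>

lemma C_isometry:
  assumes R: "orthogonal_transformation R"
  shows "length A \<le> 4 \<Longrightarrow> length B \<le> 4 \<Longrightarrow> C (map R A) (map R B) (R u + c) (R v + c) = C A B u v"
proof (induction B arbitrary: u v rule: rev_induct)
  have lin: "linear R" using R by (simp add: orthogonal_transformation)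
  have step: "R (w + s *\<^sub>R a) + c = (R w + c) + s *\<^sub>R R a" for w s a
    using lin by (simp add: linear_add linear_scale)
  let ?r = "\<lambda>m. inverse (real (Suc m))"
  have r: "?r \<longlonglongrightarrow> 0" "\<And>m. ?r m \<noteq> 0" by (rule LIMSEQ_inverse_real_of_nat) simp
  {
    case Nil
    then show ?case
    proof (induction A arbitrary: u v rule: rev_induct)
      case Nil
      have "norm (R u + c - (R v + c)) = norm (u - v)"
        using R by (metis add_diff_cancel_right linear_diff orthogonal_transformation)
      from field_isotropic[OF this] show ?case by (simp add: C_def)
    next
      case (snoc a A)
      have l: "length A < 4" "length (map R A) < 4" using snoc.prems by auto
      have IH: "C (map R A) (map R []) (R u + c) (R v + c) = C A [] u v" for u v using snoc.IH l by simp
      have 1: "(\<lambda>m. (C A [] (u + ?r m *\<^sub>R a) v - C A [] u v) / ?r m) \<longlonglongrightarrow> C (A @ [a]) [] u v"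
        by (rule C_derivative_left[OF l(1) _ r]) simp
      have "(\<lambda>m. (C (map R A) (map R []) ((R u + c) + ?r m *\<^sub>R R a) (R v + c) - C (map R A) (map R []) (R u + c) (R v + c)) / ?r m)
          \<longlonglongrightarrow> C (map R A @ [R a]) (map R []) (R u + c) (R v + c)"
        by (rule C_derivative_left[OF l(2) _ r]) simp
      then have 2: "(\<lambda>m. (C A [] (u + ?r m *\<^sub>R a) v - C A [] u v) / ?r m) \<longlonglongrightarrow> C (map R A @ [R a]) (map R []) (R u + c) (R v + c)"
        unfolding step[symmetric] IH .
      show ?case using LIMSEQ_unique[OF 2 1] by simp
    qed
  next
    case (snoc b B)
    have l: "length B < 4" "length (map R B) < 4" "length A \<le> 4" "length (map R A) \<le> 4" using snoc.prems by auto
    have IH: "C (map R A) (map R B) (R u + c) (R v + c) = C A B u v" for u v using snoc.IH l by simp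
    have 1: "(\<lambda>m. (C A B u (v + ?r m *\<^sub>R b) - C A B u v) / ?r m) \<longlonglongrightarrow> C A (B @ [b]) u v"
      by (rule C_derivative_right[OF l(3,1) r])
    have "(\<lambda>m. (C (map R A) (map R B) (R u + c) ((R v + c) + ?r m *\<^sub>R R b) - C (map R A) (map R B) (R u + c) (R v + c)) / ?r m)
        \<longlonglongrightarrow> C (map R A) (map R B @ [R b]) (R u + c) (R v + c)"
      by (rule C_derivative_right[OF l(4,2) r])
    then have 2: "(\<lambda>m. (C A B u (v + ?r m *\<^sub>R b) - C A B u v) / ?r m) \<longlonglongrightarrow> C (map R A) (map R B @ [R b]) (R u + c) (R v + c)"
      unfolding step[symmetric] IH .
    show ?case using LIMSEQ_unique[OF 2 1] by simp
  }
qed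

lemma C_shift: "length A \<le> 4 \<Longrightarrow> length B \<le> 4 \<Longrightarrow> C A B (u + c) (v + c) = C A B u v"
  using C_isometry[of "\<lambda>x. x" A B u c v] by (simp add: orthogonal_transformation_id)

lemma C_diag: "length A \<le> 4 \<Longrightarrow> length B \<le> 4 \<Longrightarrow> C A B u u = C A B 0 0"
  using C_shift[of A B 0 u 0] by simp

text \<open>Integration by parts without integrals: since \<open>C A B u v\<close> depends only on \<open>u - v\<close>, moving \<open>u\<close>
  forward has the same effect as moving \<open>v\<close> backward.\<close>

lemma C_move:
  assumes "length A < 4" "length B < 4"
  shows "C (A @ [a]) B u v = - C A (B @ [a]) u v"
proof -
  let ?r = "\<lambda>m. inverse (real (Suc m))"
  have r: "?r \<longlonglongrightarrow> 0" "\<And>m. ?r m \<noteq> 0" by (rule LIMSEQ_inverse_real_of_nat) simp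
  have r': "(\<lambda>m. - ?r m) \<longlonglongrightarrow> 0" "\<And>m. - ?r m \<noteq> 0" using tendsto_minus[OF r(1)] by auto
  have sh: "C A B (u + ?r m *\<^sub>R a) v = C A B u (v + (- ?r m) *\<^sub>R a)" for m
    using C_shift[of A B u "?r m *\<^sub>R a" "v + (- ?r m) *\<^sub>R a"] assms by simp
  have "(\<lambda>m. (C A B u (v + (- ?r m) *\<^sub>R a) - C A B u v) / ?r m) \<longlonglongrightarrow> C (A @ [a]) B u v"
    using C_derivative_left[OF assms(1) _ r, of B u a v] assms unfolding sh by simp
  then have "(\<lambda>m. - ((C A B u (v + (- ?r m) *\<^sub>R a) - C A B u v) / (- ?r m))) \<longlonglongrightarrow> C (A @ [a]) B u v" by simp
  moreover have "(\<lambda>m. - ((C A B u (v + (- ?r m) *\<^sub>R a) - C A B u v) / (- ?r m))) \<longlonglongrightarrow> - C A (B @ [a]) u v"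
    by (rule tendsto_minus[OF C_derivative_right[OF _ assms(2) r', of A u v a]]) (use assms in simp)
  ultimately show ?thesis by (rule LIMSEQ_unique)
qed

lemma C_reflection:
  assumes "s\<^sup>2 = 1" "t\<^sup>2 = 1" "set A \<subseteq> {e1, e2}" "set B \<subseteq> {e1, e2}" "length A \<le> 4" "length B \<le> 4"
  shows "C A B u v = prod_list (map (\<lambda>a. if a = e1 then s else t) A) * prod_list (map (\<lambda>a. if a = e1 then s else t) B) * C A B (reflect_axes s t u) (reflect_axes s t v)"
proof -
  let ?s = "\<lambda>a. if a = e1 then s else t"
  have R: "reflect_axes s t a = ?s a *\<^sub>R a" if "a \<in> {e1, e2}" for a
    using that by (auto simp: reflect_axes_def)
  have D: "D (map (reflect_axes s t) A) (F \<omega>) = (\<lambda>x. prod_list (map ?s A) * D A (F \<omega>) x)" if "set A \<subseteq> {e1, e2}" "length A \<le> 4" for A \<omega>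
    by (rule D_scaled_dirs) (use R that Ck_mono[OF that(2) field_smooth] in auto)
  have "C A B u v = C (map (reflect_axes s t) A) (map (reflect_axes s t) B) (reflect_axes s t u) (reflect_axes s t v)"
    using C_isometry[OF orthogonal_reflect_axes[OF assms(1,2)] assms(5,6), of u 0 v] by simp
  also have "\<dots> = expectation (\<lambda>\<omega>. (prod_list (map ?s A) * prod_list (map ?s B)) * (D A (F \<omega>) (reflect_axes s t u) * D B (F \<omega>) (reflect_axes s t v)))"
    unfolding C_def D[OF assms(3,5)] D[OF assms(4,6)] by (simp add: mult_ac)
  finally show ?thesis by (simp add: C_def)
qed

lemma reflect_axes_fixed_points: "reflect_axes s t 0 = 0" "reflect_axes 1 t (x *\<^sub>R e1) = x *\<^sub>R e1"
  by (simp_all add: reflect_axes_def)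

text \<open>The reflection at the origin multiplies the covariance at a single point by
  \<open>(- 1) ^ (length A + length B)\<close>.\<close>

lemma C_parity:
  assumes "set A \<subseteq> {e1, e2}" "set B \<subseteq> {e1, e2}" "length A \<le> 4" "length B \<le> 4" "odd (length A + length B)"
  shows "C A B u u = 0"
proof -
  have p: "prod_list (map (\<lambda>a. if a = e1 then - 1 else (- 1 :: real)) A) = (- 1) ^ length A" for A
    by (induction A) auto
  have "C A B 0 0 = (- 1) ^ (length A + length B) * C A B 0 0"
    using C_reflection[of "-1" "-1" A B 0 0] assms(1-4) by (simp add: p reflect_axes_fixed_points power_add del: if_cancel)
  then have "C A B 0 0 = 0" using assms(5) by simp
  then show ?thesis using C_diag[OF assms(3,4)] by simp
qed

text \<open>The reflection at the first axis fixes both points and changes the sign of the covariance.\<close>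

lemma C_odd_in_e2:
  assumes "set A \<subseteq> {e1, e2}" "set B \<subseteq> {e1, e2}" "length A \<le> 4" "length B \<le> 4"
    and "odd (count_list A e2 + count_list B e2)"
  shows "C A B (x *\<^sub>R e1) (y *\<^sub>R e1) = 0"
proof -
  have p: "prod_list (map (\<lambda>a. if a = e1 then 1 else (- 1 :: real)) A) = (- 1) ^ count_list A e2" if "set A \<subseteq> {e1, e2}" for A
    using that by (induction A) auto
  have "C A B (x *\<^sub>R e1) (y *\<^sub>R e1) = (- 1) ^ (count_list A e2 + count_list B e2) * C A B (x *\<^sub>R e1) (y *\<^sub>R e1)"
    using C_reflection[of 1 "-1" A B "x *\<^sub>R e1" "y *\<^sub>R e1"] assms(1-4) by (simp add: p reflect_axes_fixed_points power_add)
  then show ?thesis using assms(5) by simp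
qed

abbreviation "var1 \<equiv> C [e1] [e1] 0 0"
abbreviation "var11 \<equiv> C [e1, e1] [e1, e1] 0 0"
abbreviation "var12 \<equiv> C [e1, e2] [e1, e2] 0 0"

lemma D_e2_e1: "D [e2, e1] (F \<omega>) = D [e1, e2] (F \<omega>)"
  unfolding D_Cons D_Nil by (rule dird_commute) (rule Ck_mono[OF _ field_smooth], simp)

lemma quarter_turn: "rot (pi / 2) e1 = e2" "rot (pi / 2) e2 = - e1"
  by (simp_all add: rot_axes)

lemma C_2_2: "C [e2] [e2] 0 0 = var1"
  using C_isometry[OF orthogonal_rot[of "pi / 2"], of "[e1]" "[e1]" 0 0 0] by (simp add: quarter_turn rot_def)

lemma C_22_22: "C [e2, e2] [e2, e2] 0 0 = var11"
  using C_isometry[OF orthogonal_rot[of "pi / 2"], of "[e1, e1]" "[e1, e1]" 0 0 0] by (simp add: quarter_turn rot_def)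

lemma C_11_22: "C [e1, e1] [e2, e2] 0 0 = var12"
proof -
  have "C ([e1] @ [e1]) [e2, e2] 0 0 = - C [e1] ([e2, e2] @ [e1]) 0 0" by (rule C_move) auto
  moreover have "C ([e1] @ [e2]) [e2, e1] 0 0 = - C [e1] ([e2, e1] @ [e2]) 0 0" by (rule C_move) auto
  moreover have "D ([e2, e2] @ [e1]) (F \<omega>) = D ([e2, e1] @ [e2]) (F \<omega>)" for \<omega>
  proof -
    have "Ck 2 (dird e2 (F \<omega>))" using field_Ck[of 2 "[e2]" \<omega>] by (simp add: D_Cons)
    then show ?thesis by (simp add: D_Cons dird_commute[of _ e1 e2])
  qed
  ultimately show ?thesis by (simp add: C_def D_e2_e1)
qed

text \<open>In the frame turned by \<open>45\<close> degrees the mixed derivative is half the difference of the two pure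
  second derivatives. Its variance is \<open>var12\<close> by isotropy and \<open>(var11 - var12) / 2\<close> by expansion.\<close>

lemma var11_eq: "var11 = 3 * var12"
proof -
  let ?t = "pi / 4"
  have D: "D [rot ?t e1, rot ?t e2] (F \<omega>) u = (1 / 2) * (D [e2, e2] (F \<omega>) u - D [e1, e1] (F \<omega>) u)" for \<omega> u
  proof -
    let ?k = "sqrt 2 / 2"
    have f: "Ck 1 (F \<omega>)" by (rule Ck_mono[OF _ field_smooth]) simp
    have g: "dird a (F \<omega>) differentiable (at x)" "Ck 1 (dird a (F \<omega>))" for a x
      using field_D_differentiable[of "[a]" \<omega> x] field_Ck[of 1 "[a]" \<omega>] by (simp_all add: D_Cons)
    have d1: "dird (rot ?t e1) (F \<omega>) = (\<lambda>x. ?k * dird e1 (F \<omega>) x + ?k * dird e2 (F \<omega>) x)"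
      unfolding rot_axes cos_45 sin_45 by (rule dird_linear_combination[OF f])
    have "Ck 1 (\<lambda>x. ?k * dird e1 (F \<omega>) x + ?k * dird e2 (F \<omega>) x)" by (intro Ck_add Ck_scale g)
    then have "D [rot ?t e1, rot ?t e2] (F \<omega>) u = (- ?k) * dird e1 (\<lambda>x. ?k * dird e1 (F \<omega>) x + ?k * dird e2 (F \<omega>) x) u
        + ?k * dird e2 (\<lambda>x. ?k * dird e1 (F \<omega>) x + ?k * dird e2 (F \<omega>) x) u"
      unfolding D_Cons D_Nil d1 unfolding rot_axes cos_45 sin_45 by (simp only: dird_linear_combination)
    also have "\<dots> = (- ?k) * (?k * D [e1, e1] (F \<omega>) u + ?k * D [e2, e1] (F \<omega>) u) + ?k * (?k * D [e1, e2] (F \<omega>) u + ?k * D [e2, e2] (F \<omega>) u)"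
    proof -
      have "dird a (\<lambda>x. ?k * dird e1 (F \<omega>) x + ?k * dird e2 (F \<omega>) x) = (\<lambda>x. ?k * dird a (dird e1 (F \<omega>)) x + ?k * dird a (dird e2 (F \<omega>)) x)" for a
        by (rule dird_combination) (rule g)+
      then show ?thesis by (simp add: D_Cons)
    qed
    also have "\<dots> = (?k * ?k) * (D [e2, e2] (F \<omega>) u - D [e1, e1] (F \<omega>) u)"
      unfolding D_e2_e1 by (simp only: algebra_simps)
    finally show ?thesis by simp
  qed
  let ?X = "\<lambda>\<omega>. D [e1, e1] (F \<omega>) 0" and ?Y = "\<lambda>\<omega>. D [e2, e2] (F \<omega>) 0"
  have XY: "?X \<in> H" "?Y \<in> H" by (auto intro: field_D_in_H)
  have "var12 = C [rot ?t e1, rot ?t e2] [rot ?t e1, rot ?t e2] 0 0"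
    using C_isometry[OF orthogonal_rot[of ?t], of "[e1, e2]" "[e1, e2]" 0 0 0] by (simp add: rot_def)
  also have "\<dots> = expectation (\<lambda>\<omega>. (1/4) * (?Y \<omega> * ?Y \<omega>) - (1/2) * (?X \<omega> * ?Y \<omega>) + (1/4) * (?X \<omega> * ?X \<omega>))"
    unfolding C_def D by (intro Bochner_Integration.integral_cong refl) (simp add: algebra_simps)
  also have "\<dots> = (1/4) * C [e2, e2] [e2, e2] 0 0 - (1/2) * C [e1, e1] [e2, e2] 0 0 + (1/4) * var11"
    unfolding C_def using H_mult_integrable XY by simp
  also have "\<dots> = (1/2) * var11 - (1/2) * var12" unfolding C_22_22 C_11_22 by simp
  finally show ?thesis by simp
qed

lemma C_self_nonneg: "C A A u u \<ge> 0"
  unfolding C_def by simp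

lemma C_zero_AE: "length A \<le> 4 \<Longrightarrow> C A A u u = 0 \<Longrightarrow> AE \<omega> in M. D A (F \<omega>) u = 0"
  using variance_zero_iff[OF field_D_in_H[of A u]] by (simp add: C_def power2_eq_square)

text \<open>Otherwise the gradient vanishes almost surely on a countable dense set, hence everywhere.\<close>

lemma var1_pos: "var1 > 0"
proof (rule ccontr)
  assume "\<not> var1 > 0"
  then have v: "var1 = 0" using C_self_nonneg[of "[e1]" 0] by simp
  obtain Q :: "(real ^ 2) set" where Q: "countable Q" "\<And>X. open X \<Longrightarrow> X \<noteq> {} \<Longrightarrow> \<exists>d\<in>Q. d \<in> X"
    using countable_dense_setE by blast
  have "AE \<omega> in M. \<forall>q\<in>Q. \<forall>a\<in>{e1, e2}. D [a] (F \<omega>) q = 0"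
  proof (intro AE_ball_countable'[OF _ Q(1)] AE_ball_countable')
    fix q a assume "a \<in> {e1, e2}"
    then have "C [a] [a] q q = 0" using C_diag[of "[a]" "[a]" q] v C_2_2 by auto
    then show "AE \<omega> in M. D [a] (F \<omega>) q = 0" by (intro C_zero_AE) auto
  qed auto
  then have "AE \<omega> in M. F \<omega> constant_on UNIV"
  proof eventually_elim
    case (elim \<omega>)
    have z: "D [a] (F \<omega>) x = 0" if a: "a \<in> {e1, e2}" for a x
    proof (rule ccontr)
      assume "D [a] (F \<omega>) x \<noteq> 0"
      moreover have "open {x. D [a] (F \<omega>) x \<noteq> 0}" by (intro open_Collect_neq field_D_continuous continuous_intros) simp
      ultimately obtain q where "q \<in> Q" "D [a] (F \<omega>) q \<noteq> 0" using Q(2)[of "{x. D [a] (F \<omega>) x \<noteq> 0}"] by auto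
      then show False using elim a by blast
    qed
    have "(F \<omega> has_derivative (\<lambda>h. 0)) (at x)" for x
    proof -
      have f: "Ck 1 (F \<omega>)" by (rule Ck_mono[OF _ field_smooth]) simp
      have "dird h (F \<omega>) x = 0" for h
      proof -
        have "h = (h $ 1) *\<^sub>R e1 + (h $ 2) *\<^sub>R e2" by (simp add: vec_eq_iff forall_2)
        then have "dird h (F \<omega>) x = h $ 1 * dird e1 (F \<omega>) x + h $ 2 * dird e2 (F \<omega>) x"
          using dird_linear_combination[OF f, of "h $ 1" e1 "h $ 2" e2] by metis
        then show ?thesis using z[of e1 x] z[of e2 x] by (simp add: D_Cons)
      qed
      then show ?thesis using has_derivative_dird[of "F \<omega>" x] f by simp
    qed
    then obtain c where "\<forall>x\<in>UNIV. F \<omega> x = c"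
      using has_derivative_zero_constant[of UNIV "F \<omega>"] by auto
    then show ?case by (auto simp: constant_on_def)
  qed
  then show False using field_nonconstant by blast
qed

text \<open>Otherwise \<open>D [e1, e1] F = 0\<close> almost surely, and \<open>var1\<close>, which up to sign is the covariance of
  \<open>D [e1, e1] F\<close> with \<open>F\<close>, would vanish.\<close>

lemma var11_pos: "var11 > 0"
proof (rule ccontr)
  assume "\<not> var11 > 0"
  then have "AE \<omega> in M. D [e1, e1] (F \<omega>) 0 = 0" using C_self_nonneg[of "[e1, e1]" 0] by (intro C_zero_AE) auto
  then have "C [e1, e1] [] 0 0 = expectation (\<lambda>\<omega>. 0)"
    unfolding C_def using field_D_in_H[of "[e1, e1]" 0] field_D_in_H[of "[]" 0] H_measurable by (intro integral_cong_AE) auto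
  moreover have "C ([e1] @ [e1]) [] 0 0 = - C [e1] ([] @ [e1]) 0 0" by (rule C_move) auto
  ultimately show False using var1_pos by simp
qed

lemma var12_pos: "var12 > 0"
  using var11_pos var11_eq by simp

end

section \<open>Nondegeneracy of first and third derivatives\<close>

context gaussian_hilbert
begin

lemma variance_linear_combination:
  assumes X: "X \<in> H" and Y: "Y \<in> H"
  shows "expectation (\<lambda>\<omega>. (p * X \<omega> + q * Y \<omega>)\<^sup>2) = p\<^sup>2 * expectation (\<lambda>\<omega>. X \<omega> * X \<omega>) + 2 * p * q * expectation (\<lambda>\<omega>. X \<omega> * Y \<omega>) + q\<^sup>2 * expectation (\<lambda>\<omega>. Y \<omega> * Y \<omega>)"
proof -
  have "(\<lambda>\<omega>. (p * X \<omega> + q * Y \<omega>)\<^sup>2) = (\<lambda>\<omega>. p\<^sup>2 * (X \<omega> * X \<omega>) + 2 * p * q * (X \<omega> * Y \<omega>) + q\<^sup>2 * (Y \<omega> * Y \<omega>))"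
    by (auto simp: power2_eq_square algebra_simps)
  then show ?thesis using H_mult_integrable[OF X X] H_mult_integrable[OF X Y] H_mult_integrable[OF Y Y] by simp
qed

end

context smooth_gaussian_field
begin

lemma variance_D_combination:
  assumes "length A \<le> 4" "length B \<le> 4"
  shows "expectation (\<lambda>\<omega>. (p * D A (F \<omega>) u + q * D B (F \<omega>) v)\<^sup>2) = p\<^sup>2 * C A A u u + 2 * p * q * C A B u v + q\<^sup>2 * C B B v v"
  using variance_linear_combination[OF field_D_in_H[OF assms(1)] field_D_in_H[OF assms(2)]] by (simp add: C_def)

lemma D_combination_zero_AE:
  assumes "length A \<le> 4" "length B \<le> 4" "p\<^sup>2 * C A A u u + 2 * p * q * C A B u v + q\<^sup>2 * C B B v v = 0"
  shows "AE \<omega> in M. p * D A (F \<omega>) u + q * D B (F \<omega>) v = 0"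
proof -
  have "(\<lambda>\<omega>. p * D A (F \<omega>) u + q * D B (F \<omega>) v) \<in> H" by (intro H_add H_scale field_D_in_H assms)
  from variance_zero_iff[OF this] show ?thesis using variance_D_combination[OF assms(1,2), of p u q v] assms(3) by simp
qed

lemma rotation_derivative:
  assumes G: "\<And>x. (G :: real ^ 2 \<Rightarrow> real) differentiable (at x)"
  shows "((\<lambda>\<theta>. G (t *\<^sub>R rot \<theta> e1)) has_field_derivative t * dird e2 G (t *\<^sub>R e1)) (at 0)"
proof -
  have "((\<lambda>\<theta>. t *\<^sub>R rot \<theta> e1) has_derivative (\<lambda>h. t *\<^sub>R (h *\<^sub>R e2))) (at 0)"
    unfolding rot_axes by (auto intro!: derivative_eq_intros)
  from has_derivative_compose[OF this, of G "\<lambda>h. dird h G (t *\<^sub>R rot 0 e1)"]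
  have "((\<lambda>\<theta>. G (t *\<^sub>R rot \<theta> e1)) has_derivative (\<lambda>h. dird (t *\<^sub>R (h *\<^sub>R e2)) G (t *\<^sub>R rot 0 e1))) (at 0)"
    using has_derivative_dird[OF G] by simp
  moreover have "dird (t *\<^sub>R (h *\<^sub>R e2)) G (t *\<^sub>R rot 0 e1) = (t * dird e2 G (t *\<^sub>R e1)) * h" for h
    using dird_scale_dir[OF G, of "t * h" e2] by (simp add: rot_axes)
  ultimately show ?thesis by (simp add: has_field_derivative_def)
qed

text \<open>The degeneracy is a statement about variances, so isotropy transports it to every direction
  \<open>\<theta>\<close>.\<close>

lemma vanishing_rotated_pair:
  assumes e: "e \<in> {e1, e2}" and \<tau>: "\<tau>\<^sup>2 = 1" and z: "var1 + \<tau> * C [e] [e] (t *\<^sub>R e1) 0 = 0"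
  shows "AE \<omega> in M. D [rot \<theta> e] (F \<omega>) (t *\<^sub>R rot \<theta> e1) + \<tau> * D [rot \<theta> e] (F \<omega>) 0 = 0"
proof -
  have R: "rot \<theta> (t *\<^sub>R e1) = t *\<^sub>R rot \<theta> e1" "rot \<theta> 0 = 0"
    using orthogonal_rot[of \<theta>] by (auto simp: orthogonal_transformation linear_scale linear_0)
  have ee: "C [e] [e] 0 0 = var1" using e C_2_2 by auto
  have 1: "C [rot \<theta> e] [rot \<theta> e] u u = var1" for u
    using C_isometry[OF orthogonal_rot[of \<theta>], of "[e]" "[e]" 0 0 0] C_diag[of "[rot \<theta> e]" "[rot \<theta> e]" u] by (simp add: R ee)
  have 2: "C [rot \<theta> e] [rot \<theta> e] (t *\<^sub>R rot \<theta> e1) 0 = C [e] [e] (t *\<^sub>R e1) 0"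
    using C_isometry[OF orthogonal_rot[of \<theta>], of "[e]" "[e]" "t *\<^sub>R e1" 0 0] by (simp add: R)
  have "AE \<omega> in M. 1 * D [rot \<theta> e] (F \<omega>) (t *\<^sub>R rot \<theta> e1) + \<tau> * D [rot \<theta> e] (F \<omega>) 0 = 0"
    by (rule D_combination_zero_AE) (use z \<tau> in \<open>simp_all add: 1 2\<close>)
  then show ?thesis by simp
qed

lemma rotated_pair_derivative_vanishes:
  assumes e: "e \<in> {e1, e2}" and \<tau>: "\<tau>\<^sup>2 = 1" and z: "var1 + \<tau> * C [e] [e] (t *\<^sub>R e1) 0 = 0"
    and der: "\<And>\<omega>. ((\<lambda>\<theta>. D [rot \<theta> e] (F \<omega>) (t *\<^sub>R rot \<theta> e1) + \<tau> * D [rot \<theta> e] (F \<omega>) 0) has_field_derivative Z \<omega>) (at 0)"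
  shows "AE \<omega> in M. Z \<omega> = 0"
proof -
  let ?h = "\<lambda>\<omega> \<theta>. D [rot \<theta> e] (F \<omega>) (t *\<^sub>R rot \<theta> e1) + \<tau> * D [rot \<theta> e] (F \<omega>) 0"
  let ?r = "\<lambda>m. inverse (real (Suc m))"
  have "AE \<omega> in M. ?h \<omega> 0 = 0" "AE \<omega> in M. \<forall>m. ?h \<omega> (?r m) = 0"
    unfolding AE_all_countable by (intro allI vanishing_rotated_pair[OF e \<tau> z])+
  then show ?thesis
  proof eventually_elim
    case (elim \<omega>)
    have "((\<lambda>x. (?h \<omega> (0 + x) - ?h \<omega> 0) / x) \<longlongrightarrow> Z \<omega>) (at 0)" using der[of \<omega>] by (simp only: DERIV_def)
    moreover have "filterlim ?r (at 0) sequentially"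
      using LIMSEQ_inverse_real_of_nat by (simp add: filterlim_at del: of_nat_Suc)
    ultimately have "(\<lambda>m. (?h \<omega> (0 + ?r m) - ?h \<omega> 0) / ?r m) \<longlonglongrightarrow> Z \<omega>" by (rule filterlim_compose)
    moreover have "(?h \<omega> (0 + ?r m) - ?h \<omega> 0) / ?r m = 0" for m
      using elim(1) elim(2)[rule_format, of m] by simp
    ultimately show "Z \<omega> = 0" by (simp add: LIMSEQ_const_iff)
  qed
qed

text \<open>The partial derivatives at two different points are never perfectly correlated. If they were,
  \<open>D [e] F (t *\<^sub>R e1) + \<tau> * D [e] F 0\<close> would vanish almost surely for a sign \<open>\<tau>\<close>, together with all its
  rotated versions. Differentiating in the angle expresses a partial derivative at \<open>0\<close>, up to signs, as a
  partial derivative at \<open>t *\<^sub>R e1\<close> plus \<open>t\<close> times a second derivative there. The last two are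
  uncorrelated, both first derivatives have variance \<open>var1\<close>, and the second derivative has positive
  variance: a contradiction.\<close>

lemma C_gradient_pair_less:
  assumes t: "t \<noteq> 0" and e: "e \<in> {e1, e2}"
  shows "\<bar>C [e] [e] (t *\<^sub>R e1) 0\<bar> < var1"
proof (rule ccontr)
  assume c: "\<not> \<bar>C [e] [e] (t *\<^sub>R e1) 0\<bar> < var1"
  let ?c = "C [e] [e] (t *\<^sub>R e1) 0"
  have ee: "C [e] [e] u u = var1" for u using e C_2_2 C_diag[of "[e]" "[e]" u] by auto
  \<comment> \<open>the sign for which the variance of the combination would be \<open>2 * (var1 - \<bar>?c\<bar>)\<close>\<close>
  define \<tau> :: real where "\<tau> = (if ?c \<le> 0 then 1 else - 1)"
  have \<tau>: "\<tau>\<^sup>2 = 1" by (simp add: \<tau>_def)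
  have "0 \<le> expectation (\<lambda>\<omega>. (1 * D [e] (F \<omega>) (t *\<^sub>R e1) + \<tau> * D [e] (F \<omega>) 0)\<^sup>2)" by simp
  also have "\<dots> = 2 * (var1 + \<tau> * ?c)"
    by (subst variance_D_combination) (use \<tau> in \<open>simp_all add: ee\<close>)
  finally have "var1 + \<tau> * ?c \<ge> 0" by simp
  moreover have "var1 + \<tau> * ?c \<le> 0" using c by (auto simp: \<tau>_def)
  ultimately have z: "var1 + \<tau> * ?c = 0" by linarith
  let ?v = "t *\<^sub>R e1"
  have f: "Ck 1 (F \<omega>)" for \<omega> by (rule Ck_mono[OF _ field_smooth]) simp
  have g: "D [a] (F \<omega>) differentiable (at x)" for a x \<omega> by (rule field_D_differentiable) simp
  have D1: "D [rot \<theta> e1] (F \<omega>) x = cos \<theta> * D [e1] (F \<omega>) x + sin \<theta> * D [e2] (F \<omega>) x" for \<theta> \<omega> x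
    unfolding D_Cons D_Nil rot_axes by (simp only: dird_linear_combination[OF f])
  have D2: "D [rot \<theta> e2] (F \<omega>) x = (- sin \<theta>) * D [e1] (F \<omega>) x + cos \<theta> * D [e2] (F \<omega>) x" for \<theta> \<omega> x
    unfolding D_Cons D_Nil rot_axes by (simp only: dird_linear_combination[OF f])
  have dd: "dird b (D [a] (F \<omega>)) = D [a, b] (F \<omega>)" for a b \<omega> using D_snoc[of "[a]" b] by simp
  have r0: "t *\<^sub>R rot 0 e1 = ?v" by (simp add: rot_axes)
  note rd = rotation_derivative[where t = t, OF g, unfolded dd]
  show False
  proof (cases "e = e1")
    case True
    have der: "((\<lambda>\<theta>. D [rot \<theta> e] (F \<omega>) (t *\<^sub>R rot \<theta> e1) + \<tau> * D [rot \<theta> e] (F \<omega>) 0) has_field_derivative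
        (t * D [e1, e2] (F \<omega>) ?v + D [e2] (F \<omega>) ?v + \<tau> * D [e2] (F \<omega>) 0)) (at 0)" for \<omega>
      unfolding True D1 by (rule derivative_eq_intros rd refl)+ (simp add: r0)
    have "AE \<omega> in M. t * D [e1, e2] (F \<omega>) ?v + D [e2] (F \<omega>) ?v + \<tau> * D [e2] (F \<omega>) 0 = 0"
      by (rule rotated_pair_derivative_vanishes[OF e \<tau> z der])
    then have ae: "AE \<omega> in M. (t * D [e1, e2] (F \<omega>) ?v + 1 * D [e2] (F \<omega>) ?v)\<^sup>2 = (D [e2] (F \<omega>) 0)\<^sup>2"
    proof eventually_elim
      case (elim \<omega>)
      then have "t * D [e1, e2] (F \<omega>) ?v + 1 * D [e2] (F \<omega>) ?v = - \<tau> * D [e2] (F \<omega>) 0" by simp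
      then show ?case using \<tau> by (simp add: power_mult_distrib)
    qed
    have m: "(\<lambda>\<omega>. D A (F \<omega>) u) \<in> borel_measurable M" if "length A \<le> 4" for A u by (rule H_measurable[OF field_D_in_H[OF that]])
    have "expectation (\<lambda>\<omega>. (t * D [e1, e2] (F \<omega>) ?v + 1 * D [e2] (F \<omega>) ?v)\<^sup>2) = expectation (\<lambda>\<omega>. (D [e2] (F \<omega>) 0)\<^sup>2)"
      using m[of "[e1,e2]"] m[of "[e2]"] by (intro integral_cong_AE ae) simp_all
    also have "\<dots> = var1" using C_2_2 by (simp add: C_def power2_eq_square)
    finally have "t\<^sup>2 * C [e1, e2] [e1, e2] ?v ?v + 2 * t * 1 * C [e1, e2] [e2] ?v ?v + 1\<^sup>2 * C [e2] [e2] ?v ?v = var1"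
      by (subst (asm) variance_D_combination) simp_all
    moreover have "C [e1, e2] [e2] ?v ?v = 0" by (rule C_parity) auto
    moreover have "C [e1, e2] [e1, e2] ?v ?v = var12" "C [e2] [e2] ?v ?v = var1"
      using C_diag[of "[e1, e2]" "[e1, e2]" ?v] C_diag[of "[e2]" "[e2]" ?v] C_2_2 by simp_all
    ultimately show False using t var12_pos by simp
  next
    case False
    then have e2: "e = e2" using e by simp
    have der: "((\<lambda>\<theta>. D [rot \<theta> e] (F \<omega>) (t *\<^sub>R rot \<theta> e1) + \<tau> * D [rot \<theta> e] (F \<omega>) 0) has_field_derivative
        (t * D [e2, e2] (F \<omega>) ?v - D [e1] (F \<omega>) ?v - \<tau> * D [e1] (F \<omega>) 0)) (at 0)" for \<omega>
      unfolding e2 D2 by (rule derivative_eq_intros rd refl)+ (simp add: r0)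
    have "AE \<omega> in M. t * D [e2, e2] (F \<omega>) ?v - D [e1] (F \<omega>) ?v - \<tau> * D [e1] (F \<omega>) 0 = 0"
      by (rule rotated_pair_derivative_vanishes[OF e \<tau> z der])
    then have ae: "AE \<omega> in M. (t * D [e2, e2] (F \<omega>) ?v + (-1) * D [e1] (F \<omega>) ?v)\<^sup>2 = (D [e1] (F \<omega>) 0)\<^sup>2"
    proof eventually_elim
      case (elim \<omega>)
      then have "t * D [e2, e2] (F \<omega>) ?v + (-1) * D [e1] (F \<omega>) ?v = \<tau> * D [e1] (F \<omega>) 0" by simp
      then show ?case using \<tau> by (simp add: power_mult_distrib)
    qed
    have m: "(\<lambda>\<omega>. D A (F \<omega>) u) \<in> borel_measurable M" if "length A \<le> 4" for A u by (rule H_measurable[OF field_D_in_H[OF that]])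
    have "expectation (\<lambda>\<omega>. (t * D [e2, e2] (F \<omega>) ?v + (-1) * D [e1] (F \<omega>) ?v)\<^sup>2) = expectation (\<lambda>\<omega>. (D [e1] (F \<omega>) 0)\<^sup>2)"
      using m[of "[e2,e2]"] m[of "[e1]"] by (intro integral_cong_AE ae) simp_all
    also have "\<dots> = var1" by (simp add: C_def power2_eq_square)
    finally have "t\<^sup>2 * C [e2, e2] [e2, e2] ?v ?v + 2 * t * (-1) * C [e2, e2] [e1] ?v ?v + (-1)\<^sup>2 * C [e1] [e1] ?v ?v = var1"
      by (subst (asm) variance_D_combination) simp_all
    moreover have "C [e2, e2] [e1] ?v ?v = 0" by (rule C_parity) auto
    moreover have "C [e2, e2] [e2, e2] ?v ?v = var11" "C [e1] [e1] ?v ?v = var1"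
      using C_diag[of "[e2, e2]" "[e2, e2]" ?v] C_diag[of "[e1]" "[e1]" ?v] C_22_22 by simp_all
    ultimately show False using t var11_pos by simp
  qed
qed

lemma C_has_real_derivative:
  assumes "length A < 4" "length B \<le> 4"
  shows "((\<lambda>t. C A B (t *\<^sub>R a) v) has_field_derivative C (A @ [a]) B (t *\<^sub>R a) v) (at t)"
  unfolding DERIV_def tendsto_at_iff_sequentially o_def
proof (intro allI impI)
  fix r :: "nat \<Rightarrow> real" assume r: "\<forall>i. r i \<in> UNIV - {0}" "r \<longlonglongrightarrow> 0"
  show "(\<lambda>i. (C A B ((t + r i) *\<^sub>R a) v - C A B (t *\<^sub>R a) v) / r i) \<longlonglongrightarrow> C (A @ [a]) B (t *\<^sub>R a) v"
    using C_derivative_left[OF assms r(2), of "t *\<^sub>R a" a v] r(1) by (simp add: scaleR_add_left)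
qed

abbreviation "var111 \<equiv> C [e1, e1, e1] [e1, e1, e1] 0 0"

lemma C_111_1: "C [e1, e1, e1] [e1] u u = - var11"
proof -
  have "C ([e1, e1] @ [e1]) [e1] 0 0 = - C [e1, e1] ([e1] @ [e1]) 0 0" by (rule C_move) auto
  then show ?thesis using C_diag[of "[e1, e1, e1]" "[e1]" u] by simp
qed

text \<open>Strict Cauchy-Schwarz inequality for \<open>D [e1, e1, e1] F\<close> and \<open>D [e1] F\<close>, whose covariance at a point
  is \<open>- var11\<close>. In the case of equality the third derivative is almost surely a multiple of the first,
  at every point. The covariance \<open>P t\<close> of \<open>D [e1] F (t *\<^sub>R e1)\<close> and \<open>D [e1] F 0\<close> would then solve
  \<open>P'' = - k\<^sup>2 * P\<close>, so it would be \<open>var1 * cos (k * t)\<close>, and at \<open>t = pi / k\<close> there would be perfect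
  correlation, which \<open>C_gradient_pair_less\<close> excludes.\<close>

lemma third_derivative_nondegenerate: "var11\<^sup>2 < var111 * var1"
proof (rule ccontr)
  assume "\<not> var11\<^sup>2 < var111 * var1"
  then have le: "var111 * var1 \<le> var11\<^sup>2" by simp
  define \<alpha> where "\<alpha> = - var11 / var1"
  have "var1 \<noteq> 0" using var1_pos by simp
  have "(C [e1, e1, e1] [e1] 0 0)\<^sup>2 \<le> var111 * var1"
    using covariance_Cauchy_Schwarz[OF field_D_in_H[of "[e1, e1, e1]" 0] field_D_in_H[of "[e1]" 0]] by (simp add: C_def power2_eq_square)
  then have eq: "var111 * var1 = var11\<^sup>2" using le C_111_1 by simp
  have v: "1\<^sup>2 * C [e1, e1, e1] [e1, e1, e1] u u + 2 * 1 * (- \<alpha>) * C [e1, e1, e1] [e1] u u + (- \<alpha>)\<^sup>2 * C [e1] [e1] u u = 0" for u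
  proof -
    have "C [e1, e1, e1] [e1, e1, e1] u u = var111" "C [e1] [e1] u u = var1"
      by (rule C_diag; simp)+
    moreover have "var111 = var11\<^sup>2 / var1" using eq \<open>var1 \<noteq> 0\<close> by (simp add: field_simps)
    ultimately show ?thesis using \<open>var1 \<noteq> 0\<close> unfolding C_111_1 \<alpha>_def by (simp add: field_simps power2_eq_square)
  qed
  have ae: "AE \<omega> in M. 1 * D [e1, e1, e1] (F \<omega>) u + (- \<alpha>) * D [e1] (F \<omega>) u = 0" for u
    by (rule D_combination_zero_AE[OF _ _ v]) simp_all
  define P where "P t = C [e1] [e1] (t *\<^sub>R e1) 0" for t
  define P' where "P' t = C [e1, e1] [e1] (t *\<^sub>R e1) 0" for t
  have m: "(\<lambda>\<omega>. D A (F \<omega>) u) \<in> borel_measurable M" if "length A \<le> 4" for A u by (rule H_measurable[OF field_D_in_H[OF that]])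
  have ode: "C [e1, e1, e1] [e1] u 0 = \<alpha> * C [e1] [e1] u 0" for u
  proof -
    have "C [e1, e1, e1] [e1] u 0 = expectation (\<lambda>\<omega>. \<alpha> * (D [e1] (F \<omega>) u * D [e1] (F \<omega>) 0))"
      unfolding C_def
    proof (rule integral_cong_AE)
      show "AE \<omega> in M. D [e1, e1, e1] (F \<omega>) u * D [e1] (F \<omega>) 0 = \<alpha> * (D [e1] (F \<omega>) u * D [e1] (F \<omega>) 0)"
        using ae[of u] by eventually_elim simp
    qed (use m[of "[e1, e1, e1]"] m[of "[e1]"] in simp_all)
    then show ?thesis by (simp add: C_def)
  qed
  have dP: "(P has_field_derivative P' t) (at t)" for t
    using C_has_real_derivative[of "[e1]" "[e1]" e1 0 t] by (simp add: P_def[abs_def] P'_def)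
  have dP': "(P' has_field_derivative \<alpha> * P t) (at t)" for t
    using C_has_real_derivative[of "[e1, e1]" "[e1]" e1 0 t] by (simp add: P_def P'_def[abs_def] ode)
  have P0: "P 0 = var1" by (simp add: P_def)
  have P'0: "P' 0 = 0" unfolding P'_def scaleR_zero_left by (rule C_parity) auto
  \<comment> \<open>uniqueness for the oscillator equation, by conservation of the energy of \<open>Q\<close>\<close>
  define k where "k = sqrt (- \<alpha>)"
  have "- \<alpha> > 0" using var11_pos var1_pos by (simp add: \<alpha>_def)
  then have k: "k > 0" "k * k = - \<alpha>" by (simp_all add: k_def)
  then have al: "\<alpha> = - (k * k)" by simp
  define Q where "Q t = P t - var1 * cos (k * t)" for t
  define Q' where "Q' t = P' t + var1 * k * sin (k * t)" for t
  have dQ: "(Q has_field_derivative Q' t) (at t)" for t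
    unfolding Q_def[abs_def] Q'_def by (rule derivative_eq_intros dP refl)+ simp
  have dQ': "(Q' has_field_derivative - (k * k) * Q t) (at t)" for t
    unfolding Q_def Q'_def[abs_def] by (rule derivative_eq_intros dP' refl)+ (simp add: al algebra_simps)
  have "((\<lambda>t. (Q' t)\<^sup>2 + (k * k) * (Q t)\<^sup>2) has_field_derivative 0) (at t)" for t
    by (rule derivative_eq_intros dQ dQ' refl)+ (simp add: algebra_simps)
  then have "(Q' t)\<^sup>2 + (k * k) * (Q t)\<^sup>2 = (Q' 0)\<^sup>2 + (k * k) * (Q 0)\<^sup>2" for t
    using DERIV_isconst_all[of "\<lambda>t. (Q' t)\<^sup>2 + (k * k) * (Q t)\<^sup>2" t 0] by blast
  then have "(Q' t)\<^sup>2 + (k * k) * (Q t)\<^sup>2 = 0" for t by (simp add: Q_def Q'_def P0 P'0)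
  then have "(k * k) * (Q t)\<^sup>2 \<le> 0" for t by (metis add_le_cancel_left add.right_neutral le_add_same_cancel2 zero_le_power2 add.commute)
  then have "Q t = 0" for t using k(1) by (metis mult_pos_pos not_le zero_less_power2)
  from this[of "pi / k"] have "P (pi / k) = - var1" using k(1) by (simp add: Q_def)
  then have "\<bar>C [e1] [e1] ((pi / k) *\<^sub>R e1) 0\<bar> = var1" using var1_pos by (simp add: P_def)
  with C_gradient_pair_less[of "pi / k" e1] k(1) show False by simp
qed

end

section \<open>Pairs of critical points as zeros of one field\<close>

text \<open>A vector in \<open>real ^ 4\<close> is read as a pair of points of the plane; the area formula needs a single
  Cartesian space.\<close>

definition fst4 :: "real ^ 4 \<Rightarrow> real ^ 2" where "fst4 w = (w $ 1) *\<^sub>R e1 + (w $ 2) *\<^sub>R e2"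
definition snd4 :: "real ^ 4 \<Rightarrow> real ^ 2" where "snd4 w = (w $ 3) *\<^sub>R e1 + (w $ 4) *\<^sub>R e2"
definition join4 :: "real ^ 2 \<Rightarrow> real ^ 2 \<Rightarrow> real ^ 4" where
  "join4 u v = (\<chi> i. if i = 1 then u $ 1 else if i = 2 then u $ 2 else if i = 3 then v $ 1 else v $ 2)"

lemma distinct_4[simp]: "(1::4) \<noteq> 2" "(1::4) \<noteq> 3" "(1::4) \<noteq> 4" "(2::4) \<noteq> 1" "(2::4) \<noteq> 3" "(2::4) \<noteq> 4"
  "(3::4) \<noteq> 1" "(3::4) \<noteq> 2" "(3::4) \<noteq> 4" "(4::4) \<noteq> 1" "(4::4) \<noteq> 2" "(4::4) \<noteq> 3"
  by simp_all

lemma join4_nth[simp]: "join4 u v $ 1 = u $ 1" "join4 u v $ 2 = u $ 2" "join4 u v $ 3 = v $ 1" "join4 u v $ 4 = v $ 2"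
  by (simp_all add: join4_def)

lemma vec2_expand: "x = (x $ 1) *\<^sub>R e1 + (x $ 2) *\<^sub>R e2"
  by (simp add: vec_eq_iff forall_2)

lemma fst4_join4[simp]: "fst4 (join4 u v) = u" and snd4_join4[simp]: "snd4 (join4 u v) = v"
  and join4_fst4_snd4[simp]: "join4 (fst4 w) (snd4 w) = w"
  by (auto simp: fst4_def snd4_def vec_eq_iff forall_2 forall_4)

lemma fst4_nth[simp]: "fst4 w $ 1 = w $ 1" "fst4 w $ 2 = w $ 2" and snd4_nth[simp]: "snd4 w $ 1 = w $ 3" "snd4 w $ 2 = w $ 4"
  by (auto simp: fst4_def snd4_def)

lemma linear_fst4: "linear fst4" and linear_snd4: "linear snd4"
  by (auto intro!: linearI simp: fst4_def snd4_def algebra_simps)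

lemma fst4_continuous: "continuous_on S fst4" and snd4_continuous: "continuous_on S snd4"
  using linear_fst4 linear_snd4 by (auto intro: linear_continuous_on linear_linear[THEN iffD1] simp: linear_conv_bounded_linear)

lemma norm_join4: "(norm w)\<^sup>2 = (norm (fst4 w))\<^sup>2 + (norm (snd4 w))\<^sup>2"
  unfolding power2_norm_eq_inner by (simp add: inner_vec_def sum_2 sum_4)

lemma prod_4: "prod f (UNIV :: 4 set) = f 1 * f 2 * f 3 * f 4"
  unfolding UNIV_4 by (simp add: mult.assoc)

lemma prod_Basis_vec: "(\<Prod>b\<in>Basis. (x :: real ^ 'n) \<bullet> b) = (\<Prod>i\<in>UNIV. x $ i)"
proof -
  have B: "(Basis :: (real ^ 'n) set) = (\<lambda>k. axis k 1) ` UNIV" by (auto simp: Basis_vec_def)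
  have inj: "inj (\<lambda>k::'n. axis k (1::real))" by (auto simp: inj_on_def axis_eq_axis)
  show ?thesis unfolding B by (simp add: prod.reindex[OF inj] inner_axis)
qed

lemma emeasure_lborel_box_vec:
  fixes l u :: "real ^ 'n"
  assumes "\<And>i. l $ i \<le> u $ i"
  shows "emeasure lborel (box l u) = ennreal (\<Prod>i\<in>UNIV. u $ i - l $ i)"
proof -
  have "l \<bullet> b \<le> u \<bullet> b" if "b \<in> Basis" for b using that assms by (auto simp: Basis_vec_def inner_axis)
  then show ?thesis by (subst emeasure_lborel_box) (simp_all add: prod_Basis_vec)
qed

lemma emeasure_lborel_join4:
  assumes A: "A \<in> sets borel" and B: "B \<in> sets borel"
  shows "emeasure lborel {w. fst4 w \<in> A \<and> snd4 w \<in> B} = emeasure lborel A * emeasure lborel B"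
proof -
  let ?P = "lborel \<Otimes>\<^sub>M lborel :: ((real ^ 2) \<times> (real ^ 2)) measure"
  let ?j = "\<lambda>p. join4 (fst p) (snd p)"
  have jm: "?j \<in> measurable ?P borel"
  proof -
    have "continuous_on UNIV ?j"
      unfolding join4_def
    proof (intro continuous_on_vec_lambda)
      fix i :: 4
      show "continuous_on UNIV (\<lambda>p. if i = 1 then fst p $ 1 else if i = 2 then fst p $ 2 else if i = 3 then snd p $ 1 else snd p $ (2::2) :: real)"
        by (cases "i = 1"; cases "i = 2"; cases "i = 3") (auto intro!: continuous_intros)
    qed
    then show ?thesis unfolding lborel_prod by (simp add: borel_measurable_continuous_onI)
  qed
  have "lborel = distr ?P borel ?j"
  proof (rule lborel_eqI)
    fix l u :: "real ^ 4" assume lu: "\<And>b. b \<in> Basis \<Longrightarrow> l \<bullet> b \<le> u \<bullet> b"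
    have le: "l $ i \<le> u $ i" for i using lu[of "axis i 1"] by (simp add: inner_axis axis_in_Basis_iff)
    have le': "fst4 l $ i \<le> fst4 u $ i" "snd4 l $ i \<le> snd4 u $ i" for i
      using exhaust_2[of i] le by auto
    have "?j -` box l u \<inter> space ?P = box (fst4 l) (fst4 u) \<times> box (snd4 l) (snd4 u)"
      by (auto simp: mem_box_cart forall_2 forall_4 space_pair_measure)
    then have "emeasure (distr ?P borel ?j) (box l u) = emeasure lborel (box (fst4 l) (fst4 u)) * emeasure lborel (box (snd4 l) (snd4 u))"
      using jm by (simp add: emeasure_distr lborel.emeasure_pair_measure_Times)
    also have "\<dots> = ennreal (\<Prod>i\<in>UNIV. u $ i - l $ i)"
    proof -
      have f: "emeasure lborel (box (fst4 l) (fst4 u)) = ennreal ((u $ 1 - l $ 1) * (u $ 2 - l $ 2))"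
        using emeasure_lborel_box_vec[OF le'(1)] by (simp add: UNIV_2)
      have g: "emeasure lborel (box (snd4 l) (snd4 u)) = ennreal ((u $ 3 - l $ 3) * (u $ 4 - l $ 4))"
        using emeasure_lborel_box_vec[OF le'(2)] by (simp add: UNIV_2)
      have "(\<Prod>i\<in>UNIV. u $ i - l $ i) = ((u $ 1 - l $ 1) * (u $ 2 - l $ 2)) * ((u $ 3 - l $ 3) * (u $ 4 - l $ 4))"
        by (simp only: prod_4 mult.assoc)
      then show ?thesis unfolding f g using le by (simp only: ennreal_mult mult_nonneg_nonneg diff_ge_0_iff_ge)
    qed
    also have "(\<Prod>i\<in>UNIV. u $ i - l $ i) = (\<Prod>b\<in>Basis. (u - l) \<bullet> b)"
      unfolding prod_Basis_vec by simp
    finally show "emeasure (distr ?P borel ?j) (box l u) = (\<Prod>b\<in>Basis. (u - l) \<bullet> b)" .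
  qed simp
  moreover have "{w. fst4 w \<in> A \<and> snd4 w \<in> B} \<in> sets borel"
  proof -
    have "fst4 \<in> borel_measurable borel" "snd4 \<in> borel_measurable borel"
      by (intro borel_measurable_continuous_onI fst4_continuous snd4_continuous)+
    then have "fst4 -` A \<inter> space borel \<in> sets borel" "snd4 -` B \<inter> space borel \<in> sets borel"
      using A B by (blast intro: measurable_sets)+
    then have "fst4 -` A \<inter> snd4 -` B \<in> sets borel" by (auto intro: sets.Int)
    then show ?thesis by (simp add: vimage_def Int_def)
  qed
  moreover have "?j -` {w. fst4 w \<in> A \<and> snd4 w \<in> B} \<inter> space ?P = A \<times> B"
    by (auto simp: space_pair_measure)
  ultimately have "emeasure lborel {w. fst4 w \<in> A \<and> snd4 w \<in> B} = emeasure ?P (A \<times> B)"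
    using emeasure_distr[OF jm, of "{w. fst4 w \<in> A \<and> snd4 w \<in> B}"] by simp
  then show ?thesis using A B by (simp add: lborel.emeasure_pair_measure_Times)
qed

lemma emeasure_count_space_Times:
  "emeasure (count_space UNIV) (A \<times> B) = emeasure (count_space UNIV) A * emeasure (count_space UNIV) B"
proof (cases "finite A \<and> finite B")
  case True
  then show ?thesis by (simp add: emeasure_count_space_finite card_cartesian_product ennreal_mult' flip: ennreal_of_nat_eq_real_of_nat)
next
  case False
  show ?thesis
  proof (cases "A = {} \<or> B = {}")
    case True then show ?thesis by auto
  next
    case ne: False
    then have "infinite (A \<times> B)" using False by (auto simp: finite_cartesian_product_iff)
    moreover have "emeasure (count_space UNIV) A \<noteq> 0" "emeasure (count_space UNIV) B \<noteq> 0" using ne by (auto simp: emeasure_count_space_eq_0)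
    ultimately show ?thesis using False by (auto simp: ennreal_mult_top ennreal_top_mult)
  qed
qed

lemma emeasure_count_space_image:
  "inj_on f A \<Longrightarrow> emeasure (count_space UNIV) (f ` A) = emeasure (count_space UNIV) A"
  by (cases "finite A") (auto simp: emeasure_count_space_finite card_image emeasure_count_space_infinite finite_image_iff)

lemma mem_critical_points_iff:
  assumes f: "f differentiable (at x)"
  shows "x \<in> critical_points f \<longleftrightarrow> dird (rot \<theta> e1) f x = 0 \<and> dird (rot \<theta> e2) f x = 0"
proof -
  have "x \<in> critical_points f \<longleftrightarrow> (f has_derivative (\<lambda>h. 0)) (at x)"
    by (simp add: critical_points_def gderiv_def)
  also have "\<dots> \<longleftrightarrow> (\<forall>h. dird h f x = 0)"
  proof
    assume "(f has_derivative (\<lambda>h. 0)) (at x)"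
    then show "\<forall>h. dird h f x = 0" using dird_eqI by blast
  next
    assume "\<forall>h. dird h f x = 0"
    then show "(f has_derivative (\<lambda>h. 0)) (at x)" using has_derivative_dird[OF f] by simp
  qed
  also have "\<dots> \<longleftrightarrow> dird (rot \<theta> e1) f x = 0 \<and> dird (rot \<theta> e2) f x = 0"
  proof (intro iffI allI; (elim conjE)?)
    fix h
    assume z: "dird (rot \<theta> e1) f x = 0" "dird (rot \<theta> e2) f x = 0"
    have "surj (rot \<theta>)" using orthogonal_transformation_surj[OF orthogonal_rot] by blast
    then obtain k where "h = rot \<theta> k" by (metis surjD)
    also have "rot \<theta> k = (k $ 1) *\<^sub>R rot \<theta> e1 + (k $ 2) *\<^sub>R rot \<theta> e2" by (simp add: rot_def)
    finally show "dird h f x = 0" using z by (simp add: dird_add_dir[OF f] dird_scale_dir[OF f])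
  qed auto
  finally show ?thesis .
qed

lemma rotation_to_direction:
  assumes "norm v = r" obtains \<theta> where "v = r *\<^sub>R rot \<theta> e1"
proof (cases "r = 0")
  case True then show ?thesis using assms that[of 0] by simp
next
  case False
  have "(v $ 1)\<^sup>2 + (v $ 2)\<^sup>2 = r\<^sup>2"
    using assms power2_norm_eq_inner[of v] by (simp add: inner_vec_def sum_2 power2_eq_square)
  then have "(v $ 1 / r)\<^sup>2 + (v $ 2 / r)\<^sup>2 = 1" using False by (simp add: power_divide add_divide_distrib[symmetric])
  then obtain t where "v $ 1 / r = cos t" "v $ 2 / r = sin t" using sincos_total_2pi by metis
  then have "v = r *\<^sub>R rot t e1" using False by (simp add: rot_axes vec_eq_iff forall_2 field_simps)
  then show ?thesis by (rule that)
qed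

lemma tendsto_ennreal_if_eventually_close:
  assumes "\<And>e. e > 0 \<Longrightarrow> \<forall>\<^sub>F x in G. ennreal (K - e) \<le> f x \<and> f x \<le> ennreal (K + e)"
  shows "(f \<longlongrightarrow> ennreal K) G"
proof (rule order_tendstoI)
  fix a assume a: "a < ennreal K"
  have "((\<lambda>e. ennreal (K - e)) \<longlongrightarrow> ennreal (K - 0)) (at_right 0)" by (intro tendsto_intros)
  then have "\<forall>\<^sub>F e in at_right 0. a < ennreal (K - e)" using a by (auto dest: order_tendstoD)
  then have "\<forall>\<^sub>F e in at_right 0. a < ennreal (K - e) \<and> e > 0" using eventually_at_right_less[of "0::real"] by eventually_elim simp
  then obtain e where e: "a < ennreal (K - e)" "e > 0" using eventually_happens by force
  show "\<forall>\<^sub>F x in G. a < f x" using assms[OF e(2)] by eventually_elim (use e in \<open>auto intro: less_le_trans\<close>)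
next
  fix a assume a: "ennreal K < a"
  have "((\<lambda>e. ennreal (K + e)) \<longlongrightarrow> ennreal (K + 0)) (at_right 0)" by (intro tendsto_intros)
  then have "\<forall>\<^sub>F e in at_right 0. ennreal (K + e) < a" using a by (auto dest: order_tendstoD)
  then have "\<forall>\<^sub>F e in at_right 0. ennreal (K + e) < a \<and> e > 0" using eventually_at_right_less[of "0::real"] by eventually_elim simp
  then obtain e where e: "ennreal (K + e) < a" "e > 0" using eventually_happens by force
  show "\<forall>\<^sub>F x in G. f x < a" using assms[OF e(2)] by eventually_elim (use e in \<open>auto intro: le_less_trans\<close>)
qed

text \<open>The four equations for a pair of critical points are arranged as two sums (\<open>k = 1, 2\<close>) and two
  differences (\<open>k = 3, 4\<close>) of the partial derivatives at the two points. By symmetry these are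
  uncorrelated, while the separate equations become linearly dependent as the points merge.\<close>

definition dir4 :: "4 \<Rightarrow> real ^ 2" where "dir4 k = (if k = 1 \<or> k = 3 then e1 else e2)"
definition sgn4 :: "4 \<Rightarrow> real" where "sgn4 k = (if k = 1 \<or> k = 2 then 1 else - 1)"
definition pair_base :: "real \<Rightarrow> real ^ 4" where "pair_base s = join4 ((- s) *\<^sub>R e1) (s *\<^sub>R e1)"
definition pair_window :: "real \<Rightarrow> real \<Rightarrow> real \<Rightarrow> (real ^ 4) set" where
  "pair_window s \<epsilon> \<epsilon>' = {w. fst4 w \<in> ball ((- s) *\<^sub>R e1) \<epsilon> \<and> snd4 w \<in> ball (s *\<^sub>R e1) \<epsilon>'}"

lemma dir4_simps[simp]: "dir4 1 = e1" "dir4 2 = e2" "dir4 3 = e1" "dir4 4 = e2"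
  and sgn4_simps[simp]: "sgn4 1 = 1" "sgn4 2 = 1" "sgn4 3 = - 1" "sgn4 4 = - 1"
  by (simp_all add: dir4_def sgn4_def)

lemma dir4_in: "dir4 k \<in> {e1, e2}" by (simp add: dir4_def)
lemma sgn4_squared[simp]: "(sgn4 k)\<^sup>2 = 1" by (simp add: sgn4_def)

lemma open_pair_window: "open (pair_window s \<epsilon> \<epsilon>')"
proof -
  have "pair_window s \<epsilon> \<epsilon>' = fst4 -` ball ((- s) *\<^sub>R e1) \<epsilon> \<inter> snd4 -` ball (s *\<^sub>R e1) \<epsilon>'" by (auto simp: pair_window_def)
  then show ?thesis by (auto intro!: open_Int open_vimage fst4_continuous snd4_continuous)
qed

context smooth_gaussian_field
begin

definition pair_gradient :: "real \<Rightarrow> real ^ 2 \<Rightarrow> 'a \<Rightarrow> real ^ 4 \<Rightarrow> 4 \<Rightarrow> real" where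
  "pair_gradient \<theta> m \<omega> w k = D [rot \<theta> (dir4 k)] (F \<omega>) (rot \<theta> (snd4 w) + m) + sgn4 k * D [rot \<theta> (dir4 k)] (F \<omega>) (rot \<theta> (fst4 w) + m)"

lemma pair_gradient_zero_iff:
  "(\<forall>k. pair_gradient \<theta> m \<omega> w k = 0) \<longleftrightarrow> rot \<theta> (fst4 w) + m \<in> critical_points (F \<omega>) \<and> rot \<theta> (snd4 w) + m \<in> critical_points (F \<omega>)"
proof -
  have f: "F \<omega> differentiable (at x)" for x using field_D_differentiable[of "[]"] by simp
  show ?thesis
    unfolding mem_critical_points_iff[OF f, of _ \<theta>] forall_4 pair_gradient_def by (simp add: D_Cons) argo
qed

lemma pair_count:
  fixes s :: real
  defines "x \<equiv> \<lambda>\<theta> m. rot \<theta> ((- s) *\<^sub>R e1) + m" and "y \<equiv> \<lambda>\<theta> m. rot \<theta> (s *\<^sub>R e1) + m"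
  shows "num_critical (F \<omega>) (x \<theta> m) \<epsilon> * num_critical (F \<omega>) (y \<theta> m) \<epsilon>' =
    emeasure (count_space UNIV) {w \<in> pair_window s \<epsilon> \<epsilon>'. \<forall>k. pair_gradient \<theta> m \<omega> w k = 0}"
proof -
  have inj: "rot \<theta> a = rot \<theta> b \<Longrightarrow> a = b" for a b using orthogonal_transformation_inj[OF orthogonal_rot[of \<theta>]] by (auto dest: injD)
  have surj: "surj (rot \<theta>)" using orthogonal_transformation_surj[OF orthogonal_rot] by blast
  have dist: "dist (rot \<theta> a) (rot \<theta> b) = dist a b" for a b
    using orthogonal_rot[of \<theta>] by (simp add: dist_norm) (metis linear_diff orthogonal_transformation)
  let ?W = "{w \<in> pair_window s \<epsilon> \<epsilon>'. \<forall>k. pair_gradient \<theta> m \<omega> w k = 0}"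
  let ?\<phi> = "\<lambda>w. (rot \<theta> (fst4 w) + m, rot \<theta> (snd4 w) + m)"
  have "inj_on ?\<phi> ?W"
    by (rule inj_onI) (metis Pair_inject add_right_cancel inj join4_fst4_snd4)
  moreover have "?\<phi> ` ?W = (critical_points (F \<omega>) \<inter> ball (x \<theta> m) \<epsilon>) \<times> (critical_points (F \<omega>) \<inter> ball (y \<theta> m) \<epsilon>')" (is "_ = ?A \<times> ?B")
  proof (intro equalityI subsetI)
    fix p assume "p \<in> ?\<phi> ` ?W"
    then show "p \<in> ?A \<times> ?B" unfolding pair_gradient_zero_iff by (auto simp: pair_window_def x_def y_def dist)
  next
    fix p assume p: "p \<in> ?A \<times> ?B"
    obtain a b where ab: "fst p = rot \<theta> a + m" "snd p = rot \<theta> b + m"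
      using surj by (metis add.commute diff_add_cancel surjD)
    have "p = ?\<phi> (join4 a b)" using ab by (simp add: prod_eq_iff)
    moreover have "join4 a b \<in> ?W"
      using p ab unfolding pair_gradient_zero_iff mem_Collect_eq by (auto simp: pair_window_def x_def y_def dist)
    ultimately show "p \<in> ?\<phi> ` ?W" by blast
  qed
  ultimately show ?thesis
    using emeasure_count_space_image[of ?\<phi> ?W] emeasure_count_space_Times[of ?A ?B] by (simp add: num_critical_def)
qed

text \<open>The derivatives in the rotated and shifted frame have the same covariances as in the standard frame,
  hence the same law, and the number of zeros is a measurable function of them.\<close>

lemma pair_count_frame_invariant:
  assumes W: "open W"
  shows "(\<integral>\<^sup>+\<omega>. emeasure (count_space UNIV) {w \<in> W. \<forall>k. pair_gradient \<theta> m \<omega> w k = 0} \<partial>M)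
       = (\<integral>\<^sup>+\<omega>. emeasure (count_space UNIV) {w \<in> W. \<forall>k. pair_gradient 0 0 \<omega> w k = 0} \<partial>M)"
proof -
  define Y where "Y \<theta> m i \<omega> = D [rot \<theta> (dir4 (snd i))] (F \<omega>) (rot \<theta> (fst i) + m)" for \<theta> m i \<omega>
  have YH: "Y \<theta> m i \<in> H" for \<theta> m i unfolding Y_def[abs_def] by (rule field_D_in_H) simp
  have Ym: "(\<lambda>\<omega> i. Y \<theta> m i \<omega>) \<in> measurable M (PiM UNIV (\<lambda>_. borel))" for \<theta> m
    by (rule measurable_PiM_single') (use YH H_measurable in \<open>auto simp: space_PiM\<close>)
  have cov: "expectation (\<lambda>\<omega>. Y \<theta> m i \<omega> * Y \<theta> m j \<omega>) = C [dir4 (snd i)] [dir4 (snd j)] (fst i) (fst j)" for \<theta> m i j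
    using C_isometry[OF orthogonal_rot[of \<theta>], of "[dir4 (snd i)]" "[dir4 (snd j)]" "fst i" m "fst j"] by (simp add: Y_def C_def)
  have law: "distr M (PiM UNIV (\<lambda>_. borel)) (\<lambda>\<omega> i. Y \<theta> m i \<omega>) = distr M (PiM UNIV (\<lambda>_. borel)) (\<lambda>\<omega> i. Y 0 0 i \<omega>)"
    by (rule covariance_determines_law[OF YH YH]) (simp only: cov)
  obtain T :: "((real ^ 4) \<times> 4 \<Rightarrow> real) \<Rightarrow> ennreal" where T: "T \<in> borel_measurable (PiM UNIV (\<lambda>_. borel))"
    "\<And>g. (\<And>k. continuous_on UNIV (\<lambda>w. g (w, k))) \<Longrightarrow> T g = emeasure (count_space UNIV) {w \<in> W. \<forall>k. g (w, k) = 0}"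
    using zero_count_measurable[OF W] by blast
  define \<Psi> where "\<Psi> g i = g (snd4 (fst i), snd i) + sgn4 (snd i) * g (fst4 (fst i), snd i)" for g :: "(real ^ 2) \<times> 4 \<Rightarrow> real" and i
  have \<Psi>m: "\<Psi> \<in> measurable (PiM UNIV (\<lambda>_. borel)) (PiM UNIV (\<lambda>_. borel))"
  proof (rule measurable_PiM_single')
    have [measurable]: "(\<lambda>g. g i) \<in> borel_measurable (PiM UNIV (\<lambda>_::(real ^ 2) \<times> 4. borel :: real measure))" for i
      by (rule measurable_component_singleton) simp
    show "(\<lambda>g. \<Psi> g i) \<in> borel_measurable (PiM UNIV (\<lambda>_::(real ^ 2) \<times> 4. borel :: real measure))" for i
      unfolding \<Psi>_def by measurable
  qed (auto simp: space_PiM)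
  have T\<Psi>: "(\<lambda>g. T (\<Psi> g)) \<in> borel_measurable (PiM UNIV (\<lambda>_. borel))" by (rule measurable_compose[OF \<Psi>m T(1)])
  have count: "(\<integral>\<^sup>+\<omega>. emeasure (count_space UNIV) {w \<in> W. \<forall>k. pair_gradient \<theta> m \<omega> w k = 0} \<partial>M)
      = (\<integral>\<^sup>+g. T (\<Psi> g) \<partial>distr M (PiM UNIV (\<lambda>_. borel)) (\<lambda>\<omega> i. Y \<theta> m i \<omega>))" for \<theta> m
  proof -
    have p: "\<Psi> (\<lambda>i. Y \<theta> m i \<omega>) (w, k) = pair_gradient \<theta> m \<omega> w k" for \<omega> w k
      by (simp add: \<Psi>_def Y_def pair_gradient_def)
    have rc: "continuous_on UNIV (rot \<theta>)"
      using orthogonal_rot[of \<theta>] by (simp add: orthogonal_transformation linear_continuous_on linear_conv_bounded_linear)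
    have c: "continuous_on UNIV (\<lambda>w. D [a] (F \<omega>) (rot \<theta> (l w) + m))" if "continuous_on UNIV l" for l :: "real ^ 4 \<Rightarrow> real ^ 2" and a \<omega>
      by (rule continuous_on_compose2[OF field_D_continuous[of "[a]"]])
         (auto intro!: continuous_intros continuous_on_compose2[OF rc] that)
    have "T (\<Psi> (\<lambda>i. Y \<theta> m i \<omega>)) = emeasure (count_space UNIV) {w \<in> W. \<forall>k. \<Psi> (\<lambda>i. Y \<theta> m i \<omega>) (w, k) = 0}" for \<omega>
      by (rule T(2)) (unfold p pair_gradient_def, intro continuous_intros c fst4_continuous snd4_continuous)
    then have "T (\<Psi> (\<lambda>i. Y \<theta> m i \<omega>)) = emeasure (count_space UNIV) {w \<in> W. \<forall>k. pair_gradient \<theta> m \<omega> w k = 0}" for \<omega>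
      unfolding p .
    then show ?thesis using nn_integral_distr[OF Ym, of "\<lambda>g. T (\<Psi> g)" \<theta> m] T\<Psi> by simp
  qed
  show ?thesis unfolding count law ..
qed

text \<open>The standard deviations of the sums and differences at the base point \<open>(- s *\<^sub>R e1, s *\<^sub>R e1)\<close>.\<close>

definition pair_sd :: "real \<Rightarrow> 4 \<Rightarrow> real" where
  "pair_sd s k = sqrt (2 * (var1 + sgn4 k * C [dir4 k] [dir4 k] ((2 * s) *\<^sub>R e1) 0))"

definition pair_field :: "real \<Rightarrow> 'a \<Rightarrow> real ^ 4 \<Rightarrow> real ^ 4" where
  "pair_field s \<omega> w = (\<chi> k. (D [dir4 k] (F \<omega>) (snd4 w) + sgn4 k * D [dir4 k] (F \<omega>) (fst4 w)) / pair_sd s k)"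

definition pair_hessian :: "real \<Rightarrow> 'a \<Rightarrow> real ^ 4 \<Rightarrow> real ^ 4 ^ 4" where
  "pair_hessian s \<omega> w = (\<chi> k l. (if l = 1 \<or> l = 2 then sgn4 k * D [dir4 k, dir4 l] (F \<omega>) (fst4 w) else D [dir4 k, dir4 l] (F \<omega>) (snd4 w)) / pair_sd s k)"

lemma pair_sd_pos: "s \<noteq> 0 \<Longrightarrow> pair_sd s k > 0"
  using C_gradient_pair_less[of "2 * s" "dir4 k"] dir4_in[of k]
  by (auto simp: pair_sd_def sgn4_def abs_less_iff)

lemma pair_field_in_H: "(\<lambda>\<omega>. pair_field s \<omega> w $ k) \<in> H"
  by (simp add: pair_field_def) (intro H_divide H_add H_scale field_D_in_H; simp)

text \<open>Equations in different directions are uncorrelated by reflection at the first axis; the sum and the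
  difference in one direction are uncorrelated because both summands have variance \<open>var1\<close>.\<close>

lemma pair_field_orthonormal:
  assumes s: "s \<noteq> 0"
  shows "expectation (\<lambda>\<omega>. pair_field s \<omega> (pair_base s) $ j * pair_field s \<omega> (pair_base s) $ k) = (if j = k then 1 else 0)"
proof -
  let ?u = "(- s) *\<^sub>R e1" and ?v = "s *\<^sub>R e1"
  let ?d = "\<lambda>k u \<omega>. D [dir4 k] (F \<omega>) u"
  have dH: "?d k u \<in> H" for k u by (rule field_D_in_H) simp
  have ex: "expectation (\<lambda>\<omega>. pair_field s \<omega> (pair_base s) $ j * pair_field s \<omega> (pair_base s) $ k)
     = (C [dir4 j] [dir4 k] ?v ?v + sgn4 k * C [dir4 j] [dir4 k] ?v ?u + sgn4 j * C [dir4 j] [dir4 k] ?u ?v + sgn4 j * sgn4 k * C [dir4 j] [dir4 k] ?u ?u)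
        / (pair_sd s j * pair_sd s k)"
  proof -
    have "(\<lambda>\<omega>. pair_field s \<omega> (pair_base s) $ j * pair_field s \<omega> (pair_base s) $ k) =
      (\<lambda>\<omega>. (?d j ?v \<omega> * ?d k ?v \<omega> + sgn4 k * (?d j ?v \<omega> * ?d k ?u \<omega>) + sgn4 j * (?d j ?u \<omega> * ?d k ?v \<omega>) + sgn4 j * sgn4 k * (?d j ?u \<omega> * ?d k ?u \<omega>)) / (pair_sd s j * pair_sd s k))"
      by (simp add: pair_field_def pair_base_def fun_eq_iff algebra_simps)
    then show ?thesis using H_mult_integrable[OF dH dH] by (simp add: C_def)
  qed
  show ?thesis
  proof (cases "dir4 j = dir4 k")
    case False
    have "odd (count_list [dir4 j] e2 + count_list [dir4 k] e2)" using False dir4_in[of j] dir4_in[of k] by auto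
    then have z: "C [dir4 j] [dir4 k] (x *\<^sub>R e1) (y *\<^sub>R e1) = 0" for x y
      by (intro C_odd_in_e2) (use dir4_in[of j] dir4_in[of k] in auto)
    have "j \<noteq> k" using False by auto
    then show ?thesis unfolding ex z by simp
  next
    case True
    have vv: "C [dir4 k] [dir4 k] x x = var1" for x
      using dir4_in[of k] C_2_2 C_diag[of "[dir4 k]" "[dir4 k]" x] by auto
    have vu: "C [dir4 k] [dir4 k] ?v ?u = C [dir4 k] [dir4 k] ((2 * s) *\<^sub>R e1) 0"
      using C_shift[of "[dir4 k]" "[dir4 k]" "(2 * s) *\<^sub>R e1" ?u 0] by (simp add: scaleR_add_left[symmetric] del: scaleR_minus_left)
    have uv: "C [dir4 k] [dir4 k] ?u ?v = C [dir4 k] [dir4 k] ((2 * s) *\<^sub>R e1) 0"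
      using vu C_commute by metis
    have ex': "expectation (\<lambda>\<omega>. pair_field s \<omega> (pair_base s) $ j * pair_field s \<omega> (pair_base s) $ k)
       = ((1 + sgn4 j * sgn4 k) * var1 + (sgn4 j + sgn4 k) * C [dir4 k] [dir4 k] ((2 * s) *\<^sub>R e1) 0) / (pair_sd s j * pair_sd s k)"
      unfolding ex True vv vu uv by (simp add: algebra_simps)
    show ?thesis
    proof (cases "j = k")
      case True
      have "pair_sd s k * pair_sd s k = 2 * (var1 + sgn4 k * C [dir4 k] [dir4 k] ((2 * s) *\<^sub>R e1) 0)"
        using pair_sd_pos[OF s, of k] unfolding pair_sd_def by simp
      moreover have "pair_sd s k * pair_sd s k > 0" using pair_sd_pos[OF s, of k] by simp
      moreover have "sgn4 k * sgn4 k = 1" by (simp add: sgn4_def)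
      ultimately show ?thesis using True unfolding ex' by (simp add: algebra_simps)
    next
      case False
      then have "sgn4 j = - sgn4 k" using True exhaust_4[of j] exhaust_4[of k] by auto
      moreover have "sgn4 k * sgn4 k = 1" by (simp add: sgn4_def)
      ultimately show ?thesis using False unfolding ex' by simp
    qed
  qed
qed

lemma pair_field_has_derivative: "(pair_field s \<omega> has_derivative (\<lambda>h. pair_hessian s \<omega> w *v h)) (at w)"
proof (rule has_derivative_vec_componentwise)
  fix k :: 4
  have g: "D [dir4 k] (F \<omega>) differentiable (at x)" for x by (rule field_D_differentiable) simp
  have bl: "bounded_linear fst4" "bounded_linear snd4" using linear_fst4 linear_snd4 by (simp_all add: linear_conv_bounded_linear)
  have ch: "((\<lambda>w. D [dir4 k] (F \<omega>) (l w)) has_derivative (\<lambda>h. dird (l h) (D [dir4 k] (F \<omega>)) (l w))) (at w)" if "bounded_linear l" for l :: "real ^ 4 \<Rightarrow> real ^ 2"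
    by (rule has_derivative_compose[OF bounded_linear_imp_has_derivative[OF that] has_derivative_dird[OF g]])
  have ex: "dird a (D [dir4 k] (F \<omega>)) x = a $ 1 * D [dir4 k, e1] (F \<omega>) x + a $ 2 * D [dir4 k, e2] (F \<omega>) x" for a x
  proof -
    have "dird a (D [dir4 k] (F \<omega>)) x = dird ((a $ 1) *\<^sub>R e1 + (a $ 2) *\<^sub>R e2) (D [dir4 k] (F \<omega>)) x" using vec2_expand[of a] by simp
    also have "\<dots> = a $ 1 * dird e1 (D [dir4 k] (F \<omega>)) x + a $ 2 * dird e2 (D [dir4 k] (F \<omega>)) x"
      by (simp only: dird_add_dir[OF g] dird_scale_dir[OF g])
    finally show ?thesis using D_snoc[of "[dir4 k]"] by simp
  qed
  have "((\<lambda>w. (D [dir4 k] (F \<omega>) (snd4 w) + sgn4 k * D [dir4 k] (F \<omega>) (fst4 w)) / pair_sd s k) has_derivative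
      (\<lambda>h. (dird (snd4 h) (D [dir4 k] (F \<omega>)) (snd4 w) + sgn4 k * dird (fst4 h) (D [dir4 k] (F \<omega>)) (fst4 w)) / pair_sd s k)) (at w)"
    unfolding divide_inverse by (intro has_derivative_mult_left has_derivative_add has_derivative_mult_right ch bl)
  moreover have "(dird (snd4 h) (D [dir4 k] (F \<omega>)) (snd4 w) + sgn4 k * dird (fst4 h) (D [dir4 k] (F \<omega>)) (fst4 w)) / pair_sd s k = (pair_hessian s \<omega> w *v h) $ k" for h
    unfolding ex by (simp add: matrix_vector_mult_def sum_4 pair_hessian_def add_divide_distrib distrib_left mult_ac)
  ultimately show "((\<lambda>w. pair_field s \<omega> w $ k) has_derivative (\<lambda>h. (pair_hessian s \<omega> w *v h) $ k)) (at w)"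
    by (simp add: pair_field_def)
qed

lemma pair_hessian_continuous: "continuous_on UNIV (pair_hessian s \<omega>)"
proof -
  have c: "continuous_on UNIV (\<lambda>w. D [a, b] (F \<omega>) (l w))" if "continuous_on UNIV l" for l :: "real ^ 4 \<Rightarrow> real ^ 2" and a b
    by (rule continuous_on_compose2[OF field_D_continuous[of "[a, b]"] that]) auto
  have "continuous_on UNIV (\<lambda>w. (if l = 1 \<or> l = 2 then sgn4 k * D [dir4 k, dir4 l] (F \<omega>) (fst4 w) else D [dir4 k, dir4 l] (F \<omega>) (snd4 w)) / pair_sd s k)" for k l
    unfolding divide_inverse by (cases "l = 1 \<or> l = 2") (auto intro!: continuous_intros c fst4_continuous snd4_continuous)
  then show ?thesis unfolding pair_hessian_def[abs_def] by (intro continuous_on_vec_lambda)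
qed

text \<open>The Kac-Rice density at the base point. The joint density of the two gradients enters through the
  normalisation by \<open>pair_sd\<close>, and the conditional expectation given critical points at
  \<open>\<plusminus> s *\<^sub>R e1\<close> through the residuals.\<close>

definition pair_intensity :: "real \<Rightarrow> real" where
  "pair_intensity s = (1 / sqrt (2 * pi)) ^ 4 *
     expectation (\<lambda>\<omega>. \<bar>det (\<chi> k l. residual (\<lambda>k \<omega>. pair_field s \<omega> (pair_base s) $ k) (\<lambda>\<omega>. pair_hessian s \<omega> (pair_base s) $ k $ l) \<omega>)\<bar>)"

text \<open>A rotation and a shift bring the two points into the position \<open>\<plusminus> s *\<^sub>R e1\<close>. The expected number of
  pairs in small discs is then the integral of the continuous density \<open>j\<close> of \<open>Kac_Rice_intensity\<close> over a
  product of discs, and its mean value tends to the value of \<open>j\<close> at the centre.\<close>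

lemma two_point_correlation_pair:
  assumes s: "s > 0" and xy: "norm (x - y) = 2 * s"
  shows "has_two_point_correlation M F x y (ennreal (pair_intensity s))"
proof -
  obtain \<theta> where \<theta>: "y - x = (2 * s) *\<^sub>R rot \<theta> e1" using rotation_to_direction[of "y - x" "2 * s"] xy by (auto simp: norm_minus_commute)
  define m where "m = x + s *\<^sub>R rot \<theta> e1"
  have lin: "linear (rot \<theta>)" using orthogonal_rot by (simp add: orthogonal_transformation)
  have x: "x = rot \<theta> ((- s) *\<^sub>R e1) + m" unfolding linear_scale[OF lin] by (simp add: m_def)
  have "y = x + (2 * s) *\<^sub>R rot \<theta> e1" using \<theta> by (simp add: algebra_simps)
  moreover have "(2 * s) *\<^sub>R rot \<theta> e1 = s *\<^sub>R rot \<theta> e1 + s *\<^sub>R rot \<theta> e1" by (simp only: mult_2 scaleR_add_left)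
  ultimately have y: "y = rot \<theta> (s *\<^sub>R e1) + m" unfolding linear_scale[OF lin] by (simp add: m_def)
  have s0: "s \<noteq> 0" using s by simp
  obtain W0 j where W0: "open W0" "pair_base s \<in> W0" and j: "continuous_on W0 j" "\<And>w. 0 \<le> j w" "j (pair_base s) = pair_intensity s"
    and kr: "\<And>W. open W \<Longrightarrow> W \<subseteq> W0 \<Longrightarrow> (\<integral>\<^sup>+\<omega>. emeasure (count_space UNIV) {w \<in> W. pair_field s \<omega> w = 0} \<partial>M) = (\<integral>\<^sup>+w. indicator W w * ennreal (j w) \<partial>lborel)"
  proof (rule Kac_Rice_intensity[where X = "pair_field s" and DX = "pair_hessian s" and ?w0.0 = "pair_base s",
        OF pair_field_in_H pair_field_has_derivative pair_hessian_continuous pair_field_orthonormal[OF s0]])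
    fix W0 j
    assume a: "open W0" "pair_base s \<in> W0" "continuous_on W0 j" "\<And>w. 0 \<le> j w"
      "j (pair_base s) = (1 / sqrt (2 * pi)) ^ CARD(4) *
        expectation (\<lambda>\<omega>. \<bar>det (\<chi> k l. residual (\<lambda>k \<omega>. pair_field s \<omega> (pair_base s) $ k) (\<lambda>\<omega>. pair_hessian s \<omega> (pair_base s) $ k $ l) \<omega>)\<bar>)"
      "\<And>W. open W \<Longrightarrow> W \<subseteq> W0 \<Longrightarrow> (\<integral>\<^sup>+\<omega>. emeasure (count_space UNIV) {w \<in> W. pair_field s \<omega> w = 0} \<partial>M) = (\<integral>\<^sup>+w. indicator W w * ennreal (j w) \<partial>lborel)"
    have "j (pair_base s) = pair_intensity s" unfolding a(5) pair_intensity_def by simp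
    from that[OF a(1-4) this a(6)] show thesis .
  qed
  let ?K = "pair_intensity s"
  let ?N = "\<lambda>\<epsilon> \<epsilon>'. \<integral>\<^sup>+ \<omega>. num_critical (F \<omega>) x \<epsilon> * num_critical (F \<omega>) y \<epsilon>' \<partial>M"
  let ?V = "\<lambda>\<epsilon> \<epsilon>'. emeasure lborel (ball (0 :: real ^ 2) \<epsilon>) * emeasure lborel (ball (0 :: real ^ 2) \<epsilon>')"
  have zero: "pair_field s \<omega> w = 0 \<longleftrightarrow> (\<forall>k. pair_gradient 0 0 \<omega> w k = 0)" for \<omega> w
  proof -
    have r0: "rot 0 v = v" for v by (simp add: rot_def vec_eq_iff forall_2)
    have "pair_sd s k \<noteq> 0" for k using pair_sd_pos[OF s0, of k] by simp
    then show ?thesis by (simp add: vec_eq_iff pair_field_def pair_gradient_def r0)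
  qed
  have N: "?N \<epsilon> \<epsilon>' = (\<integral>\<^sup>+w. indicator (pair_window s \<epsilon> \<epsilon>') w * ennreal (j w) \<partial>lborel)" if "pair_window s \<epsilon> \<epsilon>' \<subseteq> W0" for \<epsilon> \<epsilon>'
  proof -
    have "?N \<epsilon> \<epsilon>' = (\<integral>\<^sup>+\<omega>. emeasure (count_space UNIV) {w \<in> pair_window s \<epsilon> \<epsilon>'. \<forall>k. pair_gradient \<theta> m \<omega> w k = 0} \<partial>M)"
      unfolding x y pair_count ..
    also have "\<dots> = (\<integral>\<^sup>+\<omega>. emeasure (count_space UNIV) {w \<in> pair_window s \<epsilon> \<epsilon>'. pair_field s \<omega> w = 0} \<partial>M)"
      unfolding zero by (rule pair_count_frame_invariant[OF open_pair_window])
    also have "\<dots> = (\<integral>\<^sup>+w. indicator (pair_window s \<epsilon> \<epsilon>') w * ennreal (j w) \<partial>lborel)"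
      by (rule kr[OF open_pair_window that])
    finally show ?thesis .
  qed
  have vol: "emeasure lborel (ball c \<epsilon>) = emeasure lborel (ball (0 :: real ^ 2) \<epsilon>)" for c :: "real ^ 2" and \<epsilon>
    by (cases "\<epsilon> \<ge> 0") (simp_all add: emeasure_ball ball_empty)
  have V: "emeasure lborel (pair_window s \<epsilon> \<epsilon>') = ?V \<epsilon> \<epsilon>'" for \<epsilon> \<epsilon>'
    using emeasure_lborel_join4[of "ball ((- s) *\<^sub>R e1) \<epsilon>" "ball (s *\<^sub>R e1) \<epsilon>'"]
    unfolding pair_window_def vol[of "(- s) *\<^sub>R e1"] vol[of "s *\<^sub>R e1"] by (simp only: borel_open open_ball)
  show ?thesis
    unfolding has_two_point_correlation_def
  proof (rule tendsto_ennreal_if_eventually_close)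
    fix e :: real assume e: "e > 0"
    have "isCont j (pair_base s)" using j(1) W0 by (simp add: continuous_on_eq_continuous_at)
    then obtain d1 where d1: "d1 > 0" "\<And>w. dist w (pair_base s) < d1 \<Longrightarrow> dist (j w) (j (pair_base s)) < e"
      using e unfolding continuous_at_eps_delta by blast
    obtain d2 where d2: "d2 > 0" "ball (pair_base s) d2 \<subseteq> W0" using W0 by (meson open_contains_ball)
    define d where "d = min d1 d2 / 2"
    have d: "d > 0" using d1 d2 by (simp add: d_def)
    have win: "dist w (pair_base s) < min d1 d2" if w: "w \<in> pair_window s \<epsilon> \<epsilon>'" and \<epsilon>: "\<epsilon> < d" "\<epsilon>' < d" for w \<epsilon> \<epsilon>'
    proof -
      have n: "norm (fst4 (w - pair_base s)) < d" "norm (snd4 (w - pair_base s)) < d"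
        using w \<epsilon> unfolding pair_window_def pair_base_def linear_diff[OF linear_fst4] linear_diff[OF linear_snd4]
        by (auto simp: dist_norm norm_minus_commute)
      have "(norm (w - pair_base s))\<^sup>2 < d\<^sup>2 + d\<^sup>2"
        unfolding norm_join4 by (intro add_strict_mono power_strict_mono n) simp_all
      also have "\<dots> \<le> (2 * d)\<^sup>2" by (simp add: power2_eq_square)
      finally have "norm (w - pair_base s) < 2 * d" using d by (auto intro: power2_less_imp_less)
      then show ?thesis by (simp add: d_def dist_norm)
    qed
    have ev: "\<forall>\<^sub>F \<epsilon> in at_right 0. 0 < \<epsilon> \<and> \<epsilon> < d" using d eventually_at_right_real by auto
    have "ennreal (?K - e) \<le> ?N \<epsilon> \<epsilon>' / ?V \<epsilon> \<epsilon>' \<and> ?N \<epsilon> \<epsilon>' / ?V \<epsilon> \<epsilon>' \<le> ennreal (?K + e)"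
      if \<epsilon>: "0 < \<epsilon>" "\<epsilon> < d" "0 < \<epsilon>'" "\<epsilon>' < d" for \<epsilon> \<epsilon>'
    proof -
      let ?W = "pair_window s \<epsilon> \<epsilon>'"
      have jw: "\<bar>j w - ?K\<bar> < e" if "w \<in> ?W" for w
        using d1(2)[of w] win[OF that \<epsilon>(2,4)] j(3) by (simp add: dist_real_def)
      have sub: "?W \<subseteq> W0"
      proof
        fix w assume "w \<in> ?W"
        then have "dist w (pair_base s) < d2" using win \<epsilon> by fastforce
        then show "w \<in> W0" using d2(2) by (auto simp: dist_commute)
      qed
      define v where "v = measure lborel (ball (0 :: real ^ 2) \<epsilon>) * measure lborel (ball (0 :: real ^ 2) \<epsilon>')"
      have "measure lborel (ball (0 :: real ^ 2) r) > 0" if "r > 0" for r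
        using content_ball_pos[OF that, of "0 :: real ^ 2"] by (simp add: measure_completion)
      then have v: "v > 0" using \<epsilon> by (simp add: v_def)
      have Vv: "?V \<epsilon> \<epsilon>' = ennreal v"
      proof -
        have "emeasure lborel (ball (0 :: real ^ 2) r) = ennreal (measure lborel (ball (0 :: real ^ 2) r))" for r
          by (rule emeasure_eq_ennreal_measure) (use emeasure_bounded_finite[of "ball (0 :: real ^ 2) r"] in auto)
        then show ?thesis by (simp add: v_def ennreal_mult)
      qed
      have Wm: "?W \<in> sets lborel" using open_pair_window by simp
      have up: "?N \<epsilon> \<epsilon>' \<le> ennreal (?K + e) * ennreal v"
      proof -
        have "?N \<epsilon> \<epsilon>' \<le> (\<integral>\<^sup>+w. ennreal (?K + e) * indicator ?W w \<partial>lborel)"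
          unfolding N[OF sub]
        proof (rule nn_integral_mono)
          fix w show "indicator ?W w * ennreal (j w) \<le> ennreal (?K + e) * indicator ?W w"
            using jw[of w] by (cases "w \<in> ?W") (auto intro!: ennreal_leI)
        qed
        also have "\<dots> = ennreal (?K + e) * ennreal v" using Wm by (simp add: nn_integral_cmult_indicator V Vv)
        finally show ?thesis .
      qed
      have low: "ennreal (?K - e) * ennreal v \<le> ?N \<epsilon> \<epsilon>'"
      proof -
        have "ennreal (?K - e) * ennreal v = (\<integral>\<^sup>+w. ennreal (?K - e) * indicator ?W w \<partial>lborel)" using Wm by (simp add: nn_integral_cmult_indicator V Vv)
        also have "\<dots> \<le> ?N \<epsilon> \<epsilon>'"
          unfolding N[OF sub]
        proof (rule nn_integral_mono)
          fix w show "ennreal (?K - e) * indicator ?W w \<le> indicator ?W w * ennreal (j w)"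
            using jw[of w] by (cases "w \<in> ?W") (auto intro!: ennreal_leI)
        qed
        finally show ?thesis .
      qed
      have "0 \<le> ?K" using j by metis
      have "?N \<epsilon> \<epsilon>' < \<infinity>" using up by (rule order_le_less_trans) (simp add: ennreal_mult_less_top)
      then obtain n where n: "?N \<epsilon> \<epsilon>' = ennreal n" "n \<ge> 0" by (cases "?N \<epsilon> \<epsilon>'" rule: ennreal_cases) auto
      have "n \<le> (?K + e) * v"
      proof -
        have p: "0 \<le> ?K + e" "0 \<le> (?K + e) * v" using v e \<open>0 \<le> ?K\<close> by simp_all
        have "ennreal n \<le> ennreal ((?K + e) * v)"
          using up unfolding n(1) by (subst ennreal_mult) (use p v in auto)
        then show ?thesis using p(2) by (simp add: ennreal_le_iff)
      qed
      then have 1: "n / v \<le> ?K + e" using v by (simp add: field_simps)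
      have 2: "?K - e \<le> n / v"
      proof (cases "?K - e \<ge> 0")
        case True
        have "ennreal ((?K - e) * v) \<le> ennreal n"
          using low unfolding n(1) by (subst ennreal_mult) (use True v in auto)
        then have "(?K - e) * v \<le> n" using n(2) by (simp add: ennreal_le_iff)
        then show ?thesis using v by (simp add: field_simps)
      next
        case False
        moreover have "n / v \<ge> 0" using n v by simp
        ultimately show ?thesis by linarith
      qed
      show ?thesis unfolding n(1) Vv divide_ennreal[OF n(2) v] using 1 2 by (intro conjI ennreal_leI)
    qed
    then show "\<forall>\<^sub>F p in at_right 0 \<times>\<^sub>F at_right 0. ennreal (?K - e) \<le> (case p of (\<epsilon>, \<epsilon>') \<Rightarrow> ?N \<epsilon> \<epsilon>' / ?V \<epsilon> \<epsilon>') \<and> (case p of (\<epsilon>, \<epsilon>') \<Rightarrow> ?N \<epsilon> \<epsilon>' / ?V \<epsilon> \<epsilon>') \<le> ennreal (?K + e)"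
      using eventually_prodI[OF ev ev] by (auto elim!: eventually_mono)
  qed
qed

end

section \<open>Merging critical points\<close>

text \<open>Two derivatives of \<open>g\<close> suffice: the derivative of \<open>g t - g (- t) - 2 * t * g' 0\<close> is twice the
  even part of \<open>g' - g' 0\<close>, in which the terms linear in \<open>t\<close> cancel. So the symmetric difference quotient differs
  from \<open>g' 0\<close> by \<open>o(t)\<close>.\<close>

lemma central_difference_limits:
  fixes g g' g'' :: "real \<Rightarrow> real"
  assumes g: "\<And>t. (g has_field_derivative g' t) (at t)" and g': "\<And>t. (g' has_field_derivative g'' t) (at t)"
    and s: "s \<longlonglongrightarrow> 0" "\<And>n. s n > 0"
  shows "(\<lambda>n. (g (s n) - g (- s n)) / (2 * s n)) \<longlonglongrightarrow> g' 0"
    and "(\<lambda>n. (g' (s n) - (g (s n) - g (- s n)) / (2 * s n)) / s n) \<longlonglongrightarrow> g'' 0"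
    and "(\<lambda>n. (g' (- s n) - (g (s n) - g (- s n)) / (2 * s n)) / s n) \<longlonglongrightarrow> - g'' 0"
proof -
  have fl: "filterlim r (at 0) sequentially" if "r \<longlonglongrightarrow> 0" "\<And>n. r n \<noteq> 0" for r :: "nat \<Rightarrow> real"
    using that by (simp add: filterlim_at)
  have quot: "(\<lambda>n. (g' (r n) - g' 0) / r n) \<longlonglongrightarrow> g'' 0" if "r \<longlonglongrightarrow> 0" "\<And>n. r n \<noteq> 0" for r
    using filterlim_compose[OF g'[of 0, unfolded DERIV_def] fl[OF that]] by simp
  \<comment> \<open>mean value theorem for the odd part of \<open>g\<close>, minus its linear term\<close>
  have "\<exists>\<xi>. 0 < \<xi> \<and> \<xi> < s n \<and> g (s n) - g (- s n) - 2 * s n * g' 0 = s n * (g' \<xi> + g' (- \<xi>) - 2 * g' 0)" for n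
  proof -
    have "((\<lambda>t. g t - g (- t) - 2 * t * g' 0) has_field_derivative (g' t + g' (- t) - 2 * g' 0)) (at t)" for t
    proof -
      have "((\<lambda>t. g (- t)) has_field_derivative - g' (- t)) (at t)"
        using DERIV_chain2[OF g[of "- t"] DERIV_minus[OF DERIV_ident]] by simp
      from this show ?thesis by (auto intro!: derivative_eq_intros g)
    qed
    from MVT2[OF s(2), OF this] show ?thesis by auto
  qed
  then obtain \<xi> where \<xi>: "\<And>n. 0 < \<xi> n" "\<And>n. \<xi> n < s n"
    "\<And>n. g (s n) - g (- s n) - 2 * s n * g' 0 = s n * (g' (\<xi> n) + g' (- \<xi> n) - 2 * g' 0)" by metis
  have \<xi>0: "\<xi> \<longlonglongrightarrow> 0"
    by (rule tendsto_sandwich[OF _ _ tendsto_const s(1)]) (use \<xi> in \<open>auto intro!: always_eventually less_imp_le\<close>)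
  have "(\<lambda>n. (g' (\<xi> n) - g' 0) / \<xi> n) \<longlonglongrightarrow> g'' 0" using \<xi>(1) by (intro quot \<xi>0) (simp add: less_imp_neq[symmetric])
  moreover have "(\<lambda>n. (g' (- \<xi> n) - g' 0) / (- \<xi> n)) \<longlonglongrightarrow> g'' 0"
    using \<xi>(1) tendsto_minus[OF \<xi>0] by (intro quot) (simp_all add: less_imp_neq[symmetric])
  ultimately have "(\<lambda>n. (g' (\<xi> n) - g' 0) / \<xi> n - (g' (- \<xi> n) - g' 0) / (- \<xi> n)) \<longlonglongrightarrow> g'' 0 - g'' 0"
    by (rule tendsto_diff)
  moreover have "(g' (\<xi> n) - g' 0) / \<xi> n - (g' (- \<xi> n) - g' 0) / (- \<xi> n) = (g' (\<xi> n) + g' (- \<xi> n) - 2 * g' 0) / \<xi> n" for n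
    by (simp add: diff_divide_distrib add_divide_distrib)
  ultimately have q0: "(\<lambda>n. (g' (\<xi> n) + g' (- \<xi> n) - 2 * g' 0) / \<xi> n) \<longlonglongrightarrow> 0" by simp
  have h: "(\<lambda>n. ((g (s n) - g (- s n)) / (2 * s n) - g' 0) / s n) \<longlonglongrightarrow> 0"
  proof (rule Lim_null_comparison[OF _ tendsto_rabs_zero[OF q0]], rule always_eventually, rule allI)
    fix n
    let ?q = "g' (\<xi> n) + g' (- \<xi> n) - 2 * g' 0"
    have "(g (s n) - g (- s n)) / (2 * s n) - g' 0 = (g (s n) - g (- s n) - 2 * s n * g' 0) / (2 * s n)"
      using s(2)[of n] by (simp add: field_simps)
    also have "\<dots> = ?q / 2" unfolding \<xi>(3) using s(2)[of n] by simp
    finally have e: "(g (s n) - g (- s n)) / (2 * s n) - g' 0 = ?q / 2" .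
    have "\<bar>((g (s n) - g (- s n)) / (2 * s n) - g' 0) / s n\<bar> = \<bar>?q\<bar> / (2 * s n)"
      unfolding e using s(2)[of n] by (simp add: abs_divide)
    also have "\<dots> \<le> \<bar>?q\<bar> / \<xi> n"
      using \<xi>(1,2)[of n] by (intro divide_left_mono) (auto intro!: mult_pos_pos)
    finally show "norm (((g (s n) - g (- s n)) / (2 * s n) - g' 0) / s n) \<le> \<bar>?q / \<xi> n\<bar>"
      using \<xi>(1)[of n] by (simp add: abs_divide)
  qed
  have "(\<lambda>n. s n * (((g (s n) - g (- s n)) / (2 * s n) - g' 0) / s n) + g' 0) \<longlonglongrightarrow> 0 * 0 + g' 0"
    by (intro tendsto_intros s(1) h)
  moreover have "s n * (((g (s n) - g (- s n)) / (2 * s n) - g' 0) / s n) + g' 0 = (g (s n) - g (- s n)) / (2 * s n)" for n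
    using s(2)[of n] by simp
  ultimately show "(\<lambda>n. (g (s n) - g (- s n)) / (2 * s n)) \<longlonglongrightarrow> g' 0" by simp
  have s0: "s n \<noteq> 0" for n using s(2)[of n] by simp
  have "(\<lambda>n. (g' (s n) - g' 0) / s n - ((g (s n) - g (- s n)) / (2 * s n) - g' 0) / s n) \<longlonglongrightarrow> g'' 0 - 0"
    by (intro tendsto_diff h quot s(1) s0)
  moreover have "(p - c) / r - (q - c) / r = (p - q) / r" for p c q r :: real by (simp add: diff_divide_distrib)
  ultimately show "(\<lambda>n. (g' (s n) - (g (s n) - g (- s n)) / (2 * s n)) / s n) \<longlonglongrightarrow> g'' 0" by simp
  have "(\<lambda>n. (g' (- s n) - g' 0) / (- s n)) \<longlonglongrightarrow> g'' 0"
    using tendsto_minus[OF s(1)] s0 by (intro quot) simp_all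
  then have "(\<lambda>n. - ((g' (- s n) - g' 0) / (- s n)) - ((g (s n) - g (- s n)) / (2 * s n) - g' 0) / s n) \<longlonglongrightarrow> - g'' 0 - 0"
    by (intro tendsto_diff tendsto_minus h)
  moreover have "- ((p - c) / (- r)) - (q - c) / r = (p - q) / r" for p c q r :: real by (simp add: diff_divide_distrib)
  ultimately show "(\<lambda>n. (g' (- s n) - (g (s n) - g (- s n)) / (2 * s n)) / s n) \<longlonglongrightarrow> - g'' 0" by simp
qed

lemma det_4:
  "det (A :: 'a::comm_ring_1 ^ 4 ^ 4) =
    A$1$1 * (A$2$2 * (A$3$3 * A$4$4 - A$3$4 * A$4$3) - A$2$3 * (A$3$2 * A$4$4 - A$3$4 * A$4$2) + A$2$4 * (A$3$2 * A$4$3 - A$3$3 * A$4$2))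
  - A$1$2 * (A$2$1 * (A$3$3 * A$4$4 - A$3$4 * A$4$3) - A$2$3 * (A$3$1 * A$4$4 - A$3$4 * A$4$1) + A$2$4 * (A$3$1 * A$4$3 - A$3$3 * A$4$1))
  + A$1$3 * (A$2$1 * (A$3$2 * A$4$4 - A$3$4 * A$4$2) - A$2$2 * (A$3$1 * A$4$4 - A$3$4 * A$4$1) + A$2$4 * (A$3$1 * A$4$2 - A$3$2 * A$4$1))
  - A$1$4 * (A$2$1 * (A$3$2 * A$4$3 - A$3$3 * A$4$2) - A$2$2 * (A$3$1 * A$4$3 - A$3$3 * A$4$1) + A$2$3 * (A$3$1 * A$4$2 - A$3$2 * A$4$1))"
proof -
  have f1234: "finite {2::4, 3, 4}" "1 \<notin> {2::4, 3, 4}" by auto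
  have f234: "finite {3::4, 4}" "2 \<notin> {3::4, 4}" by auto
  have f34: "finite {4::4}" "3 \<notin> {4::4}" by auto
  show ?thesis
    unfolding det_def UNIV_4
    unfolding sum_over_permutations_insert[OF f1234]
    unfolding sum_over_permutations_insert[OF f234]
    unfolding sum_over_permutations_insert[OF f34]
    unfolding permutes_sing
    by (simp add: sign_swap_id permutation_swap_id permutation_compose sign_compose sign_id swap_id_eq algebra_simps)
qed

text \<open>The rows are sums and differences of the rows of a block diagonal matrix with blocks
  \<open>[a, b; b, d]\<close> and \<open>[a', b'; b', d']\<close>; the factor \<open>4\<close> comes from the two \<open>2 \<times> 2\<close> changes of basis.\<close>

lemma det_pair_matrix:
  fixes M :: "real ^ 4 ^ 4"
  assumes "M$1$1 = p1 * a" "M$1$2 = p1 * b" "M$1$3 = p1 * a'" "M$1$4 = p1 * b'"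
    and "M$2$1 = p2 * b" "M$2$2 = p2 * d" "M$2$3 = p2 * b'" "M$2$4 = p2 * d'"
    and "M$3$1 = - (p3 * a)" "M$3$2 = - (p3 * b)" "M$3$3 = p3 * a'" "M$3$4 = p3 * b'"
    and "M$4$1 = - (p4 * b)" "M$4$2 = - (p4 * d)" "M$4$3 = p4 * b'" "M$4$4 = p4 * d'"
  shows "det M = 4 * (p1 * p2 * p3 * p4) * ((a * d - b * b) * (a' * d' - b' * b'))"
  unfolding det_4 assms by algebra

text \<open>A bound for the square of a product of two determinants by moments of single entries.\<close>

lemma eighth_power_bound:
  fixes a b d a' b' d' B B' :: real
  shows "(\<bar>(a * d - B * b) * (a' * d' - B' * b')\<bar>)\<^sup>2 \<le> 16 * (\<Sum>x\<leftarrow>[a, d, B, b, a', d', B', b']. x ^ 8)"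
proof -
  let ?L = "[a, d, B, b, a', d', B', b']"
  define m where "m = Max (abs ` set ?L)"
  have le: "\<bar>x\<bar> \<le> m" if "x \<in> set ?L" for x unfolding m_def using that by (intro Max_ge) auto
  have "m \<in> abs ` set ?L" unfolding m_def by (rule Max_in) auto
  then obtain y where y: "y \<in> set ?L" "m = \<bar>y\<bar>" by blast
  have m0: "0 \<le> m" using y by simp
  have f: "\<bar>p * q - r * t\<bar> \<le> 2 * m\<^sup>2" if "p \<in> set ?L" "q \<in> set ?L" "r \<in> set ?L" "t \<in> set ?L" for p q r t
  proof -
    have "\<bar>p * q\<bar> \<le> m * m" "\<bar>r * t\<bar> \<le> m * m" unfolding abs_mult using le that m0 by (intro mult_mono; simp)+
    then show ?thesis by (simp add: power2_eq_square)
  qed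
  have "\<bar>(a * d - B * b) * (a' * d' - B' * b')\<bar> \<le> (2 * m\<^sup>2) * (2 * m\<^sup>2)"
    unfolding abs_mult by (intro mult_mono f) (simp_all add: m0)
  then have "(\<bar>(a * d - B * b) * (a' * d' - B' * b')\<bar>)\<^sup>2 \<le> ((2 * m\<^sup>2) * (2 * m\<^sup>2))\<^sup>2" by (rule power_mono) simp
  also have "\<dots> = 16 * m ^ 8" by (simp add: power2_eq_square eval_nat_numeral)
  also have "m ^ 8 = y ^ 8" using y by (simp add: power_even_abs)
  also have "y ^ 8 \<le> (\<Sum>x\<leftarrow>?L. x ^ 8)" using y by (intro member_le_sum_list) auto
  finally show ?thesis by simp
qed

context gaussian_hilbert
begin

lemma residual_scale:
  fixes Z :: "'a \<Rightarrow> real"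
  shows "residual \<xi> (\<lambda>\<omega>. c * Z \<omega>) = (\<lambda>\<omega>. c * residual \<xi> Z \<omega>)"
  unfolding residual_def by (rule ext) (simp add: right_diff_distrib sum_distrib_left mult.assoc)

lemma residual_diff:
  assumes "Z \<in> H" "Y \<in> H" "\<And>k. \<xi> k \<in> H"
  shows "residual \<xi> (\<lambda>\<omega>. Z \<omega> - Y \<omega>) = (\<lambda>\<omega>. residual \<xi> Z \<omega> - residual \<xi> Y \<omega>)"
  unfolding residual_def covariance_diff_left[OF assms]
  by (rule ext) (simp add: left_diff_distrib sum_subtractf)

lemma residual_self:
  assumes orth: "\<And>j k. expectation (\<lambda>\<omega>. \<xi> j \<omega> * \<xi> k \<omega>) = (if j = k then 1 else 0)"
  shows "residual \<xi> (\<xi> k) = (\<lambda>\<omega>. 0)"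
  unfolding residual_def orth by (rule ext) (simp add: if_distrib[of "\<lambda>x. x * _"] cong: if_cong)

text \<open>Residuals converge pathwise, since their coefficients are covariances.\<close>

lemma residual_tendsto:
  fixes \<xi> :: "nat \<Rightarrow> 'n::finite \<Rightarrow> 'a \<Rightarrow> real"
  assumes Z: "\<And>n. Z n \<in> H" "Z' \<in> H" "\<And>\<omega>. (\<lambda>n. Z n \<omega>) \<longlonglongrightarrow> Z' \<omega>"
    and \<xi>: "\<And>n k. \<xi> n k \<in> H" "\<And>k. \<xi>' k \<in> H" "\<And>k \<omega>. (\<lambda>n. \<xi> n k \<omega>) \<longlonglongrightarrow> \<xi>' k \<omega>"
  shows "(\<lambda>n. residual (\<xi> n) (Z n) \<omega>) \<longlonglongrightarrow> residual \<xi>' Z' \<omega>"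
  unfolding residual_def
  by (intro tendsto_diff tendsto_sum tendsto_mult Z(3) \<xi>(3) covariance_tendsto[OF Z(1,2) AE_I2[OF Z(3)] \<xi>(1,2) AE_I2[OF \<xi>(3)]])

end

context smooth_gaussian_field
begin

text \<open>The limit of the normalised equations as the two points merge: the sums become the first
  derivatives at the midpoint, and the differences become derivatives of the gradient along the line that
  joins the points.\<close>

definition limit_frame :: "4 \<Rightarrow> 'a \<Rightarrow> real" where
  "limit_frame k \<omega> = (if k = 1 then D [e1] (F \<omega>) 0 / sqrt var1 else if k = 2 then D [e2] (F \<omega>) 0 / sqrt var1
     else if k = 3 then D [e1, e1] (F \<omega>) 0 / sqrt var11 else D [e1, e2] (F \<omega>) 0 / sqrt var12)"

lemma limit_frame_simps[simp]:
  "limit_frame 1 = (\<lambda>\<omega>. D [e1] (F \<omega>) 0 / sqrt var1)" "limit_frame 2 = (\<lambda>\<omega>. D [e2] (F \<omega>) 0 / sqrt var1)"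
  "limit_frame 3 = (\<lambda>\<omega>. D [e1, e1] (F \<omega>) 0 / sqrt var11)" "limit_frame 4 = (\<lambda>\<omega>. D [e1, e2] (F \<omega>) 0 / sqrt var12)"
  by (auto simp: limit_frame_def)

lemma limit_frame_in_H: "limit_frame k \<in> H"
  using exhaust_4[of k] by (auto intro!: H_divide field_D_in_H)

lemma covariance_D_divide: "expectation (\<lambda>\<omega>. (D A (F \<omega>) u / p) * (D B (F \<omega>) v / q)) = C A B u v / (p * q)"
  by (simp add: C_def)

lemma limit_frame_orthonormal: "expectation (\<lambda>\<omega>. limit_frame j \<omega> * limit_frame k \<omega>) = (if j = k then 1 else 0)"
proof -
  have o: "C [e1] [e2] 0 0 = 0" "C [e1, e1] [e1, e2] 0 0 = 0"
    using C_odd_in_e2[of "[e1]" "[e2]" 0 0] C_odd_in_e2[of "[e1, e1]" "[e1, e2]" 0 0] by auto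
  have p: "C [a] [b, c] 0 0 = 0" if "a \<in> {e1, e2}" "b \<in> {e1, e2}" "c \<in> {e1, e2}" for a b c
    by (rule C_parity) (use that in auto)
  have q: "C [b, c] [a] 0 0 = 0" if "a \<in> {e1, e2}" "b \<in> {e1, e2}" "c \<in> {e1, e2}" for a b c
    using p[OF that] C_commute by metis
  have o': "C [e2] [e1] 0 0 = 0" "C [e1, e2] [e1, e1] 0 0 = 0" using o C_commute by metis+
  show ?thesis
    using exhaust_4[of j] exhaust_4[of k] var1_pos var11_pos var12_pos
    by (elim disjE) (simp_all only: limit_frame_simps covariance_D_divide, simp_all add: o o' p q C_2_2)
qed

text \<open>By parity \<open>D [e1, e1, e1] F\<close> is correlated only with \<open>D [e1] F\<close>, and \<open>D [e2, e2] F\<close> only with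
  \<open>D [e1, e1] F\<close>. The residual variances are \<open>var111 - var11\<^sup>2 / var1\<close>, positive by
  \<open>third_derivative_nondegenerate\<close>, and \<open>var11 - var12\<^sup>2 / var11\<close>, positive since \<open>var11 = 3 * var12\<close>.\<close>

lemma residual_limit_frame_nondegenerate:
  assumes "A = [e1, e1, e1] \<or> A = [e2, e2]"
  shows "AE \<omega> in M. residual limit_frame (\<lambda>\<omega>. D A (F \<omega>) 0) \<omega> \<noteq> 0"
proof -
  have AH: "(\<lambda>\<omega>. D A (F \<omega>) 0) \<in> H" by (rule field_D_in_H) (use assms in auto)
  have c: "expectation (\<lambda>\<omega>. D A (F \<omega>) 0 * (D B (F \<omega>) 0 / q)) = C A B 0 0 / q" for B q by (simp add: C_def)
  have v: "expectation (\<lambda>\<omega>. (residual limit_frame (\<lambda>\<omega>. D A (F \<omega>) 0) \<omega>)\<^sup>2)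
     = C A A 0 0 - ((C A [e1] 0 0 / sqrt var1)\<^sup>2 + (C A [e2] 0 0 / sqrt var1)\<^sup>2 + (C A [e1, e1] 0 0 / sqrt var11)\<^sup>2 + (C A [e1, e2] 0 0 / sqrt var12)\<^sup>2)"
    unfolding residual_variance[OF AH limit_frame_in_H limit_frame_orthonormal] sum_4 limit_frame_simps c by (simp add: C_def power2_eq_square)
  have "expectation (\<lambda>\<omega>. (residual limit_frame (\<lambda>\<omega>. D A (F \<omega>) 0) \<omega>)\<^sup>2) \<noteq> 0"
    using assms
  proof
    assume A: "A = [e1, e1, e1]"
    have z: "C [e1, e1, e1] [e2] 0 0 = 0" "C [e1, e1, e1] [e1, e1] 0 0 = 0" "C [e1, e1, e1] [e1, e2] 0 0 = 0"
      using C_odd_in_e2[of "[e1, e1, e1]" "[e2]" 0 0] C_parity[of "[e1, e1, e1]" "[e1, e1]" 0] C_parity[of "[e1, e1, e1]" "[e1, e2]" 0] by auto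
    have "var11\<^sup>2 / var1 < var111" using third_derivative_nondegenerate var1_pos by (simp add: field_simps)
    then show ?thesis using v var1_pos unfolding A z C_111_1 by (simp add: power_divide)
  next
    assume A: "A = [e2, e2]"
    have z: "C [e2, e2] [e1] 0 0 = 0" "C [e2, e2] [e2] 0 0 = 0" "C [e2, e2] [e1, e2] 0 0 = 0"
      using C_odd_in_e2[of "[e2, e2]" "[e1, e2]" 0 0] C_parity[of "[e2, e2]" "[e1]" 0] C_parity[of "[e2, e2]" "[e2]" 0] by auto
    have y: "C [e2, e2] [e1, e1] 0 0 = var12" using C_11_22 C_commute by metis
    show ?thesis using v var12_pos var11_eq unfolding A z y C_22_22 by (simp add: power_divide power2_eq_square)
  qed
  then show ?thesis
    by (intro centred_gaussian_no_atom[OF prob_space_axioms] H_gaussian residual_in_H AH limit_frame_in_H)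
qed

end

lemma (in gaussian_hilbert) eighth_moment_bounded:
  assumes X: "\<And>n. X n \<in> H" "X' \<in> H" "\<And>\<omega>. (\<lambda>n. X n \<omega>) \<longlonglongrightarrow> X' \<omega>"
  shows "integrable M (\<lambda>\<omega>. X n \<omega> ^ 8)" and "\<exists>c. \<forall>n::nat. expectation (\<lambda>\<omega>. X n \<omega> ^ 8) \<le> c"
proof -
  note m = centred_gaussian_even_moment[OF prob_space_axioms H_gaussian[OF X(1)], where k = 4, simplified]
  show "integrable M (\<lambda>\<omega>. X n \<omega> ^ 8)" using m(1) .
  have "(\<lambda>n. expectation (\<lambda>\<omega>. X n \<omega> ^ (2 * 4))) \<longlonglongrightarrow> fact (2 * 4) / (2 ^ 4 * fact 4) * expectation (\<lambda>\<omega>. (X' \<omega>)\<^sup>2) ^ 4"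
    unfolding centred_gaussian_even_moment(2)[OF prob_space_axioms H_gaussian[OF X(1)]]
    by (intro tendsto_intros variance_tendsto[OF X(1,2)] AE_I2 X(3))
  then have "convergent (\<lambda>n. expectation (\<lambda>\<omega>. X n \<omega> ^ 8))" by (auto simp: convergent_def)
  then have "Bseq (\<lambda>n. expectation (\<lambda>\<omega>. X n \<omega> ^ 8))" by (rule convergent_imp_Bseq)
  then obtain c where "\<And>n. norm (expectation (\<lambda>\<omega>. X n \<omega> ^ 8)) \<le> c" unfolding Bseq_def by blast
  then show "\<exists>c. \<forall>n::nat. expectation (\<lambda>\<omega>. X n \<omega> ^ 8) \<le> c"
    by (intro exI[of _ c] allI) (metis abs_le_D1 real_norm_def)
qed

text \<open>Convergent Gaussian variables have bounded eighth moments, so the products have bounded second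
  moments and pathwise convergence suffices. The off-diagonal entries of each matrix appear as two
  factors \<open>e\<close> and \<open>b\<close>, because they will be scaled differently.\<close>

lemma (in gaussian_hilbert) product_of_determinants_tendsto:
  fixes a b d e a' b' d' e' :: "nat \<Rightarrow> 'a \<Rightarrow> real"
  assumes H: "\<And>n. a n \<in> H" "\<And>n. d n \<in> H" "\<And>n. e n \<in> H" "\<And>n. b n \<in> H" "\<And>n. a' n \<in> H" "\<And>n. d' n \<in> H" "\<And>n. e' n \<in> H" "\<And>n. b' n \<in> H"
    and H': "A \<in> H" "\<delta> \<in> H" "E \<in> H" "B \<in> H" "A' \<in> H" "\<delta>' \<in> H" "E' \<in> H" "B' \<in> H"
    and lim: "\<And>\<omega>. (\<lambda>n. a n \<omega>) \<longlonglongrightarrow> A \<omega>" "\<And>\<omega>. (\<lambda>n. d n \<omega>) \<longlonglongrightarrow> \<delta> \<omega>" "\<And>\<omega>. (\<lambda>n. e n \<omega>) \<longlonglongrightarrow> E \<omega>" "\<And>\<omega>. (\<lambda>n. b n \<omega>) \<longlonglongrightarrow> B \<omega>"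
      "\<And>\<omega>. (\<lambda>n. a' n \<omega>) \<longlonglongrightarrow> A' \<omega>" "\<And>\<omega>. (\<lambda>n. d' n \<omega>) \<longlonglongrightarrow> \<delta>' \<omega>" "\<And>\<omega>. (\<lambda>n. e' n \<omega>) \<longlonglongrightarrow> E' \<omega>" "\<And>\<omega>. (\<lambda>n. b' n \<omega>) \<longlonglongrightarrow> B' \<omega>"
  defines "P \<equiv> \<lambda>\<omega>. \<bar>(A \<omega> * \<delta> \<omega> - E \<omega> * B \<omega>) * (A' \<omega> * \<delta>' \<omega> - E' \<omega> * B' \<omega>)\<bar>"
  shows "integrable M P"
    and "(\<lambda>n. expectation (\<lambda>\<omega>. \<bar>(a n \<omega> * d n \<omega> - e n \<omega> * b n \<omega>) * (a' n \<omega> * d' n \<omega> - e' n \<omega> * b' n \<omega>)\<bar>)) \<longlonglongrightarrow> expectation P"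
proof -
  note [measurable] = H[THEN H_measurable] H'[THEN H_measurable]
  let ?p = "\<lambda>n \<omega>. \<bar>(a n \<omega> * d n \<omega> - e n \<omega> * b n \<omega>) * (a' n \<omega> * d' n \<omega> - e' n \<omega> * b' n \<omega>)\<bar>"
  let ?b = "\<lambda>n \<omega>. 16 * (\<Sum>x\<leftarrow>[a n \<omega>, d n \<omega>, e n \<omega>, b n \<omega>, a' n \<omega>, d' n \<omega>, e' n \<omega>, b' n \<omega>]. x ^ 8)"
  note mom = eighth_moment_bounded[OF H(1) H'(1) lim(1)] eighth_moment_bounded[OF H(2) H'(2) lim(2)] eighth_moment_bounded[OF H(3) H'(3) lim(3)]
    eighth_moment_bounded[OF H(4) H'(4) lim(4)] eighth_moment_bounded[OF H(5) H'(5) lim(5)] eighth_moment_bounded[OF H(6) H'(6) lim(6)]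
    eighth_moment_bounded[OF H(7) H'(7) lim(7)] eighth_moment_bounded[OF H(8) H'(8) lim(8)]
  obtain c1 c2 c3 c4 c5 c6 c7 c8 where
    c: "\<forall>n. expectation (\<lambda>\<omega>. a n \<omega> ^ 8) \<le> c1" "\<forall>n. expectation (\<lambda>\<omega>. d n \<omega> ^ 8) \<le> c2" "\<forall>n. expectation (\<lambda>\<omega>. e n \<omega> ^ 8) \<le> c3" "\<forall>n. expectation (\<lambda>\<omega>. b n \<omega> ^ 8) \<le> c4"
      "\<forall>n. expectation (\<lambda>\<omega>. a' n \<omega> ^ 8) \<le> c5" "\<forall>n. expectation (\<lambda>\<omega>. d' n \<omega> ^ 8) \<le> c6" "\<forall>n. expectation (\<lambda>\<omega>. e' n \<omega> ^ 8) \<le> c7" "\<forall>n. expectation (\<lambda>\<omega>. b' n \<omega> ^ 8) \<le> c8"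
    using mom(2,4,6,8,10,12,14,16) by blast
  have bi: "integrable M (?b n)" for n using mom(1,3,5,7,9,11,13,15) by simp
  have bE: "expectation (?b n) \<le> 16 * (c1 + c2 + c3 + c4 + c5 + c6 + c7 + c8)" for n
  proof -
    have "expectation (?b n) = 16 * (expectation (\<lambda>\<omega>. a n \<omega> ^ 8) + (expectation (\<lambda>\<omega>. d n \<omega> ^ 8) + (expectation (\<lambda>\<omega>. e n \<omega> ^ 8) + (expectation (\<lambda>\<omega>. b n \<omega> ^ 8)
        + (expectation (\<lambda>\<omega>. a' n \<omega> ^ 8) + (expectation (\<lambda>\<omega>. d' n \<omega> ^ 8) + (expectation (\<lambda>\<omega>. e' n \<omega> ^ 8) + expectation (\<lambda>\<omega>. b' n \<omega> ^ 8))))))))"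
      using mom(1,3,5,7,9,11,13,15) by simp
    also have "\<dots> \<le> 16 * (c1 + (c2 + (c3 + (c4 + (c5 + (c6 + (c7 + c8)))))))"
      using c by (intro mult_left_mono add_mono) auto
    finally show ?thesis by (simp only: add.assoc)
  qed
  have le: "(?p n \<omega>)\<^sup>2 \<le> ?b n \<omega>" for n \<omega> by (rule eighth_power_bound)
  have pm: "?p n \<in> borel_measurable M" for n by measurable
  have pi: "integrable M (\<lambda>\<omega>. (?p n \<omega>)\<^sup>2)" for n
  proof (rule Bochner_Integration.integrable_bound[OF bi])
    show "AE \<omega> in M. norm ((?p n \<omega>)\<^sup>2) \<le> norm (?b n \<omega>)"
      using le order_trans[OF le abs_ge_self] by (intro AE_I2) (simp only: real_norm_def abs_power2)
  qed measurable
  have pE: "expectation (\<lambda>\<omega>. (?p n \<omega>)\<^sup>2) \<le> 16 * (c1 + c2 + c3 + c4 + c5 + c6 + c7 + c8)" for n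
    using integral_mono[OF pi bi le] bE[of n] by (rule order_trans)
  have Pm: "P \<in> borel_measurable M" unfolding P_def by measurable
  have Pl: "AE \<omega> in M. (\<lambda>n. ?p n \<omega>) \<longlonglongrightarrow> P \<omega>"
    unfolding P_def by (intro AE_I2 tendsto_intros lim)
  note E = expectation_tendsto_if_L2_bounded[OF pm Pm Pl pi pE]
  show "(\<lambda>n. expectation (?p n)) \<longlonglongrightarrow> expectation P" by (rule E(2))
  show "integrable M P" by (rule square_integrable_imp_integrable[OF Pm E(1)])
qed

context smooth_gaussian_field
begin

definition pair_frame :: "real \<Rightarrow> 4 \<Rightarrow> 'a \<Rightarrow> real" where
  "pair_frame s k \<omega> = pair_field s \<omega> (pair_base s) $ k"

text \<open>The factor by which a sum or a difference has to be divided to have a nondegenerate limit.\<close>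

definition pair_scale :: "real \<Rightarrow> 4 \<Rightarrow> real" where
  "pair_scale s k = (if k = 1 \<or> k = 2 then 2 else 2 * s)"

definition scaled_pair :: "real \<Rightarrow> 4 \<Rightarrow> 'a \<Rightarrow> real" where
  "scaled_pair s k \<omega> = (D [dir4 k] (F \<omega>) (s *\<^sub>R e1) + sgn4 k * D [dir4 k] (F \<omega>) ((- s) *\<^sub>R e1)) / pair_scale s k"

definition limit_pair :: "4 \<Rightarrow> 'a \<Rightarrow> real" where
  "limit_pair k \<omega> = (if k = 1 then D [e1] (F \<omega>) 0 else if k = 2 then D [e2] (F \<omega>) 0 else if k = 3 then D [e1, e1] (F \<omega>) 0 else D [e1, e2] (F \<omega>) 0)"

lemma pair_frame_in_H: "pair_frame s k \<in> H"
  unfolding pair_frame_def[abs_def] by (rule pair_field_in_H)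

lemma pair_frame_orthonormal: "s \<noteq> 0 \<Longrightarrow> expectation (\<lambda>\<omega>. pair_frame s j \<omega> * pair_frame s k \<omega>) = (if j = k then 1 else 0)"
  unfolding pair_frame_def by (rule pair_field_orthonormal)

lemma scaled_pair_in_H: "scaled_pair s k \<in> H"
  unfolding scaled_pair_def[abs_def] by (intro H_divide H_add H_scale field_D_in_H; simp)

lemma limit_pair_in_H: "limit_pair k \<in> H"
  using exhaust_4[of k] field_D_in_H by (auto simp: limit_pair_def[abs_def])

lemma scaled_pair_eq:
  assumes "s > 0" shows "scaled_pair s k \<omega> = (pair_sd s k / pair_scale s k) * pair_frame s k \<omega>"
  using pair_sd_pos[of s k] assms by (simp add: scaled_pair_def pair_frame_def pair_field_def pair_base_def)

lemma variance_scaled_pair: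
  assumes "s > 0" shows "pair_sd s k / pair_scale s k = sqrt (expectation (\<lambda>\<omega>. (scaled_pair s k \<omega>)\<^sup>2))"
proof -
  have "expectation (\<lambda>\<omega>. (scaled_pair s k \<omega>)\<^sup>2) = (pair_sd s k / pair_scale s k)\<^sup>2 * expectation (\<lambda>\<omega>. pair_frame s k \<omega> * pair_frame s k \<omega>)"
    unfolding scaled_pair_eq[OF assms] power_mult_distrib by (simp add: power2_eq_square)
  also have "\<dots> = (pair_sd s k / pair_scale s k)\<^sup>2" using assms by (simp add: pair_frame_orthonormal)
  finally show ?thesis using pair_sd_pos[of s k] assms by (simp add: pair_scale_def)
qed

lemma D_along_e1:
  assumes "length A < 4"
  shows "((\<lambda>t. D A (F \<omega>) (t *\<^sub>R e1)) has_field_derivative D (A @ [e1]) (F \<omega>) (t *\<^sub>R e1)) (at t)"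
  using dird_along_line[of "D A (F \<omega>)" 0 e1 t, OF field_D_differentiable[OF assms]] by (simp add: D_snoc)

lemma scaled_pair_tendsto:
  assumes s: "s \<longlonglongrightarrow> 0" "\<And>n. s n > 0"
  shows "(\<lambda>n. scaled_pair (s n) k \<omega>) \<longlonglongrightarrow> limit_pair k \<omega>"
proof (cases "k = 1 \<or> k = 2")
  case True
  have t: "(\<lambda>n. D [dir4 k] (F \<omega>) (r n *\<^sub>R e1)) \<longlonglongrightarrow> D [dir4 k] (F \<omega>) 0" if "r \<longlonglongrightarrow> 0" for r
  proof -
    have "isCont (D [dir4 k] (F \<omega>)) 0" by (rule differentiable_imp_continuous_within[OF field_D_differentiable]) simp
    moreover have "(\<lambda>n. r n *\<^sub>R e1) \<longlonglongrightarrow> 0" using tendsto_scaleR[OF that tendsto_const[of e1]] by simp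
    ultimately show ?thesis by (rule isCont_tendsto_compose)
  qed
  have "(\<lambda>n. (D [dir4 k] (F \<omega>) (s n *\<^sub>R e1) + sgn4 k * D [dir4 k] (F \<omega>) ((- s n) *\<^sub>R e1)) / 2) \<longlonglongrightarrow> (D [dir4 k] (F \<omega>) 0 + sgn4 k * D [dir4 k] (F \<omega>) 0) / 2"
    using tendsto_minus[OF s(1)] by (intro tendsto_divide tendsto_add tendsto_mult tendsto_const t s(1)) simp_all
  then show ?thesis using True by (auto simp: scaled_pair_def pair_scale_def limit_pair_def)
next
  case False
  have "(\<lambda>n. (D [dir4 k] (F \<omega>) (s n *\<^sub>R e1) - D [dir4 k] (F \<omega>) ((- s n) *\<^sub>R e1)) / (2 * s n)) \<longlonglongrightarrow> D [dir4 k, e1] (F \<omega>) (0 *\<^sub>R e1)"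
    by (rule central_difference_limits(1)[OF _ _ s, where g'' = "\<lambda>t. D [dir4 k, e1, e1] (F \<omega>) (t *\<^sub>R e1)"])
       (use D_along_e1[of "[dir4 k]"] D_along_e1[of "[dir4 k, e1]"] in simp_all)
  moreover have "k = 3 \<or> k = 4" using False exhaust_4[of k] by auto
  ultimately show ?thesis using False by (auto simp: scaled_pair_def pair_scale_def limit_pair_def D_e2_e1)
qed

lemma pair_sd_tendsto:
  assumes s: "s \<longlonglongrightarrow> 0" "\<And>n. s n > 0"
  shows "(\<lambda>n. pair_sd (s n) k / pair_scale (s n) k) \<longlonglongrightarrow> sqrt (expectation (\<lambda>\<omega>. (limit_pair k \<omega>)\<^sup>2))"
  unfolding variance_scaled_pair[OF s(2)]
  by (intro tendsto_real_sqrt variance_tendsto scaled_pair_in_H limit_pair_in_H AE_I2 scaled_pair_tendsto[OF s])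

lemma limit_pair_variance_pos: "expectation (\<lambda>\<omega>. (limit_pair k \<omega>)\<^sup>2) > 0"
  using exhaust_4[of k] var1_pos C_2_2 var11_pos var12_pos by (auto simp: limit_pair_def C_def power2_eq_square)

lemma limit_frame_eq: "limit_frame k \<omega> = limit_pair k \<omega> / sqrt (expectation (\<lambda>\<omega>. (limit_pair k \<omega>)\<^sup>2))"
  using exhaust_4[of k] C_2_2 by (auto simp: limit_pair_def limit_frame_def C_def power2_eq_square)

lemma pair_frame_tendsto:
  assumes s: "s \<longlonglongrightarrow> 0" "\<And>n. s n > 0"
  shows "(\<lambda>n. pair_frame (s n) k \<omega>) \<longlonglongrightarrow> limit_frame k \<omega>"
proof -
  have "pair_frame (s n) k \<omega> = scaled_pair (s n) k \<omega> / (pair_sd (s n) k / pair_scale (s n) k)" for n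
    using pair_sd_pos[of "s n" k] s(2)[of n] by (simp add: scaled_pair_eq pair_scale_def)
  then show ?thesis
    unfolding limit_frame_eq using limit_pair_variance_pos[of k]
    by (simp only:) (intro tendsto_divide scaled_pair_tendsto[OF s] pair_sd_tendsto[OF s], simp)
qed

definition pair_residual :: "(real ^ 2) list \<Rightarrow> real \<Rightarrow> real \<Rightarrow> 'a \<Rightarrow> real" where
  "pair_residual A s t = residual (pair_frame s) (\<lambda>\<omega>. D A (F \<omega>) (t *\<^sub>R e1))"

definition limit_residual :: "(real ^ 2) list \<Rightarrow> 'a \<Rightarrow> real" where
  "limit_residual A = residual limit_frame (\<lambda>\<omega>. D A (F \<omega>) 0)"

lemma pair_residual_in_H: "length A \<le> 4 \<Longrightarrow> pair_residual A s t \<in> H"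
  unfolding pair_residual_def by (intro residual_in_H field_D_in_H pair_frame_in_H)

lemma limit_residual_in_H: "length A \<le> 4 \<Longrightarrow> limit_residual A \<in> H"
  unfolding limit_residual_def by (intro residual_in_H field_D_in_H limit_frame_in_H)

text \<open>The powers of \<open>s\<close> balance. Each of the two differences has standard deviation of order \<open>s\<close>, so the
  density of the gradients contributes \<open>s\<close> to the power \<open>- 2\<close>. Each determinant contains one factor from
  its first row, which is of order \<open>s\<close>, and this row is divided by \<open>s\<close> here. The \<open>e2\<close> entries of the
  second rows are left unscaled.\<close>

lemma pair_intensity_eq:
  assumes s: "s > 0"
  defines "a \<equiv> \<lambda>t \<omega>. pair_residual [e1, e1] s t \<omega> / s" and "b \<equiv> \<lambda>t \<omega>. pair_residual [e1, e2] s t \<omega>" and "d \<equiv> \<lambda>t. pair_residual [e2, e2] s t"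
  shows "pair_intensity s = (1 / sqrt (2 * pi)) ^ 4 / (4 * (\<Prod>k\<in>UNIV. pair_sd s k / pair_scale s k)) *
    expectation (\<lambda>\<omega>. \<bar>(a (- s) \<omega> * d (- s) \<omega> - b (- s) \<omega> / s * b (- s) \<omega>) * (a s \<omega> * d s \<omega> - b s \<omega> / s * b s \<omega>)\<bar>)"
proof -
  let ?p = "\<lambda>k. 1 / pair_sd s k"
  have fr: "(\<lambda>k \<omega>. pair_field s \<omega> (pair_base s) $ k) = pair_frame s" by (simp add: pair_frame_def fun_eq_iff)
  have bd: "D [e2, e1] (F \<omega>) = D [e1, e2] (F \<omega>)" for \<omega> by (rule D_e2_e1)
  have res: "residual (pair_frame s) (\<lambda>\<omega>. c * D A (F \<omega>) (t *\<^sub>R e1)) \<omega> = c * pair_residual A s t \<omega>" for c A t \<omega>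
    by (simp add: residual_scale pair_residual_def)
  have ent: "residual (pair_frame s) (\<lambda>\<omega>. pair_hessian s \<omega> (pair_base s) $ k $ l) \<omega> =
      (if l = 1 \<or> l = 2 then (sgn4 k * ?p k) * pair_residual [dir4 k, dir4 l] s (- s) \<omega> else ?p k * pair_residual [dir4 k, dir4 l] s s \<omega>)" for k l \<omega>
    unfolding res[symmetric] by (simp add: pair_hessian_def pair_base_def)
  have b: "pair_residual [e2, e1] s t = pair_residual [e1, e2] s t" for t by (simp add: pair_residual_def bd)
  let ?Q = "\<lambda>\<omega>. (a (- s) \<omega> * d (- s) \<omega> - b (- s) \<omega> / s * b (- s) \<omega>) * (a s \<omega> * d s \<omega> - b s \<omega> / s * b s \<omega>)"
  have "det (\<chi> k l. residual (pair_frame s) (\<lambda>\<omega>. pair_hessian s \<omega> (pair_base s) $ k $ l) \<omega>) = (4 * s\<^sup>2 * (?p 1 * ?p 2 * ?p 3 * ?p 4)) * ?Q \<omega>" for \<omega>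
  proof -
    have "det (\<chi> k l. residual (pair_frame s) (\<lambda>\<omega>. pair_hessian s \<omega> (pair_base s) $ k $ l) \<omega>) = 4 * (?p 1 * ?p 2 * ?p 3 * ?p 4) *
       ((pair_residual [e1, e1] s (- s) \<omega> * d (- s) \<omega> - b (- s) \<omega> * b (- s) \<omega>) * (pair_residual [e1, e1] s s \<omega> * d s \<omega> - b s \<omega> * b s \<omega>))"
      by (rule det_pair_matrix) (simp_all add: ent b b_def d_def)
    also have "\<dots> = 4 * (?p 1 * ?p 2 * ?p 3 * ?p 4) * ((s * (a (- s) \<omega> * d (- s) \<omega> - b (- s) \<omega> / s * b (- s) \<omega>)) * (s * (a s \<omega> * d s \<omega> - b s \<omega> / s * b s \<omega>)))"
      using s by (simp add: a_def right_diff_distrib)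
    also have "\<dots> = (4 * s\<^sup>2 * (?p 1 * ?p 2 * ?p 3 * ?p 4)) * ?Q \<omega>" by (simp only: power2_eq_square mult_ac)
    finally show ?thesis .
  qed
  then have "expectation (\<lambda>\<omega>. \<bar>det (\<chi> k l. residual (pair_frame s) (\<lambda>\<omega>. pair_hessian s \<omega> (pair_base s) $ k $ l) \<omega>)\<bar>)
      = \<bar>4 * s\<^sup>2 * (?p 1 * ?p 2 * ?p 3 * ?p 4)\<bar> * expectation (\<lambda>\<omega>. \<bar>?Q \<omega>\<bar>)"
    by (simp only: abs_mult[of "4 * s\<^sup>2 * (?p 1 * ?p 2 * ?p 3 * ?p 4)"] integral_mult_right_zero)
  moreover have "\<bar>4 * s\<^sup>2 * (?p 1 * ?p 2 * ?p 3 * ?p 4)\<bar> = 1 / (4 * (\<Prod>k\<in>UNIV. pair_sd s k / pair_scale s k))"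
  proof -
    have P: "(\<Prod>k\<in>UNIV. pair_sd s k / pair_scale s k) = (pair_sd s 1 * pair_sd s 2 * pair_sd s 3 * pair_sd s 4) / (16 * s\<^sup>2)"
      unfolding prod_4 by (simp add: pair_scale_def power2_eq_square)
    have K: "\<bar>4 * s\<^sup>2 * (1 / p * (1 / q) * (1 / r) * (1 / t))\<bar> = 1 / (4 * ((p * q * r * t) / (16 * s\<^sup>2)))"
      if "p > 0" "q > 0" "r > 0" "t > 0" for p q r t :: real
    proof -
      have "0 \<le> 4 * s\<^sup>2 * (1 / p * (1 / q) * (1 / r) * (1 / t))" using that by (intro mult_nonneg_nonneg) simp_all
      then show ?thesis by (simp only: abs_of_nonneg) (use that s in \<open>simp add: field_simps\<close>)
    qed
    show ?thesis unfolding P by (rule K) (use pair_sd_pos[of s] s in simp_all)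
  qed
  ultimately show ?thesis unfolding pair_intensity_def fr
    by (simp only: times_divide_eq_left times_divide_eq_right mult_1 mult_1_right)
qed

text \<open>The residual annihilates the difference quotient of \<open>D [dir4 k] F\<close> between the two points, which is
  a multiple of a component of the frame. Subtracting it leaves the deviation of a derivative from a
  difference quotient, which is of order \<open>s\<close>.\<close>

lemma pair_residual_second_derivative:
  assumes s: "s > 0" and k: "k = 3 \<or> k = 4"
  shows "pair_residual [dir4 k, e1] s t \<omega> / s = residual (pair_frame s) (\<lambda>\<omega>. (D [dir4 k, e1] (F \<omega>) (t *\<^sub>R e1) - (D [dir4 k] (F \<omega>) (s *\<^sub>R e1) - D [dir4 k] (F \<omega>) ((- s) *\<^sub>R e1)) / (2 * s)) / s) \<omega>"
proof -
  have Z: "(\<lambda>\<omega>. D [dir4 k, e1] (F \<omega>) (t *\<^sub>R e1)) \<in> H" by (rule field_D_in_H) simp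
  have P: "(D [dir4 k] (F \<omega>) (s *\<^sub>R e1) - D [dir4 k] (F \<omega>) ((- s) *\<^sub>R e1)) / (2 * s) = scaled_pair s k \<omega>" for \<omega>
    using k by (auto simp: scaled_pair_def pair_scale_def)
  have "residual (pair_frame s) (scaled_pair s k) = (\<lambda>\<omega>. 0)"
    unfolding scaled_pair_eq[OF s, abs_def] residual_scale
    using residual_self[of "pair_frame s" k, OF pair_frame_orthonormal] s by simp
  then have "residual (pair_frame s) (\<lambda>\<omega>. D [dir4 k, e1] (F \<omega>) (t *\<^sub>R e1) - scaled_pair s k \<omega>) = pair_residual [dir4 k, e1] s t"
    unfolding residual_diff[OF Z scaled_pair_in_H pair_frame_in_H] by (simp add: pair_residual_def)
  then show ?thesis
    unfolding P using residual_scale[of "pair_frame s" "1 / s" "\<lambda>\<omega>. D [dir4 k, e1] (F \<omega>) (t *\<^sub>R e1) - scaled_pair s k \<omega>"] by simp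
qed

lemma pair_residual_second_derivative_tendsto:
  assumes s: "s \<longlonglongrightarrow> 0" "\<And>n. s n > 0" and k: "k = 3 \<or> k = 4"
  shows "(\<lambda>n. pair_residual [dir4 k, e1] (s n) (s n) \<omega> / s n) \<longlonglongrightarrow> limit_residual [dir4 k, e1, e1] \<omega>"
    and "(\<lambda>n. pair_residual [dir4 k, e1] (s n) (- s n) \<omega> / s n) \<longlonglongrightarrow> - limit_residual [dir4 k, e1, e1] \<omega>"
proof -
  let ?g = "\<lambda>t \<omega>. D [dir4 k] (F \<omega>) (t *\<^sub>R e1)" and ?g' = "\<lambda>t \<omega>. D [dir4 k, e1] (F \<omega>) (t *\<^sub>R e1)"
  have lim: "(\<lambda>n. (?g' (s n) \<omega> - (?g (s n) \<omega> - ?g (- s n) \<omega>) / (2 * s n)) / s n) \<longlonglongrightarrow> D [dir4 k, e1, e1] (F \<omega>) (0 *\<^sub>R e1)"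
    "(\<lambda>n. (?g' (- s n) \<omega> - (?g (s n) \<omega> - ?g (- s n) \<omega>) / (2 * s n)) / s n) \<longlonglongrightarrow> - D [dir4 k, e1, e1] (F \<omega>) (0 *\<^sub>R e1)" for \<omega>
    using central_difference_limits(2,3)[of "\<lambda>t. ?g t \<omega>" "\<lambda>t. ?g' t \<omega>" "\<lambda>t. D [dir4 k, e1, e1] (F \<omega>) (t *\<^sub>R e1)", OF _ _ s]
      D_along_e1[of "[dir4 k]"] D_along_e1[of "[dir4 k, e1]"] by simp_all
  have ZH: "(\<lambda>\<omega>. (?g' t \<omega> - (?g (s n) \<omega> - ?g (- s n) \<omega>) / (2 * s n)) / s n) \<in> H" for n t
    by (intro H_divide H_diff field_D_in_H) simp_all
  have LH: "(\<lambda>\<omega>. D [dir4 k, e1, e1] (F \<omega>) 0) \<in> H" by (rule field_D_in_H) simp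
  note r = residual_tendsto[OF ZH _ _ pair_frame_in_H limit_frame_in_H pair_frame_tendsto[OF s]]
  show "(\<lambda>n. pair_residual [dir4 k, e1] (s n) (s n) \<omega> / s n) \<longlonglongrightarrow> limit_residual [dir4 k, e1, e1] \<omega>"
    unfolding pair_residual_second_derivative[OF s(2) k] limit_residual_def
    by (rule r[OF LH]) (use lim(1) in simp)
  have "(\<lambda>n. pair_residual [dir4 k, e1] (s n) (- s n) \<omega> / s n) \<longlonglongrightarrow> residual limit_frame (\<lambda>\<omega>. - 1 * D [dir4 k, e1, e1] (F \<omega>) 0) \<omega>"
    unfolding pair_residual_second_derivative[OF s(2) k]
    by (rule r[OF H_scale[OF LH]]) (use lim(2) in simp)
  then show "(\<lambda>n. pair_residual [dir4 k, e1] (s n) (- s n) \<omega> / s n) \<longlonglongrightarrow> - limit_residual [dir4 k, e1, e1] \<omega>"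
    unfolding residual_scale limit_residual_def by simp
qed

lemma pair_residual_tendsto:
  assumes s: "s \<longlonglongrightarrow> 0" "\<And>n. s n > 0" and t: "t \<longlonglongrightarrow> 0" and A: "length A \<le> 4"
  shows "(\<lambda>n. pair_residual A (s n) (t n) \<omega>) \<longlonglongrightarrow> limit_residual A \<omega>"
  unfolding pair_residual_def limit_residual_def
proof (rule residual_tendsto[OF field_D_in_H[OF A] field_D_in_H[OF A] _ pair_frame_in_H limit_frame_in_H pair_frame_tendsto[OF s]])
  fix \<omega>
  have "isCont (D A (F \<omega>)) 0" using field_D_continuous[OF A] by (simp add: continuous_on_eq_continuous_at)
  moreover have "(\<lambda>n. t n *\<^sub>R e1) \<longlonglongrightarrow> 0" using tendsto_scaleR[OF t tendsto_const[of e1]] by simp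
  ultimately show "(\<lambda>n. D A (F \<omega>) (t n *\<^sub>R e1)) \<longlonglongrightarrow> D A (F \<omega>) 0" by (rule isCont_tendsto_compose)
qed

text \<open>Divided by \<open>s\<close>, the determinants at \<open>\<plusminus> s *\<^sub>R e1\<close> converge to \<open>\<plusminus> D [e1, e1, e1] F * D [e2, e2] F\<close>, all
  taken as residuals at \<open>0\<close>: in the off-diagonal product one factor is divided by \<open>s\<close> and converges,
  and the other tends to \<open>0\<close>. The limit of the intensity is a positive multiple of the expected square of
  this product, and neither factor vanishes with positive probability.\<close>

theorem pair_intensity_tendsto:
  assumes s: "s \<longlonglongrightarrow> 0" "\<And>n. s n > 0"
  obtains L where "L > 0" "(\<lambda>n. pair_intensity (s n)) \<longlonglongrightarrow> L"
proof -
  let ?Q = "\<lambda>\<omega>. (limit_residual [e1, e1, e1] \<omega> * limit_residual [e2, e2] \<omega>)\<^sup>2"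
  let ?P = "\<Prod>k\<in>UNIV. sqrt (expectation (\<lambda>\<omega>. (limit_pair k \<omega>)\<^sup>2))"
  have s': "(\<lambda>n. - s n) \<longlonglongrightarrow> 0" using tendsto_minus[OF s(1)] by simp
  note a = pair_residual_second_derivative_tendsto[OF s, of 3, simplified]
  have b: "(\<lambda>n. pair_residual [e1, e2] (s n) (s n) \<omega> / s n) \<longlonglongrightarrow> limit_residual [e2, e1, e1] \<omega>"
      "(\<lambda>n. pair_residual [e1, e2] (s n) (- s n) \<omega> / s n) \<longlonglongrightarrow> - limit_residual [e2, e1, e1] \<omega>" for \<omega>
    using pair_residual_second_derivative_tendsto[OF s, of 4 \<omega>] by (simp_all add: pair_residual_def D_e2_e1)
  have b0: "(\<lambda>n. pair_residual [e1, e2] (s n) (s n) \<omega>) \<longlonglongrightarrow> 0" "(\<lambda>n. pair_residual [e1, e2] (s n) (- s n) \<omega>) \<longlonglongrightarrow> 0" for \<omega>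
    using tendsto_mult[OF s(1) b(1)[of \<omega>]] tendsto_mult[OF s(1) b(2)[of \<omega>]] s(2) by (simp_all add: less_imp_neq[symmetric])
  have d: "(\<lambda>n. pair_residual [e2, e2] (s n) (t n) \<omega>) \<longlonglongrightarrow> limit_residual [e2, e2] \<omega>" if "t \<longlonglongrightarrow> 0" for t \<omega>
    by (rule pair_residual_tendsto[OF s that]) simp
  have sq: "\<bar>p * q * (p * q)\<bar> = (p * q)\<^sup>2" for p q :: real by (metis abs_power2 power2_eq_square)
  have neg: "(\<lambda>\<omega>. - limit_residual A \<omega>) \<in> H" if "length A \<le> 4" for A by (intro H_minus limit_residual_in_H that)
  have quot: "(\<lambda>\<omega>. pair_residual A x t \<omega> / x) \<in> H" if "length A \<le> 4" for A x t by (intro H_divide pair_residual_in_H that)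
  let ?e = "\<lambda>\<omega>. \<bar>(- limit_residual [e1, e1, e1] \<omega> * limit_residual [e2, e2] \<omega> - (- limit_residual [e2, e1, e1] \<omega>) * 0)
      * (limit_residual [e1, e1, e1] \<omega> * limit_residual [e2, e2] \<omega> - limit_residual [e2, e1, e1] \<omega> * 0)\<bar>"
  have Q: "?e = ?Q" using sq by (simp add: fun_eq_iff)
  have Hs: "\<And>n. (\<lambda>\<omega>. pair_residual [e1, e1] (s n) (- s n) \<omega> / s n) \<in> H" "\<And>n. pair_residual [e2, e2] (s n) (- s n) \<in> H"
    "\<And>n. (\<lambda>\<omega>. pair_residual [e1, e2] (s n) (- s n) \<omega> / s n) \<in> H" "\<And>n. pair_residual [e1, e2] (s n) (- s n) \<in> H"
    "\<And>n. (\<lambda>\<omega>. pair_residual [e1, e1] (s n) (s n) \<omega> / s n) \<in> H" "\<And>n. pair_residual [e2, e2] (s n) (s n) \<in> H"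
    "\<And>n. (\<lambda>\<omega>. pair_residual [e1, e2] (s n) (s n) \<omega> / s n) \<in> H" "\<And>n. pair_residual [e1, e2] (s n) (s n) \<in> H"
    by (intro quot pair_residual_in_H; simp)+
  have Hl: "(\<lambda>\<omega>. - limit_residual [e1, e1, e1] \<omega>) \<in> H" "limit_residual [e2, e2] \<in> H" "(\<lambda>\<omega>. - limit_residual [e2, e1, e1] \<omega>) \<in> H" "(\<lambda>\<omega>. 0) \<in> H"
    "limit_residual [e1, e1, e1] \<in> H" "limit_residual [e2, e2] \<in> H" "limit_residual [e2, e1, e1] \<in> H" "(\<lambda>\<omega>. 0) \<in> H"
    by (intro neg limit_residual_in_H H_zero; simp)+
  note E = product_of_determinants_tendsto[OF Hs Hl a(2) d[OF s'] b(2) b0(2) a(1) d[OF s(1)] b(1) b0(1), unfolded Q]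
  have Qpos: "expectation ?Q > 0"
  proof -
    have "AE \<omega> in M. limit_residual [e1, e1, e1] \<omega> \<noteq> 0" "AE \<omega> in M. limit_residual [e2, e2] \<omega> \<noteq> 0"
      unfolding limit_residual_def by (rule residual_limit_frame_nondegenerate; simp)+
    then have ne: "AE \<omega> in M. ?Q \<omega> \<noteq> 0" by eventually_elim simp
    have "\<not> (AE \<omega> in M. ?Q \<omega> = 0)"
    proof
      assume "AE \<omega> in M. ?Q \<omega> = 0"
      with ne have "AE \<omega> in M. False" by eventually_elim blast
      then show False by simp
    qed
    then have "expectation ?Q \<noteq> 0" using integral_nonneg_eq_0_iff_AE[OF E(1)] by simp
    moreover have "expectation ?Q \<ge> 0" by simp
    ultimately show ?thesis by linarith
  qed
  have Ppos: "?P > 0" using limit_pair_variance_pos by (intro prod_pos) simp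
  have "(\<lambda>n. pair_intensity (s n)) \<longlonglongrightarrow> (1 / sqrt (2 * pi)) ^ 4 / (4 * ?P) * expectation ?Q"
    unfolding pair_intensity_eq[OF s(2)]
    by (intro tendsto_mult tendsto_divide tendsto_const tendsto_prod pair_sd_tendsto[OF s] E(2)) (use Ppos in linarith)
  moreover have "(1 / sqrt (2 * pi)) ^ 4 / (4 * ?P) * expectation ?Q > 0"
    using Ppos Qpos by (intro mult_pos_pos divide_pos_pos zero_less_power) simp_all
  ultimately show thesis using that by blast
qed

end

section \<open>Neither repulsion nor attraction\<close>

lemma has_two_point_correlation_AE_cong:
  assumes "AE \<omega> in M. F \<omega> = G \<omega>" shows "has_two_point_correlation M F x y K = has_two_point_correlation M G x y K"
proof -
  have "(\<integral>\<^sup>+\<omega>. num_critical (F \<omega>) x \<epsilon> * num_critical (F \<omega>) y \<epsilon>' \<partial>M) = (\<integral>\<^sup>+\<omega>. num_critical (G \<omega>) x \<epsilon> * num_critical (G \<omega>) y \<epsilon>' \<partial>M)" for \<epsilon> \<epsilon>'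
    by (rule nn_integral_cong_AE) (use assms in eventually_elim, simp)
  then show ?thesis by (simp only: has_two_point_correlation_def)
qed

text \<open>The field is replaced by \<open>0\<close> on a measurable null set that contains all outcomes with a rough
  sample function.\<close>

lemma smooth_version:
  fixes F :: "'a \<Rightarrow> real ^ 2 \<Rightarrow> real"
  assumes M: "prob_space M" and g: "gaussian_field M F" and c: "centred_field M F" and i: "isotropic_field M F" and n: "nonconstant_field M F"
    and s: "AE \<omega> in M. Ck 4 (F \<omega>)"
  obtains G where "smooth_gaussian_field M G" "AE \<omega> in M. F \<omega> = G \<omega>"
proof -
  interpret prob_space M by fact
  have gx: "gaussian_rv M (\<lambda>\<omega>. F \<omega> x)" for x
    using g[unfolded gaussian_field_def, rule_format, of "{x}" "\<lambda>_. 1"] by simp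
  have Fm[measurable]: "(\<lambda>\<omega>. F \<omega> x) \<in> borel_measurable M" for x using gx[of x] by (simp add: gaussian_rv_def)
  have F0: "expectation (\<lambda>\<omega>. F \<omega> x) = 0" for x using c by (simp add: centred_field_def)
  have Fi: "integrable M (\<lambda>\<omega>. F \<omega> x)" for x
  proof -
    have "centred_gaussian M (\<lambda>\<omega>. F \<omega> x)" by (rule gaussian_rv_imp_centred_gaussian[OF M gx F0])
    then have "integrable M (\<lambda>\<omega>. (F \<omega> x)\<^sup>2)" by (simp add: centred_gaussian_def)
    then show ?thesis by (rule square_integrable_imp_integrable[OF Fm])
  qed
  obtain N where N: "{\<omega> \<in> space M. \<not> Ck 4 (F \<omega>)} \<subseteq> N" "N \<in> null_sets M" using s by (auto elim!: AE_E simp: null_sets_def)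
  define G where "G \<omega> = (if \<omega> \<in> space M \<and> \<omega> \<notin> N then F \<omega> else (\<lambda>x. 0))" for \<omega>
  have FG: "AE \<omega> in M. F \<omega> = G \<omega>" using AE_not_in[OF N(2)] AE_space by eventually_elim (simp add: G_def)
  have Gm: "(\<lambda>\<omega>. G \<omega> x) \<in> borel_measurable M" for x
  proof -
    have [measurable]: "N \<in> sets M" using N(2) by blast
    have "(\<lambda>\<omega>. if \<omega> \<in> space M \<and> \<omega> \<notin> N then F \<omega> x else 0) \<in> borel_measurable M" by measurable
    then show ?thesis by (simp add: G_def if_distrib[of "\<lambda>f. f x"])
  qed
  have "smooth_gaussian_field M G"
  proof
    show "(\<lambda>\<omega>. G \<omega> x) \<in> borel_measurable M" for x by (rule Gm)
    show "Ck 4 (G \<omega>)" for \<omega> using N(1) Ck_zero by (auto simp: G_def)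
    show "centred_gaussian M (\<lambda>\<omega>. \<Sum>x\<in>S. a x * G \<omega> x)" if S: "finite S" for S a
    proof (rule gaussian_rv_imp_centred_gaussian[OF M])
      let ?f = "\<lambda>\<omega>. \<Sum>x\<in>S. a x * F \<omega> x" and ?g = "\<lambda>\<omega>. \<Sum>x\<in>S. a x * G \<omega> x"
      have gm: "?g \<in> borel_measurable M" using Gm by simp
      have ae: "AE \<omega> in M. ?f \<omega> = ?g \<omega>" using FG by eventually_elim simp
      have "gaussian_rv M ?f" using g S by (simp add: gaussian_field_def)
      then show "gaussian_rv M ?g"
        unfolding gaussian_rv_def
      proof (elim conjE disjE exE, goal_cases)
        case (1 \<mu> \<sigma>)
        have "distr M lborel ?g = distr M lborel ?f" using ae gm 1(1) by (intro distr_cong_AE) (auto elim: eventually_mono)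
        then show ?case using 1 gm by (auto simp: distributed_def)
      next
        case (2 \<mu>)
        from 2(2) ae have "AE \<omega> in M. ?g \<omega> = \<mu>" by eventually_elim simp
        then show ?case using gm by blast
      qed
      have "expectation ?g = expectation ?f" using ae gm by (intro integral_cong_AE) (auto elim: eventually_mono)
      also have "\<dots> = 0" using Fi F0 by simp
      finally show "expectation ?g = 0" .
    qed
    have E: "expectation (\<lambda>\<omega>. G \<omega> x * G \<omega> y) = expectation (\<lambda>\<omega>. F \<omega> x * F \<omega> y)" for x y
    proof (rule integral_cong_AE)
      show "AE \<omega> in M. G \<omega> x * G \<omega> y = F \<omega> x * F \<omega> y" using FG by eventually_elim simp
    qed (use Gm Fm in simp_all)
    show "expectation (\<lambda>\<omega>. G \<omega> x * G \<omega> y) = expectation (\<lambda>\<omega>. G \<omega> x' * G \<omega> y')" if "norm (x - y) = norm (x' - y')" for x y x' y'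
      unfolding E using i[unfolded isotropic_field_def, rule_format, OF that] .
    show "\<not> (AE \<omega> in M. G \<omega> constant_on UNIV)"
    proof
      assume "AE \<omega> in M. G \<omega> constant_on UNIV"
      with FG have "AE \<omega> in M. F \<omega> constant_on UNIV" by eventually_elim simp
      with n show False by (simp add: nonconstant_field_def)
    qed
  qed
  then show thesis using FG that by blast
qed

theorem corollary1p4:
  fixes M :: "'a measure" and F :: "'a \<Rightarrow> real ^ 2 \<Rightarrow> real" and \<epsilon> :: real
  assumes "prob_space M"
    and "gaussian_field M F"
    and "centred_field M F"
    and "stationary_field M F"
    and "isotropic_field M F"
    and "nonconstant_field M F"
    and "\<epsilon> > 0"
    and "AE \<omega> in M. C_class (4 + \<epsilon>) (F \<omega>)"
  shows "\<exists>K\<^sub>2 :: real \<Rightarrow> ennreal.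
           (\<forall>x y. x \<noteq> y \<longrightarrow> has_two_point_correlation M F x y (K\<^sub>2 (norm (x - y)))) \<and>
           \<not> (K\<^sub>2 \<longlongrightarrow> 0) (at_right 0) \<and>
           \<not> (K\<^sub>2 \<longlongrightarrow> \<infinity>) (at_right 0)"
proof -
  have "AE \<omega> in M. Ck 4 (F \<omega>)"
    using assms(8) by eventually_elim (rule C_class_imp_Ck[of _ "4 + \<epsilon>"], use assms(7) in simp_all)
  then obtain G where G: "smooth_gaussian_field M G" "AE \<omega> in M. F \<omega> = G \<omega>"
    using smooth_version[OF assms(1-3,5,6)] by blast
  interpret smooth_gaussian_field M G by (rule G(1))
  define K\<^sub>2 where "K\<^sub>2 r = ennreal (pair_intensity (r / 2))" for r
  have corr: "has_two_point_correlation M F x y (K\<^sub>2 (norm (x - y)))" if "x \<noteq> y" for x y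
    unfolding has_two_point_correlation_AE_cong[OF G(2)] K\<^sub>2_def
    by (rule two_point_correlation_pair) (use that in simp_all)
  let ?s = "\<lambda>n. inverse (real (Suc n))"
  obtain L where L: "L > 0" "(\<lambda>n. pair_intensity (?s n)) \<longlonglongrightarrow> L"
    using pair_intensity_tendsto[OF LIMSEQ_inverse_real_of_nat] by auto
  have r: "filterlim (\<lambda>n. 2 * ?s n) (at_right 0) sequentially"
    using tendsto_mult[OF tendsto_const[of 2] LIMSEQ_inverse_real_of_nat] by (auto simp: filterlim_at)
  have lim: "(\<lambda>n. K\<^sub>2 (2 * ?s n)) \<longlonglongrightarrow> ennreal L"
    unfolding K\<^sub>2_def using L(2) by (intro tendsto_ennrealI) simp
  have "\<not> (K\<^sub>2 \<longlongrightarrow> c) (at_right 0)" if "c \<noteq> ennreal L" for c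
    using filterlim_compose[OF _ r, of K\<^sub>2] LIMSEQ_unique[OF lim] that by blast
  then have "\<not> (K\<^sub>2 \<longlongrightarrow> 0) (at_right 0)" "\<not> (K\<^sub>2 \<longlongrightarrow> \<infinity>) (at_right 0)" using L(1) by simp_all
  with corr show ?thesis by blast
qed

end
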